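(* Let $\omega\in\mathbb R^n\setminus\{0\}$ and let $H\in G^{\alpha,L}(\mathcal D_R)$ be of the form $H(\theta,I)=l_\omega(I)+f(\theta,I)$ on $\mathcal D_R$, where $l_\omega(I)=\omega\cdot I$ and $|f|_{\alpha,L}\le\varepsilon$ with $\varepsilon>0$. There exist positive constants $c,c_1,a_1,\dots,a_6$ depending only on $n,R,\omega,\alpha$ and $L$ such that, if $\Delta_\omega^*(c\varepsilon^{-1})\ge c_1$, the following holds. Let $(\theta(t),I(t))$ be a solution of the Hamiltonian system defined by $H$ with $(\theta(0),I(0))=(\theta_0,I_0)\in\mathcal D_{R/4}$, and let $T_0$ be the smallest $t\in\,]0,+\infty]$ such that $(\theta(t),I(t))\notin\mathcal D_{R/4}$. Then for any $\delta$ with $a_1\left(\Delta_\omega^*(a_2\varepsilon^{-1})\right)^{-1}\le\delta\le a_3$, $$|\Pi_F(I(t)-I_0)|\le\delta\quad\text{for}\quad |t|\le a_4\min\left\{T_0,\ \delta\varepsilon^{-1}\exp\left(a_5\,\Delta_\omega^*(a_6\varepsilon^{-1})^{\frac1\alpha}\right)\right\}.$$ Moreover, if $F=\mathbb R^n$, then for any such $\delta$, $$|I(t)-I_0|\le\delta\quad\text{for}\quad |t|\le a_4\,\delta\varepsilon^{-1}\exp\left(a_5\,\Delta_\omega^*(a_6\varepsilon^{-1})^{\frac1\alpha}\right).$$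
   Context: Here $n\ge2$ is an integer, $R>0$, $\alpha\ge1$, $L>0$, and $\mathbb T^n=\mathbb R^n/\mathbb Z^n$. $|\cdot|$ is the supremum norm of vectors and $\cdot$ the Euclidean scalar product. For $\rho>0$, $B_\rho\subset\mathbb R^n$ is the closed ball of radius $\rho$ centered at the origin for the supremum norm, and $\mathcal D_\rho=\mathbb T^n\times B_\rho$, with coordinates $(\theta,I)$ and the canonical symplectic structure; the Hamiltonian system defined by $H$ is $\dot\theta=\partial_IH$, $\dot I=-\partial_\theta H$. The value $T_0=+\infty$ corresponds to a solution that does not leave $\mathcal D_{R/4}$ in positive time. Gevrey functions: a real-valued $f\in C^\infty(\mathcal D_R)$ belongs to $G^{\alpha,L}(\mathcal D_R)$ if $|f|_{\alpha,L}=\sup_{l\in\mathbb N^{2n}}L^{|l|\alpha}(l!)^{-\alpha}|\partial^l f|_{C^0(\mathcal D_R)}<\infty$ (multi-index notation, $|l|$ the sum of the components of $l$, $|\cdot|_{C^0(\mathcal D_R)}$ the supremum norm of functions on $\mathcal D_R$). Arithmetic of $\omega$: $F=F_\omega$ is the smallest rational subspace of $\mathbb R^n$ containing $\omega$ (a subspace is rational if it has a basis of vectors with rational components), $d=\dim F$, $1\le d\le n$, and $\Pi_F$ is the (orthogonal) projection onto $F$. $Q_\omega>0$ is a constant depending only on $\omega$ such that $\{k\in\mathbb Z^n\cap F: 0<|k|\le Q\}\neq\emptyset$ for $Q\ge Q_\omega$. For $Q\ge Q_\omega$, $$\Psi_\omega(Q)=\max\{|k\cdot\omega|^{-1}: k\in\mathbb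 Z^n\cap F,\ 0<|k|\le Q\},\qquad \Delta_\omega(Q)=Q\Psi_\omega(Q),$$ and $\Delta_\omega^*(x)=\sup\{Q\ge Q_\omega:\Delta_\omega(Q)\le x\}$ for $x\ge\Delta_\omega(Q_\omega)$. Whenever $\Delta_\omega^*(x)$ is written it is understood that $x\ge\Delta_\omega(Q_\omega)$. *)

theory Defs
  imports "HOL-Analysis.Analysis"
begin

text \<open>
  The torus is rendered through its universal cover: functions on
  \<open>\<T>\<^sup>n \<times> B\<^sub>\<rho>\<close> are functions of \<open>(\<theta>, I)\<close> in \<open>\<real>\<^sup>n \<times> B\<^sub>\<rho>\<close> that are integer-periodic in \<open>\<theta>\<close>,
  and curves are given by a lift of their angle component.
  The supremum norm of a vector is the library's \<^const>\<open>infnorm\<close>.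
\<close>

type_synonym 'n phase = "(real^'n) \<times> (real^'n)"

definition int_vecs :: "(real^'n) set" where
  "int_vecs = {k. \<forall>i. k $ i \<in> \<int>}"

definition phase_dom :: "real \<Rightarrow> (('n::finite) phase) set" where
  "phase_dom \<rho> = UNIV \<times> {I. infnorm I \<le> \<rho>}"

definition angle_periodic :: "(('n::finite) phase) set \<Rightarrow> ('n phase \<Rightarrow> real) \<Rightarrow> bool" where
  "angle_periodic D f \<longleftrightarrow> (\<forall>(\<theta>, I)\<in>D. \<forall>k\<in>int_vecs. f (\<theta> + k, I) = f (\<theta>, I))"


section \<open>Smooth and Gevrey functions\<close>

text \<open>
  The \<open>2n\<close> coordinate directions are indexed by \<open>'n + 'n\<close> (\<open>Inl\<close> for angles, \<open>Inr\<close> for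
  actions), and a multi-index is a function \<open>'n + 'n \<Rightarrow> nat\<close>.
\<close>

definition coord_dir :: "'n + 'n \<Rightarrow> ('n::finite) phase" where
  "coord_dir j = (case j of Inl i \<Rightarrow> (axis i 1, 0) | Inr i \<Rightarrow> (0, axis i 1))"

text \<open>
  \<open>jet_on D f g\<close>: the family \<open>g l\<close> consists of the partial derivatives of \<open>f\<close> of all orders
  on \<open>D\<close>, continuous on \<open>D\<close>. Derivatives are taken within \<open>D\<close>, hence are one-sided at boundary
  points of the closed set \<open>D\<close>. For \<open>D = phase_dom \<rho>\<close> with \<open>\<rho> > 0\<close> they are uniquely determined
  on \<open>D\<close>.
\<close>

definition jet_on ::
  "(('n::finite) phase) set \<Rightarrow> ('n phase \<Rightarrow> real) \<Rightarrow>
   (('n + 'n \<Rightarrow> nat) \<Rightarrow> 'n phase \<Rightarrow> real) \<Rightarrow> bool" where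
  "jet_on D f g \<longleftrightarrow>
     (\<forall>x\<in>D. g (\<lambda>_. 0) x = f x) \<and>
     (\<forall>l. continuous_on D (g l)) \<and>
     (\<forall>l j. \<forall>x\<in>D.
        ((\<lambda>s. g l (x + s *\<^sub>R coord_dir j)) has_real_derivative g (l(j := Suc (l j))) x)
          (at 0 within {s. x + s *\<^sub>R coord_dir j \<in> D}))"

definition smooth_fun_on :: "(('n::finite) phase) set \<Rightarrow> ('n phase \<Rightarrow> real) \<Rightarrow> bool" where
  "smooth_fun_on D f \<longleftrightarrow> (\<exists>g. jet_on D f g)"

definition mpartial ::
  "(('n::finite) phase) set \<Rightarrow> ('n + 'n \<Rightarrow> nat) \<Rightarrow> ('n phase \<Rightarrow> real) \<Rightarrow>
   'n phase \<Rightarrow> real" where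
  "mpartial D l f = (SOME g. jet_on D f g) l"

definition partial ::
  "(('n::finite) phase) set \<Rightarrow> 'n + 'n \<Rightarrow> ('n phase \<Rightarrow> real) \<Rightarrow>
   'n phase \<Rightarrow> real" where
  "partial D j f = mpartial D ((\<lambda>_. 0)(j := 1)) f"

definition C0_norm :: "(('n::finite) phase) set \<Rightarrow> ('n phase \<Rightarrow> real) \<Rightarrow> ereal" where
  "C0_norm D h = (SUP x\<in>D. ereal \<bar>h x\<bar>)"

definition gevrey_norm ::
  "real \<Rightarrow> real \<Rightarrow> (('n::finite) phase) set \<Rightarrow> ('n phase \<Rightarrow> real) \<Rightarrow> ereal" where
  "gevrey_norm \<alpha> L D f =
     (SUP l :: 'n + 'n \<Rightarrow> nat.
        ereal (L powr (real (\<Sum>j\<in>UNIV. l j) * \<alpha>) * (\<Prod>j\<in>UNIV. fact (l j)) powr (- \<alpha>))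
          * C0_norm D (mpartial D l f))"

definition gevrey ::
  "real \<Rightarrow> real \<Rightarrow> (('n::finite) phase) set \<Rightarrow> ('n phase \<Rightarrow> real) set" where
  "gevrey \<alpha> L D = {f. angle_periodic D f \<and> smooth_fun_on D f \<and> gevrey_norm \<alpha> L D f < \<infinity>}"


section \<open>Arithmetic of the frequency vector\<close>

definition rational_subspace :: "(real^'n) set \<Rightarrow> bool" where
  "rational_subspace S \<longleftrightarrow>
     (\<exists>B. B \<subseteq> {v. \<forall>i. v $ i \<in> \<rat>} \<and> independent B \<and> span B = S)"

definition rat_hull :: "real^'n \<Rightarrow> (real^'n) set" where
  "rat_hull \<omega> = (LEAST S. rational_subspace S \<and> \<omega> \<in> S)"

definition orth_proj :: "(real^'n) set \<Rightarrow> real^'n \<Rightarrow> real^'n" where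
  "orth_proj S x = (THE y. y \<in> S \<and> (\<forall>z\<in>S. orthogonal (x - y) z))"

lemma orth_proj_exists1:
  fixes S :: "(real^'n) set"
  assumes "subspace S"
  shows "\<exists>!y. y \<in> S \<and> (\<forall>z\<in>S. orthogonal (x - y) z)"
proof -
  obtain y w where y: "y \<in> span S" and w: "\<And>z. z \<in> span S \<Longrightarrow> orthogonal w z" and x: "x = y + w"
    using orthogonal_subspace_decomp_exists by metis
  have S: "span S = S" using assms by (simp add: span_eq_iff)
  show ?thesis
  proof (rule ex1I[of _ y])
    show "y \<in> S \<and> (\<forall>z\<in>S. orthogonal (x - y) z)" using y w x S by auto
  next
    fix v assume v: "v \<in> S \<and> (\<forall>z\<in>S. orthogonal (x - v) z)"
    then have m: "v - y \<in> S" using y S assms by (simp add: subspace_diff)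
    then have "(x - v) \<bullet> (v - y) = 0" "(x - y) \<bullet> (v - y) = 0"
      using v w x S by (auto simp: orthogonal_def)
    then have "(v - y) \<bullet> (v - y) = 0" by (simp add: inner_diff_left)
    then show "v = y" by simp
  qed
qed

definition resonance_vecs :: "real^'n \<Rightarrow> real \<Rightarrow> (real^'n) set" where
  "resonance_vecs \<omega> Q = {k \<in> int_vecs \<inter> rat_hull \<omega>. 0 < infnorm k \<and> infnorm k \<le> Q}"

definition Psi :: "real^'n \<Rightarrow> real \<Rightarrow> real" where
  "Psi \<omega> Q = Max ((\<lambda>k. inverse \<bar>k \<bullet> \<omega>\<bar>) ` resonance_vecs \<omega> Q)"

definition Delta :: "real^'n \<Rightarrow> real \<Rightarrow> real" where
  "Delta \<omega> Q = Q * Psi \<omega> Q"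

text \<open>
  The second argument is the constant \<open>Q\<^sub>\<omega>\<close>. The value is meaningful for \<open>x \<ge> Delta \<omega> Q\<^sub>\<omega>\<close>.
\<close>

definition Delta_star :: "real^'n \<Rightarrow> real \<Rightarrow> real \<Rightarrow> real" where
  "Delta_star \<omega> Q\<^sub>\<omega> x = Sup {Q. Q \<ge> Q\<^sub>\<omega> \<and> Delta \<omega> Q \<le> x}"


section \<open>Hamiltonian solutions\<close>

definition ham_solution ::
  "('n phase) set \<Rightarrow> ('n phase \<Rightarrow> real) \<Rightarrow>
   real set \<Rightarrow> (real \<Rightarrow> real^'n) \<Rightarrow> (real \<Rightarrow> real^'n) \<Rightarrow> bool" where
  "ham_solution D H J \<theta> I \<longleftrightarrow>
     is_interval J \<and> 0 \<in> J \<and>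
     (\<forall>t\<in>J. (\<theta> t, I t) \<in> D \<and>
        (\<theta> has_vector_derivative (\<chi> i. partial D (Inr i) H (\<theta> t, I t))) (at t within J) \<and>
        (I has_vector_derivative (\<chi> i. - partial D (Inl i) H (\<theta> t, I t))) (at t within J))"

definition maximal_ham_solution ::
  "('n phase) set \<Rightarrow> ('n phase \<Rightarrow> real) \<Rightarrow>
   real set \<Rightarrow> (real \<Rightarrow> real^'n) \<Rightarrow> (real \<Rightarrow> real^'n) \<Rightarrow> bool" where
  "maximal_ham_solution D H J \<theta> I \<longleftrightarrow>
     ham_solution D H J \<theta> I \<and>
     \<not> (\<exists>J' \<theta>' I'. J \<subset> J' \<and> ham_solution D H J' \<theta>' I' \<and>
          (\<forall>t\<in>J. \<theta>' t = \<theta> t \<and> I' t = I t))"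

text \<open>
  The first positive exit time is the infimum of the positive exit times (the infimum
  need not be attained, as \<open>D\<close> is closed), with value \<open>\<infinity>\<close> if there are none.
\<close>

definition exit_time ::
  "('n phase) set \<Rightarrow> real set \<Rightarrow> (real \<Rightarrow> real^'n) \<Rightarrow> (real \<Rightarrow> real^'n) \<Rightarrow> ereal" where
  "exit_time D J \<theta> I = (INF t\<in>{t\<in>J. 0 < t \<and> (\<theta> t, I t) \<notin> D}. ereal t)"

end

theory Submission
  imports Defs "HOL-Library.Poly_Mapping" "HOL-Computational_Algebra.Formal_Power_Series"
begin

text \<open>
  For every vector \<open>v\<close> in the rational hull \<open>F\<close> of \<open>\<omega>\<close> there is an observable that stays close to the
  linear function \<open>v \<bullet> I\<close> on all of \<open>phase_dom R\<close> and whose derivative along the flow is \<open>\<epsilon>\<close> times an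
  exponentially small factor. Taking for \<open>v\<close> the projections to \<open>F\<close> of the coordinate vectors bounds
  every component of the projection of \<open>I t - I 0\<close>. No change of coordinates is made: the observable
  is a finite sum of iterated Poisson brackets, so the estimate holds up to the boundary of the
  domain and for times of both signs.

  The observable comes from a formal first integral. Replace \<open>f\<close> by its Fourier truncation at order
  \<open>K\<close>, called \<open>H1\<close>, and solve successively the equations \<open>{X r, lin \<omega>} + M r = S r\<close>, where \<open>X r\<close>
  collects the Fourier modes of the source \<open>S r\<close> with \<open>|k| \<le> K\<close> and \<open>k \<bullet> \<omega> \<noteq> 0\<close>, and \<open>M r\<close> the
  others. Transporting \<open>v \<bullet> I\<close> along the formal time-dependent flow generated by \<open>X\<close> gives
  coefficients \<open>G r\<close>. As the transport respects brackets (\<open>T_br\<close>, a consequence of the Jacobi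
  identity), the bracket of the series \<open>G\<close> with \<open>lin \<omega> + t H1\<close> is generated by the brackets of
  \<open>v \<bullet> I\<close> with the terms \<open>M r\<close> alone (\<open>first_integral_defect\<close>). A mode of \<open>M r\<close> with \<open>k \<bullet> \<omega> = 0\<close> has
  \<open>k \<bullet> v = 0\<close>, because \<open>v\<close> lies in \<open>F\<close>, and does not contribute; a mode with \<open>|k| > K\<close> is exponentially
  small. Cutting the series at order \<open>m\<close> leaves an error \<open>exp (- m)\<close>, if consecutive orders decrease by
  the factor \<open>exp (- 1)\<close> (\<open>quasi_integral\<close>).

  This decrease is proved with weighted \<open>\<ell>\<^sup>1\<close>-norms of Fourier-Taylor coefficients, in which a width \<open>s\<close>
  plays the role of the width of a complex domain for analytic functions: a derivative costs a power
  \<open>- \<alpha>\<close> of the loss of width. With \<open>m\<close> steps and an uneven distribution of the width, one order costs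
  \<open>m powr \<alpha> * \<Psi> * \<epsilon>\<close> up to a constant, where \<open>\<Psi>\<close> bounds the inverses of the divisors \<open>k \<bullet> \<omega>\<close>. For
  \<open>K\<close> proportional to \<open>Q\<close> and \<open>m\<close> close to \<open>Q powr (1 / \<alpha>)\<close> the smallness condition becomes a bound on
  \<open>Q * Psi \<omega> Q * \<epsilon> = Delta \<omega> Q * \<epsilon>\<close>, which is how \<open>Delta_star\<close> enters, and all the errors are of the form
  \<open>exp (- a * Q powr (1 / \<alpha>))\<close> (\<open>near_conservation\<close>).

  If \<open>F\<close> is the whole space, the estimate keeps the actions in the ball of radius \<open>R / 2\<close>. A solution
  that cannot be continued then exists for the whole time considered (\<open>maximal_sol_exists_until\<close>).
\<close>

section \<open>Poisson brackets in a commutative ring with commuting derivations\<close>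

text \<open>Only commuting derivations are used, no functions: the same algebra is applied to observables and to
  formal power series of observables. Absence of torsion is what the Jacobi identity and the
  uniqueness of formal solutions need, since both are obtained after multiplication by an integer.\<close>

locale poisson_ring =
  fixes dq dp :: "'i::finite \<Rightarrow> 'a::comm_ring_1 \<Rightarrow> 'a"
  assumes q_add: "dq i (a + b) = dq i a + dq i b"
    and p_add: "dp i (a + b) = dp i a + dp i b"
    and q_mult: "dq i (a * b) = dq i a * b + a * dq i b"
    and p_mult: "dp i (a * b) = dp i a * b + a * dp i b"
    and qq: "dq i (dq j a) = dq j (dq i a)"
    and pp: "dp i (dp j a) = dp j (dp i a)"
    and qp: "dq i (dp j a) = dp j (dq i a)"
    and torsion_free: "of_nat (Suc m) * a = 0 \<Longrightarrow> a = 0"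
begin

definition br :: "'a \<Rightarrow> 'a \<Rightarrow> 'a" where
  "br a b = (\<Sum>i\<in>UNIV. dq i a * dp i b - dp i a * dq i b)"

lemma q_zero [simp]: "dq i 0 = 0" using q_add[of i 0 0] by simp
lemma p_zero [simp]: "dp i 0 = 0" using p_add[of i 0 0] by simp
lemma q_minus: "dq i (- a) = - dq i a"
  using q_add[of i a "- a"] by (simp add: eq_neg_iff_add_eq_0 add.commute)
lemma p_minus: "dp i (- a) = - dp i a"
  using p_add[of i a "- a"] by (simp add: eq_neg_iff_add_eq_0 add.commute)
lemma q_diff: "dq i (a - b) = dq i a - dq i b"
  using q_add[of i a "- b"] by (simp add: q_minus)
lemma p_diff: "dp i (a - b) = dp i a - dp i b"
  using p_add[of i a "- b"] by (simp add: p_minus)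
lemma q_sum: "dq i (sum f S) = (\<Sum>x\<in>S. dq i (f x))"
  by (induction S rule: infinite_finite_induct) (auto simp: q_add)
lemma p_sum: "dp i (sum f S) = (\<Sum>x\<in>S. dp i (f x))"
  by (induction S rule: infinite_finite_induct) (auto simp: p_add)

lemma br_add_left: "br (a + b) c = br a c + br b c"
  by (simp add: br_def q_add p_add algebra_simps flip: sum.distrib)
lemma br_add_right: "br c (a + b) = br c a + br c b"
  by (simp add: br_def q_add p_add algebra_simps flip: sum.distrib)
lemma br_zero [simp]: "br 0 a = 0" "br a 0 = 0"
  by (simp_all add: br_def)
lemma br_anti: "br a b = - br b a"
  by (simp add: br_def algebra_simps flip: sum_negf)
lemma br_diff_right: "br c (a - b) = br c a - br c b"
  by (simp add: br_def q_diff p_diff algebra_simps flip: sum_subtractf)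
lemma br_sum_right: "br c (sum f S) = (\<Sum>x\<in>S. br c (f x))"
  by (induction S rule: infinite_finite_induct) (auto simp: br_add_right)
lemma br_sum_left: "br (sum f S) c = (\<Sum>x\<in>S. br (f x) c)"
  by (induction S rule: infinite_finite_induct) (auto simp: br_add_left)

lemma q_of_nat: "dq i (of_nat n * a) = of_nat n * dq i a"
  by (induction n) (simp_all add: q_add distrib_right)
lemma p_of_nat: "dp i (of_nat n * a) = of_nat n * dp i a"
  by (induction n) (simp_all add: p_add distrib_right)
lemma br_of_nat: "br (of_nat n * a) b = of_nat n * br a b" "br a (of_nat n * b) = of_nat n * br a b"
  by (simp_all add: br_def q_of_nat p_of_nat sum_distrib_left right_diff_distrib mult.assoc mult.left_commute[of _ "of_nat n"])

lemma q_br: "dq j (br a b) = br (dq j a) b + br a (dq j b)"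
  unfolding br_def by (simp add: q_sum q_diff q_mult qq[of j] qp[of j] algebra_simps flip: sum.distrib)
lemma p_br: "dp j (br a b) = br (dp j a) b + br a (dp j b)"
  unfolding br_def by (simp add: p_sum p_diff p_mult pp[of j] qp[symmetric] algebra_simps flip: sum.distrib)

text \<open>Expanded in second derivatives, the defect of the Jacobi identity is a double sum over
  pairs of indices whose summand changes sign when the two indices are exchanged.\<close>

lemma jacobi: "br a (br b c) = br (br a b) c + br b (br a c)"
proof -
  define F where "F j i =
      dq j a * ((dq i (dp j b) * dp i c - dp i (dp j b) * dq i c) + (dq i b * dp i (dp j c) - dp i b * dq i (dp j c)))
    - dp j a * ((dq i (dq j b) * dp i c - dp i (dq j b) * dq i c) + (dq i b * dp i (dq j c) - dp i b * dq i (dq j c)))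
    - ((dq i (dq j a) * dp i b - dp i (dq j a) * dq i b) + (dq i a * dp i (dq j b) - dp i a * dq i (dq j b))) * dp j c
    + ((dq i (dp j a) * dp i b - dp i (dp j a) * dq i b) + (dq i a * dp i (dp j b) - dp i a * dq i (dp j b))) * dq j c
    - dq j b * ((dq i (dp j a) * dp i c - dp i (dp j a) * dq i c) + (dq i a * dp i (dp j c) - dp i a * dq i (dp j c)))
    + dp j b * ((dq i (dq j a) * dp i c - dp i (dq j a) * dq i c) + (dq i a * dp i (dq j c) - dp i a * dq i (dq j c)))"
    for i j
  have anti: "F j i = - F i j" for i j
    unfolding F_def qq[of j i] pp[of j i] qp by (simp add: algebra_simps)
  define D where "D = br a (br b c) - br (br a b) c - br b (br a c)"
  have D: "D = (\<Sum>j\<in>UNIV. \<Sum>i\<in>UNIV. F j i)"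
    unfolding D_def br_def[of a "br b c"] br_def[of "br a b" c] br_def[of b "br a c"] q_br p_br
    unfolding br_def F_def
    by (simp add: sum_distrib_left sum_distrib_right algebra_simps sum.distrib sum_subtractf)
  have "D = (\<Sum>i\<in>UNIV. \<Sum>j\<in>UNIV. F j i)"
    unfolding D by (rule sum.swap)
  also have "\<dots> = - D"
    unfolding D by (subst anti) (simp add: sum_negf)
  finally have "of_nat (Suc 1) * D = 0" by (simp add: algebra_simps eq_neg_iff_add_eq_0)
  then have "D = 0" by (rule torsion_free)
  then show ?thesis by (simp add: D_def algebra_simps)
qed

end

definition fps_lift :: "('a::comm_ring_1 \<Rightarrow> 'a) \<Rightarrow> 'a fps \<Rightarrow> 'a fps" where
  "fps_lift d A = Abs_fps (\<lambda>n. d (fps_nth A n))"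

lemma fps_lift_nth [simp]: "fps_nth (fps_lift d A) n = d (fps_nth A n)"
  by (simp add: fps_lift_def)

lemma (in poisson_ring) poisson_ring_fps:
  "poisson_ring (\<lambda>i. fps_lift (dq i)) (\<lambda>i. fps_lift (dp i))"
proof unfold_locales
  fix m and a :: "'a fps" assume *: "of_nat (Suc m) * a = 0"
  have "of_nat (Suc m) * fps_nth a n = 0" for n
    using arg_cong[OF *, of "\<lambda>A. fps_nth A n"] by (simp add: fps_of_nat[symmetric] del: of_nat_Suc)
  then show "a = 0" using torsion_free by (intro fps_ext) (auto simp del: of_nat_Suc)
qed (auto intro!: fps_ext simp: fps_mult_nth q_add p_add q_mult p_mult q_sum p_sum qq pp qp
       simp flip: sum.distrib intro: qq pp)

context poisson_ring
begin

interpretation ser: poisson_ring "\<lambda>i. fps_lift (dq i)" "\<lambda>i. fps_lift (dp i)"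
  by (rule poisson_ring_fps)

lemma ser_br_nth: "fps_nth (ser.br A B) n = (\<Sum>i\<le>n. br (fps_nth A i) (fps_nth B (n - i)))"
proof -
  have "fps_nth (ser.br A B) n = (\<Sum>i\<in>UNIV. \<Sum>j=0..n.
        dq i (fps_nth A j) * dp i (fps_nth B (n - j)) - dp i (fps_nth A j) * dq i (fps_nth B (n - j)))"
    by (simp add: ser.br_def fps_sum_nth fps_mult_nth sum_subtractf)
  also have "\<dots> = (\<Sum>j=0..n. br (fps_nth A j) (fps_nth B (n - j)))"
    unfolding br_def by (rule sum.swap)
  finally show ?thesis by (simp add: atMost_atLeast0)
qed

text \<open>The Euler operator multiplies the coefficient of order \<open>n\<close> by \<open>n\<close>; it is a
  derivation of the bracket of series.\<close>

lemma ser_br_euler: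
  "of_nat n * fps_nth (ser.br A B) n =
     fps_nth (ser.br (Abs_fps (\<lambda>n. of_nat n * fps_nth A n)) B) n
     + fps_nth (ser.br A (Abs_fps (\<lambda>n. of_nat n * fps_nth B n))) n"
proof -
  have "of_nat n * br (fps_nth A i) (fps_nth B (n - i)) =
      of_nat i * br (fps_nth A i) (fps_nth B (n - i)) + of_nat (n - i) * br (fps_nth A i) (fps_nth B (n - i))"
    if "i \<le> n" for i
    using that by (simp flip: distrib_right of_nat_add)
  then show ?thesis
    by (simp add: ser_br_nth br_of_nat sum_distrib_left del: of_nat_diff flip: sum.distrib)
qed

end

section \<open>The formal Lie transform\<close>

text \<open>\<open>dv n\<close> divides by \<open>n + 1\<close>. It is a parameter because the elements form a ring without scalars.\<close>

locale lie_transform = poisson_ring dq dp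
  for dq dp :: "'i::finite \<Rightarrow> 'a::comm_ring_1 \<Rightarrow> 'a" +
  fixes dv :: "nat \<Rightarrow> 'a \<Rightarrow> 'a"
  assumes dv: "of_nat (Suc n) * dv n a = a"
begin

interpretation ser: poisson_ring "\<lambda>i. fps_lift (dq i)" "\<lambda>i. fps_lift (dp i)"
  by (rule poisson_ring_fps)

text \<open>The coefficients of the solution \<open>A\<close> of \<open>t A' = {X, A}\<close> with \<open>A(0) = a\<close>, for
  \<open>X = X 1 t + X 2 t\<^sup>2 + \<dots>\<close>.\<close>

fun T :: "(nat \<Rightarrow> 'a) \<Rightarrow> 'a \<Rightarrow> nat \<Rightarrow> 'a" where
  "T X a 0 = a"
| "T X a (Suc n) = dv n (\<Sum>j\<le>n. br (X (Suc j)) (T X a (n - j)))"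

declare T.simps(2) [simp del]

text \<open>The coefficient of order \<open>n\<close> depends on the generators up to order \<open>n\<close> only, which makes the recursion for
  the generators well-founded.\<close>

lemma T_cong:
  assumes "\<And>j. 1 \<le> j \<Longrightarrow> j \<le> n \<Longrightarrow> X j = X' j"
  shows "T X a n = T X' a n"
  using assms
proof (induction n rule: less_induct)
  case (less n)
  then show ?case by (cases n) (auto simp: T.simps(2) intro!: arg_cong[of _ _ "dv _"] sum.cong)
qed

definition gen :: "(nat \<Rightarrow> 'a) \<Rightarrow> 'a fps" where
  "gen X = Abs_fps (\<lambda>n. if n = 0 then 0 else X n)"

lemma ser_br_gen:
  "fps_nth (ser.br (gen X) A) 0 = 0"
  "fps_nth (ser.br (gen X) A) (Suc n) = (\<Sum>j\<le>n. br (X (Suc j)) (fps_nth A (n - j)))"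
  by (simp_all add: ser_br_nth gen_def sum.atMost_Suc_shift del: sum.atMost_Suc)

lemma euler_T: "of_nat n * T X a n = fps_nth (ser.br (gen X) (Abs_fps (T X a))) n"
  by (cases n) (simp_all only: ser_br_gen T.simps(2) dv, simp_all)

text \<open>Order by order, \<open>t A' = {X, A}\<close> determines the coefficient of order \<open>n\<close>, multiplied by \<open>n\<close>, from the earlier ones.\<close>

lemma T_unique:
  assumes A: "\<And>n. of_nat n * fps_nth A n = fps_nth (ser.br (gen X) A) n"
    and a: "fps_nth A 0 = a"
  shows "fps_nth A n = T X a n"
proof (induction n rule: less_induct)
  case (less n)
  show ?case
  proof (cases n)
    case 0 then show ?thesis using a by simp
  next
    case (Suc m)
    have "fps_nth (ser.br (gen X) A) n = fps_nth (ser.br (gen X) (Abs_fps (T X a))) n"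
      unfolding Suc ser_br_gen using less Suc by (intro sum.cong) auto
    then have "of_nat (Suc m) * (fps_nth A n - T X a n) = 0"
      using A[of n] euler_T[of n X a] Suc by (simp add: right_diff_distrib del: of_nat_Suc)
    then have "fps_nth A n - T X a n = 0" by (rule torsion_free)
    then show ?thesis by simp
  qed
qed

text \<open>By the Jacobi identity the bracket of two solutions of \<open>t A' = {X, A}\<close> is a solution.\<close>

lemma T_br: "(\<Sum>i\<le>n. br (T X a i) (T X b (n - i))) = T X (br a b) n"
proof -
  let ?A = "Abs_fps (T X a)" and ?B = "Abs_fps (T X b)"
  have E: "Abs_fps (\<lambda>n. of_nat n * fps_nth (Abs_fps (T X c)) n) = ser.br (gen X) (Abs_fps (T X c))" for c
    by (rule fps_ext) (simp add: euler_T)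
  have "fps_nth (ser.br ?A ?B) n = T X (br a b) n"
  proof (rule T_unique)
    show "fps_nth (ser.br ?A ?B) 0 = br a b" by (simp add: ser_br_nth)
    fix n
    show "of_nat n * fps_nth (ser.br ?A ?B) n = fps_nth (ser.br (gen X) (ser.br ?A ?B)) n"
      unfolding ser_br_euler E ser.jacobi[of "gen X" ?A ?B] by simp
  qed
  then show ?thesis by (simp add: ser_br_nth)
qed

text \<open>The normal form recursion. \<open>S r\<close> is the source at order \<open>r\<close> of the equation
  \<open>{X r, h\<^sub>0} + M r = S r\<close>; together these equations say that
  \<open>t H' - {X, H} = \<Sum>\<^sub>q t\<^sup>q T(M q)\<close> for \<open>H = h\<^sub>0 + t H\<^sub>1\<close>.\<close>

definition source :: "(nat \<Rightarrow> 'a) \<Rightarrow> (nat \<Rightarrow> 'a) \<Rightarrow> 'a \<Rightarrow> nat \<Rightarrow> 'a" where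
  "source X M H1 r = (if r \<le> 1 then H1
     else - br (X (r - 1)) H1 - (\<Sum>q\<in>{1..<r}. T X (M q) (r - q)))"

text \<open>\<open>slv\<close> and \<open>rst\<close> stand for the two parts in which a source is split; the recursion is well-founded
  because the source at order \<open>r\<close> refers to smaller orders only.\<close>

lemma normal_form_exists:
  fixes slv rst :: "'a \<Rightarrow> 'a"
  shows "\<exists>S. \<forall>r. S r = source (\<lambda>j. slv (S j)) (\<lambda>j. rst (S j)) H1 r"
proof -
  define F where "F S r = source (\<lambda>j. slv (S j)) (\<lambda>j. rst (S j)) H1 r" for S r
  have "adm_wf less_than F"
    unfolding adm_wf_def F_def source_def
    by (auto intro!: arg_cong2[of _ _ _ _ "(-)"] sum.cong T_cong arg_cong2[of _ _ _ _ br])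
  then have fp: "wfrec less_than F = F (wfrec less_than F)"
    by (rule wfrec_fixpoint[OF wf_less_than])
  have "wfrec less_than F r = source (\<lambda>j. slv (wfrec less_than F j)) (\<lambda>j. rst (wfrec less_than F j)) H1 r" for r
    using fun_cong[OF fp, of r] by (simp only: F_def)
  then show ?thesis by blast
qed

text \<open>\<open>c r\<close> is the coefficient of order \<open>r\<close> of \<open>{T g, h\<^sub>0 + t H\<^sub>1}\<close>. It is driven by the brackets of
  \<open>g\<close> with the terms \<open>M q\<close> only: were these brackets zero, \<open>T g\<close> would be a formal first integral.\<close>

lemma first_integral_defect:
  assumes eq: "\<And>r. 1 \<le> r \<Longrightarrow> br (X r) h0 + M r = source X M H1 r"
    and gh: "br g h0 = 0"
  defines "c r \<equiv> (if r = 0 then 0 else br (T X g r) h0 + br (T X g (r - 1)) H1)"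
  shows "of_nat (Suc r) * c (Suc r) =
      (\<Sum>j\<le>r. br (X (Suc j)) (c (r - j))) + (\<Sum>q\<in>{1..Suc r}. T X (br g (M q)) (Suc r - q))"
proof -
  define H where "H = Abs_fps (\<lambda>n. if n = 0 then h0 else if n = 1 then H1 else 0)"
  let ?G = "Abs_fps (T X g)"
  define N where "N = Abs_fps (\<lambda>n. of_nat n * fps_nth H n) - ser.br (gen X) H"
  have c: "fps_nth (ser.br ?G H) n = c n" for n
  proof (cases n)
    case 0 then show ?thesis by (simp add: ser_br_nth H_def c_def gh)
  next
    case (Suc m)
    have "fps_nth (ser.br ?G H) n = (\<Sum>i\<le>n. br (T X g i) (fps_nth H (n - i)))"
      by (simp add: ser_br_nth)
    also have "\<dots> = (\<Sum>i\<in>{m, n}. br (T X g i) (fps_nth H (n - i)))"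
      using Suc by (intro sum.mono_neutral_right) (auto simp: H_def)
    finally show ?thesis using Suc by (simp add: H_def c_def)
  qed
  have N0: "fps_nth N 0 = 0" by (simp add: N_def ser_br_gen)
  have N: "fps_nth N n = (\<Sum>q\<in>{1..n}. T X (M q) (n - q))" for n
  proof (cases n)
    case 0 then show ?thesis using N0 by simp
  next
    case (Suc m)
    have sb: "fps_nth (ser.br (gen X) H) n = (\<Sum>j\<le>m. br (X (Suc j)) (fps_nth H (m - j)))"
      unfolding Suc by (rule ser_br_gen)
    show ?thesis
    proof (cases m)
      case 0
      then show ?thesis using Suc sb eq[of 1] by (simp add: N_def H_def source_def algebra_simps)
    next
      case (Suc l)
      have "(\<Sum>j\<le>m. br (X (Suc j)) (fps_nth H (m - j))) = (\<Sum>j\<in>{l, m}. br (X (Suc j)) (fps_nth H (m - j)))"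
        using Suc by (intro sum.mono_neutral_right) (auto simp: H_def)
      then have 1: "fps_nth N n = - br (X n) h0 - br (X m) H1"
        using Suc \<open>n = Suc m\<close> sb by (simp add: N_def H_def)
      have 2: "br (X n) h0 + M n = - br (X m) H1 - (\<Sum>q\<in>{1..<n}. T X (M q) (n - q))"
        using eq[of n] Suc \<open>n = Suc m\<close> by (simp add: source_def)
      have 3: "{1..n} = insert n {1..<n}" using \<open>n = Suc m\<close> by auto
      have 4: "(\<Sum>q\<in>{1..n}. T X (M q) (n - q)) = M n + (\<Sum>q\<in>{1..<n}. T X (M q) (n - q))"
        unfolding 3 by simp
      have "- br (X n) h0 - br (X m) H1 = M n + (- br (X m) H1 - (br (X n) h0 + M n))"
        by simp
      then show ?thesis unfolding 1 4 2 by simp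
    qed
  qed
  have E: "Abs_fps (\<lambda>n. of_nat n * fps_nth ?G n) = ser.br (gen X) ?G"
    by (rule fps_ext) (simp add: euler_T)
  have EH: "Abs_fps (\<lambda>n. of_nat n * fps_nth H n) = ser.br (gen X) H + N"
    by (simp add: N_def)
  have "of_nat (Suc r) * c (Suc r) = fps_nth (ser.br (ser.br (gen X) ?G) H + ser.br ?G (ser.br (gen X) H + N)) (Suc r)"
    by (simp only: c[symmetric] ser_br_euler E EH fps_add_nth)
  also have "\<dots> = fps_nth (ser.br (gen X) (ser.br ?G H) + ser.br ?G N) (Suc r)"
    unfolding ser.jacobi[of "gen X" ?G H] ser.br_add_right by (simp only: add.assoc)
  also have "\<dots> = (\<Sum>j\<le>r. br (X (Suc j)) (c (r - j))) + fps_nth (ser.br ?G N) (Suc r)"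
    by (simp add: ser_br_gen c)
  also have "fps_nth (ser.br ?G N) (Suc r) = (\<Sum>i\<le>Suc r. \<Sum>q\<in>{1..Suc r - i}. br (T X g i) (T X (M q) (Suc r - i - q)))"
    by (simp add: ser_br_nth N br_sum_right del: sum.atMost_Suc)
  also have "\<dots> = (\<Sum>q\<in>{1..Suc r}. \<Sum>i\<le>Suc r - q. br (T X g i) (T X (M q) (Suc r - q - i)))"
    unfolding sum.Sigma[OF finite_atMost ballI[OF finite_atLeastAtMost]]
      sum.Sigma[OF finite_atLeastAtMost ballI[OF finite_atMost]]
    by (rule sum.reindex_bij_witness[of _ "\<lambda>(q, i). (i, q)" "\<lambda>(i, q). (q, i)"])
       (auto simp: add.commute)
  also have "\<dots> = (\<Sum>q\<in>{1..Suc r}. T X (br g (M q)) (Suc r - q))"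
    by (simp only: T_br)
  finally show ?thesis .
qed

end

section \<open>Jets and trigonometric polynomials\<close>

text \<open>\<open>jcoef a l I\<close> is the candidate for the Taylor coefficient \<open>\<partial>\<^sup>l a(I) / l!\<close>. No relation between different \<open>l\<close> or
  different points is built in: product and derivative of jets are then plain algebra on
  coefficients, and that the coefficients are derivatives of a function is the separate predicate
  \<open>jet_smooth\<close>. With coefficients divided by \<open>l!\<close>, the Leibniz rule is a convolution without
  binomial factors.\<close>

typedef ('n::finite) jet = "UNIV :: (nat^'n \<Rightarrow> real^'n \<Rightarrow> complex) set"
  morphisms jcoef Jet
  by simp

lemma jcoef_Jet [simp]: "jcoef (Jet f) = f"
  by (simp add: Jet_inverse)

lemma jet_eqI: "(\<And>l I. jcoef a l I = jcoef b l I) \<Longrightarrow> a = b"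
  by (metis ext jcoef_inject)

definition splits :: "nat^'n \<Rightarrow> ((nat^'n) \<times> (nat^'n)) set" where
  "splits l = {(p, q). p + q = l}"

lemma finite_below: "finite {p :: nat^'n. \<forall>i. p $ i \<le> m i}"
proof -
  have "{p :: nat^'n. \<forall>i. p $ i \<le> m i} \<subseteq> (\<lambda>f. \<chi> i. f i) ` (\<Pi>\<^sub>E i\<in>UNIV. {..m i})"
  proof
    fix p :: "nat^'n" assume "p \<in> {p. \<forall>i. p $ i \<le> m i}"
    then show "p \<in> (\<lambda>f. \<chi> i. f i) ` (\<Pi>\<^sub>E i\<in>UNIV. {..m i})"
      by (intro image_eqI[of _ _ "\<lambda>i. p $ i"]) (auto simp: vec_eq_iff)
  qed
  then show ?thesis by (rule finite_subset) (intro finite_imageI finite_PiE, auto)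
qed

lemma finite_splits [simp]: "finite (splits (l :: nat^'n))"
proof -
  have "splits l \<subseteq> {p. \<forall>i. p $ i \<le> l $ i} \<times> {p. \<forall>i. p $ i \<le> l $ i}"
    by (auto simp: splits_def)
  then show ?thesis by (rule finite_subset) (intro finite_cartesian_product finite_below)
qed

instantiation jet :: (finite) comm_ring_1
begin

definition "0 = Jet (\<lambda>l I. 0)"
definition "1 = Jet (\<lambda>l I. if l = 0 then 1 else 0)"
definition "a + b = Jet (\<lambda>l I. jcoef a l I + jcoef b l I)"
definition "a - b = Jet (\<lambda>l I. jcoef a l I - jcoef b l I)"
definition "- a = Jet (\<lambda>l I. - jcoef a l I)"
definition "a * b = Jet (\<lambda>l I. \<Sum>(p, q)\<in>splits l. jcoef a p I * jcoef b q I)"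

instance
proof
  fix a b c :: "'a jet"
  show "a + b + c = a + (b + c)" "a + b = b + a" "0 + a = a" "- a + a = 0" "a - b = a + - b"
    by (auto intro!: jet_eqI simp: plus_jet_def zero_jet_def uminus_jet_def minus_jet_def)
  show "(0::'a jet) \<noteq> 1"
  proof
    assume "(0::'a jet) = 1"
    then have "jcoef (0::'a jet) 0 0 = jcoef 1 0 0" by simp
    then show False by (simp add: zero_jet_def one_jet_def)
  qed
  show "a * b = b * a"
  proof (rule jet_eqI)
    fix l I
    show "jcoef (a * b) l I = jcoef (b * a) l I"
      unfolding times_jet_def jcoef_Jet
      by (rule sum.reindex_bij_witness[of _ "\<lambda>(p, q). (q, p)" "\<lambda>(p, q). (q, p)"])
         (auto simp: splits_def add.commute)
  qed
  show "1 * a = a"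
  proof (rule jet_eqI)
    fix l :: "nat^'a" and I
    have "jcoef (1 * a) l I = (\<Sum>(p, q)\<in>splits l. (if p = 0 then 1 else 0) * jcoef a q I)"
      by (simp add: times_jet_def one_jet_def)
    also have "\<dots> = (\<Sum>(p, q)\<in>{(0 :: nat^'a, l)}. (if p = 0 then 1 else 0) * jcoef a q I)"
      by (rule sum.mono_neutral_right[OF finite_splits]) (auto simp: splits_def split: if_splits)
    finally show "jcoef (1 * a) l I = jcoef a l I" by simp
  qed
  show "(a + b) * c = a * c + b * c"
    by (rule jet_eqI) (simp add: times_jet_def plus_jet_def distrib_right case_prod_unfold sum.distrib)
  show "a * b * c = a * (b * c)"
  proof (rule jet_eqI)
    fix l :: "nat^'a" and I
    have "jcoef (a * b * c) l I =
        (\<Sum>x\<in>splits l. \<Sum>y\<in>splits (fst x). jcoef a (fst y) I * jcoef b (snd y) I * jcoef c (snd x) I)"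
      by (simp add: times_jet_def case_prod_unfold sum_distrib_right)
    also have "\<dots> = (\<Sum>x\<in>splits l. \<Sum>y\<in>splits (snd x). jcoef a (fst x) I * jcoef b (fst y) I * jcoef c (snd y) I)"
      unfolding sum.Sigma[OF finite_splits ballI[OF finite_splits]]
      by (rule sum.reindex_bij_witness[of _ "\<lambda>((p, q), (u, v)). ((p + u, v), (p, u))"
            "\<lambda>((p, q), (u, v)). ((u, v + q), (v, q))"])
         (auto simp: splits_def add.assoc)
    also have "\<dots> = jcoef (a * (b * c)) l I"
      by (simp add: times_jet_def case_prod_unfold sum_distrib_left mult.assoc)
    finally show "jcoef (a * b * c) l I = jcoef (a * (b * c)) l I" .
  qed
qed

end

lemmas jet_ops = zero_jet_def one_jet_def plus_jet_def minus_jet_def uminus_jet_def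

lemma jcoef_sum: "jcoef (sum f S) l I = (\<Sum>x\<in>S. jcoef (f x) l I)"
  by (induction S rule: infinite_finite_induct) (simp_all add: jet_ops)

definition jsc :: "complex \<Rightarrow> ('n::finite) jet \<Rightarrow> 'n jet" where
  "jsc c a = Jet (\<lambda>l I. c * jcoef a l I)"

definition jd :: "'n \<Rightarrow> ('n::finite) jet \<Rightarrow> 'n jet" where
  "jd i a = Jet (\<lambda>l I. of_nat (Suc (l $ i)) * jcoef a (l + axis i 1) I)"

lemma jsc_simps [simp]:
  "jsc c 0 = 0" "jsc 0 a = 0" "jsc 1 a = a" "jsc c (jsc d a) = jsc (c * d) a"
  by (auto intro!: jet_eqI simp: jsc_def jet_ops)

lemma jsc_add: "jsc c (a + b) = jsc c a + jsc c b" "jsc (c + d) a = jsc c a + jsc d a"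
  by (auto intro!: jet_eqI simp: jsc_def jet_ops algebra_simps)

lemma jsc_mult: "jsc c a * b = jsc c (a * b)" "a * jsc c b = jsc c (a * b)"
  by (auto intro!: jet_eqI simp: jsc_def times_jet_def sum_distrib_left case_prod_unfold mult.left_commute mult.assoc)

lemma jsc_sum: "jsc c (sum f S) = (\<Sum>x\<in>S. jsc c (f x))"
  by (induction S rule: infinite_finite_induct) (auto simp: jsc_add)

lemma jd_zero [simp]: "jd i 0 = 0"
  by (simp add: jd_def jet_ops)

lemma jd_add: "jd i (a + b) = jd i a + jd i b"
  by (auto intro!: jet_eqI simp: jd_def jet_ops algebra_simps)

lemma jd_sum: "jd i (sum f S) = (\<Sum>x\<in>S. jd i (f x))"
  by (induction S rule: infinite_finite_induct) (auto simp: jd_add)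

lemma jd_jsc: "jd i (jsc c a) = jsc c (jd i a)"
  by (auto intro!: jet_eqI simp: jd_def jsc_def algebra_simps)

lemma jd_commute: "jd i (jd j a) = jd j (jd i a)"
proof (rule jet_eqI)
  fix l I
  have "l + axis i 1 + axis j 1 = l + axis j 1 + axis i (1::nat)" by (simp add: ac_simps)
  then show "jcoef (jd i (jd j a)) l I = jcoef (jd j (jd i a)) l I"
    by (cases "i = j") (simp_all add: jd_def axis_def mult.left_commute)
qed

lemma jd_mult: "jd i (a * b) = jd i a * b + a * jd i b"
proof (rule jet_eqI)
  fix l :: "nat^'a" and I
  let ?e = "axis i 1 :: nat^'a"
  have cancel: "p - ?e + ?e = p" if "p $ i \<noteq> 0" for p :: "nat^'a"
    using that by (auto simp: vec_eq_iff axis_def)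
  have half: "(\<Sum>x\<in>splits (l + ?e). of_nat (fst x $ i) * (jcoef a (fst x) I * jcoef b (snd x) I))
      = (\<Sum>x\<in>splits l. of_nat (Suc (fst x $ i)) * jcoef a (fst x + ?e) I * jcoef b (snd x) I)" for a b :: "'a jet"
  proof -
    have "(\<Sum>x\<in>splits (l + ?e). of_nat (fst x $ i) * (jcoef a (fst x) I * jcoef b (snd x) I))
        = (\<Sum>x\<in>{x\<in>splits (l + ?e). fst x $ i \<noteq> 0}. of_nat (fst x $ i) * (jcoef a (fst x) I * jcoef b (snd x) I))"
      by (intro sum.mono_neutral_right) auto
    also have "\<dots> = (\<Sum>x\<in>splits l. of_nat (Suc (fst x $ i)) * jcoef a (fst x + ?e) I * jcoef b (snd x) I)"
    proof (rule sum.reindex_bij_witness[of _ "\<lambda>(p, q). (p + ?e, q)" "\<lambda>(p, q). (p - ?e, q)"])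
      fix x assume x: "x \<in> {x \<in> splits (l + ?e). fst x $ i \<noteq> 0}"
      obtain p q where pq: "x = (p, q)" by force
      then have "p + q = l + ?e" and p: "p $ i \<noteq> 0" using x by (auto simp: splits_def)
      then have "(p - ?e) + q + ?e = l + ?e" using cancel[OF p] by (metis add.assoc add.commute)
      then have "(p - ?e) + q = l" by simp
      moreover have "Suc ((p - ?e) $ i) = p $ i" using p by (simp add: axis_def)
      ultimately show "(case x of (p, q) \<Rightarrow> (p - ?e, q)) \<in> splits l"
        "(case case x of (p, q) \<Rightarrow> (p - ?e, q) of (p, q) \<Rightarrow> (p + ?e, q)) = x"
        "of_nat (Suc (fst (case x of (p, q) \<Rightarrow> (p - ?e, q)) $ i)) *
           jcoef a (fst (case x of (p, q) \<Rightarrow> (p - ?e, q)) + ?e) I * jcoef b (snd (case x of (p, q) \<Rightarrow> (p - ?e, q))) I =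
         of_nat (fst x $ i) * (jcoef a (fst x) I * jcoef b (snd x) I)"
        using cancel[OF p] pq by (simp_all add: splits_def del: of_nat_Suc)
    next
      fix x assume x: "x \<in> splits l"
      obtain p q where pq: "x = (p, q)" by force
      have "p + ?e - ?e = p" by (simp add: vec_eq_iff)
      moreover have "p + ?e + q = p + q + ?e" by (simp add: ac_simps)
      ultimately show "(case case x of (p, q) \<Rightarrow> (p + ?e, q) of (p, q) \<Rightarrow> (p - ?e, q)) = x"
        "(case x of (p, q) \<Rightarrow> (p + ?e, q)) \<in> {x \<in> splits (l + ?e). fst x $ i \<noteq> 0}"
        using x pq by (simp_all add: splits_def axis_def)
    qed
    finally show ?thesis .
  qed
  have swp: "(\<Sum>x\<in>splits k. f (fst x) (snd x)) = (\<Sum>x\<in>splits k. f (snd x) (fst x))"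
    for k :: "nat^'a" and f :: "nat^'a \<Rightarrow> nat^'a \<Rightarrow> complex"
    by (rule sum.reindex_bij_witness[of _ "\<lambda>(p, q). (q, p)" "\<lambda>(p, q). (q, p)"])
       (auto simp: splits_def add.commute)
  have tot: "of_nat (Suc (l $ i)) = (of_nat (fst x $ i) + of_nat (snd x $ i) :: complex)"
    if "x \<in> splits (l + ?e)" for x
  proof -
    have "fst x + snd x = l + ?e" using that by (auto simp: splits_def)
    then have "(fst x + snd x) $ i = Suc (l $ i)" by (simp add: axis_def)
    then show ?thesis by (metis of_nat_add vector_add_component)
  qed
  have "jcoef (jd i (a * b)) l I = (\<Sum>x\<in>splits (l + ?e). of_nat (Suc (l $ i)) * (jcoef a (fst x) I * jcoef b (snd x) I))"
    by (simp add: jd_def times_jet_def case_prod_unfold sum_distrib_left del: of_nat_Suc)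
  also have "\<dots> = (\<Sum>x\<in>splits (l + ?e). of_nat (fst x $ i) * (jcoef a (fst x) I * jcoef b (snd x) I)
      + of_nat (snd x $ i) * (jcoef b (snd x) I * jcoef a (fst x) I))"
    by (intro sum.cong refl) (simp add: tot algebra_simps del: of_nat_Suc)
  also have "\<dots> = (\<Sum>x\<in>splits l. of_nat (Suc (fst x $ i)) * jcoef a (fst x + ?e) I * jcoef b (snd x) I)
      + (\<Sum>x\<in>splits l. of_nat (Suc (fst x $ i)) * jcoef b (fst x + ?e) I * jcoef a (snd x) I)"
    unfolding sum.distrib half swp[where k="l + ?e" and f="\<lambda>p q. of_nat (q $ i) * (jcoef b q I * jcoef a p I)"] ..
  also have "\<dots> = jcoef (jd i a * b + a * jd i b) l I"
    unfolding swp[where k=l and f="\<lambda>p q. of_nat (Suc (p $ i)) * jcoef b (p + ?e) I * jcoef a q I"]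
    by (simp add: jd_def times_jet_def plus_jet_def case_prod_unfold mult.commute mult.left_commute del: of_nat_Suc)
  finally show "jcoef (jd i (a * b)) l I = jcoef (jd i a * b + a * jd i b) l I" .
qed

text \<open>Trigonometric polynomials in the angles whose coefficients are jets in the actions. Their ring structure is
  the convolution of \<^theory>\<open>HOL-Library.Poly_Mapping\<close>.\<close>

type_synonym 'n obs = "(int^'n) \<Rightarrow>\<^sub>0 'n jet"

abbreviation lk :: "('n::finite) obs \<Rightarrow> int^'n \<Rightarrow> 'n jet" where "lk \<equiv> poly_mapping.lookup"

lemma lk_mult: "lk (a * b) k = (\<Sum>u\<in>Poly_Mapping.keys a. lk a u * lk b (k - u))"
proof -
  have "(\<Sum>q. lk b q when k = u + q) = lk b (k - u)" for u
  proof -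
    have "(\<Sum>q. lk b q when k = u + q) = (\<Sum>q. lk b q when q = k - u)"
      by (intro Sum_any.cong when_cong) (auto simp: algebra_simps)
    then show ?thesis by simp
  qed
  then have "lk (a * b) k = (\<Sum>u. lk a u * lk b (k - u))"
    by (simp add: lookup_mult)
  also have "\<dots> = (\<Sum>u\<in>Poly_Mapping.keys a. lk a u * lk b (k - u))"
    by (rule Sum_any.expand_superset) (auto simp: in_keys_iff)
  finally show ?thesis .
qed

text \<open>Angle derivatives, the solution of the homological equation and the splitting into modes are all Fourier
  multipliers, so one operation covers them.\<close>

definition mulf :: "(int^'n \<Rightarrow> complex) \<Rightarrow> ('n::finite) obs \<Rightarrow> 'n obs" where
  "mulf \<mu> a = Poly_Mapping.mapp (\<lambda>k x. jsc (\<mu> k) x) a"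

lemma lk_mulf [simp]: "lk (mulf \<mu> a) k = jsc (\<mu> k) (lk a k)"
  by (simp add: mulf_def lookup_mapp when_def not_in_keys_iff_lookup_eq_zero)

definition dth :: "'n \<Rightarrow> ('n::finite) obs \<Rightarrow> 'n obs" where
  "dth i = mulf (\<lambda>k. 2 * pi * \<i> * of_int (k $ i))"

definition dac :: "'n \<Rightarrow> ('n::finite) obs \<Rightarrow> 'n obs" where
  "dac i a = Poly_Mapping.mapp (\<lambda>k x. jd i x) a"

lemma lk_dth [simp]: "lk (dth i a) k = jsc (2 * pi * \<i> * of_int (k $ i)) (lk a k)"
  by (simp add: dth_def)

lemma lk_dac [simp]: "lk (dac i a) k = jd i (lk a k)"
  by (simp add: dac_def lookup_mapp when_def not_in_keys_iff_lookup_eq_zero)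

lemma lk_of_nat_mult: "lk (of_nat n * a) k = jsc (of_nat n) (lk a k)"
  by (induction n) (simp_all add: distrib_right lookup_add jsc_add)

lemma mulf_mulf [simp]: "mulf \<mu> (mulf \<nu> a) = mulf (\<lambda>k. \<mu> k * \<nu> k) a"
  by (intro poly_mapping_eqI) simp

lemma lk_mult_superset:
  assumes "finite K" "Poly_Mapping.keys a \<subseteq> K"
  shows "lk (a * b) k = (\<Sum>u\<in>K. lk a u * lk b (k - u))"
  unfolding lk_mult using assms
  by (intro sum.mono_neutral_left) (auto simp: in_keys_iff)

definition div_Suc :: "nat \<Rightarrow> ('n::finite) obs \<Rightarrow> 'n obs" where
  "div_Suc n = mulf (\<lambda>_. 1 / of_nat (Suc n))"

interpretation obs: lie_transform dth dac div_Suc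
proof
  fix i j :: "'n::finite" and a b :: "'n obs" and n
  show "dth i (a + b) = dth i a + dth i b" "dac i (a + b) = dac i a + dac i b"
    by (intro poly_mapping_eqI; simp add: lookup_add jsc_add jd_add)+
  show "dth i (dth j a) = dth j (dth i a)" "dac i (dac j a) = dac j (dac i a)" "dth i (dac j a) = dac j (dth i a)"
    by (intro poly_mapping_eqI; simp add: mult.commute jd_commute[of i] jd_jsc)+
  show "dac i (a * b) = dac i a * b + a * dac i b"
  proof (rule poly_mapping_eqI)
    fix k
    have "lk (dac i a * b) k = (\<Sum>u\<in>Poly_Mapping.keys a. lk (dac i a) u * lk b (k - u))"
      by (rule lk_mult_superset) (auto simp: dac_def intro: keys_mapp_subset[THEN subsetD])
    then show "lk (dac i (a * b)) k = lk (dac i a * b + a * dac i b) k"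
      by (simp add: lookup_add lk_mult jd_sum jd_mult sum.distrib)
  qed
  show "dth i (a * b) = dth i a * b + a * dth i b"
  proof (rule poly_mapping_eqI)
    fix k :: "int^'n"
    have 1: "lk (dth i a * b) k = (\<Sum>u\<in>Poly_Mapping.keys a. lk (dth i a) u * lk b (k - u))"
      by (rule lk_mult_superset) (auto simp: dth_def mulf_def intro: keys_mapp_subset[THEN subsetD])
    have 2: "2 * pi * \<i> * of_int (k $ i) = 2 * pi * \<i> * of_int (u $ i) + 2 * pi * \<i> * of_int ((k - u) $ i)" for u
      by (simp add: algebra_simps)
    show "lk (dth i (a * b)) k = lk (dth i a * b + a * dth i b) k"
      unfolding lookup_add 1 unfolding lk_mult lk_dth jsc_sum jsc_mult sum.distrib[symmetric] jsc_add[symmetric] 2[symmetric] ..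
  qed
  show "of_nat (Suc n) * a = 0 \<Longrightarrow> a = 0"
  proof (rule poly_mapping_eqI)
    fix k assume "of_nat (Suc n) * a = 0"
    then have "jsc (of_nat (Suc n)) (lk a k) = 0"
      using lk_of_nat_mult[of "Suc n" a k] by (simp del: of_nat_Suc)
    then have "jsc (1 / of_nat (Suc n)) (jsc (of_nat (Suc n)) (lk a k)) = 0" by simp
    then show "lk a k = lk 0 k" by (simp del: of_nat_Suc)
  qed
  show "of_nat (Suc n) * div_Suc n a = a"
    by (intro poly_mapping_eqI) (simp add: div_Suc_def lk_of_nat_mult del: of_nat_Suc)
qed

abbreviation pb :: "('n::finite) obs \<Rightarrow> 'n obs \<Rightarrow> 'n obs" where "pb \<equiv> obs.br"
abbreviation lieT :: "(nat \<Rightarrow> ('n::finite) obs) \<Rightarrow> 'n obs \<Rightarrow> nat \<Rightarrow> 'n obs" where "lieT \<equiv> obs.T"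

definition kdot :: "int^'n \<Rightarrow> real^'n \<Rightarrow> real" where
  "kdot k v = (\<Sum>i\<in>UNIV. of_int (k $ i) * v $ i)"

text \<open>The observable \<open>v \<bullet> I\<close>: its first Taylor coefficients are the components of \<open>v\<close>, all higher ones vanish.\<close>

definition lin :: "real^'n \<Rightarrow> ('n::finite) obs" where
  "lin v = Poly_Mapping.single 0 (Jet (\<lambda>l I. if l = 0 then of_real (v \<bullet> I)
     else (\<Sum>i\<in>UNIV. if l = axis i 1 then of_real (v $ i) else 0)))"

lemma dth_lin: "dth i (lin v) = 0"
  by (intro poly_mapping_eqI) (simp add: lin_def lookup_single when_def)

lemma dac_lin: "dac i (lin v) = mulf (\<lambda>_. of_real (v $ i)) 1"
proof (intro poly_mapping_eqI)
  fix k :: "int^'a"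
  have 1: "(l + axis i 1 = axis j 1) = (l = 0 \<and> i = j)" for l :: "nat^'a" and j
  proof
    assume *: "l + axis i 1 = axis j 1"
    then have "i = j" by (auto simp: vec_eq_iff axis_def split: if_splits dest: spec[of _ i])
    then show "l = 0 \<and> i = j" using * by simp
  qed auto
  have 2: "l + axis i 1 \<noteq> 0" for l :: "nat^'a"
    by (auto simp: vec_eq_iff axis_def intro!: exI[of _ i])
  have 3: "(axis i 1 = (axis j 1 :: nat^'a)) = (i = j)" for j
    using 1[of 0 j] by simp
  show "lk (dac i (lin v)) k = lk (mulf (\<lambda>_. of_real (v $ i)) 1) k"
  proof (cases "k = 0")
    case True
    show ?thesis
      by (rule jet_eqI)
         (simp add: True lin_def jd_def jsc_def one_jet_def 1 2 3 if_distrib if_distribR cong: if_cong del: One_nat_def)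
  next
    case False
    then show ?thesis by (simp add: lin_def lookup_single lookup_one when_def)
  qed
qed

lemma mult_const: "a * mulf (\<lambda>_. c) 1 = mulf (\<lambda>_. c) a"
proof -
  have "lk (a * mulf (\<lambda>_. c) 1) k = jsc c (lk a k)" for k
  proof -
    have "lk (a * mulf (\<lambda>_. c) 1) k = (\<Sum>u\<in>Poly_Mapping.keys a. if u = k then jsc c (lk a u) else 0)"
      unfolding lk_mult by (intro sum.cong refl) (auto simp: lookup_one when_def jsc_mult)
    then show ?thesis by (auto simp: not_in_keys_iff_lookup_eq_zero)
  qed
  then show ?thesis by (intro poly_mapping_eqI) simp
qed

lemma pb_lin: "pb a (lin v) = mulf (\<lambda>k. 2 * pi * \<i> * of_real (kdot k v)) a"
proof -
  have "pb a (lin v) = (\<Sum>i\<in>UNIV. mulf (\<lambda>_. of_real (v $ i)) (dth i a))"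
    by (simp add: obs.br_def dth_lin dac_lin mult_const)
  also have "\<dots> = mulf (\<lambda>k. 2 * pi * \<i> * of_real (kdot k v)) a"
  proof (intro poly_mapping_eqI)
    fix k
    have "(\<Sum>i\<in>S. jsc (f i) x) = jsc (sum f S) x" for f :: "'a \<Rightarrow> complex" and S and x :: "'a jet"
      by (induction S rule: infinite_finite_induct) (auto simp: jsc_add)
    then show "lk (\<Sum>i\<in>UNIV. mulf (\<lambda>_. of_real (v $ i)) (dth i a)) k = lk (mulf (\<lambda>k. 2 * pi * \<i> * of_real (kdot k v)) a) k"
      by (simp add: lookup_sum kdot_def sum_distrib_left mult.commute mult.left_commute)
  qed
  finally show ?thesis .
qed

lemma pb_lin_lin: "pb (lin v) (lin w) = 0"
proof (rule poly_mapping_eqI)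
  fix k :: "int^'a"
  show "lk (pb (lin v) (lin w)) k = lk 0 k"
    unfolding pb_lin by (cases "k = 0") (simp_all add: kdot_def lin_def lookup_single when_def)
qed

section \<open>Differentiation along curves\<close>

lemma infnorm_le_iff: "infnorm (x :: real^'n) \<le> R \<longleftrightarrow> (\<forall>i. \<bar>x $ i\<bar> \<le> R)"
proof
  assume "infnorm x \<le> R"
  then show "\<forall>i. \<bar>x $ i\<bar> \<le> R" using component_le_infnorm_cart order_trans by blast
next
  assume "\<forall>i. \<bar>x $ i\<bar> \<le> R"
  then have "infnorm x \<in> {\<bar>x \<bullet> b\<bar> |b. b \<in> Basis} \<Longrightarrow> infnorm x \<le> R"
    by (auto simp: Basis_vec_def inner_axis)
  then show "infnorm x \<le> R"
    using infnorm_Max[of x] \<open>\<forall>i. \<bar>x $ i\<bar> \<le> R\<close>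
    by (auto simp: Basis_vec_def inner_axis intro!: Max.boundedI)
qed

text \<open>The increment is split into steps along single coordinates, and the mean value theorem is
  applied to each step.\<close>

lemma increment_le:
  fixes g :: "'a::real_vector \<Rightarrow> 'b::real_normed_vector" and u :: "'j \<Rightarrow> 'a"
  assumes "finite S"
    and dom: "\<And>t :: 'j \<Rightarrow> real. (\<And>j. j \<in> S \<Longrightarrow> 0 \<le> t j \<and> t j \<le> 1) \<Longrightarrow> x + (\<Sum>j\<in>S. (t j * h j) *\<^sub>R u j) \<in> D"
    and der: "\<And>j y. j \<in> S \<Longrightarrow> y \<in> D \<Longrightarrow>
      ((\<lambda>s. g (y + s *\<^sub>R u j)) has_vector_derivative g' j y) (at 0 within {s. y + s *\<^sub>R u j \<in> D})"
    and bd: "\<And>j (t :: 'j \<Rightarrow> real). j \<in> S \<Longrightarrow> (\<And>j. j \<in> S \<Longrightarrow> 0 \<le> t j \<and> t j \<le> 1) \<Longrightarrow>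
      norm (g' j (x + (\<Sum>j\<in>S. (t j * h j) *\<^sub>R u j)) - c j) \<le> e"
  shows "norm (g (x + (\<Sum>j\<in>S. h j *\<^sub>R u j)) - g x - (\<Sum>j\<in>S. h j *\<^sub>R c j)) \<le> e * (\<Sum>j\<in>S. \<bar>h j\<bar>)"
  using assms
proof (induction S rule: finite_induct)
  case empty
  then show ?case by simp
next
  case (insert j S)
  define x1 where "x1 = x + (\<Sum>j\<in>S. h j *\<^sub>R u j)"
  have ext: "x + (\<Sum>i\<in>insert j S. ((t(j := a)) i * h i) *\<^sub>R u i) = x + (\<Sum>i\<in>S. (t i * h i) *\<^sub>R u i) + (a * h j) *\<^sub>R u j" for t :: "'j \<Rightarrow> real" and a
  proof -
    have "(\<Sum>i\<in>S. ((t(j := a)) i * h i) *\<^sub>R u i) = (\<Sum>i\<in>S. (t i * h i) *\<^sub>R u i)"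
      using insert.hyps by (intro sum.cong) auto
    then show ?thesis using insert.hyps by simp
  qed
  have 1: "norm (g x1 - g x - (\<Sum>j\<in>S. h j *\<^sub>R c j)) \<le> e * (\<Sum>j\<in>S. \<bar>h j\<bar>)"
    unfolding x1_def
  proof (rule insert.IH)
    fix t :: "'j \<Rightarrow> real" assume t: "\<And>i. i \<in> S \<Longrightarrow> 0 \<le> t i \<and> t i \<le> 1"
    have "x + (\<Sum>i\<in>S. (t i * h i) *\<^sub>R u i) + (0 * h j) *\<^sub>R u j \<in> D"
      unfolding ext[symmetric] by (rule insert.prems(1)) (use t in auto)
    then show "x + (\<Sum>j\<in>S. (t j * h j) *\<^sub>R u j) \<in> D" by simp
  next
    fix i and t :: "'j \<Rightarrow> real" assume i: "i \<in> S" and t: "\<And>i. i \<in> S \<Longrightarrow> 0 \<le> t i \<and> t i \<le> 1"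
    have "norm (g' i (x + (\<Sum>i\<in>S. (t i * h i) *\<^sub>R u i) + (0 * h j) *\<^sub>R u j) - c i) \<le> e"
      unfolding ext[symmetric] by (rule insert.prems(3)) (use i t in auto)
    then show "norm (g' i (x + (\<Sum>j\<in>S. (t j * h j) *\<^sub>R u j)) - c i) \<le> e" by simp
  qed (use insert.prems(2) in auto)
  have dom1: "x1 + (a * h j) *\<^sub>R u j \<in> D" if "0 \<le> a" "a \<le> 1" for a
    using insert.prems(1)[of "(\<lambda>_. 1)(j := a)"] that unfolding ext by (simp add: x1_def)
  have bd1: "norm (g' j (x1 + (a * h j) *\<^sub>R u j) - c j) \<le> e" if "0 \<le> a" "a \<le> 1" for a
    using insert.prems(3)[of j "(\<lambda>_. 1)(j := a)"] that unfolding ext by (simp add: x1_def)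
  define \<phi> where "\<phi> a = g (x1 + (a * h j) *\<^sub>R u j) - (a * h j) *\<^sub>R c j" for a
  have der: "(\<phi> has_vector_derivative (h j *\<^sub>R (g' j (x1 + (a * h j) *\<^sub>R u j) - c j))) (at a within {0..1})"
    if a: "a \<in> {0..1}" for a
  proof -
    define y where "y = x1 + (a * h j) *\<^sub>R u j"
    have "((\<lambda>s. g (y + s *\<^sub>R u j)) has_vector_derivative g' j y) (at 0 within {s. y + s *\<^sub>R u j \<in> D})"
      using insert.prems(2)[of j y] dom1 a by (auto simp: y_def)
    moreover have "(\<lambda>b. (b - a) * h j) ` {0..1} \<subseteq> {s. y + s *\<^sub>R u j \<in> D}"
      using dom1 by (auto simp: y_def algebra_simps simp flip: scaleR_add_left)
    ultimately have "((\<lambda>s. g (y + s *\<^sub>R u j)) has_vector_derivative g' j y) (at ((a - a) * h j) within (\<lambda>b. (b - a) * h j) ` {0..1})"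
      by (auto intro: has_vector_derivative_within_subset)
    moreover have "((\<lambda>b. (b - a) * h j) has_vector_derivative h j) (at a within {0..1})"
      by (auto intro!: derivative_eq_intros simp: has_real_derivative_iff_has_vector_derivative[symmetric])
    ultimately have "((\<lambda>s. g (y + s *\<^sub>R u j)) \<circ> (\<lambda>b. (b - a) * h j) has_vector_derivative h j *\<^sub>R g' j y) (at a within {0..1})"
      by (intro vector_diff_chain_within)
    moreover have "(\<lambda>s. g (y + s *\<^sub>R u j)) \<circ> (\<lambda>b. (b - a) * h j) = (\<lambda>b. g (x1 + (b * h j) *\<^sub>R u j))"
      by (auto simp: y_def algebra_simps simp flip: scaleR_add_left)
    ultimately have "((\<lambda>b. g (x1 + (b * h j) *\<^sub>R u j)) has_vector_derivative h j *\<^sub>R g' j y) (at a within {0..1})"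
      by simp
    moreover have "((\<lambda>b. (b * h j) *\<^sub>R c j) has_vector_derivative h j *\<^sub>R c j) (at a within {0..1})"
      by (auto intro!: derivative_eq_intros)
    ultimately show ?thesis
      unfolding \<phi>_def y_def scaleR_diff_right by (rule has_vector_derivative_diff)
  qed
  have "norm (\<phi> 1 - \<phi> 0) \<le> (\<bar>h j\<bar> * e) * norm (1 - 0 :: real)"
  proof (rule differentiable_bound[where S="{0..1}" and f'="\<lambda>a s. s *\<^sub>R (h j *\<^sub>R (g' j (x1 + (a * h j) *\<^sub>R u j) - c j))"])
    fix a :: real assume "a \<in> {0..1}"
    then show "(\<phi> has_derivative (\<lambda>s. s *\<^sub>R (h j *\<^sub>R (g' j (x1 + (a * h j) *\<^sub>R u j) - c j)))) (at a within {0..1})"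
      using der unfolding has_vector_derivative_def by simp
    show "onorm (\<lambda>s. s *\<^sub>R (h j *\<^sub>R (g' j (x1 + (a * h j) *\<^sub>R u j) - c j))) \<le> \<bar>h j\<bar> * e"
    proof (rule onorm_le)
      fix s :: real
      have "\<bar>s\<bar> * (\<bar>h j\<bar> * norm (g' j (x1 + (a * h j) *\<^sub>R u j) - c j)) \<le> \<bar>s\<bar> * (\<bar>h j\<bar> * e)"
        using bd1 \<open>a \<in> {0..1}\<close> by (intro mult_left_mono) auto
      then show "norm (s *\<^sub>R (h j *\<^sub>R (g' j (x1 + (a * h j) *\<^sub>R u j) - c j))) \<le> \<bar>h j\<bar> * e * norm s"
        by (simp add: abs_mult mult.commute mult.left_commute)
    qed
  qed auto
  moreover have "\<phi> 1 - \<phi> 0 = g (x1 + h j *\<^sub>R u j) - g x1 - h j *\<^sub>R c j"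
    by (simp add: \<phi>_def)
  ultimately have 2: "norm (g (x1 + h j *\<^sub>R u j) - g x1 - h j *\<^sub>R c j) \<le> \<bar>h j\<bar> * e" by simp
  have "norm (g (x1 + h j *\<^sub>R u j) - g x - (h j *\<^sub>R c j + (\<Sum>j\<in>S. h j *\<^sub>R c j))) \<le> \<bar>h j\<bar> * e + e * (\<Sum>j\<in>S. \<bar>h j\<bar>)"
    using norm_triangle_ineq[of "g (x1 + h j *\<^sub>R u j) - g x1 - h j *\<^sub>R c j" "g x1 - g x - (\<Sum>j\<in>S. h j *\<^sub>R c j)"] 1 2
    by (simp add: algebra_simps)
  then show ?case using insert.hyps by (simp add: x1_def algebra_simps)
qed

abbreviation aball :: "real \<Rightarrow> (real^'n) set" where "aball R \<equiv> {I. infnorm I \<le> R}"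

lemma vec_as_sum: "(v :: real^'n) = (\<Sum>j\<in>UNIV. (v $ j) *\<^sub>R axis j 1)"
  by (simp add: vec_eq_iff axis_def if_distrib cong: if_cong)

lemma axis_sum_nth: "(\<Sum>j\<in>UNIV. (t j) *\<^sub>R axis j (1::real)) $ i = t i"
  by (simp add: axis_def if_distrib cong: if_cong)

text \<open>Continuous partial derivatives give a total derivative also at boundary points of the cube of actions: the
  partial derivatives within the cube are one-sided there, and the path along the coordinate
  directions used in \<open>increment_le\<close> stays inside the cube.\<close>

lemma has_derivative_aball:
  fixes g :: "real^'n \<Rightarrow> 'b::real_normed_vector"
  assumes x: "x \<in> aball R"
    and der: "\<And>j y. y \<in> aball R \<Longrightarrow>
      ((\<lambda>s. g (y + s *\<^sub>R axis j 1)) has_vector_derivative g' j y) (at 0 within {s. y + s *\<^sub>R axis j 1 \<in> aball R})"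
    and cont: "\<And>j. continuous_on (aball R) (g' j)"
  shows "(g has_derivative (\<lambda>v. \<Sum>j\<in>UNIV. (v $ j) *\<^sub>R g' j x)) (at x within aball R)"
  unfolding has_derivative_within_alt
proof (intro conjI allI impI)
  show "bounded_linear (\<lambda>v. \<Sum>j\<in>UNIV. (v $ j) *\<^sub>R g' j x)"
    by (intro bounded_linear_sum bounded_linear_scaleR_const bounded_linear_vec_nth)
next
  fix e :: real assume e: "0 < e"
  define e' where "e' = e / real CARD('n)"
  have e': "e' > 0" using e by (simp add: e'_def)
  have "\<forall>j. \<exists>d>0. \<forall>y\<in>aball R. dist y x < d \<longrightarrow> dist (g' j y) (g' j x) < e'"
    using cont x e' unfolding continuous_on_iff by blast
  then obtain d where d: "\<And>j. d j > 0" "\<And>j y. y \<in> aball R \<Longrightarrow> dist y x < d j \<Longrightarrow> dist (g' j y) (g' j x) < e'"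
    by metis
  define d0 where "d0 = Min (range d)"
  have d0: "d0 > 0" "\<And>j. d0 \<le> d j" using d by (auto simp: d0_def)
  show "\<exists>d>0. \<forall>y\<in>aball R. norm (y - x) < d \<longrightarrow>
      norm (g y - g x - (\<Sum>j\<in>UNIV. ((y - x) $ j) *\<^sub>R g' j x)) \<le> e * norm (y - x)"
  proof (intro exI conjI ballI impI)
    fix y assume y: "y \<in> aball R" "norm (y - x) < d0"
    define h where "h j = (y - x) $ j" for j
    have pt: "x + (\<Sum>j\<in>UNIV. (t j * h j) *\<^sub>R axis j 1) \<in> aball R \<and>
        dist (x + (\<Sum>j\<in>UNIV. (t j * h j) *\<^sub>R axis j 1)) x < d0"
      if t: "\<And>j. j \<in> UNIV \<Longrightarrow> 0 \<le> t j \<and> t j \<le> 1" for t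
    proof
      have "\<bar>x $ i + t i * (y $ i - x $ i)\<bar> \<le> R" for i
      proof -
        have "\<bar>(1 - t i) * x $ i + t i * y $ i\<bar> \<le> (1 - t i) * \<bar>x $ i\<bar> + t i * \<bar>y $ i\<bar>"
          using t[of i] by (intro order_trans[OF abs_triangle_ineq]) (simp add: abs_mult)
        also have "\<dots> \<le> (1 - t i) * R + t i * R"
          using t[of i] x y by (intro add_mono mult_left_mono) (auto simp: infnorm_le_iff)
        finally show ?thesis by (simp add: algebra_simps)
      qed
      then show "x + (\<Sum>j\<in>UNIV. (t j * h j) *\<^sub>R axis j 1) \<in> aball R"
        by (simp add: infnorm_le_iff axis_sum_nth h_def del: sum_component)
      have "norm (\<Sum>j\<in>UNIV. (t j * h j) *\<^sub>R axis j 1 :: real^'n) \<le> norm (y - x)"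
        using t by (intro norm_le_componentwise_cart)
          (simp add: axis_sum_nth h_def abs_mult mult_left_le_one_le del: sum_component)
      then show "dist (x + (\<Sum>j\<in>UNIV. (t j * h j) *\<^sub>R axis j 1)) x < d0"
        using y by (simp add: dist_norm)
    qed
    have "norm (g (x + (\<Sum>j\<in>UNIV. h j *\<^sub>R axis j 1)) - g x - (\<Sum>j\<in>UNIV. h j *\<^sub>R g' j x)) \<le> e' * (\<Sum>j\<in>UNIV. \<bar>h j\<bar>)"
    proof (rule increment_le[where D="aball R" and g'=g'])
      fix j :: 'n and t :: "'n \<Rightarrow> real" assume t: "\<And>j. j \<in> UNIV \<Longrightarrow> 0 \<le> t j \<and> t j \<le> 1"
      show "norm (g' j (x + (\<Sum>j\<in>UNIV. (t j * h j) *\<^sub>R axis j 1)) - g' j x) \<le> e'"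
        using pt[of t, OF t] d(2)[of "x + (\<Sum>j\<in>UNIV. (t j * h j) *\<^sub>R axis j 1)" j] d0(2)[of j]
        by (auto simp: dist_norm)
    qed (use pt der in auto)
    moreover have "x + (\<Sum>j\<in>UNIV. h j *\<^sub>R axis j 1) = y"
      unfolding h_def vec_as_sum[of "y - x", symmetric] by simp
    moreover have "(\<Sum>j\<in>UNIV. \<bar>h j\<bar>) \<le> real CARD('n) * norm (y - x)"
      using sum_bounded_above[of UNIV "\<lambda>j. \<bar>h j\<bar>" "norm (y - x)"] component_le_norm_cart[of "y - x"]
      by (simp add: h_def)
    then have "e' * (\<Sum>j\<in>UNIV. \<bar>h j\<bar>) \<le> e * norm (y - x)"
      using e' mult_left_mono[of "\<Sum>j\<in>UNIV. \<bar>h j\<bar>" "real CARD('n) * norm (y - x)" e'] by (simp add: e'_def)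
    ultimately show "norm (g y - g x - (\<Sum>j\<in>UNIV. ((y - x) $ j) *\<^sub>R g' j x)) \<le> e * norm (y - x)"
      by (simp add: h_def)
  qed (rule d0)
qed

text \<open>The jet \<open>a\<close> consists of the Taylor coefficients of a smooth function on the set of actions.\<close>

definition jet_smooth :: "real \<Rightarrow> ('n::finite) jet \<Rightarrow> bool" where
  "jet_smooth R a \<longleftrightarrow> (\<forall>l. continuous_on (aball R) (jcoef a l)) \<and>
     (\<forall>l i. \<forall>I\<in>aball R. ((\<lambda>s. jcoef a l (I + s *\<^sub>R axis i 1)) has_vector_derivative jcoef (jd i a) l I)
        (at 0 within {s. I + s *\<^sub>R axis i 1 \<in> aball R}))"

lemma jet_smooth_0: "jet_smooth R 0"
  unfolding jet_smooth_def jd_zero by (simp add: zero_jet_def)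

lemma jet_smooth_add: "jet_smooth R a \<Longrightarrow> jet_smooth R b \<Longrightarrow> jet_smooth R (a + b)"
  unfolding jet_smooth_def jd_add
  by (auto simp: plus_jet_def intro!: continuous_on_add has_vector_derivative_add)

lemma jet_smooth_jsc: "jet_smooth R a \<Longrightarrow> jet_smooth R (jsc c a)"
  unfolding jet_smooth_def jd_jsc
  by (auto simp: jsc_def intro!: continuous_on_mult_left has_vector_derivative_mult_right)

lemma jet_smooth_sum: "(\<And>x. x \<in> S \<Longrightarrow> jet_smooth R (f x)) \<Longrightarrow> jet_smooth R (sum f S)"
  by (induction S rule: infinite_finite_induct) (auto intro: jet_smooth_0 jet_smooth_add)

lemma jet_smooth_jd: assumes "jet_smooth R a" shows "jet_smooth R (jd i a)"
  unfolding jet_smooth_def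
proof (intro conjI allI ballI)
  fix l show "continuous_on (aball R) (jcoef (jd i a) l)"
    using assms by (auto simp: jd_def jet_smooth_def intro!: continuous_on_mult_left)
next
  fix l j and I :: "real^'a" assume "I \<in> aball R"
  then have "((\<lambda>s. jcoef a (l + axis i 1) (I + s *\<^sub>R axis j 1)) has_vector_derivative jcoef (jd j a) (l + axis i 1) I)
        (at 0 within {s. I + s *\<^sub>R axis j 1 \<in> aball R})"
    using assms by (auto simp: jet_smooth_def)
  then have "((\<lambda>s. of_nat (Suc (l $ i)) * jcoef a (l + axis i 1) (I + s *\<^sub>R axis j 1)) has_vector_derivative
        of_nat (Suc (l $ i)) * jcoef (jd j a) (l + axis i 1) I) (at 0 within {s. I + s *\<^sub>R axis j 1 \<in> aball R})"
    by (rule has_vector_derivative_mult_right)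
  moreover have "of_nat (Suc (l $ i)) * jcoef (jd j a) (l + axis i 1) I = jcoef (jd j (jd i a)) l I"
    unfolding jd_commute[of j i] by (simp add: jd_def)
  ultimately show "((\<lambda>s. jcoef (jd i a) l (I + s *\<^sub>R axis j 1)) has_vector_derivative jcoef (jd j (jd i a)) l I)
        (at 0 within {s. I + s *\<^sub>R axis j 1 \<in> aball R})"
    by (simp add: jd_def)
qed

lemma jet_smooth_mult: assumes a: "jet_smooth R a" and b: "jet_smooth R b" shows "jet_smooth R (a * b)"
  unfolding jet_smooth_def
proof (intro conjI allI ballI)
  fix l show "continuous_on (aball R) (jcoef (a * b) l)"
    using a b by (auto simp: times_jet_def jet_smooth_def case_prod_unfold intro!: continuous_on_sum continuous_on_mult)
next
  fix l i and I :: "real^'a" assume I: "I \<in> aball R"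
  have "((\<lambda>s. \<Sum>x\<in>splits l. jcoef a (fst x) (I + s *\<^sub>R axis i 1) * jcoef b (snd x) (I + s *\<^sub>R axis i 1)) has_vector_derivative
      (\<Sum>x\<in>splits l. jcoef a (fst x) I * jcoef (jd i b) (snd x) I + jcoef (jd i a) (fst x) I * jcoef b (snd x) I))
      (at 0 within {s. I + s *\<^sub>R axis i 1 \<in> aball R})"
  proof (rule has_vector_derivative_sum)
    fix x
    show "((\<lambda>s. jcoef a (fst x) (I + s *\<^sub>R axis i 1) * jcoef b (snd x) (I + s *\<^sub>R axis i 1)) has_vector_derivative
      (jcoef a (fst x) I * jcoef (jd i b) (snd x) I + jcoef (jd i a) (fst x) I * jcoef b (snd x) I))
      (at 0 within {s. I + s *\<^sub>R axis i 1 \<in> aball R})"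
      using a b I has_vector_derivative_mult[of "\<lambda>s. jcoef a (fst x) (I + s *\<^sub>R axis i 1)" "jcoef (jd i a) (fst x) I" 0
          "{s. I + s *\<^sub>R axis i 1 \<in> aball R}" "\<lambda>s. jcoef b (snd x) (I + s *\<^sub>R axis i 1)" "jcoef (jd i b) (snd x) I"]
      by (simp add: jet_smooth_def)
  qed
  then show "((\<lambda>s. jcoef (a * b) l (I + s *\<^sub>R axis i 1)) has_vector_derivative jcoef (jd i (a * b)) l I)
        (at 0 within {s. I + s *\<^sub>R axis i 1 \<in> aball R})"
    unfolding jd_mult by (simp add: times_jet_def plus_jet_def case_prod_unfold sum.distrib add.commute)
qed

definition obs_smooth :: "real \<Rightarrow> ('n::finite) obs \<Rightarrow> bool" where
  "obs_smooth R a \<longleftrightarrow> (\<forall>k. jet_smooth R (lk a k))"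

lemma obs_smooth_0: "obs_smooth R 0"
  by (simp add: obs_smooth_def jet_smooth_0)
lemma obs_smooth_add: "obs_smooth R a \<Longrightarrow> obs_smooth R b \<Longrightarrow> obs_smooth R (a + b)"
  by (simp add: obs_smooth_def lookup_add jet_smooth_add)
lemma obs_smooth_mulf: "obs_smooth R a \<Longrightarrow> obs_smooth R (mulf \<mu> a)"
  by (simp add: obs_smooth_def jet_smooth_jsc)
lemma obs_smooth_dac: "obs_smooth R a \<Longrightarrow> obs_smooth R (dac i a)"
  by (simp add: obs_smooth_def jet_smooth_jd)
lemma obs_smooth_mult: "obs_smooth R a \<Longrightarrow> obs_smooth R b \<Longrightarrow> obs_smooth R (a * b)"
  by (simp add: obs_smooth_def lk_mult jet_smooth_sum jet_smooth_mult)
lemma obs_smooth_minus: "obs_smooth R a \<Longrightarrow> obs_smooth R (- a)"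
proof -
  have "- a = mulf (\<lambda>_. -1) a"
    by (intro poly_mapping_eqI jet_eqI) (simp add: jsc_def uminus_jet_def)
  then show "obs_smooth R a \<Longrightarrow> obs_smooth R (- a)" by (simp add: obs_smooth_mulf)
qed
lemma obs_smooth_diff: "obs_smooth R a \<Longrightarrow> obs_smooth R b \<Longrightarrow> obs_smooth R (a - b)"
  using obs_smooth_add[OF _ obs_smooth_minus, of R a b] by simp
lemma obs_smooth_sum: "(\<And>x. x \<in> S \<Longrightarrow> obs_smooth R (f x)) \<Longrightarrow> obs_smooth R (sum f S)"
  by (induction S rule: infinite_finite_induct) (auto intro: obs_smooth_0 obs_smooth_add)
lemma obs_smooth_pb: "obs_smooth R a \<Longrightarrow> obs_smooth R b \<Longrightarrow> obs_smooth R (pb a b)"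
  unfolding obs.br_def dth_def
  by (intro obs_smooth_sum obs_smooth_diff obs_smooth_mult obs_smooth_mulf obs_smooth_dac)

lemma obs_smooth_lin: "obs_smooth R (lin v)"
  unfolding obs_smooth_def
proof
  fix k :: "int^'a"
  define f where "f l I = (if k \<noteq> 0 then 0 else if l = 0 then of_real (v \<bullet> I) else
      (\<Sum>i\<in>UNIV. if l = axis i 1 then of_real (v $ i) else 0 :: complex))" for l :: "nat^'a" and I
  have c: "jcoef (lk (lin v) k) l = f l" for l
    by (simp add: lin_def lookup_single when_def zero_jet_def f_def fun_eq_iff)
  have d: "jcoef (jd i (lk (lin v) k)) l I = (if k = 0 \<and> l = 0 then of_real (v $ i) else 0)" for i l I
    using arg_cong[OF dac_lin[of i v], of "\<lambda>a. jcoef (lk a k) l I"]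
    by (simp add: lookup_one jsc_def one_jet_def zero_jet_def when_def split: if_splits)
  show "jet_smooth R (lk (lin v) k)"
    unfolding jet_smooth_def c d
  proof (intro conjI allI ballI)
    fix l show "continuous_on (aball R) (f l)"
      unfolding f_def by (cases "k = 0"; cases "l = 0") (auto intro!: continuous_intros)
  next
    fix l i and I :: "real^'a"
    show "((\<lambda>s. f l (I + s *\<^sub>R axis i 1)) has_vector_derivative
        (if k = 0 \<and> l = 0 then complex_of_real (v $ i) else 0)) (at 0 within {s. I + s *\<^sub>R axis i 1 \<in> aball R})"
      unfolding f_def by (cases "k = 0"; cases "l = 0")
        (auto intro!: derivative_eq_intros simp: inner_axis inner_add_right)
  qed
qed

definition ek :: "int^'n \<Rightarrow> real^('n::finite) \<Rightarrow> complex" where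
  "ek k \<theta> = cis (2 * pi * kdot k \<theta>)"

lemma kdot_add: "kdot (k + k') v = kdot k v + kdot k' v" "kdot k (v + w) = kdot k v + kdot k w"
  by (simp_all add: kdot_def distrib_right distrib_left sum.distrib)

lemma ek_add: "ek (k + k') \<theta> = ek k \<theta> * ek k' \<theta>"
  by (simp add: ek_def kdot_add cis_mult distrib_left)

lemma norm_ek [simp]: "norm (ek k \<theta>) = 1"
  by (simp add: ek_def)

text \<open>The value of an observable at a point of phase space.\<close>

definition ev :: "real^'n \<Rightarrow> real^'n \<Rightarrow> ('n::finite) obs \<Rightarrow> complex" where
  "ev \<theta> I a = (\<Sum>k\<in>Poly_Mapping.keys a. jcoef (lk a k) 0 I * ek k \<theta>)"

lemma ev_superset:
  assumes "finite K" "Poly_Mapping.keys a \<subseteq> K"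
  shows "ev \<theta> I a = (\<Sum>k\<in>K. jcoef (lk a k) 0 I * ek k \<theta>)"
  unfolding ev_def using assms
  by (intro sum.mono_neutral_left) (auto simp: not_in_keys_iff_lookup_eq_zero zero_jet_def)

lemma ev_zero [simp]: "ev \<theta> I 0 = 0"
  by (simp add: ev_def)

lemma ev_add: "ev \<theta> I (a + b) = ev \<theta> I a + ev \<theta> I b"
proof -
  let ?K = "Poly_Mapping.keys a \<union> Poly_Mapping.keys b"
  have "ev \<theta> I c = (\<Sum>k\<in>?K. jcoef (lk c k) 0 I * ek k \<theta>)" if "c \<in> {a, b, a + b}" for c
    using that keys_add[of a b] by (intro ev_superset) auto
  then show ?thesis by (simp add: lookup_add plus_jet_def distrib_right sum.distrib)
qed

lemma ev_mulf_const: "ev \<theta> I (mulf (\<lambda>_. c) a) = c * ev \<theta> I a"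
proof -
  have "ev \<theta> I (mulf (\<lambda>_. c) a) = (\<Sum>k\<in>Poly_Mapping.keys a. jcoef (lk (mulf (\<lambda>_. c) a) k) 0 I * ek k \<theta>)"
    by (rule ev_superset) (auto simp: mulf_def intro: keys_mapp_subset[THEN subsetD])
  then show ?thesis by (simp add: ev_def jsc_def sum_distrib_left mult.assoc)
qed

lemma ev_minus: "ev \<theta> I (- a) = - ev \<theta> I a"
  using ev_add[of \<theta> I a "- a"] by (simp add: eq_neg_iff_add_eq_0 add.commute)

lemma ev_diff: "ev \<theta> I (a - b) = ev \<theta> I a - ev \<theta> I b"
  using ev_add[of \<theta> I a "- b"] by (simp add: ev_minus)

lemma ev_sum: "ev \<theta> I (sum f S) = (\<Sum>x\<in>S. ev \<theta> I (f x))"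
  by (induction S rule: infinite_finite_induct) (auto simp: ev_add)

lemma ev_mult: "ev \<theta> I (a * b) = ev \<theta> I a * ev \<theta> I b"
proof -
  let ?A = "Poly_Mapping.keys a" and ?B = "Poly_Mapping.keys b"
  define K where "K = (\<lambda>(u, v). u + v) ` (?A \<times> ?B)"
  have K: "finite K" "Poly_Mapping.keys (a * b) \<subseteq> K"
    using keys_mult[of a b] by (auto simp: K_def)
  have mc: "jcoef (x * y) 0 I = jcoef x 0 I * jcoef y 0 I" for x y :: "'a jet"
  proof -
    have "splits (0 :: nat^'a) = {(0, 0)}"
      by (auto simp: splits_def vec_eq_iff)
    then show ?thesis by (simp add: times_jet_def)
  qed
  have "ev \<theta> I (a * b) = (\<Sum>k\<in>K. \<Sum>u\<in>?A. jcoef (lk a u) 0 I * jcoef (lk b (k - u)) 0 I * ek k \<theta>)"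
    by (simp add: ev_superset[OF K] lk_mult jcoef_sum mc sum_distrib_right)
  also have "\<dots> = (\<Sum>u\<in>?A. \<Sum>k\<in>K. jcoef (lk a u) 0 I * jcoef (lk b (k - u)) 0 I * ek k \<theta>)"
    by (rule sum.swap)
  also have "\<dots> = (\<Sum>u\<in>?A. jcoef (lk a u) 0 I * ek u \<theta> * ev \<theta> I b)"
  proof (rule sum.cong[OF refl])
    fix u assume u: "u \<in> ?A"
    have ek: "ek k \<theta> = ek u \<theta> * ek (k - u) \<theta>" for k
      by (simp flip: ek_add)
    have "(\<Sum>k\<in>K. jcoef (lk a u) 0 I * jcoef (lk b (k - u)) 0 I * ek k \<theta>)
        = jcoef (lk a u) 0 I * ek u \<theta> * (\<Sum>k\<in>K. jcoef (lk b (k - u)) 0 I * ek (k - u) \<theta>)"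
      by (subst ek) (simp add: sum_distrib_left mult.assoc mult.left_commute)
    also have "(\<Sum>k\<in>K. jcoef (lk b (k - u)) 0 I * ek (k - u) \<theta>) = (\<Sum>w\<in>(\<lambda>k. k - u) ` K. jcoef (lk b w) 0 I * ek w \<theta>)"
      by (subst sum.reindex) (auto simp: inj_on_def)
    also have "\<dots> = ev \<theta> I b"
    proof (rule ev_superset[symmetric])
      show "?B \<subseteq> (\<lambda>k. k - u) ` K"
      proof
        fix v assume "v \<in> ?B"
        then show "v \<in> (\<lambda>k. k - u) ` K" using u by (intro image_eqI[of _ _ "u + v"]) (auto simp: K_def)
      qed
    qed (use K in auto)
    finally show "(\<Sum>k\<in>K. jcoef (lk a u) 0 I * jcoef (lk b (k - u)) 0 I * ek k \<theta>) = jcoef (lk a u) 0 I * ek u \<theta> * ev \<theta> I b" .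
  qed
  also have "\<dots> = ev \<theta> I a * ev \<theta> I b"
    by (simp add: ev_def[of \<theta> I a] sum_distrib_right)
  finally show ?thesis .
qed

lemma ev_pb: "ev \<theta> I (pb a b) = (\<Sum>i\<in>UNIV. ev \<theta> I (dth i a) * ev \<theta> I (dac i b) - ev \<theta> I (dac i a) * ev \<theta> I (dth i b))"
  by (simp add: obs.br_def ev_sum ev_diff ev_mult)

lemma ev_lin: "ev \<theta> I (lin v) = of_real (v \<bullet> I)"
proof -
  have "ev \<theta> I (lin v) = (\<Sum>k\<in>{0}. jcoef (lk (lin v) k) 0 I * ek k \<theta>)"
    by (rule ev_superset) (auto simp: lin_def in_keys_iff lookup_single when_def split: if_splits)
  then show ?thesis by (simp add: lin_def ek_def kdot_def)
qed

text \<open>The actions of the curve may run on the boundary of the cube, where only the derivative within the cube is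
  available; the chain rule applies because the curve stays in the cube.\<close>

lemma ev_has_vector_derivative:
  fixes \<theta> I :: "real \<Rightarrow> real^'n"
  assumes sm: "obs_smooth R a" and J: "\<And>t. t \<in> J \<Longrightarrow> I t \<in> aball R" and t: "t \<in> J"
    and th: "(\<theta> has_vector_derivative \<theta>') (at t within J)"
    and ac: "(I has_vector_derivative I') (at t within J)"
  shows "((\<lambda>t. ev (\<theta> t) (I t) a) has_vector_derivative
     (\<Sum>i\<in>UNIV. of_real (\<theta>' $ i) * ev (\<theta> t) (I t) (dth i a) + of_real (I' $ i) * ev (\<theta> t) (I t) (dac i a))) (at t within J)"
proof -
  let ?K = "Poly_Mapping.keys a"
  have 1: "((\<lambda>t. jcoef (lk a k) 0 (I t)) has_vector_derivative (\<Sum>i\<in>UNIV. I' $ i *\<^sub>R jcoef (jd i (lk a k)) 0 (I t))) (at t within J)" for k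
  proof -
    have s: "jet_smooth R (lk a k)" using sm by (simp add: obs_smooth_def)
    have "(jcoef (lk a k) 0 has_derivative (\<lambda>v. \<Sum>i\<in>UNIV. v $ i *\<^sub>R jcoef (jd i (lk a k)) 0 (I t))) (at (I t) within aball R)"
      using s jet_smooth_jd[OF s] J[OF t] by (intro has_derivative_aball) (auto simp: jet_smooth_def)
    then have "(jcoef (lk a k) 0 has_derivative (\<lambda>v. \<Sum>i\<in>UNIV. v $ i *\<^sub>R jcoef (jd i (lk a k)) 0 (I t))) (at (I t) within I ` J)"
      by (rule has_derivative_subset) (use J in auto)
    from vector_derivative_diff_chain_within[OF ac this] show ?thesis by (simp add: o_def)
  qed
  have 2: "((\<lambda>t. ek k (\<theta> t)) has_vector_derivative (2 * pi * \<i> * of_real (kdot k \<theta>')) * ek k (\<theta> t)) (at t within J)" for k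
  proof -
    have bl: "bounded_linear (kdot k)"
      unfolding kdot_def by (intro bounded_linear_sum bounded_linear_const_mult bounded_linear_vec_nth)
    have "((\<lambda>t. kdot k (\<theta> t)) has_vector_derivative kdot k \<theta>') (at t within J)"
      by (rule bounded_linear.has_vector_derivative[OF bl th])
    then have "((\<lambda>t. 2 * pi * kdot k (\<theta> t)) has_vector_derivative 2 * pi * kdot k \<theta>') (at t within J)"
      by (rule has_vector_derivative_mult_right)
    moreover have "(cis has_vector_derivative (\<i> * cis x)) (at x within S)" for x S
    proof -
      have "((\<lambda>x. exp (\<i> * of_real x)) has_vector_derivative (\<i> * exp (\<i> * of_real x))) (at x within S)"
        by (auto intro!: derivative_eq_intros has_vector_derivative_real_field)
      then show ?thesis by (simp add: cis_conv_exp[abs_def])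
    qed
    ultimately have "(cis \<circ> (\<lambda>t. 2 * pi * kdot k (\<theta> t)) has_vector_derivative
        (2 * pi * kdot k \<theta>') *\<^sub>R (\<i> * cis (2 * pi * kdot k (\<theta> t)))) (at t within J)"
      by (rule vector_diff_chain_within)
    then show ?thesis by (simp add: o_def ek_def scaleR_conv_of_real mult.assoc mult.left_commute)
  qed
  have "((\<lambda>t. ev (\<theta> t) (I t) a) has_vector_derivative (\<Sum>k\<in>?K. jcoef (lk a k) 0 (I t) * ((2 * pi * \<i> * of_real (kdot k \<theta>')) * ek k (\<theta> t))
      + (\<Sum>i\<in>UNIV. I' $ i *\<^sub>R jcoef (jd i (lk a k)) 0 (I t)) * ek k (\<theta> t))) (at t within J)"
    unfolding ev_def by (intro has_vector_derivative_sum has_vector_derivative_mult 1 2)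
  moreover have "ev (\<theta> t) (I t) (dth i a) = (\<Sum>k\<in>?K. 2 * pi * \<i> * of_int (k $ i) * jcoef (lk a k) 0 (I t) * ek k (\<theta> t))" for i
  proof -
    have "ev (\<theta> t) (I t) (dth i a) = (\<Sum>k\<in>?K. jcoef (lk (dth i a) k) 0 (I t) * ek k (\<theta> t))"
      by (rule ev_superset) (auto simp: dth_def mulf_def intro: keys_mapp_subset[THEN subsetD])
    then show ?thesis by (simp add: jsc_def)
  qed
  moreover have "ev (\<theta> t) (I t) (dac i a) = (\<Sum>k\<in>?K. jcoef (jd i (lk a k)) 0 (I t) * ek k (\<theta> t))" for i
  proof -
    have "ev (\<theta> t) (I t) (dac i a) = (\<Sum>k\<in>?K. jcoef (lk (dac i a) k) 0 (I t) * ek k (\<theta> t))"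
      by (rule ev_superset) (auto simp: dac_def intro: keys_mapp_subset[THEN subsetD])
    then show ?thesis by simp
  qed
  moreover have "(\<Sum>k\<in>?K. jcoef (lk a k) 0 (I t) * ((2 * pi * \<i> * of_real (kdot k \<theta>')) * ek k (\<theta> t))
      + (\<Sum>i\<in>UNIV. I' $ i *\<^sub>R jcoef (jd i (lk a k)) 0 (I t)) * ek k (\<theta> t))
    = (\<Sum>k\<in>?K. \<Sum>i\<in>UNIV. of_real (\<theta>' $ i) * (2 * pi * \<i> * of_int (k $ i) * jcoef (lk a k) 0 (I t) * ek k (\<theta> t))
      + of_real (I' $ i) * (jcoef (jd i (lk a k)) 0 (I t) * ek k (\<theta> t)))"
    by (simp add: kdot_def sum_distrib_left sum_distrib_right sum.distrib scaleR_conv_of_real mult.assoc mult.left_commute)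
  moreover have "\<dots> = (\<Sum>i\<in>UNIV. \<Sum>k\<in>?K. of_real (\<theta>' $ i) * (2 * pi * \<i> * of_int (k $ i) * jcoef (lk a k) 0 (I t) * ek k (\<theta> t))
      + of_real (I' $ i) * (jcoef (jd i (lk a k)) 0 (I t) * ek k (\<theta> t)))"
    by (rule sum.swap)
  ultimately show ?thesis by (simp add: sum_distrib_left sum.distrib)
qed

section \<open>Weighted norms\<close>

text \<open>Subadditivity of the exponent \<open>|k| powr (1 / \<alpha>)\<close> makes the weights submultiplicative in the Fourier index.\<close>

lemma powr_add_le_add_powr:
  fixes x y p :: real
  assumes "0 \<le> x" "0 \<le> y" "0 < p" "p \<le> 1"
  shows "(x + y) powr p \<le> x powr p + y powr p"
proof (cases "x + y = 0")
  case True
  then show ?thesis by simp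
next
  case False
  define z where "z = x + y"
  have z: "z > 0" using assms False by (simp add: z_def)
  have *: "z powr p * (u / z) \<le> u powr p" if u: "0 \<le> u" "u \<le> z" for u
  proof -
    have "u / z \<le> (u / z) powr p"
      using u z assms powr_mono'[of p 1 "u / z"] by (simp add: powr_one')
    then have "z powr p * (u / z) \<le> z powr p * (u / z) powr p"
      by (intro mult_left_mono) auto
    also have "\<dots> = u powr p" using u z by (simp add: powr_divide)
    finally show ?thesis .
  qed
  have "z powr p = z powr p * (x / z) + z powr p * (y / z)"
    using z by (simp add: z_def flip: distrib_left add_divide_distrib)
  also have "\<dots> \<le> x powr p + y powr p"
    using assms by (intro add_mono *) (auto simp: z_def)
  finally show ?thesis by (simp add: z_def)
qed

text \<open>The bound that converts a derivative into a loss in the exponent of the weight.\<close>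

lemma le_powr_mult_exp:
  fixes y \<alpha> c :: real
  assumes "0 \<le> y" "\<alpha> > 0" "c > 0"
  shows "y \<le> (\<alpha> / c) powr \<alpha> * exp (c * y powr (1 / \<alpha>))"
proof -
  define z where "z = y powr (1 / \<alpha>)"
  have z: "z \<ge> 0" by (simp add: z_def)
  have "c * z / \<alpha> \<le> exp (c * z / \<alpha>)"
    using exp_ge_add_one_self[of "c * z / \<alpha>"] by linarith
  then have "z \<le> (\<alpha> / c) * exp (c * z / \<alpha>)"
    using assms by (simp add: field_simps)
  then have "z powr \<alpha> \<le> ((\<alpha> / c) * exp (c * z / \<alpha>)) powr \<alpha>"
    using z assms by (intro powr_mono2) auto
  also have "\<dots> = (\<alpha> / c) powr \<alpha> * exp (c * z)"
    using assms by (subst powr_mult) (simp_all add: exp_powr_real)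
  also have "z powr \<alpha> = y" using assms by (simp add: z_def powr_powr)
  finally show ?thesis by (simp add: z_def)
qed

definition kn :: "int^'n \<Rightarrow> real" where
  "kn k = infnorm (\<chi> i. real_of_int (k $ i))"

definition lsum :: "nat^'n \<Rightarrow> nat" where "lsum l = (\<Sum>i\<in>UNIV. l $ i)"
definition lfact :: "nat^'n \<Rightarrow> real" where "lfact l = (\<Prod>i\<in>UNIV. fact (l $ i))"

lemma kn_nonneg [simp]: "0 \<le> kn k"
  by (simp add: kn_def infnorm_pos_le)

lemma kn_zero [simp]: "kn 0 = 0"
  by (simp add: kn_def infnorm_eq_0 vec_eq_iff)

lemma kn_add: "kn (k + k') \<le> kn k + kn k'"
proof -
  have "(\<chi> i. real_of_int ((k + k') $ i)) = (\<chi> i. real_of_int (k $ i)) + (\<chi> i. real_of_int (k' $ i))"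
    by (simp add: vec_eq_iff)
  then show ?thesis unfolding kn_def by (simp add: infnorm_triangle)
qed

lemma nth_le_kn: "\<bar>real_of_int (k $ i)\<bar> \<le> kn k"
  using component_le_infnorm_cart[of "\<chi> i. real_of_int (k $ i)" i] by (simp add: kn_def)

lemma lsum_add: "lsum (l + l') = lsum l + lsum l'"
  by (simp add: lsum_def sum.distrib)

lemma lsum_zero [simp]: "lsum 0 = 0"
  by (simp add: lsum_def)

lemma lsum_axis [simp]: "lsum (axis i n) = n"
  by (simp add: lsum_def axis_def)

lemma nth_le_lsum: "l $ i \<le> lsum l"
  unfolding lsum_def by (rule member_le_sum) auto

lemma lfact_pos [simp]: "lfact l > 0"
  by (simp add: lfact_def prod_pos)

lemma lfact_nonzero [simp]: "lfact l \<noteq> 0"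
  using lfact_pos[of l] by linarith

lemma lfact_zero [simp]: "lfact 0 = 1"
  by (simp add: lfact_def)

lemma lfact_axis [simp]: "lfact (axis i (Suc 0)) = 1"
  unfolding lfact_def by (rule prod.neutral) (auto simp: axis_def)

lemma lfact_mult_le: "lfact l * lfact l' \<le> lfact (l + l')"
proof -
  have "(fact m * fact n :: real) \<le> fact (m + n)" for m n
  proof -
    have "(fact m * fact n :: nat) \<le> fact (m + n)"
      by (rule dvd_imp_le[OF fact_fact_dvd_fact]) simp
    then have "real (fact m * fact n) \<le> real (fact (m + n))" by (rule of_nat_mono)
    then show ?thesis by simp
  qed
  then have "(\<Prod>i\<in>UNIV. fact (l $ i) * fact (l' $ i) :: real) \<le> (\<Prod>i\<in>UNIV. fact (l $ i + l' $ i))"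
    by (intro prod_mono) auto
  then show ?thesis by (simp add: lfact_def prod.distrib)
qed

lemma lfact_Suc: "lfact (l + axis i 1) = real (Suc (l $ i)) * lfact l"
proof -
  have "lfact (l + axis i 1) = (\<Prod>j\<in>UNIV. (if j = i then real (Suc (l $ i)) else 1) * fact (l $ j))"
    unfolding lfact_def by (rule prod.cong) (auto simp: axis_def)
  then show ?thesis by (simp add: prod.distrib lfact_def)
qed

text \<open>\<open>b\<close> and \<open>\<rho>\<close> are the units in which the width is measured in the angles and in the actions.\<close>

locale gevrey_weight =
  fixes \<alpha> b \<rho> R :: real and dummy :: "'n::finite itself"
  assumes \<alpha>: "\<alpha> \<ge> 1" and b: "b > 0" and \<rho>: "\<rho> > 0" and R: "R > 0"
begin

text \<open>For \<open>s > 0\<close> the first factor describes Gevrey functions of the angles by their Fourier coefficients. The factor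
  \<open>lfact l powr (1 - \<alpha>)\<close> applies to Taylor coefficients, which are already divided by \<open>lfact l\<close>.\<close>

definition wt :: "real \<Rightarrow> int^'n \<Rightarrow> nat^'n \<Rightarrow> real" where
  "wt s k l = exp (s * (b * kn k powr (1 / \<alpha>) + lsum l)) * lfact l powr (1 - \<alpha>) * \<rho> ^ lsum l"

lemma wt_pos: "wt s k l > 0"
  using \<rho> lfact_pos[of l] unfolding wt_def by (intro mult_pos_pos) auto

lemma wt_shift: "wt (s - \<sigma>) k l = exp (- \<sigma> * (b * kn k powr (1 / \<alpha>) + lsum l)) * wt s k l"
  by (simp add: wt_def left_diff_distrib exp_diff exp_minus divide_simps)

lemma wt_mono: "s \<le> s' \<Longrightarrow> wt s k l \<le> wt s' k l"
  unfolding wt_def using \<rho> b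
  by (intro mult_right_mono) (auto intro!: mult_right_mono add_nonneg_nonneg mult_nonneg_nonneg)

lemma wt_add:
  assumes "s \<ge> 0"
  shows "wt s (k + k') (l + l') \<le> wt s k l * wt s k' l'"
proof -
  have "kn (k + k') powr (1 / \<alpha>) \<le> (kn k + kn k') powr (1 / \<alpha>)"
    using \<alpha> by (intro powr_mono2 kn_add) auto
  also have "\<dots> \<le> kn k powr (1 / \<alpha>) + kn k' powr (1 / \<alpha>)"
    using \<alpha> by (intro powr_add_le_add_powr) auto
  finally have "s * (b * kn (k + k') powr (1 / \<alpha>) + real (lsum (l + l')))
     \<le> s * (b * (kn k powr (1 / \<alpha>) + kn k' powr (1 / \<alpha>)) + real (lsum (l + l')))"
    using assms b by (intro mult_left_mono add_right_mono) auto
  then have 1: "exp (s * (b * kn (k + k') powr (1 / \<alpha>) + real (lsum (l + l')))) \<le>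
     exp (s * (b * kn k powr (1 / \<alpha>) + lsum l)) * exp (s * (b * kn k' powr (1 / \<alpha>) + lsum l'))"
    by (simp add: lsum_add algebra_simps flip: exp_add)
  have 2: "lfact (l + l') powr (1 - \<alpha>) \<le> lfact l powr (1 - \<alpha>) * lfact l' powr (1 - \<alpha>)"
    using \<alpha> lfact_mult_le[of l l'] powr_mono2'[of "1 - \<alpha>" "lfact l * lfact l'" "lfact (l + l')"]
    by (simp add: powr_mult)
  have "wt s (k + k') (l + l') \<le> (exp (s * (b * kn k powr (1 / \<alpha>) + lsum l)) * exp (s * (b * kn k' powr (1 / \<alpha>) + lsum l')))
     * (lfact l powr (1 - \<alpha>) * lfact l' powr (1 - \<alpha>)) * \<rho> ^ lsum (l + l')"
    unfolding wt_def using 1 2 \<rho> by (intro mult_right_mono mult_mono) auto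
  then show ?thesis by (simp add: wt_def lsum_add power_add mult_ac)
qed

text \<open>The larger one of the constants in the costs of an angle derivative and of an action derivative.\<close>

definition c0 :: real where
  "c0 = max (2 * pi * (\<alpha> / b) powr \<alpha>) (\<alpha> powr \<alpha> / \<rho>)"

lemma c0_pos: "c0 > 0"
  using \<alpha> b \<rho> by (auto simp: c0_def less_max_iff_disj)

lemma wt_angle:
  assumes "\<sigma> > 0"
  shows "2 * pi * \<bar>real_of_int (k $ i)\<bar> * wt (s - \<sigma>) k l \<le> c0 * \<sigma> powr (- \<alpha>) * wt s k l"
proof -
  have "\<bar>real_of_int (k $ i)\<bar> \<le> kn k" by (rule nth_le_kn)
  also have "kn k \<le> (\<alpha> / (\<sigma> * b)) powr \<alpha> * exp (\<sigma> * b * kn k powr (1 / \<alpha>))"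
    using \<alpha> b assms by (intro le_powr_mult_exp) auto
  also have "\<dots> \<le> (\<alpha> / (\<sigma> * b)) powr \<alpha> * exp (\<sigma> * (b * kn k powr (1 / \<alpha>) + lsum l))"
    using assms by (intro mult_left_mono) (auto simp: algebra_simps)
  finally have "2 * pi * \<bar>real_of_int (k $ i)\<bar> * wt (s - \<sigma>) k l
      \<le> 2 * pi * ((\<alpha> / (\<sigma> * b)) powr \<alpha> * exp (\<sigma> * (b * kn k powr (1 / \<alpha>) + lsum l))) * wt (s - \<sigma>) k l"
    using wt_pos by (intro mult_right_mono mult_left_mono) (auto intro: less_imp_le)
  also have "\<dots> = 2 * pi * (\<alpha> / b) powr \<alpha> * \<sigma> powr (- \<alpha>) * wt s k l"
    using \<alpha> b assms by (simp add: wt_shift exp_minus powr_mult powr_divide powr_minus divide_simps)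
  also have "\<dots> \<le> c0 * \<sigma> powr (- \<alpha>) * wt s k l"
    using wt_pos[of s k l] by (intro mult_right_mono) (auto simp: c0_def)
  finally show ?thesis .
qed

lemma wt_action:
  assumes "\<sigma> > 0" "\<sigma> \<le> s"
  shows "real (Suc (l $ i)) * wt (s - \<sigma>) k l \<le> c0 * \<sigma> powr (- \<alpha>) * wt s k (l + axis i 1)"
proof -
  define x where "x = real (Suc (l $ i))"
  have x: "x > 0" by (simp add: x_def)
  define E where "E = exp (s * (b * kn k powr (1 / \<alpha>) + lsum l))"
  have E: "E > 0" by (simp add: E_def)
  have "x powr \<alpha> \<le> (\<alpha> / \<sigma>) powr \<alpha> * exp (\<sigma> * (x powr \<alpha>) powr (1 / \<alpha>))"
    using \<alpha> assms by (intro le_powr_mult_exp) auto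
  also have "(x powr \<alpha>) powr (1 / \<alpha>) = x" using \<alpha> x by (simp add: powr_powr)
  also have "exp (\<sigma> * x) \<le> exp (s + \<sigma> * lsum l)"
  proof -
    have "\<sigma> * x = \<sigma> + \<sigma> * (l $ i)" by (simp add: x_def algebra_simps)
    also have "\<dots> \<le> s + \<sigma> * lsum l"
      using assms nth_le_lsum[of l i] by (intro add_mono mult_left_mono) auto
    finally show ?thesis by simp
  qed
  finally have *: "x powr \<alpha> \<le> (\<alpha> / \<sigma>) powr \<alpha> * exp (s + \<sigma> * lsum l)" by (simp add: mult_left_mono)
  have lf: "x * lfact l powr (1 - \<alpha>) = x powr \<alpha> * lfact (l + axis i 1) powr (1 - \<alpha>)"
  proof -
    have "lfact (l + axis i 1) powr (1 - \<alpha>) = x powr (1 - \<alpha>) * lfact l powr (1 - \<alpha>)"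
      unfolding lfact_Suc x_def by (rule powr_mult)
    moreover have x1: "x powr \<alpha> * x powr (1 - \<alpha>) = x" using x by (simp flip: powr_add)
    ultimately show ?thesis by (simp only: mult.assoc[symmetric] x1)
  qed
  have "x * wt (s - \<sigma>) k l = exp (- \<sigma> * (b * kn k powr (1 / \<alpha>) + lsum l)) * E * (x * lfact l powr (1 - \<alpha>)) * \<rho> ^ lsum l"
    by (simp only: wt_shift) (simp only: wt_def E_def mult_ac)
  also have "\<dots> \<le> exp (- \<sigma> * real (lsum l)) * E * (((\<alpha> / \<sigma>) powr \<alpha> * exp (s + \<sigma> * lsum l)) * lfact (l + axis i 1) powr (1 - \<alpha>)) * \<rho> ^ lsum l"
    unfolding lf using * b assms \<rho> E
    by (intro mult_right_mono mult_mono) (auto simp: algebra_simps)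
  also have "\<dots> = \<alpha> powr \<alpha> / \<rho> * \<sigma> powr (- \<alpha>) * wt s k (l + axis i 1)"
  proof -
    have "wt s k (l + axis i 1) = E * exp s * lfact (l + axis i 1) powr (1 - \<alpha>) * (\<rho> ^ lsum l * \<rho>)"
      by (simp add: wt_def E_def lsum_add distrib_left flip: exp_add)
    moreover have e: "exp (- \<sigma> * real (lsum l)) * exp (s + \<sigma> * lsum l) = exp s"
      by (simp flip: exp_add)
    moreover have "(\<alpha> / \<sigma>) powr \<alpha> = \<alpha> powr \<alpha> * \<sigma> powr (- \<alpha>)"
      using \<alpha> assms by (simp add: powr_divide powr_minus_divide)
    moreover have "exp (- \<sigma> * real (lsum l)) * E * ((X * exp (s + \<sigma> * lsum l)) * Y) * Z
        = (exp (- \<sigma> * real (lsum l)) * exp (s + \<sigma> * lsum l)) * (E * X * Y * Z)" for X Y Z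
      by (simp only: mult_ac)
    ultimately have "exp (- \<sigma> * real (lsum l)) * E * (((\<alpha> / \<sigma>) powr \<alpha> * exp (s + \<sigma> * lsum l)) * lfact (l + axis i 1) powr (1 - \<alpha>)) * \<rho> ^ lsum l
        = exp s * (E * (\<alpha> powr \<alpha> * \<sigma> powr (- \<alpha>)) * lfact (l + axis i 1) powr (1 - \<alpha>) * \<rho> ^ lsum l)"
      by (simp only:)
    also have "\<dots> = \<alpha> powr \<alpha> / \<rho> * \<sigma> powr (- \<alpha>) * (E * exp s * lfact (l + axis i 1) powr (1 - \<alpha>) * (\<rho> ^ lsum l * \<rho>))"
      using \<rho> by simp
    finally show ?thesis using \<open>wt s k (l + axis i 1) = _\<close> by (simp only:)
  qed
  also have "\<dots> \<le> c0 * \<sigma> powr (- \<alpha>) * wt s k (l + axis i 1)"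
    using wt_pos[of s k "l + axis i 1"] by (intro mult_right_mono) (auto simp: c0_def)
  finally show ?thesis by (simp add: x_def)
qed

lemma one_le_wt_0: "s \<ge> 0 \<Longrightarrow> 1 \<le> wt s k 0"
  using b by (simp add: wt_def)

text \<open>\<open>nle s A a\<close>: the weighted \<open>\<ell>\<^sup>1\<close>-norm of the coefficients of \<open>a\<close> at width \<open>s\<close> is at most \<open>A\<close>,
  uniformly in the actions.\<close>

definition nle :: "real \<Rightarrow> real \<Rightarrow> 'n obs \<Rightarrow> bool" where
  "nle s A a \<longleftrightarrow> (\<forall>I\<in>aball R. \<forall>F. finite F \<longrightarrow>
     (\<Sum>x\<in>F. wt s (fst x) (snd x) * norm (jcoef (lk a (fst x)) (snd x) I)) \<le> A)"

lemma zero_in_aball: "0 \<in> aball R"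
  using R by (simp add: infnorm_0)

lemma nleD: "nle s A a \<Longrightarrow> I \<in> aball R \<Longrightarrow> finite F \<Longrightarrow>
    (\<Sum>x\<in>F. wt s (fst x) (snd x) * norm (jcoef (lk a (fst x)) (snd x) I)) \<le> A"
  unfolding nle_def by blast

lemma nleI: "(\<And>I F. I \<in> aball R \<Longrightarrow> finite F \<Longrightarrow>
    (\<Sum>x\<in>F. wt s (fst x) (snd x) * norm (jcoef (lk a (fst x)) (snd x) I)) \<le> A) \<Longrightarrow> nle s A a"
  unfolding nle_def by blast

lemma nle_nonneg: "nle s A a \<Longrightarrow> 0 \<le> A"
  using nleD[of s A a 0 "{}"] zero_in_aball by simp

lemma nle_mono: "nle s A a \<Longrightarrow> A \<le> B \<Longrightarrow> nle s B a"
  by (rule nleI) (rule order_trans[OF nleD])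

lemma nle_zero: "nle s 0 0"
  by (simp add: nle_def zero_jet_def)

lemma nle_add:
  assumes "nle s A a" "nle s B c"
  shows "nle s (A + B) (a + c)"
proof (rule nleI)
  fix I :: "real^'n" and F :: "((int^'n) \<times> (nat^'n)) set" assume IF: "I \<in> aball R" "finite F"
  have "(\<Sum>x\<in>F. wt s (fst x) (snd x) * norm (jcoef (lk (a + c) (fst x)) (snd x) I))
      \<le> (\<Sum>x\<in>F. wt s (fst x) (snd x) * norm (jcoef (lk a (fst x)) (snd x) I) + wt s (fst x) (snd x) * norm (jcoef (lk c (fst x)) (snd x) I))"
  proof (rule sum_mono)
    fix x
    show "wt s (fst x) (snd x) * norm (jcoef (lk (a + c) (fst x)) (snd x) I) \<le>
        wt s (fst x) (snd x) * norm (jcoef (lk a (fst x)) (snd x) I) + wt s (fst x) (snd x) * norm (jcoef (lk c (fst x)) (snd x) I)"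
      unfolding distrib_left[symmetric] lookup_add plus_jet_def jcoef_Jet
      by (intro mult_left_mono norm_triangle_ineq less_imp_le wt_pos)
  qed
  also have "\<dots> \<le> A + B"
    unfolding sum.distrib using assms IF by (intro add_mono nleD)
  finally show "(\<Sum>x\<in>F. wt s (fst x) (snd x) * norm (jcoef (lk (a + c) (fst x)) (snd x) I)) \<le> A + B" .
qed

lemma nle_sum:
  assumes "\<And>x. x \<in> S \<Longrightarrow> nle s (A x) (f x)"
  shows "nle s (sum A S) (sum f S)"
  using assms by (induction S rule: infinite_finite_induct) (auto intro: nle_zero nle_add)

lemma nle_mulf:
  assumes "nle s A a" and *: "\<And>k l. norm (\<mu> k) * wt s' k l \<le> c * wt s k l"
  shows "nle s' (c * A) (mulf \<mu> a)"
proof (rule nleI)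
  fix I :: "real^'n" and F :: "((int^'n) \<times> (nat^'n)) set" assume IF: "I \<in> aball R" "finite F"
  have "0 \<le> c * wt s 0 0"
    using order_trans[OF _ *[of 0 0]] wt_pos[of s' 0 0] by (simp add: less_imp_le)
  then have c: "0 \<le> c" using wt_pos[of s 0 0] by (simp add: zero_le_mult_iff)
  have "(\<Sum>x\<in>F. wt s' (fst x) (snd x) * norm (jcoef (lk (mulf \<mu> a) (fst x)) (snd x) I))
      \<le> (\<Sum>x\<in>F. c * (wt s (fst x) (snd x) * norm (jcoef (lk a (fst x)) (snd x) I)))"
  proof (rule sum_mono)
    fix x
    show "wt s' (fst x) (snd x) * norm (jcoef (lk (mulf \<mu> a) (fst x)) (snd x) I)
        \<le> c * (wt s (fst x) (snd x) * norm (jcoef (lk a (fst x)) (snd x) I))"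
      using mult_right_mono[OF *[of "fst x" "snd x"], of "norm (jcoef (lk a (fst x)) (snd x) I)"]
      by (simp add: jsc_def norm_mult mult_ac)
  qed
  also have "\<dots> \<le> c * A"
    unfolding sum_distrib_left[symmetric] using assms(1) IF c by (intro mult_left_mono nleD)
  finally show "(\<Sum>x\<in>F. wt s' (fst x) (snd x) * norm (jcoef (lk (mulf \<mu> a) (fst x)) (snd x) I)) \<le> c * A" .
qed

lemma nle_mulf_bounded:
  assumes "nle s A a" "\<And>k. norm (\<mu> k) \<le> c"
  shows "nle s (c * A) (mulf \<mu> a)"
  using assms by (intro nle_mulf mult_right_mono) (auto simp: wt_pos less_imp_le)

lemma nle_narrow: "nle s A a \<Longrightarrow> s' \<le> s \<Longrightarrow> nle s' A a"
proof -
  assume "nle s A a" "s' \<le> s"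
  then have "nle s' (1 * A) (mulf (\<lambda>_. 1) a)"
    by (intro nle_mulf) (auto simp: wt_mono)
  moreover have "mulf (\<lambda>_. 1) a = a" by (intro poly_mapping_eqI) simp
  ultimately show ?thesis by simp
qed

lemma nle_minus: "nle s A a \<Longrightarrow> nle s A (- a)"
proof -
  assume "nle s A a"
  then have "nle s (1 * A) (mulf (\<lambda>_. -1) a)" by (rule nle_mulf_bounded) simp
  moreover have "mulf (\<lambda>_. -1) a = - a"
    by (intro poly_mapping_eqI jet_eqI) (simp add: jsc_def uminus_jet_def)
  ultimately show ?thesis by simp
qed

lemma nle_diff: "nle s A a \<Longrightarrow> nle s B c \<Longrightarrow> nle s (A + B) (a - c)"
  using nle_add[OF _ nle_minus, of s A a B c] by simp

lemma nle_dth: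
  assumes "nle s A a" "s' < s"
  shows "nle s' (c0 * (s - s') powr (- \<alpha>) * A) (dth i a)"
  unfolding dth_def using wt_angle[of "s - s'" _ i s] assms
  by (intro nle_mulf) (auto simp: norm_mult)

text \<open>An action derivative moves the coefficient of index \<open>l + axis i 1\<close> to \<open>l\<close>, so the cost is a bound for a
  quotient of two weights, paid by the loss of width.\<close>

lemma nle_dac:
  assumes a: "nle s A a" and s: "0 \<le> s'" "s' < s"
  shows "nle s' (c0 * (s - s') powr (- \<alpha>) * A) (dac i a)"
proof (rule nleI)
  fix I :: "real^'n" and F :: "((int^'n) \<times> (nat^'n)) set" assume IF: "I \<in> aball R" "finite F"
  define C where "C = c0 * (s - s') powr (- \<alpha>)"
  have C: "C \<ge> 0" using c0_pos by (simp add: C_def)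
  let ?g = "\<lambda>x :: (int^'n) \<times> (nat^'n). (fst x, snd x + axis i 1)"
  let ?f = "\<lambda>x. wt s (fst x) (snd x) * norm (jcoef (lk a (fst x)) (snd x) I)"
  have "(\<Sum>x\<in>F. wt s' (fst x) (snd x) * norm (jcoef (lk (dac i a) (fst x)) (snd x) I)) \<le> (\<Sum>x\<in>F. C * ?f (?g x))"
  proof (rule sum_mono)
    fix x
    show "wt s' (fst x) (snd x) * norm (jcoef (lk (dac i a) (fst x)) (snd x) I) \<le> C * ?f (?g x)"
      using mult_right_mono[OF wt_action[of "s - s'" s "snd x" i "fst x"], of "norm (jcoef (lk a (fst x)) (snd x + axis i 1) I)"] s
      by (simp add: jd_def norm_mult C_def mult_ac del: of_nat_Suc)
  qed
  also have "\<dots> = C * (\<Sum>x\<in>?g ` F. ?f x)"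
    by (subst sum.reindex) (auto simp: inj_on_def sum_distrib_left)
  also have "\<dots> \<le> C * A"
    using a IF C by (intro mult_left_mono nleD) auto
  finally show "(\<Sum>x\<in>F. wt s' (fst x) (snd x) * norm (jcoef (lk (dac i a) (fst x)) (snd x) I)) \<le> c0 * (s - s') powr (- \<alpha>) * A"
    by (simp add: C_def)
qed

text \<open>Submultiplicativity of the weights. The sum over all pairs of indices is bounded by the product of two sums over
  finite sets of indices.\<close>

lemma nle_mult:
  assumes a: "nle s A a" and c: "nle s B c" and s: "s \<ge> 0"
  shows "nle s (A * B) (a * c)"
proof (rule nleI)
  fix I :: "real^'n" and F :: "((int^'n) \<times> (nat^'n)) set" assume IF: "I \<in> aball R" "finite F"
  let ?K = "Poly_Mapping.keys a"
  define f where "f x = wt s (fst x) (snd x) * norm (jcoef (lk a (fst x)) (snd x) I)" for x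
  define g where "g x = wt s (fst x) (snd x) * norm (jcoef (lk c (fst x)) (snd x) I)" for x
  have f: "f x \<ge> 0" and g: "g x \<ge> 0" for x by (auto simp: f_def g_def wt_pos less_imp_le)
  define Z where "Z = Sigma F (\<lambda>x. ?K \<times> splits (snd x))"
  have Z: "finite Z" using IF by (auto simp: Z_def)
  define h where "h z = (case z of (x, (u, pq)) \<Rightarrow> ((u, fst pq), (fst x - u, snd pq)))"
    for z :: "((int^'n) \<times> (nat^'n)) \<times> ((int^'n) \<times> (nat^'n) \<times> (nat^'n))"
  have h: "inj_on h Z"
    by (rule inj_onI) (auto simp: h_def Z_def splits_def)
  have "(\<Sum>x\<in>F. wt s (fst x) (snd x) * norm (jcoef (lk (a * c) (fst x)) (snd x) I))
     \<le> (\<Sum>x\<in>F. \<Sum>y\<in>?K \<times> splits (snd x). f (fst (h (x, y))) * g (snd (h (x, y))))"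
  proof (rule sum_mono)
    fix x :: "(int^'n) \<times> (nat^'n)"
    have "jcoef (lk (a * c) (fst x)) (snd x) I = (\<Sum>y\<in>?K \<times> splits (snd x).
        jcoef (lk a (fst y)) (fst (snd y)) I * jcoef (lk c (fst x - fst y)) (snd (snd y)) I)"
      by (simp add: lk_mult jcoef_sum times_jet_def sum.cartesian_product case_prod_unfold)
    then have "wt s (fst x) (snd x) * norm (jcoef (lk (a * c) (fst x)) (snd x) I) \<le> wt s (fst x) (snd x) *
        (\<Sum>y\<in>?K \<times> splits (snd x). norm (jcoef (lk a (fst y)) (fst (snd y)) I) * norm (jcoef (lk c (fst x - fst y)) (snd (snd y)) I))"
      by (auto intro!: mult_left_mono sum_norm_le simp: norm_mult wt_pos less_imp_le)
    also have "\<dots> \<le> (\<Sum>y\<in>?K \<times> splits (snd x). f (fst (h (x, y))) * g (snd (h (x, y))))"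
      unfolding sum_distrib_left
    proof (rule sum_mono)
      fix y assume y: "y \<in> ?K \<times> splits (snd x)"
      have "wt s (fst x) (snd x) \<le> wt s (fst y) (fst (snd y)) * wt s (fst x - fst y) (snd (snd y))"
        using wt_add[OF s, of "fst y" "fst x - fst y" "fst (snd y)" "snd (snd y)"] y by (auto simp: splits_def)
      then show "wt s (fst x) (snd x) * (norm (jcoef (lk a (fst y)) (fst (snd y)) I) * norm (jcoef (lk c (fst x - fst y)) (snd (snd y)) I))
         \<le> f (fst (h (x, y))) * g (snd (h (x, y)))"
        using mult_right_mono[of "wt s (fst x) (snd x)" "wt s (fst y) (fst (snd y)) * wt s (fst x - fst y) (snd (snd y))"
           "norm (jcoef (lk a (fst y)) (fst (snd y)) I) * norm (jcoef (lk c (fst x - fst y)) (snd (snd y)) I)"]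
        by (simp add: f_def g_def h_def case_prod_unfold mult_ac)
    qed
    finally show "wt s (fst x) (snd x) * norm (jcoef (lk (a * c) (fst x)) (snd x) I)
       \<le> (\<Sum>y\<in>?K \<times> splits (snd x). f (fst (h (x, y))) * g (snd (h (x, y))))" .
  qed
  also have "\<dots> = (\<Sum>z\<in>Z. f (fst (h z)) * g (snd (h z)))"
    unfolding Z_def using IF by (subst sum.Sigma) (auto simp: case_prod_unfold)
  also have "\<dots> = (\<Sum>w\<in>h ` Z. f (fst w) * g (snd w))"
    unfolding sum.reindex[OF h] by simp
  also have "\<dots> \<le> (\<Sum>w\<in>(fst ` h ` Z) \<times> (snd ` h ` Z). f (fst w) * g (snd w))"
  proof (rule sum_mono2)
    show "h ` Z \<subseteq> (fst ` h ` Z) \<times> (snd ` h ` Z)"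
      by (rule subset_fst_snd)
  qed (use Z f g in auto)
  also have "\<dots> = (\<Sum>x\<in>fst ` h ` Z. f x) * (\<Sum>y\<in>snd ` h ` Z. g y)"
    by (simp add: sum_product sum.cartesian_product case_prod_unfold)
  also have "\<dots> \<le> A * B"
    using nleD[OF a IF(1), of "fst ` h ` Z"] nleD[OF c IF(1), of "snd ` h ` Z"] Z nle_nonneg[OF a]
    by (intro mult_mono sum_nonneg f g) (auto simp: f_def g_def)
  finally show "(\<Sum>x\<in>F. wt s (fst x) (snd x) * norm (jcoef (lk (a * c) (fst x)) (snd x) I)) \<le> A * B" .
qed

text \<open>Each argument of the bracket loses width according to how much more room it has.\<close>

lemma nle_pb:
  assumes a: "nle s1 A a" and c: "nle s2 B c" and s: "0 \<le> s" "s < s1" "s < s2"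
  shows "nle s (2 * CARD('n) * c0\<^sup>2 * ((s1 - s) powr (- \<alpha>) * (s2 - s) powr (- \<alpha>)) * (A * B)) (pb a c)"
proof -
  define D1 where "D1 = c0 * (s1 - s) powr (- \<alpha>) * A"
  define D2 where "D2 = c0 * (s2 - s) powr (- \<alpha>) * B"
  have "nle s (\<Sum>i\<in>(UNIV :: 'n set). D1 * D2 + D1 * D2) (pb a c)"
    unfolding obs.br_def D1_def D2_def using s
    by (intro nle_sum nle_diff nle_mult nle_dth nle_dac a c) auto
  moreover have "(\<Sum>i\<in>(UNIV :: 'n set). D1 * D2 + D1 * D2) = 2 * CARD('n) * (D1 * D2)" by simp
  moreover have "D1 * D2 = c0\<^sup>2 * ((s1 - s) powr (- \<alpha>) * (s2 - s) powr (- \<alpha>)) * (A * B)"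
    by (simp only: D1_def D2_def power2_eq_square mult_ac)
  ultimately show ?thesis by (simp only: mult.assoc)
qed

lemma norm_ev_le:
  assumes a: "nle s A a" and s: "s \<ge> 0" and I: "I \<in> aball R"
  shows "norm (ev \<theta> I a) \<le> A"
proof -
  let ?K = "Poly_Mapping.keys a"
  have "norm (ev \<theta> I a) \<le> (\<Sum>k\<in>?K. wt s k 0 * norm (jcoef (lk a k) 0 I))"
    unfolding ev_def
  proof (rule sum_norm_le)
    fix k show "norm (jcoef (lk a k) 0 I * ek k \<theta>) \<le> wt s k 0 * norm (jcoef (lk a k) 0 I)"
      using mult_right_mono[OF one_le_wt_0[OF s, of k], of "norm (jcoef (lk a k) 0 I)"] by (simp add: norm_mult)
  qed
  also have "\<dots> = (\<Sum>x\<in>(\<lambda>k. (k, 0)) ` ?K. wt s (fst x) (snd x) * norm (jcoef (lk a (fst x)) (snd x) I))"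
    by (subst sum.reindex) (auto simp: inj_on_def)
  also have "\<dots> \<le> A" using a I by (intro nleD) auto
  finally show ?thesis .
qed

lemma nle_lin:
  assumes v: "\<And>i. \<bar>v $ i\<bar> \<le> 1" and s: "s \<le> 1"
  shows "nle s (CARD('n) * (R + exp 1 * \<rho>)) (lin v)"
proof (rule nleI)
  fix I :: "real^'n" and F :: "((int^'n) \<times> (nat^'n)) set" assume IF: "I \<in> aball R" "finite F"
  define f where "f x = wt s (fst x) (snd x) * norm (jcoef (lk (lin v) (fst x)) (snd x) I)" for x
  have f: "f x \<ge> 0" for x by (auto simp: f_def wt_pos less_imp_le)
  define Z where "Z = insert (0, 0) (range (\<lambda>i. (0 :: int^'n, axis i 1 :: nat^'n)))"
  have ax0: "axis i 1 \<noteq> (0 :: nat^'n)" for i by (simp add: vec_eq_iff axis_def)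
  have axe: "axis i 1 = (axis j 1 :: nat^'n) \<longleftrightarrow> i = j" for i j by (simp add: axis_eq_axis)
  have "(\<Sum>x\<in>F. f x) \<le> (\<Sum>x\<in>Z. f x)"
  proof -
    have "(\<Sum>x\<in>F. f x) = (\<Sum>x\<in>F \<inter> Z. f x)"
    proof (rule sum.mono_neutral_right)
      show "\<forall>x\<in>F - F \<inter> Z. f x = 0"
      proof
        fix x assume "x \<in> F - F \<inter> Z"
        then have "x \<noteq> (0, 0)" "\<And>i. x \<noteq> (0, axis i 1)" by (auto simp: Z_def)
        then show "f x = 0"
          by (cases x) (auto simp: f_def lin_def lookup_single when_def zero_jet_def intro!: sum.neutral)
      qed
    qed (use IF in auto)
    also have "\<dots> \<le> (\<Sum>x\<in>Z. f x)" by (rule sum_mono2) (auto simp: Z_def f)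
    finally show ?thesis .
  qed
  also have "(\<Sum>x\<in>Z. f x) = f (0, 0) + (\<Sum>i\<in>UNIV. f (0, axis i 1))"
    unfolding Z_def using ax0 by (subst sum.insert) (auto simp: sum.reindex inj_on_def axe simp del: One_nat_def)
  also have "f (0, 0) \<le> CARD('n) * R"
  proof -
    have "f (0, 0) = \<bar>v \<bullet> I\<bar>" by (simp add: f_def wt_def lin_def)
    also have "\<dots> \<le> (\<Sum>i\<in>UNIV. \<bar>v $ i\<bar> * \<bar>I $ i\<bar>)"
      unfolding inner_vec_def by (rule order_trans[OF sum_abs]) (simp add: abs_mult)
    also have "\<dots> \<le> (\<Sum>i\<in>(UNIV :: 'n set). 1 * R)"
      using v IF by (intro sum_mono mult_mono) (auto simp: infnorm_le_iff)
    finally show ?thesis by simp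
  qed
  also have "(\<Sum>i\<in>UNIV. f (0, axis i 1)) \<le> (\<Sum>i\<in>(UNIV :: 'n set). exp 1 * \<rho>)"
  proof (rule sum_mono)
    fix i
    have "f (0, axis i 1) = exp s * \<rho> * \<bar>v $ i\<bar>"
      by (simp add: f_def wt_def lin_def ax0 axe del: One_nat_def) (simp add: \<rho> less_imp_le)
    also have "\<dots> \<le> exp 1 * \<rho> * 1" using v s \<rho> by (intro mult_mono) auto
    finally show "f (0, axis i 1) \<le> exp 1 * \<rho>" by simp
  qed
  finally show "(\<Sum>x\<in>F. wt s (fst x) (snd x) * norm (jcoef (lk (lin v) (fst x)) (snd x) I)) \<le> CARD('n) * (R + exp 1 * \<rho>)"
    by (simp add: f_def distrib_left)
qed

end

section \<open>The quasi-integral\<close>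

lemma sum_inverse_squares_le: "(\<Sum>j<n. 1 / (real (Suc j))\<^sup>2) \<le> 2"
proof (cases n)
  case 0 then show ?thesis by simp
next
  case (Suc m)
  have "(\<Sum>j<Suc m. 1 / (real (Suc j))\<^sup>2) \<le> 2 - 1 / real (Suc m)"
  proof (induction m)
    case 0 then show ?case by simp
  next
    case (Suc k)
    define x where "x = real (Suc k)"
    have x: "x \<ge> 1" by (simp add: x_def)
    have "1 / (x + 1)\<^sup>2 \<le> 1 / (x * (x + 1))"
      using x by (intro divide_left_mono) (auto simp: power2_eq_square)
    also have "\<dots> = 1 / x - 1 / (x + 1)" using x by (simp add: field_simps)
    finally show ?case using Suc.IH by (simp add: x_def add.commute)
  qed
  then show ?thesis using Suc by (smt (verit) divide_nonneg_nonneg of_nat_0_le_iff)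
qed

text \<open>The sequence \<open>1 / r\<^sup>2\<close> reproduces itself under convolution up to a factor. It is carried along in the bounds of the
  recursion, so that sums over all splittings of an order do not grow with the order.\<close>

lemma convolution_inverse_squares:
  "(\<Sum>j<n. 1 / ((real (Suc j))\<^sup>2 * (real (n - j))\<^sup>2)) \<le> 8 / (real (Suc n))\<^sup>2"
proof -
  have "(real (Suc n))\<^sup>2 * (\<Sum>j<n. 1 / ((real (Suc j))\<^sup>2 * (real (n - j))\<^sup>2))
      \<le> (\<Sum>j<n. 2 / (real (Suc j))\<^sup>2 + 2 / (real (n - j))\<^sup>2)"
    unfolding sum_distrib_left
  proof (rule sum_mono)
    fix j assume "j \<in> {..<n}"
    define p where "p = real (Suc j)"
    define q where "q = real (n - j)"
    have pq: "p > 0" "q > 0" "real (Suc n) = p + q"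
      using \<open>j \<in> {..<n}\<close> by (auto simp: p_def q_def)
    have "(p + q)\<^sup>2 \<le> 2 * q\<^sup>2 + 2 * p\<^sup>2"
      using zero_le_power2[of "p - q"] by (simp add: power2_eq_square algebra_simps)
    then have "(p + q)\<^sup>2 / (p\<^sup>2 * q\<^sup>2) \<le> (2 * q\<^sup>2 + 2 * p\<^sup>2) / (p\<^sup>2 * q\<^sup>2)"
      by (intro divide_right_mono) auto
    also have "\<dots> = 2 / p\<^sup>2 + 2 / q\<^sup>2"
      using pq by (simp add: add_divide_distrib)
    finally show "(real (Suc n))\<^sup>2 * (1 / ((real (Suc j))\<^sup>2 * (real (n - j))\<^sup>2)) \<le> 2 / (real (Suc j))\<^sup>2 + 2 / (real (n - j))\<^sup>2"
      unfolding pq(3) p_def[symmetric] q_def[symmetric] by simp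
  qed
  also have "\<dots> = 2 * (\<Sum>j<n. 1 / (real (Suc j))\<^sup>2) + 2 * (\<Sum>j<n. 1 / (real (n - j))\<^sup>2)"
    by (simp add: sum.distrib sum_distrib_left)
  also have "(\<Sum>j<n. 1 / (real (n - j))\<^sup>2) = (\<Sum>j<n. 1 / (real (Suc j))\<^sup>2)"
    by (rule sum.reindex_bij_witness[of _ "\<lambda>j. n - Suc j" "\<lambda>j. n - Suc j"]) auto
  finally show ?thesis
    using sum_inverse_squares_le[of n] by (simp add: field_simps)
qed

lemma sum_upt_shift: "(\<Sum>q\<in>{1..<Suc n}. f q) = (\<Sum>j<n. f (Suc j))"
  by (rule sum.reindex_bij_witness[of _ Suc "\<lambda>q. q - 1"]) auto

text \<open>\<open>v\<close> is orthogonal to all resonances of \<open>\<omega>\<close> up to order \<open>K\<close>; \<open>\<Psi>\<close> bounds the inverses of the other divisors. The threshold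
  says that one step of the recursion, with \<open>m\<close> steps sharing the available width, gains at least
  the factor \<open>exp (- 1) / 32\<close>.\<close>

locale averaging = gevrey_weight \<alpha> b \<rho> R "TYPE('n::finite)" for \<alpha> b \<rho> R +
  fixes \<omega> v :: "real^'n" and H1 :: "'n obs" and A K \<Psi> :: real and m :: nat
  assumes A: "A > 0" and Psi: "\<Psi> > 0" and m: "m \<ge> 1" and K: "K \<ge> 0"
    and H1: "nle 1 A H1" and H1_smooth: "obs_smooth R H1"
    and small_div: "\<And>k. kn k \<le> K \<Longrightarrow> kdot k \<omega> \<noteq> 0 \<Longrightarrow> 1 \<le> \<Psi> * (2 * pi * \<bar>kdot k \<omega>\<bar>)"
    and resonant: "\<And>k. kn k \<le> K \<Longrightarrow> kdot k \<omega> = 0 \<Longrightarrow> kdot k v = 0"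
    and v: "\<And>i. \<bar>v $ i\<bar> \<le> 1"
    and threshold: "2 * CARD('n) * c0\<^sup>2 * 16 powr \<alpha> * real (m + 2) powr \<alpha> * \<Psi> * A \<le> exp (- 1) / 32"
begin

definition nonres :: "int^'n \<Rightarrow> bool" where "nonres k \<longleftrightarrow> kn k \<le> K \<and> kdot k \<omega> \<noteq> 0"

definition slv :: "'n obs \<Rightarrow> 'n obs" where
  "slv = mulf (\<lambda>k. if nonres k then 1 / (2 * pi * \<i> * of_real (kdot k \<omega>)) else 0)"

definition rst :: "'n obs \<Rightarrow> 'n obs" where
  "rst = mulf (\<lambda>k. if nonres k then 0 else 1)"

lemma homological: "pb (slv s) (lin \<omega>) + rst s = s"
proof (rule poly_mapping_eqI)
  fix k show "lk (pb (slv s) (lin \<omega>) + rst s) k = lk s k"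
    by (cases "nonres k") (auto simp: pb_lin slv_def rst_def lookup_add nonres_def)
qed

definition S :: "nat \<Rightarrow> 'n obs" where
  "S = (SOME S. \<forall>r. S r = obs.source (\<lambda>j. slv (S j)) (\<lambda>j. rst (S j)) H1 r)"

definition X :: "nat \<Rightarrow> 'n obs" where "X r = slv (S r)"
definition M :: "nat \<Rightarrow> 'n obs" where "M r = rst (S r)"

lemma S_eq: "S r = obs.source X M H1 r"
proof -
  have "\<exists>S. \<forall>r. S r = obs.source (\<lambda>j. slv (S j)) (\<lambda>j. rst (S j)) H1 r"
    by (rule obs.normal_form_exists)
  from someI_ex[OF this]
  have "\<forall>r. S r = obs.source (\<lambda>j. slv (S j)) (\<lambda>j. rst (S j)) H1 r"
    unfolding S_def[symmetric] .
  then show ?thesis unfolding X_def[abs_def] M_def[abs_def] by (rule spec)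
qed

lemma normal_form: "pb (X r) (lin \<omega>) + M r = obs.source X M H1 r"
  unfolding S_eq[symmetric] by (simp add: X_def M_def homological)

subsection \<open>Graded norms\<close>

definition N :: real where "N = real (m + 2)"

text \<open>The width available at order \<open>r\<close> is \<open>x + sc r\<close>. The first order keeps a margin independent of
  \<open>m\<close> over the others; it therefore pays no power of \<open>m\<close> for a derivative, and the weight of every
  later order gains \<open>N powr - \<alpha>\<close>. This is what makes one bracket cost \<open>N powr \<alpha>\<close> rather than its square.\<close>

definition sc :: "nat \<Rightarrow> real" where "sc r = (if r = 1 then 3 / 4 else 1 / 2 - r / (4 * N))"
definition wg :: "nat \<Rightarrow> real" where "wg r = (if r = 1 then 1 else N powr (- \<alpha>))"
definition \<Gamma>0 :: real where "\<Gamma>0 = 2 * CARD('n) * c0\<^sup>2 * 16 powr \<alpha>"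
definition \<Gamma> :: real where "\<Gamma> = \<Gamma>0 * N powr \<alpha>"

definition gn :: "real \<Rightarrow> nat \<Rightarrow> real \<Rightarrow> 'n obs \<Rightarrow> bool" where
  "gn x r B a \<longleftrightarrow> nle (x + sc r) (B * wg r) a"

lemma N: "N \<ge> 3" using m by (simp add: N_def)

lemma sc_ge: "r \<le> m + 2 \<Longrightarrow> 1 / 4 \<le> sc r"
  using N by (auto simp: sc_def N_def field_simps)

lemma sc_less: "1 \<le> r \<Longrightarrow> 1 \<le> r' \<Longrightarrow> sc (r + r') < sc r"
  using N by (auto simp: sc_def field_simps)

lemma wg_pos: "wg r > 0"
  using N by (simp add: wg_def)

lemma wg_le: "wg r \<le> 1"
proof -
  have "N powr - \<alpha> \<le> N powr 0" using N \<alpha> by (intro powr_mono) auto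
  then show ?thesis using N by (simp add: wg_def)
qed

lemma \<Gamma>0_pos: "\<Gamma>0 > 0"
  using c0_pos by (simp add: \<Gamma>0_def)

lemma \<Gamma>_pos: "\<Gamma> > 0"
  using \<Gamma>0_pos N by (simp add: \<Gamma>_def)

lemma threshold': "\<Gamma> * \<Psi> * A \<le> exp (- 1) / 32"
  using threshold by (simp add: \<Gamma>_def \<Gamma>0_def N_def)

text \<open>In the bracket of elements of orders \<open>r\<close> and \<open>r'\<close>, the element of order \<open>r > 1\<close> loses the width
  \<open>r' / (4 * N)\<close>, which costs \<open>N powr \<alpha>\<close> and is compensated by its weight. An element of order 1 has the
  weight 1, but loses at least \<open>1 / 4\<close>.\<close>

lemma derivative_cost:
  assumes "1 \<le> r" "1 \<le> r'"
  shows "(sc r - sc (r + r')) powr (- \<alpha>) * wg r \<le> 4 powr \<alpha>"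
proof (cases "r = 1")
  case True
  have "1 / 4 \<le> sc r - sc (r + r')" using True assms N by (auto simp: sc_def field_simps)
  then have "(sc r - sc (r + r')) powr (- \<alpha>) \<le> (1 / 4) powr (- \<alpha>)"
    using \<alpha> by (intro powr_mono2') auto
  also have "\<dots> = 4 powr \<alpha>" by (simp add: powr_minus powr_divide)
  finally show ?thesis using True by (simp add: wg_def)
next
  case False
  then have "sc r - sc (r + r') = r' / (4 * N)"
    using assms by (simp add: sc_def add_divide_distrib)
  then have "(sc r - sc (r + r')) powr (- \<alpha>) * wg r = (r' / (4 * N)) powr (- \<alpha>) * N powr (- \<alpha>)"
    using False by (simp add: wg_def)
  also have "\<dots> = (r' / 4) powr (- \<alpha>)"
    using N assms by (simp add: powr_mult[symmetric])
  also have "\<dots> \<le> (1 / 4) powr (- \<alpha>)"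
    using \<alpha> assms by (intro powr_mono2') auto
  also have "\<dots> = 4 powr \<alpha>" by (simp add: powr_minus powr_divide)
  finally show ?thesis .
qed

lemma gn_mono: "gn x r B a \<Longrightarrow> B \<le> B' \<Longrightarrow> gn x r B' a"
  unfolding gn_def using wg_pos[of r] by (auto elim!: nle_mono intro: mult_right_mono)

lemma gn_nonneg: "gn x r B a \<Longrightarrow> 0 \<le> B"
  unfolding gn_def using wg_pos[of r] by (drule_tac nle_nonneg) (simp add: zero_le_mult_iff)

lemma gn_add: "gn x r B a \<Longrightarrow> gn x r B' a' \<Longrightarrow> gn x r (B + B') (a + a')"
  unfolding gn_def by (auto simp: distrib_right intro: nle_add)

lemma gn_minus: "gn x r B a \<Longrightarrow> gn x r B (- a)"
  unfolding gn_def by (rule nle_minus)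

lemma gn_sum: "(\<And>j. j \<in> J \<Longrightarrow> gn x r (B j) (f j)) \<Longrightarrow> gn x r (sum B J) (sum f J)"
  unfolding gn_def sum_distrib_right by (rule nle_sum)

lemma gn_mulf: "gn x r B a \<Longrightarrow> (\<And>k. norm (\<mu> k) \<le> c) \<Longrightarrow> gn x r (c * B) (mulf \<mu> a)"
  unfolding gn_def mult.assoc by (rule nle_mulf_bounded)

lemma gn_div: "gn x r B a \<Longrightarrow> gn x r (1 / real (Suc n) * B) (div_Suc n a)"
  unfolding div_Suc_def by (erule gn_mulf) (simp add: norm_divide del: of_nat_Suc)

text \<open>Both derivatives in the bracket are free of powers of \<open>N\<close> by \<open>derivative_cost\<close>. The single factor \<open>N powr \<alpha>\<close>
  comes from the weight \<open>N powr (- \<alpha>)\<close> required of the result.\<close>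

lemma gn_pb:
  assumes a: "gn x r B a" and c: "gn x r' C c" and r: "1 \<le> r" "1 \<le> r'" "r + r' \<le> m + 2" and x: "0 \<le> x"
  shows "gn x (r + r') (\<Gamma> * (B * C)) (pb a c)"
proof -
  let ?P = "(sc r - sc (r + r')) powr (- \<alpha>) * wg r"
  let ?Q = "(sc r' - sc (r + r')) powr (- \<alpha>) * wg r'"
  have B: "B \<ge> 0" "C \<ge> 0" using a c gn_nonneg by auto
  have n1: "nle (x + sc (r + r')) (2 * CARD('n) * c0\<^sup>2 * (((x + sc r) - (x + sc (r + r'))) powr (- \<alpha>) *
      ((x + sc r') - (x + sc (r + r'))) powr (- \<alpha>)) * (B * wg r * (C * wg r'))) (pb a c)"
    using a c r x sc_ge[OF r(3)] sc_less[of r r'] sc_less[of r' r] unfolding gn_def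
    by (intro nle_pb) (auto simp: add.commute)
  have e1: "2 * CARD('n) * c0\<^sup>2 * (((x + sc r) - (x + sc (r + r'))) powr (- \<alpha>) *
      ((x + sc r') - (x + sc (r + r'))) powr (- \<alpha>)) * (B * wg r * (C * wg r'))
      = 2 * CARD('n) * c0\<^sup>2 * (?P * ?Q) * (B * C)"
    unfolding add_diff_cancel_left by (simp only: mult_ac)
  have i1: "2 * CARD('n) * c0\<^sup>2 * (?P * ?Q) * (B * C) \<le> 2 * CARD('n) * c0\<^sup>2 * (4 powr \<alpha> * 4 powr \<alpha>) * (B * C)"
    using derivative_cost[of r r'] derivative_cost[of r' r] r B wg_pos[of r] wg_pos[of r']
    by (intro mult_right_mono mult_left_mono mult_mono) (auto simp: add.commute[of r'])
  have e2: "2 * CARD('n) * c0\<^sup>2 * (4 powr \<alpha> * 4 powr \<alpha>) * (B * C) = \<Gamma> * (B * C) * wg (r + r')"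
  proof -
    have "wg (r + r') = N powr (- \<alpha>)" using r by (simp add: wg_def)
    moreover have "4 powr \<alpha> * 4 powr \<alpha> = 16 powr \<alpha>" by (simp flip: powr_mult)
    moreover have "N powr \<alpha> * N powr (- \<alpha>) = 1" using N by (simp flip: powr_add)
    ultimately show ?thesis by (simp add: \<Gamma>_def \<Gamma>0_def)
  qed
  show ?thesis unfolding gn_def
    by (rule nle_mono[OF n1]) (rule order_trans[OF eq_refl[OF e1] order_trans[OF i1 eq_refl[OF e2]]])
qed

subsection \<open>Bounds for the recursion\<close>

definition \<kappa> :: real where "\<kappa> = exp (- 1)"
definition Y :: "nat \<Rightarrow> real" where "Y r = A * \<kappa> ^ (r - 1) / (real r)\<^sup>2"
definition e :: "nat \<Rightarrow> real" where "e r = (if r = 0 then 1 else \<kappa> ^ r / (16 * (real r)\<^sup>2))"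

lemma \<kappa>: "\<kappa> > 0" "\<kappa> \<le> 1 / 2"
  using exp_ge_add_one_self[of 1] by (auto simp: \<kappa>_def exp_minus field_simps)

lemma Y_nonneg: "Y r \<ge> 0" using A \<kappa> by (simp add: Y_def)
lemma e_nonneg: "e r \<ge> 0" using \<kappa> by (simp add: e_def)

lemma e_0: "e 0 = 1" by (simp add: e_def)

lemma Y_le: "Y (Suc r) \<le> A * \<kappa> ^ r"
proof -
  have "A * \<kappa> ^ r / (real (Suc r))\<^sup>2 \<le> A * \<kappa> ^ r / 1"
    using A \<kappa> by (intro divide_left_mono) (auto simp: power2_eq_square intro: mult_ge1_I)
  then show ?thesis by (simp add: Y_def)
qed

lemma e_le: "e r \<le> \<kappa> ^ r"
proof (cases r)
  case 0 then show ?thesis by (simp add: e_def)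
next
  case (Suc n)
  have "1 \<le> 16 * (real r)\<^sup>2" using Suc by (simp add: power2_eq_square algebra_simps)
  then have "\<kappa> ^ r / (16 * (real r)\<^sup>2) \<le> \<kappa> ^ r / 1"
    using \<kappa> by (intro divide_left_mono) (linarith | simp)+
  then show ?thesis using Suc by (simp add: e_def)
qed

lemma gen_cost: "\<Gamma> * (\<Psi> * Y (Suc j)) \<le> \<kappa> ^ Suc j / (32 * (real (Suc j))\<^sup>2)"
proof -
  have "\<Gamma> * (\<Psi> * Y (Suc j)) = (\<Gamma> * \<Psi> * A) * (\<kappa> ^ j / (real (Suc j))\<^sup>2)"
    by (simp add: Y_def)
  also have "\<dots> \<le> (\<kappa> / 32) * (\<kappa> ^ j / (real (Suc j))\<^sup>2)"
    using threshold' \<kappa> by (intro mult_right_mono) (auto simp: \<kappa>_def)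
  finally show ?thesis by (simp add: divide_simps)
qed

lemma gen_cost': "\<Gamma> * (\<Psi> * Y (Suc j)) \<le> \<kappa> ^ Suc j / 32"
proof -
  have "\<kappa> ^ Suc j / (32 * (real (Suc j))\<^sup>2) \<le> \<kappa> ^ Suc j / (32 * 1)"
    using \<kappa> by (intro divide_left_mono mult_left_mono) (auto simp: power2_eq_square intro: mult_ge1_I)
  then show ?thesis using gen_cost[of j] by simp
qed

lemma convolution_e: "(\<Sum>j\<le>n. \<Gamma> * (\<Psi> * Y (Suc j)) * e (n - j)) \<le> e (Suc n)"
proof -
  let ?r = "(real (Suc n))\<^sup>2"
  have "(\<Sum>j\<le>n. \<Gamma> * (\<Psi> * Y (Suc j)) * e (n - j))
      \<le> (\<Sum>j\<le>n. \<kappa> ^ Suc j / (32 * (real (Suc j))\<^sup>2) * e (n - j))"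
    by (intro sum_mono mult_right_mono gen_cost e_nonneg)
  also have "\<dots> = (\<Sum>j<n. \<kappa> ^ Suc j / (32 * (real (Suc j))\<^sup>2) * e (n - j)) + \<kappa> ^ Suc n / (32 * ?r)"
    unfolding lessThan_Suc_atMost[symmetric] sum.lessThan_Suc by (simp add: e_0)
  also have "(\<Sum>j<n. \<kappa> ^ Suc j / (32 * (real (Suc j))\<^sup>2) * e (n - j))
      = \<kappa> ^ Suc n / 512 * (\<Sum>j<n. 1 / ((real (Suc j))\<^sup>2 * (real (n - j))\<^sup>2))"
    unfolding sum_distrib_left
  proof (rule sum.cong[OF refl])
    fix j assume "j \<in> {..<n}"
    then have "\<kappa> ^ Suc j * \<kappa> ^ (n - j) = \<kappa> ^ Suc n" by (simp flip: power_add)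
    moreover have "\<kappa> ^ Suc j / (32 * (real (Suc j))\<^sup>2) * e (n - j) = (\<kappa> ^ Suc j * \<kappa> ^ (n - j)) / 512 * (1 / ((real (Suc j))\<^sup>2 * (real (n - j))\<^sup>2))"
      using \<open>j \<in> {..<n}\<close> by (simp add: e_def del: power_Suc of_nat_Suc)
    ultimately show "\<kappa> ^ Suc j / (32 * (real (Suc j))\<^sup>2) * e (n - j) = \<kappa> ^ Suc n / 512 * (1 / ((real (Suc j))\<^sup>2 * (real (n - j))\<^sup>2))"
      by (simp only:)
  qed
  also have "\<dots> \<le> \<kappa> ^ Suc n / 512 * (8 / ?r)"
    using \<kappa> by (intro mult_left_mono convolution_inverse_squares) auto
  also have "\<kappa> ^ Suc n / 512 * (8 / ?r) + \<kappa> ^ Suc n / (32 * ?r) \<le> e (Suc n)"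
    using \<kappa> by (simp add: e_def divide_simps del: power_Suc of_nat_Suc)
  finally show ?thesis by simp
qed

lemma convolution_Y: "(\<Sum>q\<in>{1..<Suc n}. Y q * e (Suc n - q)) \<le> Y (Suc n) / 2"
proof -
  have "(\<Sum>q\<in>{1..<Suc n}. Y q * e (Suc n - q)) = (\<Sum>j<n. Y (Suc j) * e (n - j))"
    unfolding sum_upt_shift by simp
  also have "\<dots> = A * \<kappa> ^ n / 16 * (\<Sum>j<n. 1 / ((real (Suc j))\<^sup>2 * (real (n - j))\<^sup>2))"
    unfolding sum_distrib_left
  proof (rule sum.cong[OF refl])
    fix j assume "j \<in> {..<n}"
    then have "\<kappa> ^ j * \<kappa> ^ (n - j) = \<kappa> ^ n" by (simp flip: power_add)
    moreover have "Y (Suc j) * e (n - j) = A * (\<kappa> ^ j * \<kappa> ^ (n - j)) / 16 * (1 / ((real (Suc j))\<^sup>2 * (real (n - j))\<^sup>2))"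
      using \<open>j \<in> {..<n}\<close> by (simp add: Y_def e_def mult_ac del: of_nat_Suc)
    ultimately show "Y (Suc j) * e (n - j) = A * \<kappa> ^ n / 16 * (1 / ((real (Suc j))\<^sup>2 * (real (n - j))\<^sup>2))"
      by (simp only:)
  qed
  also have "\<dots> \<le> A * \<kappa> ^ n / 16 * (8 / (real (Suc n))\<^sup>2)"
    using \<kappa> A by (intro mult_left_mono convolution_inverse_squares) auto
  finally show ?thesis by (simp add: Y_def)
qed

text \<open>The factor \<open>1 / (n + 1)\<close> in the recursion of \<open>T\<close> is bounded by 1; the decrease comes from the generators.\<close>

lemma gn_T:
  assumes X: "\<And>j. 1 \<le> j \<Longrightarrow> j \<le> r0 \<Longrightarrow> gn x j (\<Psi> * Y j) (X j)"
    and a: "gn x p B a" and p: "1 \<le> p" and x: "0 \<le> x"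
  shows "r \<le> r0 \<Longrightarrow> r + p \<le> m + 2 \<Longrightarrow> gn x (r + p) (B * e r) (lieT X a r)"
proof (induction r rule: less_induct)
  case (less r)
  show ?case
  proof (cases r)
    case 0
    then show ?thesis using a by (simp add: e_def)
  next
    case (Suc n)
    have "gn x (r + p) (\<Gamma> * (\<Psi> * Y (Suc j) * (B * e (n - j)))) (pb (X (Suc j)) (lieT X a (n - j)))" if "j \<le> n" for j
    proof -
      have "gn x (Suc j + (n - j + p)) (\<Gamma> * (\<Psi> * Y (Suc j) * (B * e (n - j)))) (pb (X (Suc j)) (lieT X a (n - j)))"
        using that Suc less.prems p x by (intro gn_pb X less.IH) auto
      moreover have eq: "Suc j + (n - j + p) = r + p" using that Suc by simp
      ultimately show ?thesis unfolding eq by simp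
    qed
    then have "gn x (r + p) (\<Sum>j\<le>n. \<Gamma> * (\<Psi> * Y (Suc j) * (B * e (n - j)))) (\<Sum>j\<le>n. pb (X (Suc j)) (lieT X a (n - j)))"
      by (intro gn_sum) simp
    then have "gn x (r + p) (1 * (\<Sum>j\<le>n. \<Gamma> * (\<Psi> * Y (Suc j) * (B * e (n - j))))) (lieT X a r)"
      unfolding Suc obs.T.simps(2) div_Suc_def by (rule gn_mulf) (simp add: norm_divide del: of_nat_Suc)
    moreover have "(\<Sum>j\<le>n. \<Gamma> * (\<Psi> * Y (Suc j) * (B * e (n - j)))) = B * (\<Sum>j\<le>n. \<Gamma> * (\<Psi> * Y (Suc j)) * e (n - j))"
      by (simp add: sum_distrib_left mult_ac)
    moreover have "\<dots> \<le> B * e r"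
      unfolding Suc using gn_nonneg[OF a] by (intro mult_left_mono convolution_e)
    ultimately show ?thesis using gn_mono by auto
  qed
qed

lemma gn_X_of_S: "gn x r B (S r) \<Longrightarrow> gn x r (\<Psi> * B) (X r)"
  unfolding X_def slv_def
proof (rule gn_mulf)
  fix k
  show "norm (if nonres k then 1 / (2 * pi * \<i> * of_real (kdot k \<omega>)) else 0 :: complex) \<le> \<Psi>"
    using small_div[of k] Psi by (auto simp: nonres_def norm_divide norm_mult divide_simps)
qed

lemma gn_M_of_S: "gn x r B (S r) \<Longrightarrow> gn x r B (M r)"
  unfolding M_def rst_def using gn_mulf[of x r B "S r" "\<lambda>k. if nonres k then 0 else 1" 1] by auto

lemma gn_H1: "x \<le> 1 / 4 \<Longrightarrow> gn x 1 A H1"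
  using nle_narrow[OF H1, of "x + sc 1"] by (simp add: gn_def sc_def wg_def)

text \<open>Half of the bound \<open>Y r\<close> is used for the bracket with \<open>H1\<close>, which gains a factor by the threshold, and half for the
  transported terms \<open>M q\<close>, a convolution of \<open>Y\<close> with the small sequence \<open>e\<close>.\<close>

lemma gn_S:
  assumes x: "0 \<le> x" "x \<le> 1 / 4"
  shows "1 \<le> r \<Longrightarrow> r \<le> m + 2 \<Longrightarrow> gn x r (Y r) (S r)"
proof (induction r rule: less_induct)
  case (less r)
  show ?case
  proof (cases "r = 1")
    case True
    then show ?thesis using gn_H1[OF x(2)] by (simp add: S_eq obs.source_def Y_def)
  next
    case False
    then obtain n where n: "r = Suc n" "n \<ge> 1" using less.prems by (cases r) auto
    have 1: "gn x (n + 1) (\<Gamma> * (\<Psi> * Y n * A)) (pb (X n) H1)"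
      using n less x by (intro gn_pb gn_X_of_S gn_H1) auto
    have 2: "gn x r (\<Sum>q\<in>{1..<r}. Y q * e (r - q)) (\<Sum>q\<in>{1..<r}. lieT X (M q) (r - q))"
    proof (rule gn_sum)
      fix q assume q: "q \<in> {1..<r}"
      have "gn x (r - q + q) (Y q * e (r - q)) (lieT X (M q) (r - q))"
        using q less x n gn_T[of n x q "Y q" "M q" "r - q"] gn_X_of_S[of x] gn_M_of_S[of x q] by auto
      then show "gn x r (Y q * e (r - q)) (lieT X (M q) (r - q))" using q by simp
    qed
    have "S r = - pb (X n) H1 + - (\<Sum>q\<in>{1..<r}. lieT X (M q) (r - q))"
      unfolding S_eq[of r] using n by (simp add: obs.source_def)
    moreover have "gn x r (\<Gamma> * (\<Psi> * Y n * A) + (\<Sum>q\<in>{1..<r}. Y q * e (r - q)))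
        (- pb (X n) H1 + - (\<Sum>q\<in>{1..<r}. lieT X (M q) (r - q)))"
      using 1 2 n by (intro gn_add gn_minus) auto
    moreover have "\<Gamma> * (\<Psi> * Y n * A) \<le> Y r / 2"
    proof -
      obtain k where k: "n = Suc k" using n by (cases n) auto
      have "\<Gamma> * (\<Psi> * Y n * A) = \<Gamma> * (\<Psi> * Y n) * A" by simp
      also have "\<dots> \<le> \<kappa> ^ n / (32 * (real n)\<^sup>2) * A"
        unfolding k using A by (intro mult_right_mono gen_cost) auto
      also have "\<dots> \<le> A * \<kappa> ^ n / (2 * (real r)\<^sup>2)"
      proof -
        have "real r \<le> 2 * real n" using n by simp
        then have "(real r)\<^sup>2 \<le> (2 * real n)\<^sup>2" by (intro power_mono) auto
        then have "(real r)\<^sup>2 \<le> 4 * (real n)\<^sup>2" by (simp add: power_mult_distrib)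
        moreover have "2 * s \<le> 32 * t" if "s \<le> 4 * t" "0 \<le> t" for s t :: real
          using that by linarith
        ultimately have "2 * (real r)\<^sup>2 \<le> 32 * (real n)\<^sup>2" by (meson zero_le_power2)
        then show ?thesis using A \<kappa> n by (simp add: frac_le)
      qed
      finally show ?thesis using n by (simp add: Y_def)
    qed
    moreover have "(\<Sum>q\<in>{1..<r}. Y q * e (r - q)) \<le> Y r / 2"
      unfolding n by (rule convolution_Y)
    ultimately show ?thesis using gn_mono by fastforce
  qed
qed

lemma gn_X: "0 \<le> x \<Longrightarrow> x \<le> 1 / 4 \<Longrightarrow> 1 \<le> r \<Longrightarrow> r \<le> m + 2 \<Longrightarrow> gn x r (\<Psi> * Y r) (X r)"
  by (intro gn_X_of_S gn_S)

definition V :: real where "V = CARD('n) * (R + exp 1 * \<rho>)"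

lemma V_pos: "V > 0"
  using R \<rho> unfolding V_def by (intro mult_pos_pos add_pos_pos) auto

lemma gn_lin: "x \<le> 1 / 4 \<Longrightarrow> gn x 1 V (lin v)"
  unfolding gn_def V_def using nle_lin[of v "x + sc 1"] v by (simp add: sc_def wg_def)

abbreviation G :: "nat \<Rightarrow> 'n obs" where "G \<equiv> lieT X (lin v)"

lemma gn_G: "0 \<le> x \<Longrightarrow> x \<le> 1 / 4 \<Longrightarrow> r \<le> m + 1 \<Longrightarrow> gn x (r + 1) (V * e r) (G r)"
  using gn_T[of "m + 1" x 1 V "lin v" r] gn_X[of x] gn_lin[of x] by simp

definition \<theta>0 :: real where "\<theta>0 = exp (- (b * K powr (1 / \<alpha>) / 4))"

lemma \<theta>0_pos: "\<theta>0 > 0" by (simp add: \<theta>0_def)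

text \<open>The modes with \<open>k \<bullet> \<omega> = 0\<close> commute with \<open>lin v\<close>. On the remaining modes, \<open>|k| > K\<close>, giving up the width \<open>1 / 4\<close> gains
  the factor \<open>\<theta>0\<close>.\<close>

lemma gn_pb_lin_M:
  assumes q: "1 \<le> q" "q \<le> m + 1"
  shows "gn 0 (q + 1) (\<Gamma> * (\<theta>0 * Y q * V)) (pb (lin v) (M q))"
proof -
  define Mh where "Mh = mulf (\<lambda>k. if kn k > K then 1 else 0) (S q)"
  have "pb (M q) (lin v) = pb Mh (lin v)"
  proof (rule poly_mapping_eqI)
    fix k show "lk (pb (M q) (lin v)) k = lk (pb Mh (lin v)) k"
      using resonant[of k] by (auto simp: pb_lin M_def rst_def Mh_def nonres_def)
  qed
  then have eq: "pb (lin v) (M q) = - pb Mh (lin v)"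
    using obs.br_anti[of "lin v" "M q"] by simp
  have "nle (1 / 4 + sc q) (Y q * wg q) (S q)"
    using gn_S[of "1/4" q] q by (simp add: gn_def)
  then have "nle (0 + sc q) (\<theta>0 * (Y q * wg q)) Mh"
    unfolding Mh_def
  proof (rule nle_mulf)
    fix k :: "int^'n" and l :: "nat^'n"
    show "norm (if kn k > K then 1 else 0 :: complex) * wt (0 + sc q) k l \<le> \<theta>0 * wt (1 / 4 + sc q) k l"
    proof (cases "kn k > K")
      case True
      then have "K powr (1 / \<alpha>) \<le> kn k powr (1 / \<alpha>)" using K \<alpha> by (intro powr_mono2) auto
      then have "b * K powr (1 / \<alpha>) \<le> b * kn k powr (1 / \<alpha>) + lsum l"
        using b by (simp add: add_increasing2)
      then have "exp (- (1 / 4) * (b * kn k powr (1 / \<alpha>) + lsum l)) \<le> \<theta>0"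
        by (simp add: \<theta>0_def)
      then have "exp (- (1 / 4) * (b * kn k powr (1 / \<alpha>) + lsum l)) * wt (1 / 4 + sc q) k l \<le> \<theta>0 * wt (1 / 4 + sc q) k l"
        using wt_pos[of "1 / 4 + sc q" k l] by (intro mult_right_mono) auto
      then show ?thesis using True wt_shift[of "1 / 4 + sc q" "1 / 4" k l] by simp
    next
      case False
      then show ?thesis using \<theta>0_pos wt_pos[of "1 / 4 + sc q" k l] by simp
    qed
  qed
  then have "gn 0 q (\<theta>0 * Y q) Mh" by (simp add: gn_def mult.assoc)
  then show ?thesis unfolding eq using q by (intro gn_minus gn_pb gn_lin) auto
qed

definition c :: "nat \<Rightarrow> 'n obs" where
  "c r = (if r = 0 then 0 else pb (G r) (lin \<omega>) + pb (G (r - 1)) H1)"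

definition D :: real where "D = 2 * \<Gamma> * V * \<theta>0 * A / \<kappa>"

lemma D_pos: "D > 0"
  using \<Gamma>_pos V_pos \<theta>0_pos A \<kappa> by (simp add: D_def)

text \<open>In the equation of \<open>first_integral_defect\<close> each of the \<open>n + 1\<close> terms of both sums is at most a fraction of the
  claimed bound; division by \<open>n + 1\<close> compensates their number.\<close>

lemma gn_c: "r \<le> m + 1 \<Longrightarrow> gn 0 (r + 1) (D * \<kappa> ^ r) (c r)"
proof (induction r rule: less_induct)
  case (less r)
  show ?case
  proof (cases r)
    case 0
    then show ?thesis using D_pos wg_pos[of 1]
      by (auto simp: c_def gn_def intro: nle_mono[OF nle_zero])
  next
    case (Suc n)
    let ?s = "(\<Sum>j\<le>n. pb (X (Suc j)) (c (n - j))) + (\<Sum>q\<in>{1..Suc n}. lieT X (pb (lin v) (M q)) (Suc n - q))"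
    have defect: "of_nat (Suc n) * c (Suc n) = ?s"
      unfolding c_def by (rule obs.first_integral_defect) (auto simp: normal_form pb_lin_lin)
    have "c r = div_Suc n ?s"
      unfolding Suc defect[symmetric] div_Suc_def
      by (intro poly_mapping_eqI) (simp add: lk_of_nat_mult del: of_nat_Suc)
    have 1: "gn 0 (r + 1) (\<kappa> ^ Suc j / 32 * (D * \<kappa> ^ (n - j))) (pb (X (Suc j)) (c (n - j)))" if "j \<le> n" for j
    proof -
      have "gn 0 (Suc j + (n - j + 1)) (\<Gamma> * (\<Psi> * Y (Suc j) * (D * \<kappa> ^ (n - j)))) (pb (X (Suc j)) (c (n - j)))"
        using that less Suc by (intro gn_pb gn_X less.IH) auto
      moreover have "\<Gamma> * (\<Psi> * Y (Suc j) * (D * \<kappa> ^ (n - j))) \<le> \<kappa> ^ Suc j / 32 * (D * \<kappa> ^ (n - j))"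
        using mult_right_mono[OF gen_cost'[of j], of "D * \<kappa> ^ (n - j)"] D_pos \<kappa> by (simp add: mult.assoc)
      ultimately show ?thesis using that Suc gn_mono by fastforce
    qed
    have 2: "gn 0 (r + 1) (D * \<kappa> ^ Suc n / 2) (lieT X (pb (lin v) (M q)) (Suc n - q))" if q: "q \<in> {1..Suc n}" for q
    proof -
      obtain q' where q': "q = Suc q'" using q by (cases q) auto
      have "gn 0 (Suc n - q + (q + 1)) (\<Gamma> * (\<theta>0 * Y q * V) * e (Suc n - q)) (lieT X (pb (lin v) (M q)) (Suc n - q))"
        using q less Suc gn_X[of 0] gn_pb_lin_M[of q]
          gn_T[of "m + 1" 0 "q + 1" "\<Gamma> * (\<theta>0 * Y q * V)" "pb (lin v) (M q)" "Suc n - q"] by auto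
      moreover have "\<Gamma> * (\<theta>0 * Y q * V) * e (Suc n - q) \<le> \<Gamma> * (\<theta>0 * (A * \<kappa> ^ q') * V) * \<kappa> ^ (Suc n - q)"
        unfolding q' using \<Gamma>_pos \<theta>0_pos V_pos A \<kappa> e_le e_nonneg Y_nonneg Y_le
        by (intro mult_mono mult_nonneg_nonneg order_refl) auto
      moreover have "\<kappa> ^ q' * \<kappa> ^ (Suc n - q) = \<kappa> ^ n"
        using q q' by (simp flip: power_add)
      then have "\<Gamma> * (\<theta>0 * (A * \<kappa> ^ q') * V) * \<kappa> ^ (Suc n - q) = \<Gamma> * V * \<theta>0 * A * \<kappa> ^ n"
        by (simp add: mult_ac)
      moreover have "\<Gamma> * V * \<theta>0 * A * \<kappa> ^ n = D * \<kappa> ^ Suc n / 2"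
        using \<kappa> by (simp add: D_def)
      ultimately show ?thesis using q Suc gn_mono by fastforce
    qed
    have "gn 0 (r + 1) ((\<Sum>j\<le>n. \<kappa> ^ Suc j / 32 * (D * \<kappa> ^ (n - j))) + (\<Sum>q\<in>{1..Suc n}. D * \<kappa> ^ Suc n / 2)) ?s"
      by (intro gn_add gn_sum 1 2) auto
    moreover have "(\<Sum>j\<le>n. \<kappa> ^ Suc j / 32 * (D * \<kappa> ^ (n - j))) = (\<Sum>j\<le>n. D * \<kappa> ^ Suc n / 32)"
    proof (rule sum.cong[OF refl])
      fix j assume "j \<in> {..n}"
      then have "\<kappa> ^ Suc j * \<kappa> ^ (n - j) = \<kappa> ^ Suc n" by (simp flip: power_add)
      then show "\<kappa> ^ Suc j / 32 * (D * \<kappa> ^ (n - j)) = D * \<kappa> ^ Suc n / 32"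
        by (simp only: times_divide_eq_left mult.left_commute[of _ D])
    qed
    moreover have "(\<Sum>j\<le>n. D * \<kappa> ^ Suc n / 32) + (\<Sum>q\<in>{1..Suc n}. D * \<kappa> ^ Suc n / 2)
        = real (Suc n) * (D * \<kappa> ^ Suc n * (17 / 32))"
      by (simp add: algebra_simps)
    ultimately have "gn 0 (r + 1) (real (Suc n) * (D * \<kappa> ^ Suc n * (17 / 32))) ?s"
      by (simp only:)
    then have "gn 0 (r + 1) (1 / real (Suc n) * (real (Suc n) * (D * \<kappa> ^ Suc n * (17 / 32)))) (div_Suc n ?s)"
      by (rule gn_div)
    moreover have "1 / real (Suc n) * (real (Suc n) * (D * \<kappa> ^ Suc n * (17 / 32))) \<le> D * \<kappa> ^ r"
      unfolding Suc using D_pos \<kappa> by simp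
    ultimately show ?thesis unfolding \<open>c r = _\<close> by (rule gn_mono)
  qed
qed

lemma obs_smooth_div: "obs_smooth R a \<Longrightarrow> obs_smooth R (div_Suc n a)"
  unfolding div_Suc_def by (rule obs_smooth_mulf)

lemma T_smooth:
  assumes "\<And>j. 1 \<le> j \<Longrightarrow> j \<le> n \<Longrightarrow> obs_smooth R (Z j)" and a: "obs_smooth R a"
  shows "obs_smooth R (lieT Z a n)"
  using assms(1)
proof (induction n rule: less_induct)
  case (less n)
  show ?case
  proof (cases n)
    case 0 then show ?thesis using a by simp
  next
    case (Suc k)
    show ?thesis unfolding Suc obs.T.simps(2)
      by (intro obs_smooth_div obs_smooth_sum obs_smooth_pb less.IH less.prems) (auto simp: Suc)
  qed
qed

lemma S_smooth: "obs_smooth R (S r)"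
proof (induction r rule: less_induct)
  case (less r)
  have X: "obs_smooth R (X j)" if "j < r" for j
    unfolding X_def slv_def by (intro obs_smooth_mulf less that)
  have M: "obs_smooth R (M j)" if "j < r" for j
    unfolding M_def rst_def by (intro obs_smooth_mulf less that)
  show ?case unfolding S_eq[of r] obs.source_def
    by (auto intro!: H1_smooth obs_smooth_diff obs_smooth_minus obs_smooth_pb obs_smooth_sum X M T_smooth)
qed

lemma G_smooth: "obs_smooth R (G r)"
  by (intro T_smooth obs_smooth_lin) (simp add: X_def slv_def S_smooth obs_smooth_mulf)

lemma sum_powers_\<kappa>: "(\<Sum>r\<in>{1..m}. \<kappa> ^ r) \<le> 1"
proof -
  have "(\<Sum>r\<in>{1..n}. \<kappa> ^ r) \<le> 1 - \<kappa> ^ n" for n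
  proof (induction n)
    case (Suc n)
    have "2 * \<kappa> ^ Suc n \<le> \<kappa> ^ n" using \<kappa> mult_right_mono[of \<kappa> "1/2" "\<kappa> ^ n"] by simp
    then show ?case using Suc by simp
  qed simp
  then show ?thesis using \<kappa> by (meson diff_le_eq le_add_same_cancel1 less_imp_le order_trans zero_less_power)
qed

text \<open>The sum of the first \<open>m + 1\<close> coefficients of the transported \<open>lin v\<close>. Its bracket with the Hamiltonian
  is the sum of the defects \<open>c r\<close>, which carry the factor \<open>\<theta>0\<close>, and of the single term
  \<open>{G m, H1}\<close> cut off at the end, which carries \<open>exp (- m)\<close>.\<close>

theorem quasi_integral:
  obtains g where "obs_smooth R g"
    "\<And>\<theta> I. I \<in> aball R \<Longrightarrow> norm (ev \<theta> I g - of_real (v \<bullet> I)) \<le> V * N powr (- \<alpha>)"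
    "\<And>\<theta> I. I \<in> aball R \<Longrightarrow> norm (ev \<theta> I (pb g (lin \<omega> + H1))) \<le> \<Gamma>0 * V * A * (2 * exp 1 * \<theta>0 + exp (- real m))"
    "\<And>\<theta> I i. I \<in> aball R \<Longrightarrow> norm (ev \<theta> I (dth i g)) \<le> c0 * 4 powr \<alpha> * (2 * V)"
    "\<And>\<theta> I i. I \<in> aball R \<Longrightarrow> norm (ev \<theta> I (dac i g)) \<le> c0 * 4 powr \<alpha> * (2 * V)"
proof
  define g where "g = (\<Sum>r\<le>m. G r)"
  define g' where "g' = (\<Sum>r\<in>{1..m}. G r)"
  have g: "g = lin v + g'"
    unfolding g_def g'_def by (simp add: atMost_atLeast0 sum.atLeast_Suc_atMost)
  have wN: "wg (r + 1) = N powr (- \<alpha>)" if "r \<ge> 1" for r using that by (simp add: wg_def)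
  have N1: "N powr (- \<alpha>) \<le> 1" "N powr (- \<alpha>) > 0" using wg_le[of 2] wg_pos[of 2] by (auto simp: wg_def)
  have g': "nle (1 / 4) (V * N powr (- \<alpha>)) g'"
  proof -
    have "nle (1 / 4) (\<Sum>r\<in>{1..m}. V * N powr (- \<alpha>) * \<kappa> ^ r) g'"
      unfolding g'_def
    proof (rule nle_sum)
      fix r assume r: "r \<in> {1..m}"
      have "nle (1 / 4 + sc (r + 1)) (V * e r * wg (r + 1)) (G r)"
        using gn_G[of "1 / 4" r] r by (simp add: gn_def)
      then have "nle (1 / 4) (V * e r * wg (r + 1)) (G r)"
        by (rule nle_narrow) (use sc_ge[of "r + 1"] r in simp)
      then show "nle (1 / 4) (V * N powr (- \<alpha>) * \<kappa> ^ r) (G r)"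
      proof (rule nle_mono)
        show "V * e r * wg (r + 1) \<le> V * N powr (- \<alpha>) * \<kappa> ^ r"
          using mult_left_mono[OF e_le[of r], of "V * N powr (- \<alpha>)"] V_pos r wN[of r] by (simp add: mult_ac)
      qed
    qed
    then show ?thesis
    proof (rule nle_mono)
      show "(\<Sum>r\<in>{1..m}. V * N powr (- \<alpha>) * \<kappa> ^ r) \<le> V * N powr (- \<alpha>)"
        using mult_left_mono[OF sum_powers_\<kappa>, of "V * N powr (- \<alpha>)"] V_pos by (simp add: sum_distrib_left)
    qed
  qed
  have gV: "nle (1 / 4) (2 * V) g"
  proof -
    have "nle (1 / 4) (V + V * N powr (- \<alpha>)) g"
      unfolding g V_def using v g'[unfolded V_def] by (intro nle_add nle_lin) auto
    then show ?thesis
      by (rule nle_mono) (use N1 V_pos mult_left_mono[OF N1(1), of V] in simp)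
  qed
  show "obs_smooth R g" unfolding g_def by (intro obs_smooth_sum G_smooth)
  fix \<theta> I :: "real^'n" assume I: "I \<in> aball R"
  show "norm (ev \<theta> I g - of_real (v \<bullet> I)) \<le> V * N powr (- \<alpha>)"
    using norm_ev_le[OF g' _ I, of \<theta>] by (simp add: g ev_add ev_lin)
  have cost: "c0 * (1 / 4 - 0) powr (- \<alpha>) * (2 * V) = c0 * 4 powr \<alpha> * (2 * V)"
    by (simp add: powr_minus powr_divide)
  show "norm (ev \<theta> I (dth i g)) \<le> c0 * 4 powr \<alpha> * (2 * V)" for i
    using norm_ev_le[OF nle_dth[OF gV, of 0 i] _ I, of \<theta>] unfolding cost by simp
  show "norm (ev \<theta> I (dac i g)) \<le> c0 * 4 powr \<alpha> * (2 * V)" for i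
    using norm_ev_le[OF nle_dac[OF gV, of 0 i] _ I, of \<theta>] unfolding cost by simp
  have "pb g (lin \<omega> + H1) = (\<Sum>r\<le>m. pb (G r) (lin \<omega>)) + (\<Sum>r\<le>m. pb (G r) H1)"
    by (simp add: g_def obs.br_add_right obs.br_sum_left)
  also have "(\<Sum>r\<le>m. pb (G r) (lin \<omega>)) = (\<Sum>r\<in>{1..m}. pb (G r) (lin \<omega>))"
    by (simp add: atMost_atLeast0 sum.atLeast_Suc_atMost pb_lin_lin)
  also have "(\<Sum>r\<le>m. pb (G r) H1) = (\<Sum>r\<in>{1..m}. pb (G (r - 1)) H1) + pb (G m) H1"
  proof -
    have "(\<Sum>r\<in>{1..m}. pb (G (r - 1)) H1) = (\<Sum>r<m. pb (G r) H1)"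
      by (rule sum.reindex_bij_witness[of _ Suc "\<lambda>r. r - 1"]) auto
    then show ?thesis by (simp add: lessThan_Suc_atMost[symmetric])
  qed
  finally have eq: "pb g (lin \<omega> + H1) = (\<Sum>r\<in>{1..m}. c r) + pb (G m) H1"
    by (simp add: c_def sum.distrib add.assoc)
  have 1: "norm (ev \<theta> I (\<Sum>r\<in>{1..m}. c r)) \<le> \<Gamma>0 * V * A * (2 * exp 1 * \<theta>0)"
  proof -
    have "norm (ev \<theta> I (c r)) \<le> D * N powr (- \<alpha>) * \<kappa> ^ r" if r: "r \<in> {1..m}" for r
    proof -
      have "nle (0 + sc (r + 1)) (D * \<kappa> ^ r * wg (r + 1)) (c r)"
        using gn_c[of r] r by (simp add: gn_def)
      from norm_ev_le[OF this _ I, of \<theta>] show ?thesis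
        using sc_ge[of "r + 1"] r wN[of r] by (simp add: mult_ac)
    qed
    then have "norm (ev \<theta> I (\<Sum>r\<in>{1..m}. c r)) \<le> (\<Sum>r\<in>{1..m}. D * N powr (- \<alpha>) * \<kappa> ^ r)"
      unfolding ev_sum by (intro sum_norm_le) auto
    also have "\<dots> \<le> D * N powr (- \<alpha>)"
      using mult_left_mono[OF sum_powers_\<kappa>, of "D * N powr (- \<alpha>)"] D_pos by (simp add: sum_distrib_left)
    also have "\<dots> = \<Gamma>0 * V * A * (2 * exp 1 * \<theta>0)"
      using N by (simp add: D_def \<Gamma>_def \<kappa>_def exp_minus powr_minus field_simps)
    finally show ?thesis .
  qed
  have 2: "norm (ev \<theta> I (pb (G m) H1)) \<le> \<Gamma>0 * V * A * exp (- real m)"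
  proof -
    have "gn 0 (m + 1 + 1) (\<Gamma> * (V * e m * A)) (pb (G m) H1)"
      by (intro gn_pb gn_G gn_H1) auto
    then have "norm (ev \<theta> I (pb (G m) H1)) \<le> \<Gamma> * (V * e m * A) * wg (m + 1 + 1)"
      unfolding gn_def using sc_ge[of "m + 2"] by (intro norm_ev_le[OF _ _ I]) auto
    also have "\<dots> = \<Gamma>0 * V * A * e m"
      using N by (simp add: wg_def \<Gamma>_def powr_minus)
    also have "\<dots> \<le> \<Gamma>0 * V * A * \<kappa> ^ m"
      using \<Gamma>0_pos V_pos A by (intro mult_left_mono e_le) auto
    also have "\<kappa> ^ m = exp (- real m)"
      by (simp add: \<kappa>_def flip: exp_of_nat_mult)
    finally show ?thesis .
  qed
  show "norm (ev \<theta> I (pb g (lin \<omega> + H1))) \<le> \<Gamma>0 * V * A * (2 * exp 1 * \<theta>0 + exp (- real m))"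
    unfolding eq ev_add distrib_left using 1 2 by (rule norm_triangle_le[OF add_mono])
qed

end

section \<open>Fourier series on the torus\<close>

definition rv :: "int^'n \<Rightarrow> real^('n::finite)" where "rv k = (\<chi> i. of_int (k $ i))"

definition periodic :: "(real^('n::finite) \<Rightarrow> 'b) \<Rightarrow> bool" where
  "periodic g \<longleftrightarrow> (\<forall>\<theta> k. g (\<theta> + rv k) = g \<theta>)"

abbreviation unit_cube :: "(real^'n) set" where "unit_cube \<equiv> cbox 0 1"

lemma periodicD: "periodic g \<Longrightarrow> g (\<theta> + rv k) = g \<theta>"
  by (simp add: periodic_def)

lemma rv_axis: "rv (axis i 1) = axis i 1"
  by (simp add: rv_def axis_def vec_eq_iff)

lemma rv_floor_in_cube: "\<exists>k. \<theta> - rv k \<in> unit_cube"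
proof
  show "\<theta> - rv (\<chi> i. \<lfloor>\<theta> $ i\<rfloor>) \<in> unit_cube"
    by (auto simp: mem_box_cart rv_def) linarith
qed

lemma kdot_rv: "kdot k (rv k') \<in> \<int>"
  by (auto simp: kdot_def rv_def intro!: Ints_sum Ints_mult)

lemma periodic_ek: "periodic (ek k)"
proof -
  have "cis (2 * pi * r) = 1" if "r \<in> \<int>" for r
    using that by (auto elim!: Ints_cases simp: cis_multiple_2pi)
  then have "cis (2 * pi * kdot k (rv k')) = 1" for k' using kdot_rv by blast
  then show ?thesis by (simp add: periodic_def ek_def kdot_add distrib_left flip: cis_mult)
qed

lemma continuous_on_kdot [continuous_intros]: "continuous_on S f \<Longrightarrow> continuous_on S (\<lambda>x. kdot k (f x))"
  unfolding kdot_def by (intro continuous_intros)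

lemma continuous_on_ek [continuous_intros]: "continuous_on S f \<Longrightarrow> continuous_on S (\<lambda>x. ek k (f x))"
  unfolding ek_def cis_conv_exp by (intro continuous_intros)

lemma measure_unit_cube: "measure lborel (unit_cube :: (real^'n) set) = 1"
proof -
  have "(0 :: real^'n) \<in> unit_cube" by (simp add: mem_box_cart)
  then have "(unit_cube :: (real^'n) set) \<noteq> {}" by blast
  then show ?thesis by (simp add: content_cbox_cart)
qed

text \<open>The unit cube with its side in direction \<open>i\<close> replaced by the interval from \<open>u\<close> to \<open>w\<close>. Cutting the cube
  into two slabs reduces the invariance of integrals under translations to a periodic shift of one
  slab.\<close>

definition slab :: "'n \<Rightarrow> real \<Rightarrow> real \<Rightarrow> (real^('n::finite)) set" where
  "slab i u w = cbox (u *\<^sub>R axis i 1) (1 + (w - 1) *\<^sub>R axis i 1)"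

lemma mem_slab: "x \<in> slab i u w \<longleftrightarrow> (u \<le> x $ i \<and> x $ i \<le> w) \<and> (\<forall>j. j \<noteq> i \<longrightarrow> 0 \<le> x $ j \<and> x $ j \<le> 1)"
  by (auto simp: slab_def mem_box_cart axis_def split: if_splits)

lemma integral_slab_split:
  fixes h :: "real^'n \<Rightarrow> complex"
  assumes h: "continuous_on UNIV h" and "u \<le> c" "c \<le> w"
  shows "integral (slab i u w) h = integral (slab i u c) h + integral (slab i c w) h"
proof -
  have int: "(h has_integral integral (slab i a b) h) (slab i a b)" for a b
    unfolding slab_def by (intro integrable_integral integrable_continuous continuous_on_subset[OF h]) auto
  have "slab i u w \<inter> {x. x \<bullet> axis i 1 \<le> c} = slab i u c" "slab i u w \<inter> {x. x \<bullet> axis i 1 \<ge> c} = slab i c w"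
    using assms(2,3) by (auto simp: mem_slab inner_axis)
  then have "(h has_integral (integral (slab i u c) h + integral (slab i c w) h)) (slab i u w)"
    using has_integral_split[of h "integral (slab i u c) h" "u *\<^sub>R axis i 1" "1 + (w - 1) *\<^sub>R axis i 1" "axis i 1" c "integral (slab i c w) h"]
      int by (simp add: slab_def)
  then show ?thesis by (rule integral_unique)
qed

lemma integral_shift_periodic:
  fixes h :: "real^'n \<Rightarrow> complex"
  assumes h: "continuous_on UNIV h" and per: "periodic h" and s: "0 \<le> s" "s \<le> 1"
  shows "integral unit_cube (\<lambda>\<theta>. h (\<theta> + s *\<^sub>R axis i 1)) = integral unit_cube h"
proof -
  have shift: "integral (slab i u w) (\<lambda>\<theta>. h (\<theta> + a *\<^sub>R axis i 1)) = integral (slab i (u + a) (w + a)) h" for u w a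
    using integral_shift_cbox[of "(u + a) *\<^sub>R axis i 1" "a *\<^sub>R axis i 1" "1 + (w + a - 1) *\<^sub>R axis i 1" h]
    by (simp add: slab_def algebra_simps)
  have Q: "unit_cube = slab i 0 1" by (simp add: slab_def)
  have "integral (slab i 0 s) h = integral (slab i 0 s) (\<lambda>\<theta>. h (\<theta> + 1 *\<^sub>R axis i 1))"
    using periodicD[OF per, of _ "axis i 1"] by (simp add: rv_axis)
  also have "\<dots> = integral (slab i 1 (1 + s)) h"
    unfolding shift by (simp add: add.commute)
  finally have 1: "integral (slab i 0 s) h = integral (slab i 1 (1 + s)) h" .
  have "integral unit_cube (\<lambda>\<theta>. h (\<theta> + s *\<^sub>R axis i 1)) = integral (slab i s (1 + s)) h"
    unfolding Q shift by simp
  also have "\<dots> = integral (slab i s 1) h + integral (slab i 0 s) h"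
    unfolding 1 using s by (intro integral_slab_split[OF h]) auto
  also have "\<dots> = integral unit_cube h"
    unfolding Q using integral_slab_split[OF h s, of i] by simp
  finally show ?thesis .
qed

lemma has_vector_derivative_shift:
  fixes e :: "'a::real_vector" and h :: "'a \<Rightarrow> 'b::real_normed_vector"
  assumes "\<And>\<theta>. ((\<lambda>s. h (\<theta> + s *\<^sub>R e)) has_vector_derivative h' \<theta>) (at 0)"
  shows "((\<lambda>s. h (\<theta> + s *\<^sub>R e)) has_vector_derivative h' (\<theta> + s *\<^sub>R e)) (at s within U)"
proof -
  have "((\<lambda>\<sigma>. h ((\<theta> + s *\<^sub>R e) + \<sigma> *\<^sub>R e)) has_vector_derivative h' (\<theta> + s *\<^sub>R e)) (at (s - s))"
    using assms[of "\<theta> + s *\<^sub>R e"] by simp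
  moreover have "((\<lambda>\<sigma>. \<sigma> - s) has_vector_derivative 1) (at s)"
    by (auto intro!: derivative_eq_intros)
  ultimately have "((\<lambda>\<sigma>. h ((\<theta> + s *\<^sub>R e) + \<sigma> *\<^sub>R e)) \<circ> (\<lambda>\<sigma>. \<sigma> - s) has_vector_derivative 1 *\<^sub>R h' (\<theta> + s *\<^sub>R e)) (at s)"
    by (intro vector_diff_chain_at)
  moreover have "s *\<^sub>R e + (x - s) *\<^sub>R e = x *\<^sub>R e" for x
    using scaleR_left.add[of s "x - s" e] by simp
  then have "(\<lambda>\<sigma>. h ((\<theta> + s *\<^sub>R e) + \<sigma> *\<^sub>R e)) \<circ> (\<lambda>\<sigma>. \<sigma> - s) = (\<lambda>\<sigma>. h (\<theta> + \<sigma> *\<^sub>R e))"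
    by (simp add: fun_eq_iff o_def add.assoc)
  ultimately show ?thesis by (auto intro: has_vector_derivative_at_within)
qed

text \<open>The integral over a translate of the cube does not depend on the translation, hence its derivative with
  respect to the translation vanishes. This is integration by parts on the torus.\<close>

lemma integral_derivative_periodic:
  fixes h :: "real^'n \<Rightarrow> complex"
  assumes h: "continuous_on UNIV h" and h': "continuous_on UNIV h'" and per: "periodic h"
    and der: "\<And>\<theta>. ((\<lambda>s. h (\<theta> + s *\<^sub>R axis i 1)) has_vector_derivative h' \<theta>) (at 0)"
  shows "integral unit_cube h' = 0"
proof -
  have "((\<lambda>s. integral unit_cube (\<lambda>\<theta>. h (\<theta> + s *\<^sub>R axis i 1))) has_vector_derivative
      integral unit_cube (\<lambda>\<theta>. h' (\<theta> + 0 *\<^sub>R axis i 1))) (at 0 within {0..1})"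
  proof (rule leibniz_rule_vector_derivative)
    show "((\<lambda>s. h (\<theta> + s *\<^sub>R axis i 1)) has_vector_derivative h' (\<theta> + s *\<^sub>R axis i 1)) (at s within {0..1})" for \<theta> s
      by (rule has_vector_derivative_shift[OF der])
    show "(\<lambda>\<theta>. h (\<theta> + s *\<^sub>R axis i 1)) integrable_on unit_cube" for s
      by (intro integrable_continuous continuous_on_compose2[OF h] continuous_intros) auto
    show "continuous_on ({0..1} \<times> unit_cube) (\<lambda>(s, \<theta>). h' (\<theta> + s *\<^sub>R axis i 1))"
      unfolding case_prod_unfold by (intro continuous_on_compose2[OF h'] continuous_intros) auto
  qed auto
  then have "((\<lambda>s. integral unit_cube (\<lambda>\<theta>. h (\<theta> + s *\<^sub>R axis i 1))) has_vector_derivative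
      integral unit_cube h') (at 0 within {0..1})" by simp
  moreover have "((\<lambda>s. integral unit_cube (\<lambda>\<theta>. h (\<theta> + s *\<^sub>R axis i 1))) has_vector_derivative 0) (at 0 within {0..1})"
    by (rule has_vector_derivative_transform[of _ _ _ "\<lambda>_. integral unit_cube h"])
      (auto simp: integral_shift_periodic[OF h per])
  ultimately show ?thesis
    by (rule vector_derivative_unique_within[rotated]) (simp add: trivial_limit_within islimpt_Icc)
qed

definition fc :: "(real^('n::finite) \<Rightarrow> complex) \<Rightarrow> int^'n \<Rightarrow> complex" where
  "fc g k = integral unit_cube (\<lambda>\<theta>. g \<theta> * ek (- k) \<theta>)"

lemma integrable_cube: "continuous_on UNIV (g :: real^'n \<Rightarrow> complex) \<Longrightarrow> g integrable_on unit_cube"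
  by (intro integrable_continuous) (auto intro: continuous_on_subset)

lemma norm_integral_cube_le:
  fixes g :: "real^'n \<Rightarrow> complex"
  assumes "continuous_on UNIV g" "\<And>\<theta>. norm (g \<theta>) \<le> B"
  shows "norm (integral unit_cube g) \<le> B"
proof -
  have "0 \<le> B" using assms(2)[of 0] norm_ge_zero order_trans by blast
  then have "norm (integral unit_cube g) \<le> B * measure lborel (unit_cube :: (real^'n) set)"
    using assms by (intro has_integral_bound[OF _ integrable_integral[OF integrable_cube]]) auto
  then show ?thesis by (simp add: measure_unit_cube)
qed

lemma norm_fc_le:
  assumes "continuous_on UNIV g" "\<And>\<theta>. norm (g \<theta>) \<le> B"
  shows "norm (fc g k) \<le> B"
  unfolding fc_def using assms
  by (intro norm_integral_cube_le continuous_intros) (auto simp: norm_mult)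

lemma ek_zero: "ek 0 \<theta> = 1" by (simp add: ek_def kdot_def)

lemma kdot_minus: "kdot (- k) v = - kdot k v" by (simp add: kdot_def sum_negf)

lemma kdot_scaleR: "kdot k (s *\<^sub>R v) = s * kdot k v"
  by (simp add: kdot_def sum_distrib_left mult_ac)

lemma kdot_axis: "kdot k (axis i 1) = of_int (k $ i)"
  by (simp add: kdot_def axis_def if_distrib cong: if_cong)

lemma ek_derivative:
  "((\<lambda>s. ek k (\<theta> + s *\<^sub>R axis i 1)) has_vector_derivative (2 * pi * \<i> * of_int (k $ i)) * ek k \<theta>) (at 0)"
proof -
  have "((\<lambda>s. exp (\<i> * of_real (2 * pi * kdot k \<theta> + s * (2 * pi * of_int (k $ i))))) has_vector_derivative
     (\<i> * of_real (2 * pi * of_int (k $ i))) * exp (\<i> * of_real (2 * pi * kdot k \<theta> + 0 * (2 * pi * of_int (k $ i))))) (at 0)"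
    by (auto intro!: derivative_eq_intros has_vector_derivative_real_field simp: algebra_simps)
  then show ?thesis
    by (simp add: ek_def cis_conv_exp kdot_add kdot_scaleR kdot_axis distrib_left mult_ac)
qed

lemma fc_derivative:
  assumes g: "continuous_on UNIV g" and g': "continuous_on UNIV g'" and per: "periodic g"
    and der: "\<And>\<theta>. ((\<lambda>s. g (\<theta> + s *\<^sub>R axis i 1)) has_vector_derivative g' \<theta>) (at 0)"
  shows "fc g' k = 2 * pi * \<i> * of_int (k $ i) * fc g k"
proof -
  let ?c = "2 * pi * \<i> * of_int ((- k) $ i) :: complex"
  have "integral unit_cube (\<lambda>\<theta>. g \<theta> * (?c * ek (- k) \<theta>) + g' \<theta> * ek (- k) \<theta>) = 0"
  proof (rule integral_derivative_periodic)
    show "continuous_on UNIV (\<lambda>\<theta>. g \<theta> * ek (- k) \<theta>)"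
      "continuous_on UNIV (\<lambda>\<theta>. g \<theta> * (?c * ek (- k) \<theta>) + g' \<theta> * ek (- k) \<theta>)"
      using g g' by (auto intro!: continuous_intros)
    show "periodic (\<lambda>\<theta>. g \<theta> * ek (- k) \<theta>)"
      using per periodic_ek[of "- k"] by (simp add: periodic_def)
    show "((\<lambda>s. g (\<theta> + s *\<^sub>R axis i 1) * ek (- k) (\<theta> + s *\<^sub>R axis i 1)) has_vector_derivative
        g \<theta> * (?c * ek (- k) \<theta>) + g' \<theta> * ek (- k) \<theta>) (at 0)" for \<theta>
      using has_vector_derivative_mult[OF der[of \<theta>] ek_derivative[of "- k" \<theta> i]] by simp
  qed
  moreover have "integral unit_cube (\<lambda>\<theta>. g \<theta> * (?c * ek (- k) \<theta>) + g' \<theta> * ek (- k) \<theta>) = ?c * fc g k + fc g' k"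
  proof -
    have "integral unit_cube (\<lambda>\<theta>. ?c * (g \<theta> * ek (- k) \<theta>) + g' \<theta> * ek (- k) \<theta>) = ?c * fc g k + fc g' k"
      unfolding fc_def using g g'
      by (subst integral_add) (auto intro!: integrable_cube continuous_intros)
    then show ?thesis by (simp add: mult_ac)
  qed
  ultimately have "fc g' k + ?c * fc g k = 0" by simp
  then show ?thesis by (simp add: algebra_simps)
qed

lemma integral_ek: "integral unit_cube (ek k) = (if k = 0 then 1 else 0)"
proof (cases "k = 0")
  case True
  then show ?thesis by (simp add: ek_zero[abs_def] measure_unit_cube)
next
  case False
  then obtain i where i: "k $ i \<noteq> 0" by (auto simp: vec_eq_iff)
  have "integral unit_cube (\<lambda>\<theta>. (2 * pi * \<i> * of_int (k $ i)) * ek k \<theta>) = 0"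
    by (rule integral_derivative_periodic[OF _ _ periodic_ek ek_derivative]) (auto intro!: continuous_intros)
  then show ?thesis using i False by simp
qed

inductive trig_poly :: "(real^('n::finite) \<Rightarrow> complex) \<Rightarrow> bool" where
  ek: "trig_poly (\<lambda>\<theta>. c * ek k \<theta>)"
| add: "trig_poly p \<Longrightarrow> trig_poly q \<Longrightarrow> trig_poly (\<lambda>\<theta>. p \<theta> + q \<theta>)"

lemma trig_poly_const: "trig_poly (\<lambda>\<theta>. c)"
  using trig_poly.ek[of c 0] by (simp add: ek_zero)

lemma trig_poly_mult:
  assumes "trig_poly p" "trig_poly q"
  shows "trig_poly (\<lambda>\<theta>. p \<theta> * q \<theta>)"
  using assms
proof (induction arbitrary: q)
  case (ek c k)
  from ek show ?case
  proof (induction)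
    case (ek d l)
    show ?case using trig_poly.ek[of "c * d" "k + l"] by (simp add: ek_add mult_ac)
  next
    case (add p q)
    show ?case unfolding distrib_left using add.IH by (rule trig_poly.add)
  qed
next
  case (add p p')
  show ?case unfolding distrib_right using add.IH[OF add.prems] by (rule trig_poly.add)
qed

lemma trig_poly_scale: "trig_poly p \<Longrightarrow> trig_poly (\<lambda>\<theta>. c * p \<theta>)"
  by (intro trig_poly_mult trig_poly_const)

lemma trig_poly_sum: "(\<And>x. x \<in> S \<Longrightarrow> trig_poly (f x)) \<Longrightarrow> trig_poly (\<lambda>\<theta>. \<Sum>x\<in>S. f x \<theta>)"
  by (induction S rule: infinite_finite_induct) (simp_all add: trig_poly_const trig_poly.add)

lemma trig_poly_continuous: "trig_poly p \<Longrightarrow> continuous_on S p"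
  by (induction rule: trig_poly.induct) (intro continuous_intros; simp)+

lemma trig_poly_cos_sin:
  "trig_poly (\<lambda>\<theta>. of_real (cos (2 * pi * \<theta> $ i)))" "trig_poly (\<lambda>\<theta>. of_real (sin (2 * pi * \<theta> $ i)))"
proof -
  let ?e = "axis i 1 :: int^'a"
  have k: "kdot ?e \<theta> = \<theta> $ i" "kdot (- ?e) \<theta> = - \<theta> $ i" for \<theta>
    by (simp_all add: kdot_minus) (simp_all add: kdot_def axis_def if_distrib if_distribR cong: if_cong)
  have "complex_of_real (cos (2 * pi * \<theta> $ i)) = 1 / 2 * ek ?e \<theta> + 1 / 2 * ek (- ?e) \<theta>"
    "complex_of_real (sin (2 * pi * \<theta> $ i)) = - \<i> / 2 * ek ?e \<theta> + \<i> / 2 * ek (- ?e) \<theta>" for \<theta>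
    by (auto simp: ek_def k complex_eq_iff)
  then show "trig_poly (\<lambda>\<theta>. of_real (cos (2 * pi * \<theta> $ i)))" "trig_poly (\<lambda>\<theta>. of_real (sin (2 * pi * \<theta> $ i)))"
    by (simp_all only:) (intro trig_poly.intros)+
qed

text \<open>The embedding of the torus in a complex space, used to transfer the Stone-Weierstrass theorem from a
  compact subset of a Euclidean space to periodic functions.\<close>

definition to_torus :: "real^('n::finite) \<Rightarrow> complex^'n" where
  "to_torus \<theta> = (\<chi> i. cis (2 * pi * \<theta> $ i))"

lemma continuous_to_torus: "continuous_on S to_torus"
  unfolding to_torus_def cis_conv_exp by (intro continuous_intros)

lemma to_torus_eq: "to_torus \<theta> = to_torus \<theta>' \<Longrightarrow> \<exists>k. \<theta>' = \<theta> + rv k"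
proof -
  assume eq: "to_torus \<theta> = to_torus \<theta>'"
  have "\<exists>m :: int. \<theta>' $ i = \<theta> $ i + m" for i
  proof -
    have "cis (2 * pi * \<theta> $ i) = cis (2 * pi * \<theta>' $ i)"
      using eq by (simp add: to_torus_def vec_eq_iff)
    then have "exp (\<i> * of_real (2 * pi * \<theta>' $ i)) = exp (\<i> * of_real (2 * pi * \<theta> $ i))"
      by (simp add: cis_conv_exp)
    then obtain m :: int where "\<i> * of_real (2 * pi * \<theta>' $ i) = \<i> * of_real (2 * pi * \<theta> $ i) + complex_of_real (real_of_int (2 * m) * pi) * \<i>"
      unfolding exp_eq by blast
    then have "2 * pi * \<theta>' $ i = 2 * pi * \<theta> $ i + 2 * m * pi"
      by (auto simp: complex_eq_iff)
    then have "2 * pi * (\<theta>' $ i) = 2 * pi * (\<theta> $ i + m)" by (simp add: algebra_simps)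
    then show ?thesis by (intro exI[of _ m]) simp
  qed
  then obtain m where "\<And>i. \<theta>' $ i = \<theta> $ i + of_int (m i)" by metis
  then have "\<theta>' = \<theta> + rv (\<chi> i. m i)" by (simp add: vec_eq_iff rv_def)
  then show ?thesis by blast
qed

lemma trig_poly_of_polynomial:
  assumes "real_polynomial_function (f :: complex^'n \<Rightarrow> real)"
  shows "trig_poly (\<lambda>\<theta>. of_real (f (to_torus \<theta>)))"
  using assms
proof induction
  case (linear f)
  then interpret bounded_linear f .
  have "to_torus \<theta> = (\<Sum>i\<in>UNIV. cos (2 * pi * \<theta> $ i) *\<^sub>R axis i 1 + sin (2 * pi * \<theta> $ i) *\<^sub>R axis i \<i>)" for \<theta> :: "real^'n"
    by (simp add: to_torus_def vec_eq_iff axis_def if_distrib complex_eq_iff cong: if_cong)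
  then have "complex_of_real (f (to_torus \<theta>)) = (\<Sum>i\<in>UNIV. of_real (f (axis i 1)) * of_real (cos (2 * pi * \<theta> $ i))
      + of_real (f (axis i \<i>)) * of_real (sin (2 * pi * \<theta> $ i)))" for \<theta>
    by (simp add: sum add scaleR mult.commute)
  then show ?case
    by (simp only:) (intro trig_poly_sum trig_poly.add trig_poly_scale trig_poly_cos_sin)
next
  case (const c)
  show ?case by (rule trig_poly_const)
next
  case (add f g)
  then show ?case by (simp add: trig_poly.add)
next
  case (mult f g)
  then show ?case by (simp add: trig_poly_mult)
qed

text \<open>A periodic function is a continuous function on the compact image of the torus, where polynomials are
  dense; a polynomial in the coordinates of \<open>to_torus \<theta>\<close> is a trigonometric polynomial.\<close>

lemma trig_poly_approx:
  fixes w :: "real^'n \<Rightarrow> real"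
  assumes w: "continuous_on UNIV w" and per: "periodic w" and e: "e > 0"
  obtains p where "trig_poly (\<lambda>\<theta>. of_real (p \<theta>))" "\<And>\<theta>. \<bar>w \<theta> - p \<theta>\<bar> < e"
proof -
  define W where "W = (\<lambda>z. w (SOME \<theta>. to_torus \<theta> = z))"
  have W: "W (to_torus \<theta>) = w \<theta>" for \<theta>
  proof -
    have "to_torus (SOME \<theta>'. to_torus \<theta>' = to_torus \<theta>) = to_torus \<theta>"
      by (rule someI[of _ \<theta>]) simp
    from to_torus_eq[OF this] obtain k where "\<theta> = (SOME \<theta>'. to_torus \<theta>' = to_torus \<theta>) + rv k" by blast
    then show ?thesis unfolding W_def using periodicD[OF per] by metis
  qed
  let ?S = "to_torus ` (unit_cube :: (real^'n) set)"
  have S: "compact ?S" by (intro compact_continuous_image continuous_to_torus compact_cbox)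
  have "continuous_on ?S W"
    unfolding continuous_on_closed_vimage[OF compact_imp_closed[OF S]]
  proof (intro allI impI)
    fix B :: "real set" assume "closed B"
    then have "closed (w -` B)" using w by (simp add: continuous_closed_vimage continuous_on_eq_continuous_at)
    then have "compact (unit_cube \<inter> w -` B)" by (intro compact_Int_closed compact_cbox)
    then have "compact (to_torus ` (unit_cube \<inter> w -` B))"
      by (intro compact_continuous_image continuous_to_torus)
    moreover have "W -` B \<inter> ?S = to_torus ` (unit_cube \<inter> w -` B)"
      by (auto simp: W)
    ultimately show "closed (W -` B \<inter> ?S)" by (simp add: compact_imp_closed)
  qed
  from Stone_Weierstrass_real_polynomial_function[OF S this e]
  obtain f where f: "real_polynomial_function f" "\<And>z. z \<in> ?S \<Longrightarrow> \<bar>W z - f z\<bar> < e" by blast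
  show ?thesis
  proof (rule that[of "\<lambda>\<theta>. f (to_torus \<theta>)"])
    show "trig_poly (\<lambda>\<theta>. of_real (f (to_torus \<theta>)))" by (rule trig_poly_of_polynomial[OF f(1)])
    fix \<theta> :: "real^'n"
    obtain k where k: "\<theta> - rv k \<in> unit_cube" using rv_floor_in_cube by blast
    have "to_torus (\<theta> - rv k) = to_torus \<theta>"
    proof -
      have "cis (2 * pi * (\<theta> $ i - of_int (k $ i))) = cis (2 * pi * \<theta> $ i)" for i
        using cis_multiple_2pi[of "of_int (k $ i)"] by (simp add: right_diff_distrib flip: cis_divide)
      then show ?thesis by (simp add: to_torus_def rv_def vec_eq_iff)
    qed
    then have "to_torus \<theta> \<in> ?S" using k by (metis imageI)
    from f(2)[OF this] show "\<bar>w \<theta> - f (to_torus \<theta>)\<bar> < e" by (simp add: W)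
  qed
qed

text \<open>Approximate \<open>w\<close> by trigonometric polynomials \<open>p\<close>: the integral of \<open>w\<^sup>2 = w (w - p) + w p\<close> is arbitrarily small.\<close>

lemma orthogonal_trig_poly_imp_zero:
  fixes w :: "real^'n \<Rightarrow> real"
  assumes w: "continuous_on UNIV w" and per: "periodic w"
    and orth: "\<And>p. trig_poly (\<lambda>\<theta>. of_real (p \<theta>)) \<Longrightarrow> integral unit_cube (\<lambda>\<theta>. w \<theta> * p \<theta>) = 0"
  shows "w \<theta> = 0"
proof -
  have cw: "continuous_on unit_cube w" using w by (rule continuous_on_subset) auto
  have "bounded (w ` unit_cube)" by (intro compact_imp_bounded compact_continuous_image cw compact_cbox)
  then obtain B where B: "B > 0" "\<And>\<theta>. \<theta> \<in> unit_cube \<Longrightarrow> \<bar>w \<theta>\<bar> \<le> B"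
    unfolding bounded_pos by auto
  have ww: "(\<lambda>\<theta>. w \<theta> * w \<theta>) integrable_on unit_cube"
    by (intro integrable_continuous continuous_intros cw)
  have "\<bar>integral unit_cube (\<lambda>\<theta>. w \<theta> * w \<theta>)\<bar> \<le> e" if "e > 0" for e
  proof -
    obtain p where p: "trig_poly (\<lambda>\<theta>. of_real (p \<theta>))" "\<And>\<theta>. \<bar>w \<theta> - p \<theta>\<bar> < e / B"
      using trig_poly_approx[OF w per, of "e / B"] \<open>e > 0\<close> B by auto
    have "continuous_on unit_cube (\<lambda>\<theta>. Re (complex_of_real (p \<theta>)))"
      by (intro continuous_intros trig_poly_continuous p)
    then have wp: "(\<lambda>\<theta>. w \<theta> * p \<theta>) integrable_on unit_cube"
      by (intro integrable_continuous continuous_intros cw) simp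
    have "integral unit_cube (\<lambda>\<theta>. w \<theta> * w \<theta>) = integral unit_cube (\<lambda>\<theta>. w \<theta> * w \<theta> - w \<theta> * p \<theta>)"
      using orth[OF p(1)] ww wp by (simp add: integral_diff)
    also have "\<bar>\<dots>\<bar> \<le> e * measure lborel (unit_cube :: (real^'n) set)"
      unfolding real_norm_def[symmetric]
    proof (rule has_integral_bound[OF _ integrable_integral[OF integrable_diff[OF ww wp]]])
      fix \<theta> :: "real^'n" assume "\<theta> \<in> unit_cube"
      have "norm (w \<theta> * w \<theta> - w \<theta> * p \<theta>) = \<bar>w \<theta>\<bar> * \<bar>w \<theta> - p \<theta>\<bar>"
        by (simp add: abs_mult[symmetric] right_diff_distrib)
      also have "\<dots> \<le> B * (e / B)"
        using B(2)[OF \<open>\<theta> \<in> unit_cube\<close>] p(2)[of \<theta>] B(1) by (intro mult_mono) auto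
      finally show "norm (w \<theta> * w \<theta> - w \<theta> * p \<theta>) \<le> e" using B by simp
    qed (use \<open>e > 0\<close> in auto)
    finally show ?thesis by (simp add: measure_unit_cube)
  qed
  then have "integral unit_cube (\<lambda>\<theta>. w \<theta> * w \<theta>) = 0"
    using dense_ge[of 0 "\<bar>integral unit_cube (\<lambda>\<theta>. w \<theta> * w \<theta>)\<bar>"] by simp
  then have int0: "((\<lambda>\<theta>. w \<theta> * w \<theta>) has_integral 0) unit_cube"
    using ww by (metis integrable_integral)
  obtain k where k: "\<theta> - rv k \<in> unit_cube" using rv_floor_in_cube by blast
  have "(\<chi> i. 1 / 2) \<in> box (0 :: real^'n) 1" by (simp add: mem_box_cart)
  then have "box (0 :: real^'n) 1 \<noteq> {}" by blast
  then have "w (\<theta> - rv k) * w (\<theta> - rv k) = 0"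
    by (intro has_integral_0_cbox_imp_0[OF _ _ int0 _ k] continuous_intros cw) auto
  then show ?thesis using periodicD[OF per, of "\<theta> - rv k" k] by simp
qed

theorem fc_zero_imp_zero:
  assumes g: "continuous_on UNIV g" and per: "periodic g" and fc: "\<And>k. fc g k = 0"
  shows "g \<theta> = 0"
proof -
  have int: "integral unit_cube (\<lambda>\<theta>. g \<theta> * p \<theta>) = 0" if "trig_poly p" for p
    using that
  proof induction
    case (ek c k)
    have "integral unit_cube (\<lambda>\<theta>. c * (g \<theta> * ek k \<theta>)) = 0"
      using fc[of "- k"] by (simp add: fc_def)
    then show ?case by (simp add: mult.left_commute)
  next
    case (add p q)
    then show ?case unfolding distrib_left
      by (subst integral_add) (simp_all add: integrable_cube continuous_on_mult g trig_poly_continuous)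
  qed
  have part: "integral unit_cube (\<lambda>\<theta>. T (g \<theta>) * p \<theta>) = 0"
    if T: "bounded_linear T" "\<And>z r. T (z * of_real r) = T z * r" and p: "trig_poly (\<lambda>\<theta>. of_real (p \<theta>))" for T :: "complex \<Rightarrow> real" and p
  proof -
    have "(\<lambda>\<theta>. g \<theta> * of_real (p \<theta>)) integrable_on unit_cube"
      by (intro integrable_cube continuous_intros g trig_poly_continuous p)
    then have "integral unit_cube (T \<circ> (\<lambda>\<theta>. g \<theta> * of_real (p \<theta>))) = T 0"
      using integral_linear[OF _ T(1)] int[OF p] by metis
    then show ?thesis using T linear_0[OF bounded_linear.linear[OF T(1)]] by (simp add: o_def)
  qed
  have "Re (g \<theta>) = 0"
    by (rule orthogonal_trig_poly_imp_zero[OF _ _ part])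
      (use per in \<open>auto intro!: continuous_intros g bounded_linear_Re simp: periodic_def\<close>)
  moreover have "Im (g \<theta>) = 0"
    by (rule orthogonal_trig_poly_imp_zero[OF _ _ part])
      (use per in \<open>auto intro!: continuous_intros g bounded_linear_Im simp: periodic_def\<close>)
  ultimately show ?thesis by (simp add: complex_eq_iff)
qed

text \<open>The series converges uniformly to a continuous function with the same Fourier coefficients, and a continuous
  periodic function is determined by them.\<close>

theorem fourier_inversion:
  assumes g: "continuous_on UNIV g" and per: "periodic g"
    and b: "\<And>k. norm (fc g k) \<le> b k" "b summable_on UNIV"
  shows "((\<lambda>k. fc g k * ek k \<theta>) has_sum g \<theta>) UNIV"
proof -
  define s where "s \<theta> = (\<Sum>\<^sub>\<infinity>k. fc g k * ek k \<theta>)" for \<theta>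
  have lim: "uniform_limit UNIV (\<lambda>F \<theta>. \<Sum>k\<in>F. fc g k * ek k \<theta>) s (finite_subsets_at_top UNIV)"
    unfolding s_def by (rule Weierstrass_m_test_general[OF _ b(2)]) (use b(1) in \<open>auto simp: norm_mult\<close>)
  have s: "continuous_on UNIV s"
    by (rule uniform_limit_theorem[OF _ lim]) (auto intro!: always_eventually continuous_intros)
  have s_per: "periodic s"
    unfolding s_def periodic_def by (intro allI infsum_cong) (simp add: periodicD[OF periodic_ek])
  have s_fc: "fc s k = fc g k" for k
  proof -
    have lim': "uniform_limit unit_cube (\<lambda>F \<theta>. (\<Sum>l\<in>F. fc g l * ek l \<theta>) * ek (- k) \<theta>) (\<lambda>\<theta>. s \<theta> * ek (- k) \<theta>) (finite_subsets_at_top UNIV)"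
      unfolding uniform_limit_iff
    proof (intro allI impI)
      fix e :: real assume "e > 0"
      then have "\<forall>\<^sub>F F in finite_subsets_at_top UNIV. \<forall>\<theta>\<in>UNIV. dist (\<Sum>k\<in>F. fc g k * ek k \<theta>) (s \<theta>) < e"
        using lim unfolding uniform_limit_iff by blast
      then show "\<forall>\<^sub>F F in finite_subsets_at_top UNIV. \<forall>\<theta>\<in>unit_cube. dist ((\<Sum>l\<in>F. fc g l * ek l \<theta>) * ek (- k) \<theta>) (s \<theta> * ek (- k) \<theta>) < e"
        by (rule eventually_mono) (auto simp: dist_norm norm_mult simp flip: left_diff_distrib)
    qed
    obtain I J where IJ: "\<And>F. ((\<lambda>\<theta>. (\<Sum>l\<in>F. fc g l * ek l \<theta>) * ek (- k) \<theta>) has_integral I F) unit_cube"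
      "((\<lambda>\<theta>. s \<theta> * ek (- k) \<theta>) has_integral J) unit_cube" "(I \<longlongrightarrow> J) (finite_subsets_at_top UNIV)"
      by (rule uniform_limit_integral_cbox[OF lim']) (auto intro!: continuous_intros)
    have "I F = fc g k" if F: "finite F" "{k} \<subseteq> F" for F
    proof -
      have "I F = integral unit_cube (\<lambda>\<theta>. \<Sum>l\<in>F. fc g l * ek (l - k) \<theta>)"
        using integral_unique[OF IJ(1)[of F]] by (simp add: sum_distrib_right mult.assoc flip: ek_add)
      also have "\<dots> = (\<Sum>l\<in>F. fc g l * integral unit_cube (ek (l - k)))"
        using F by (subst integral_sum) (auto intro!: integrable_cube continuous_intros)
      also have "\<dots> = fc g k"
        using F by (simp add: integral_ek if_distrib cong: if_cong)
      finally show ?thesis .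
    qed
    then have "\<forall>\<^sub>F F in finite_subsets_at_top UNIV. I F = fc g k"
      unfolding eventually_finite_subsets_at_top by (intro exI[of _ "{k}"]) auto
    then have "(I \<longlongrightarrow> fc g k) (finite_subsets_at_top UNIV)" by (rule tendsto_eventually)
    then have "J = fc g k" using IJ(3) by (metis finite_subsets_at_top_neq_bot tendsto_unique)
    then show ?thesis unfolding fc_def[of s] using integral_unique[OF IJ(2)] by simp
  qed
  have "g \<theta> - s \<theta> = 0"
  proof (rule fc_zero_imp_zero[of "\<lambda>\<theta>. g \<theta> - s \<theta>"])
    show "periodic (\<lambda>\<theta>. g \<theta> - s \<theta>)" using per s_per by (simp add: periodic_def)
    fix k
    have "fc (\<lambda>\<theta>. g \<theta> - s \<theta>) k = fc g k - fc s k"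
      unfolding fc_def left_diff_distrib using g s
      by (intro integral_diff integrable_cube continuous_intros) auto
    then show "fc (\<lambda>\<theta>. g \<theta> - s \<theta>) k = 0" by (simp add: s_fc)
  qed (intro continuous_intros g s)
  moreover have "(\<lambda>k. fc g k * ek k \<theta>) summable_on UNIV"
  proof (rule abs_summable_summable)
    show "(\<lambda>k. norm (fc g k * ek k \<theta>)) summable_on UNIV"
      by (rule summable_on_comparison_test[OF b(2)]) (use b(1) in \<open>auto simp: norm_mult\<close>)
  qed
  ultimately show ?thesis unfolding s_def by (simp add: has_sum_infsum)
qed

lemma fourier_truncation:
  assumes g: "continuous_on UNIV g" and per: "periodic g"
    and b: "\<And>k. norm (fc g k) \<le> b k" "b summable_on UNIV" and F: "finite F"
    and tail: "\<And>F'. finite F' \<Longrightarrow> F' \<inter> F = {} \<Longrightarrow> sum b F' \<le> E"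
  shows "norm (g \<theta> - (\<Sum>k\<in>F. fc g k * ek k \<theta>)) \<le> E"
proof (rule tendsto_upperbound)
  have "((\<lambda>X. \<Sum>k\<in>X. fc g k * ek k \<theta>) \<longlongrightarrow> g \<theta>) (finite_subsets_at_top UNIV)"
    using fourier_inversion[OF g per b] by (simp add: has_sum_def)
  then show "((\<lambda>X. norm ((\<Sum>k\<in>X. fc g k * ek k \<theta>) - (\<Sum>k\<in>F. fc g k * ek k \<theta>))) \<longlongrightarrow> norm (g \<theta> - (\<Sum>k\<in>F. fc g k * ek k \<theta>))) (finite_subsets_at_top UNIV)"
    by (intro tendsto_intros)
  show "\<forall>\<^sub>F X in finite_subsets_at_top UNIV. norm ((\<Sum>k\<in>X. fc g k * ek k \<theta>) - (\<Sum>k\<in>F. fc g k * ek k \<theta>)) \<le> E"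
    unfolding eventually_finite_subsets_at_top
  proof (intro exI[of _ F] conjI allI impI)
    fix X assume X: "finite X \<and> F \<subseteq> X \<and> X \<subseteq> UNIV"
    then have "(\<Sum>k\<in>X. fc g k * ek k \<theta>) - (\<Sum>k\<in>F. fc g k * ek k \<theta>) = (\<Sum>k\<in>X - F. fc g k * ek k \<theta>)"
      by (simp add: sum_diff)
    also have "norm \<dots> \<le> sum b (X - F)"
      using b(1) by (intro sum_norm_le) (simp add: norm_mult)
    also have "\<dots> \<le> E" using X by (intro tail) auto
    finally show "norm ((\<Sum>k\<in>X. fc g k * ek k \<theta>) - (\<Sum>k\<in>F. fc g k * ek k \<theta>)) \<le> E" .
  qed (use F in auto)
qed (rule finite_subsets_at_top_neq_bot)

section \<open>Decay of Fourier coefficients and lattice sums\<close>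

lemma fc_iterated_derivative:
  assumes "\<And>p. continuous_on UNIV (G p)" "\<And>p. periodic (G p)"
    and "\<And>p \<theta>. ((\<lambda>s. G p (\<theta> + s *\<^sub>R axis i 1)) has_vector_derivative G (Suc p) \<theta>) (at 0)"
  shows "fc (G p) k = (2 * pi * \<i> * of_int (k $ i)) ^ p * fc (G 0) k"
proof (induction p)
  case (Suc p)
  then show ?case using fc_derivative[of "G p" "G (Suc p)" i k] assms by simp
qed simp

lemma fact_le_power_self: "(fact p :: real) \<le> real p ^ p"
  using fact_le_power[of p, where 'a=real] by simp

text \<open>The best choice of the number \<open>p\<close> of integrations by parts is about \<open>x powr (1 / \<alpha>) / e\<close>.\<close>

lemma exists_gevrey_order:
  fixes x \<alpha> :: real
  assumes "x \<ge> 0" "\<alpha> \<ge> 1"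
  obtains p where "fact p powr \<alpha> \<le> x ^ p * (exp \<alpha> * exp (- (\<alpha> / exp 1) * x powr (1 / \<alpha>)))"
proof -
  define y where "y = x powr (1 / \<alpha>)"
  have y: "y \<ge> 0" by (simp add: y_def)
  define p where "p = nat \<lfloor>y / exp 1\<rfloor>"
  have p: "real p \<le> y / exp 1" "y / exp 1 < real p + 1"
    using y by (auto simp: p_def)
  have "fact p powr \<alpha> \<le> (y ^ p * exp (- real p)) powr \<alpha>"
  proof (rule powr_mono2)
    have "(fact p :: real) \<le> real p ^ p" by (rule fact_le_power_self)
    also have "\<dots> \<le> (y / exp 1) ^ p" using p by (intro power_mono) auto
    also have "\<dots> = y ^ p * exp (- real p)"
      unfolding power_divide using exp_of_nat_mult[of p "1 :: real"] by (simp add: exp_minus divide_inverse)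
    finally show "fact p \<le> y ^ p * exp (- real p)" .
  qed (use assms in auto)
  also have "\<dots> = (y ^ p) powr \<alpha> * exp (- \<alpha> * real p)"
    by (simp add: powr_mult exp_powr_real mult.commute)
  also have "(y ^ p) powr \<alpha> = x ^ p"
  proof (cases "x = 0")
    case True
    then show ?thesis by (cases p) (auto simp: y_def)
  next
    case False
    then have "(y ^ p) powr \<alpha> = (y powr \<alpha>) ^ p"
      using assms by (simp add: y_def powr_powr flip: powr_realpow)
    then show ?thesis using assms False by (simp add: y_def powr_powr)
  qed
  also have "exp (- \<alpha> * real p) \<le> exp (\<alpha> + - (\<alpha> / exp 1) * y)"
  proof -
    have "\<alpha> * (y / exp 1) \<le> \<alpha> * (real p + 1)" using p assms by (intro mult_left_mono) auto
    then show ?thesis by (simp add: algebra_simps)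
  qed
  finally have "fact p powr \<alpha> \<le> x ^ p * exp (\<alpha> + - (\<alpha> / exp 1) * y)"
    using assms by (simp add: mult_left_mono)
  then show ?thesis by (intro that[of p]) (simp only: exp_add y_def)
qed

lemma sum_prod_vec_le:
  fixes h :: "'a \<Rightarrow> real"
  assumes h: "\<And>x. h x \<ge> 0" and C: "\<And>T. finite T \<Longrightarrow> sum h T \<le> C" and F: "finite (F :: ('a^'n) set)"
  shows "(\<Sum>x\<in>F. \<Prod>i\<in>UNIV. h (x $ i)) \<le> C ^ CARD('n)"
proof -
  define T where "T = (\<Union>x\<in>F. range (($) x))"
  have T: "finite T" unfolding T_def using F by auto
  have "(\<Sum>x\<in>F. \<Prod>i\<in>UNIV. h (x $ i)) = (\<Sum>g\<in>($) ` F. \<Prod>i\<in>UNIV. h (g i))"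
    by (subst sum.reindex) (auto simp: inj_on_def vec_nth_inject)
  also have "\<dots> \<le> (\<Sum>g\<in>PiE (UNIV :: 'n set) (\<lambda>_. T). \<Prod>i\<in>UNIV. h (g i))"
    using T by (intro sum_mono2 finite_PiE) (auto simp: T_def intro!: prod_nonneg h)
  also have "\<dots> = (\<Prod>i\<in>(UNIV :: 'n set). \<Sum>t\<in>T. h t)"
    using T by (subst prod_sum_PiE) auto
  also have "\<dots> \<le> (\<Prod>i\<in>(UNIV :: 'n set). C)"
    using C[OF T] h by (intro prod_mono) (auto intro: sum_nonneg)
  finally show ?thesis by simp
qed

lemma sum_half_powers_le: "finite F \<Longrightarrow> (\<Sum>l\<in>F. (1 / 2) ^ lsum l) \<le> (2 :: real) ^ CARD('n)" for F :: "(nat^'n) set"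
proof -
  assume F: "finite F"
  have "(\<Sum>l\<in>F. \<Prod>i\<in>UNIV. (1 / 2) ^ (l $ i)) \<le> (2 :: real) ^ CARD('n)"
  proof (rule sum_prod_vec_le[OF _ _ F])
    fix T :: "nat set" assume "finite T"
    then have "(\<Sum>t\<in>T. (1 / 2 :: real) ^ t) \<le> suminf (\<lambda>t. (1 / 2 :: real) ^ t)"
      by (intro sum_le_suminf summable_geometric) auto
    then show "(\<Sum>t\<in>T. (1 / 2 :: real) ^ t) \<le> 2" by (simp add: suminf_geometric)
  qed auto
  then show ?thesis by (simp add: lsum_def power_sum)
qed

lemma sum_int_le: "finite T \<Longrightarrow> (\<Sum>j\<in>T. 1 / (1 + \<bar>real_of_int j\<bar>)\<^sup>2) \<le> 5"
proof -
  assume T: "finite T"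
  define M where "M = nat (Max (insert 0 (abs ` T)))"
  have TM: "T \<subseteq> (\<lambda>j. int j) ` {..M} \<union> (\<lambda>j. - int (Suc j)) ` {..<M}"
  proof
    fix j assume j: "j \<in> T"
    then have "\<bar>j\<bar> \<le> Max (insert 0 (abs ` T))" using T by (intro Max_ge) auto
    then have M: "nat \<bar>j\<bar> \<le> M" unfolding M_def by linarith
    show "j \<in> (\<lambda>j. int j) ` {..M} \<union> (\<lambda>j. - int (Suc j)) ` {..<M}"
    proof (cases "j \<ge> 0")
      case True
      then show ?thesis using M by (auto intro!: image_eqI[of _ _ "nat j"])
    next
      case False
      then show ?thesis using M by (auto intro!: image_eqI[of _ _ "nat (- j - 1)"])
    qed
  qed
  have "(\<Sum>j\<in>T. 1 / (1 + \<bar>real_of_int j\<bar>)\<^sup>2) \<le> (\<Sum>j\<in>(\<lambda>j. int j) ` {..M} \<union> (\<lambda>j. - int (Suc j)) ` {..<M}. 1 / (1 + \<bar>real_of_int j\<bar>)\<^sup>2)"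
    using TM by (intro sum_mono2) auto
  also have "\<dots> \<le> (\<Sum>j\<in>(\<lambda>j. int j) ` {..M}. 1 / (1 + \<bar>real_of_int j\<bar>)\<^sup>2) + (\<Sum>j\<in>(\<lambda>j. - int (Suc j)) ` {..<M}. 1 / (1 + \<bar>real_of_int j\<bar>)\<^sup>2)"
    by (subst sum_Un) (auto intro!: sum_nonneg)
  also have "(\<Sum>j\<in>(\<lambda>j. int j) ` {..M}. 1 / (1 + \<bar>real_of_int j\<bar>)\<^sup>2) = (\<Sum>j<Suc M. 1 / (real (Suc j))\<^sup>2)"
    by (subst sum.reindex) (auto simp: inj_on_def lessThan_Suc_atMost)
  also have "(\<Sum>j\<in>(\<lambda>j. - int (Suc j)) ` {..<M}. 1 / (1 + \<bar>real_of_int j\<bar>)\<^sup>2) \<le> (\<Sum>j<M. 1 / (real (Suc j))\<^sup>2)"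
    by (subst sum.reindex) (auto simp: inj_on_def intro!: sum_mono divide_left_mono power_mono)
  finally show ?thesis using sum_inverse_squares_le[of "Suc M"] sum_inverse_squares_le[of M] by linarith
qed

text \<open>The exponential is bounded by a negative power of \<open>1 + |k|\<close> of order \<open>2n\<close>, hence by the product of \<open>(1 + |k $ i|) powr (- 2)\<close>;
  each of the \<open>n\<close> one-dimensional sums is at most 5.\<close>

definition lattice_const :: "real \<Rightarrow> real \<Rightarrow> nat \<Rightarrow> real" where
  "lattice_const \<alpha> c n = 2 ^ (2 * n) * (1 + ((\<alpha> / (c / real (2 * n))) powr \<alpha>) ^ (2 * n)) * 5 ^ n"

lemma lattice_const_pos: "lattice_const \<alpha> c n > 0"
  by (simp add: lattice_const_def add_pos_nonneg)

lemma sum_exp_kn_le: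
  assumes \<alpha>: "\<alpha> > 0" and c: "c > 0" and F: "finite (F :: (int^'n) set)"
  shows "(\<Sum>k\<in>F. exp (- c * kn k powr (1 / \<alpha>))) \<le> lattice_const \<alpha> c CARD('n)"
proof -
  define m where "m = 2 * CARD('n)"
  have m: "m > 0" by (simp add: m_def)
  define D where "D = 1 + ((\<alpha> / (c / m)) powr \<alpha>) ^ m"
  have "exp (- c * kn k powr (1 / \<alpha>)) \<le> 2 ^ m * D * (\<Prod>i\<in>UNIV. 1 / (1 + \<bar>real_of_int (k $ i)\<bar>)\<^sup>2)" for k :: "int^'n"
  proof -
    define y where "y = kn k"
    have y: "y \<ge> 0" by (simp add: y_def)
    define E where "E = exp (c * y powr (1 / \<alpha>))"
    have E: "E \<ge> 1" using c by (simp add: E_def)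
    have "y ^ m \<le> ((\<alpha> / (c / m)) powr \<alpha> * exp (c / m * y powr (1 / \<alpha>))) ^ m"
      using \<alpha> c m y by (intro power_mono le_powr_mult_exp) auto
    also have "\<dots> = ((\<alpha> / (c / m)) powr \<alpha>) ^ m * E"
      using m by (simp add: power_mult_distrib E_def flip: exp_of_nat_mult)
    finally have ym: "1 + y ^ m \<le> D * E" using E by (simp add: D_def algebra_simps)
    have "(1 + y) ^ m \<le> (2 * max 1 y) ^ m" using y by (intro power_mono) auto
    also have "\<dots> = 2 ^ m * max 1 y ^ m" by (simp add: power_mult_distrib)
    also have "max 1 y ^ m \<le> 1 + y ^ m" using y by (auto simp: max_def)
    finally have y1: "(1 + y) ^ m \<le> 2 ^ m * (D * E)" using ym by (smt (verit) mult_left_mono zero_le_power)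
    have "(\<Prod>i\<in>UNIV. (1 + \<bar>real_of_int (k $ i)\<bar>)\<^sup>2) \<le> (\<Prod>i\<in>(UNIV :: 'n set). (1 + y)\<^sup>2)"
      using nth_le_kn[of k] by (intro prod_mono conjI power_mono) (auto simp: y_def)
    also have "\<dots> = (1 + y) ^ m" by (simp add: m_def power_mult)
    finally have "(\<Prod>i\<in>UNIV. (1 + \<bar>real_of_int (k $ i)\<bar>)\<^sup>2) \<le> 2 ^ m * (D * E)" using y1 by linarith
    moreover have "(\<Prod>i\<in>UNIV. (1 + \<bar>real_of_int (k $ i)\<bar>)\<^sup>2) > 0"
      by (intro prod_pos) auto
    ultimately have "1 / E \<le> 2 ^ m * D / (\<Prod>i\<in>UNIV. (1 + \<bar>real_of_int (k $ i)\<bar>)\<^sup>2)"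
      using E by (simp add: field_simps)
    moreover have "(\<Prod>i\<in>UNIV. 1 / (1 + \<bar>real_of_int (k $ i)\<bar>)\<^sup>2) = 1 / (\<Prod>i\<in>UNIV. (1 + \<bar>real_of_int (k $ i)\<bar>)\<^sup>2)"
      by (simp add: prod_dividef)
    ultimately show ?thesis by (simp add: E_def y_def exp_minus divide_inverse)
  qed
  then have "(\<Sum>k\<in>F. exp (- c * kn k powr (1 / \<alpha>))) \<le> (\<Sum>k\<in>F. 2 ^ m * D * (\<Prod>i\<in>UNIV. 1 / (1 + \<bar>real_of_int (k $ i)\<bar>)\<^sup>2))"
    by (intro sum_mono)
  also have "\<dots> = 2 ^ m * D * (\<Sum>k\<in>F. \<Prod>i\<in>UNIV. 1 / (1 + \<bar>real_of_int (k $ i)\<bar>)\<^sup>2)"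
    by (simp add: sum_distrib_left)
  also have "\<dots> \<le> 2 ^ m * D * 5 ^ CARD('n)"
  proof (intro mult_left_mono)
    show "(\<Sum>k\<in>F. \<Prod>i\<in>UNIV. 1 / (1 + \<bar>real_of_int (k $ i)\<bar>)\<^sup>2) \<le> 5 ^ CARD('n)"
      by (rule sum_prod_vec_le[OF _ sum_int_le F]) auto
  qed (simp_all add: D_def)
  finally show ?thesis by (simp add: lattice_const_def m_def D_def)
qed

section \<open>Arithmetic of the frequency vector\<close>

definition ratv :: "real^'n \<Rightarrow> bool" where "ratv x \<longleftrightarrow> (\<forall>i. x $ i \<in> \<rat>)"

lemma ratv_diff: "ratv x \<Longrightarrow> ratv y \<Longrightarrow> ratv (x - y)" by (simp add: ratv_def)
lemma ratv_scale: "c \<in> \<rat> \<Longrightarrow> ratv x \<Longrightarrow> ratv (c *\<^sub>R x)" by (simp add: ratv_def)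
lemma ratv_sum: "(\<And>c. c \<in> C \<Longrightarrow> ratv (f c)) \<Longrightarrow> ratv (\<Sum>c\<in>C. f c)"
  by (induction C rule: infinite_finite_induct) (auto simp: ratv_def)
lemma Rats_inner: "ratv x \<Longrightarrow> ratv y \<Longrightarrow> x \<bullet> y \<in> \<rat>"
  unfolding inner_vec_def ratv_def by (rule Rats_sum) simp

lemma ratv_axis: "ratv (axis i 1)"
  by (auto simp: ratv_def axis_def)

lemma ratv_rv: "ratv (rv k)"
  by (simp add: ratv_def rv_def)

lemma kdot_inner: "kdot k x = rv k \<bullet> x"
  by (simp add: kdot_def inner_vec_def rv_def)

lemma kn_rv: "kn k = infnorm (rv k)"
  by (simp add: kn_def rv_def)

text \<open>The orthogonal projection to the span of \<open>C\<close>, for pairwise orthogonal \<open>C\<close>. The formula shows that it preserves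
  rationality.\<close>

definition eproj :: "(real^'n) set \<Rightarrow> real^'n \<Rightarrow> real^'n" where
  "eproj C x = (\<Sum>c\<in>C. (c \<bullet> x / (c \<bullet> c)) *\<^sub>R c)"

lemma eproj_in_span: "eproj C x \<in> span C"
  unfolding eproj_def by (intro span_sum span_scale span_base)

lemma eproj_orthogonal:
  assumes "pairwise orthogonal C" "finite C" "y \<in> span C"
  shows "y \<bullet> (x - eproj C x) = 0"
  using Gram_Schmidt_step[OF assms(1,3), of x] by (simp add: eproj_def orthogonal_def)

lemma ratv_eproj: "(\<And>c. c \<in> C \<Longrightarrow> ratv c) \<Longrightarrow> ratv x \<Longrightarrow> ratv (eproj C x)"
  unfolding eproj_def by (intro ratv_sum ratv_scale Rats_divide Rats_inner) auto

lemma rational_orthogonal_basis: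
  assumes "finite B" "\<And>x. x \<in> B \<Longrightarrow> ratv x"
  obtains C where "finite C" "pairwise orthogonal C" "\<And>c. c \<in> C \<Longrightarrow> ratv c" "span C = span B"
proof -
  have "\<exists>C. finite C \<and> pairwise orthogonal C \<and> (\<forall>c\<in>C. ratv c) \<and> span C = span B"
    using assms
  proof (induction B rule: finite_induct)
    case empty
    show ?case by (intro exI[of _ "{}"]) auto
  next
    case (insert b B)
    then obtain C where C: "finite C" "pairwise orthogonal C" "\<And>c. c \<in> C \<Longrightarrow> ratv c" "span C = span B" by auto
    let ?a = "b - eproj C b"
    have a: "ratv ?a" using insert.prems C by (intro ratv_diff ratv_eproj) auto
    have orth: "pairwise orthogonal (insert ?a C)"
      using C(2) eproj_orthogonal[OF C(2,1) span_base, of _ b]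
      by (auto simp: pairwise_insert orthogonal_def inner_commute)
    have "span (insert ?a C) = span (insert b C)"
      by (rule eq_span_insert_eq) (simp add: eproj_in_span span_neg)
    also have "\<dots> = span (insert b B)"
      unfolding span_insert C(4) ..
    finally show ?case using C a orth by (intro exI[of _ "insert ?a C"]) auto
  qed
  then show ?thesis using that by blast
qed

lemma eproj_linear: "linear (eproj C)"
  unfolding eproj_def
  by (rule linearI) (simp_all add: inner_add_right add_divide_distrib scaleR_add_left sum.distrib scaleR_sum_right)

text \<open>The orthogonal complement of a rational space is spanned by the rational vectors
  \<open>axis i 1 - P (axis i 1)\<close>, where \<open>P\<close> is the orthogonal projection.\<close>

lemma rational_complement:
  assumes "finite B" "\<And>x. x \<in> B \<Longrightarrow> ratv x"
  obtains C where "finite C" "\<And>c. c \<in> C \<Longrightarrow> ratv c" "span C = {x. \<forall>b\<in>B. b \<bullet> x = 0}"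
proof -
  obtain E where E: "finite E" "pairwise orthogonal E" "\<And>c. c \<in> E \<Longrightarrow> ratv c" "span E = span B"
    using rational_orthogonal_basis[OF assms] by blast
  define C where "C = range (\<lambda>i. axis i 1 - eproj E (axis i 1))"
  have "span C = {x. \<forall>b\<in>B. b \<bullet> x = 0}"
  proof
    have "subspace {x. \<forall>b\<in>B. b \<bullet> x = 0}"
      by (auto simp: subspace_def inner_add_right)
    moreover have "C \<subseteq> {x. \<forall>b\<in>B. b \<bullet> x = 0}"
      using eproj_orthogonal[OF E(2,1)] E(4) span_base[of _ B] by (auto simp: C_def)
    ultimately show "span C \<subseteq> {x. \<forall>b\<in>B. b \<bullet> x = 0}" by (intro span_minimal)
  next
    show "{x. \<forall>b\<in>B. b \<bullet> x = 0} \<subseteq> span C"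
    proof
      fix x assume "x \<in> {x. \<forall>b\<in>B. b \<bullet> x = 0}"
      then have "B \<subseteq> {y. y \<bullet> x = 0}" by auto
      moreover have "subspace {y. y \<bullet> x = 0}" by (auto simp: subspace_def inner_add_left)
      ultimately have "span B \<subseteq> {y. y \<bullet> x = 0}" by (rule span_minimal)
      then have "eproj E x = 0"
        unfolding eproj_def using E(4) span_base[of _ E] by (intro sum.neutral) auto
      moreover have "eproj E x = (\<Sum>i\<in>UNIV. (x $ i) *\<^sub>R eproj E (axis i 1))"
        by (subst vec_as_sum[of x]) (simp add: linear_sum[OF eproj_linear] linear_scale[OF eproj_linear] axis_sum_nth del: sum_component)
      ultimately have "x = (\<Sum>i\<in>UNIV. (x $ i) *\<^sub>R (axis i 1 - eproj E (axis i 1)))"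
        using vec_as_sum[of x] by (simp add: scaleR_diff_right sum_subtractf del: sum_component)
      also have "\<dots> \<in> span C" by (intro span_sum span_scale span_base) (auto simp: C_def)
      finally show "x \<in> span C" .
    qed
  qed
  moreover have "ratv c" if "c \<in> C" for c
    using that E(3) by (auto simp: C_def intro!: ratv_diff ratv_eproj ratv_axis)
  ultimately show ?thesis using that[of C] by (simp add: C_def)
qed

text \<open>The common orthogonal complement of all integer vectors orthogonal to \<open>\<omega>\<close>. This dual description of the rational
  hull is the one used for resonances.\<close>

definition res_space :: "real^'n \<Rightarrow> (real^'n) set" where
  "res_space \<omega> = {x. \<forall>k. kdot k \<omega> = 0 \<longrightarrow> kdot k x = 0}"

lemma subspace_res_space: "subspace (res_space \<omega>)"
  by (auto simp: subspace_def res_space_def kdot_inner inner_add_right)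

lemma self_in_res_space: "\<omega> \<in> res_space \<omega>"
  by (simp add: res_space_def)

lemma rational_subspace_span:
  assumes "\<And>c. c \<in> C \<Longrightarrow> ratv c"
  shows "rational_subspace (span C)"
proof -
  obtain B where B: "B \<subseteq> C" "independent B" "C \<subseteq> span B"
    using maximal_independent_subset[of C] by blast
  then have "span B = span C" by (meson span_mono span_minimal subspace_span subset_antisym)
  then show ?thesis unfolding rational_subspace_def using B assms by (auto simp: ratv_def intro!: exI[of _ B])
qed

lemma rational_res_space: "rational_subspace (res_space \<omega>)"
proof -
  let ?N = "{rv k | k. kdot k \<omega> = 0}"
  obtain B where B: "B \<subseteq> ?N" "independent B" "?N \<subseteq> span B"
    using maximal_independent_subset[of ?N] by blast
  obtain C where C: "finite C" "\<And>c. c \<in> C \<Longrightarrow> ratv c" "span C = {x. \<forall>b\<in>B. b \<bullet> x = 0}"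
    using rational_complement[OF independent_imp_finite[OF B(2)]] B(1) ratv_rv by blast
  have "{x. \<forall>b\<in>B. b \<bullet> x = 0} = res_space \<omega>"
  proof
    show "res_space \<omega> \<subseteq> {x. \<forall>b\<in>B. b \<bullet> x = 0}"
      using B(1) by (force simp: res_space_def kdot_inner)
    show "{x. \<forall>b\<in>B. b \<bullet> x = 0} \<subseteq> res_space \<omega>"
    proof
      fix x assume "x \<in> {x. \<forall>b\<in>B. b \<bullet> x = 0}"
      then have "B \<subseteq> {y. y \<bullet> x = 0}" by auto
      moreover have "subspace {y. y \<bullet> x = 0}" by (auto simp: subspace_def inner_add_left)
      ultimately have "span B \<subseteq> {y. y \<bullet> x = 0}" by (rule span_minimal)
      then show "x \<in> res_space \<omega>" using B(3) by (auto simp: res_space_def kdot_inner)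
    qed
  qed
  then show ?thesis using rational_subspace_span[of C] C by simp
qed

lemma common_denominator:
  assumes "finite X" "X \<subseteq> \<rat>"
  shows "\<exists>q::nat. q > 0 \<and> (\<forall>x\<in>X. real q * x \<in> \<int>)"
  using assms
proof (induction X rule: finite_induct)
    case empty
    show ?case by (intro exI[of _ 1]) auto
  next
    case (insert x X)
    then obtain q :: nat where q: "q > 0" "\<And>x. x \<in> X \<Longrightarrow> real q * x \<in> \<int>" by auto
    have "x \<in> \<rat>" using insert by simp
    then obtain a :: int and d :: int where d: "d > 0" "x = of_int a / of_int d"
      by (auto elim: Rats_cases')
    have "real (q * nat d) * y \<in> \<int>" if "y \<in> insert x X" for y
    proof (cases "y = x")
      case True
      then have "real (q * nat d) * y = of_int (int q * a)" using d by simp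
      then show ?thesis by (simp only: Ints_of_int)
    next
      case False
      then have "real q * y \<in> \<int>" using q(2)[of y] that by blast
      then have "of_int d * (real q * y) \<in> \<int>" by (rule Ints_mult[OF Ints_of_int])
      moreover have "real (q * nat d) * y = of_int d * (real q * y)" using d by simp
      ultimately show ?thesis by (simp only:)
    qed
    then show ?case using q d by (intro exI[of _ "q * nat d"]) auto
qed

lemma int_vec_as_rv:
  assumes "\<And>i. x $ i \<in> \<int>"
  shows "\<exists>k. x = rv k"
proof -
  have "\<exists>m :: int. x $ i = of_int m" for i
    using assms[of i] by (auto elim: Ints_cases)
  then obtain m where "\<And>i. x $ i = of_int (m i)" by metis
  then show ?thesis by (intro exI[of _ "\<chi> i. m i"]) (simp add: vec_eq_iff rv_def)
qed

text \<open>If \<open>S\<close> is rational and contains \<open>\<omega>\<close>, its orthogonal complement is spanned by rational vectors, which can be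
  scaled to integer vectors orthogonal to \<open>\<omega>\<close>; a vector orthogonal to all of these lies in \<open>S\<close>.\<close>

lemma rat_hull_eq: "rat_hull \<omega> = res_space \<omega>"
  unfolding rat_hull_def
proof (rule Least_equality)
  show "rational_subspace (res_space \<omega>) \<and> \<omega> \<in> res_space \<omega>"
    using rational_res_space self_in_res_space by blast
next
  fix S assume "rational_subspace S \<and> \<omega> \<in> S"
  then obtain B where B: "B \<subseteq> {v. \<forall>i. v $ i \<in> \<rat>}" "independent B" "span B = S" and \<omega>: "\<omega> \<in> S"
    by (auto simp: rational_subspace_def)
  have Br: "ratv x" if "x \<in> B" for x using B(1) that by (auto simp: ratv_def)
  obtain C where C: "finite C" "\<And>c. c \<in> C \<Longrightarrow> ratv c" "span C = {x. \<forall>b\<in>B. b \<bullet> x = 0}"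
    using rational_complement[OF independent_imp_finite[OF B(2)] Br] by blast
  show "res_space \<omega> \<le> S"
  proof
    fix x assume x: "x \<in> res_space \<omega>"
    have orth: "c \<bullet> y = 0" if "c \<in> span C" "y \<in> S" for c y
    proof -
      have "B \<subseteq> {y. c \<bullet> y = 0}" using that C(3) by (auto simp: inner_commute)
      moreover have "subspace {y. c \<bullet> y = 0}" by (auto simp: subspace_def inner_add_right)
      ultimately have "span B \<subseteq> {y. c \<bullet> y = 0}" by (rule span_minimal)
      then show ?thesis using that B(3) by auto
    qed
    have xC: "x \<bullet> c = 0" if "c \<in> C" for c
    proof -
      have "range (($) c) \<subseteq> \<rat>" using C(2)[OF that] by (auto simp: ratv_def)
      from common_denominator[OF finite_imageI[OF finite] this]
      obtain q :: nat where q: "q > 0" "\<forall>y\<in>range (($) c). real q * y \<in> \<int>" by blast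
      then obtain k where k: "real q *\<^sub>R c = rv k" using int_vec_as_rv[of "real q *\<^sub>R c"] q(2) by auto
      have "kdot k \<omega> = 0"
        unfolding kdot_inner k[symmetric] using orth[OF span_base[OF that] \<omega>] by simp
      then have "kdot k x = 0" using x by (simp add: res_space_def)
      then show ?thesis using q(1) unfolding kdot_inner k[symmetric] by (simp add: inner_commute)
    qed
    have "C \<subseteq> {c. x \<bullet> c = 0}" using xC by auto
    moreover have "subspace {c. x \<bullet> c = 0}" by (auto simp: subspace_def inner_add_right)
    ultimately have xspan: "span C \<subseteq> {c. x \<bullet> c = 0}" by (rule span_minimal)
    obtain y z where yz: "y \<in> span S" "\<And>w. w \<in> span S \<Longrightarrow> orthogonal z w" "x = y + z"
      using orthogonal_subspace_decomp_exists[of S x] by blast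
    have "b \<bullet> z = 0" if "b \<in> B" for b
    proof -
      have "b \<in> span S" using span_base[OF that] unfolding B(3) by (rule span_base)
      then show ?thesis using yz(2)[of b] by (simp add: orthogonal_def inner_commute)
    qed
    then have "z \<in> span C" unfolding C(3) by blast
    then have "x \<bullet> z = 0" using xspan by auto
    moreover have "y \<bullet> z = 0" using yz(2)[OF yz(1)] by (simp add: orthogonal_def inner_commute)
    ultimately have "z \<bullet> z = 0" by (simp add: yz(3) inner_add_left)
    moreover have "y \<in> S" using yz(1) subspace_span[of B] unfolding B(3) by (simp add: span_eq_iff[symmetric] del: span_eq_iff)
    ultimately show "x \<in> S" using yz(3) by simp
  qed
qed

lemma orth_proj_props:
  assumes "subspace S"
  shows "orth_proj S x \<in> S" "z \<in> S \<Longrightarrow> (x - orth_proj S x) \<bullet> z = 0"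
  using theI'[OF orth_proj_exists1[OF assms, of x]] unfolding orth_proj_def by (auto simp: orthogonal_def)

lemma orth_proj_unique:
  assumes "subspace S" "y \<in> S" "\<And>z. z \<in> S \<Longrightarrow> (x - y) \<bullet> z = 0"
  shows "orth_proj S x = y"
  unfolding orth_proj_def using assms(2,3)
  by (intro the1_equality[OF orth_proj_exists1[OF assms(1)]]) (auto simp: orthogonal_def)

lemma orth_proj_UNIV: "orth_proj UNIV x = x"
  by (rule orth_proj_unique) auto

lemma orth_proj_symmetric:
  assumes "subspace S"
  shows "orth_proj S x \<bullet> y = x \<bullet> orth_proj S y"
proof -
  have "(x - orth_proj S x) \<bullet> orth_proj S y = 0" "(y - orth_proj S y) \<bullet> orth_proj S x = 0"
    using orth_proj_props[OF assms] by auto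
  then have "x \<bullet> orth_proj S y = orth_proj S x \<bullet> orth_proj S y" "y \<bullet> orth_proj S x = orth_proj S y \<bullet> orth_proj S x"
    by (simp_all add: inner_diff_left)
  then show ?thesis by (metis inner_commute)
qed

lemma norm_orth_proj_le:
  assumes "subspace S"
  shows "norm (orth_proj S x) \<le> norm x"
proof -
  have "orth_proj S x \<bullet> orth_proj S x = x \<bullet> orth_proj S x"
    using orth_proj_props(2)[OF assms orth_proj_props(1)[OF assms], of x x] by (simp add: inner_diff_left)
  also have "\<dots> \<le> norm x * norm (orth_proj S x)" by (rule norm_cauchy_schwarz)
  finally have "norm (orth_proj S x) * norm (orth_proj S x) \<le> norm x * norm (orth_proj S x)"
    by (simp add: dot_square_norm power2_eq_square)
  then show ?thesis
    by (cases "norm (orth_proj S x) = 0") (auto simp: mult_le_cancel_right)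
qed

lemma norm_le_card_infnorm: "norm (x :: real^'n) \<le> real CARD('n) * infnorm x"
  using order_trans[OF norm_le_l1_cart[of x] sum_bounded_above[of UNIV "\<lambda>i. \<bar>x $ i\<bar>" "infnorm x"]]
    component_le_infnorm_cart[of x] by auto

text \<open>The projections of the coordinate vectors are rational, and \<open>q\<close> is a common denominator of their entries.\<close>

lemma orth_proj_integral:
  assumes "rational_subspace S"
  obtains q :: nat where "q > 0" "\<And>k. \<exists>k'. rv k' = real q *\<^sub>R orth_proj S (rv k)"
proof -
  obtain B where B: "B \<subseteq> {v. \<forall>i. v $ i \<in> \<rat>}" "independent B" "span B = S"
    using assms by (auto simp: rational_subspace_def)
  obtain E where E: "finite E" "pairwise orthogonal E" "\<And>c. c \<in> E \<Longrightarrow> ratv c" "span E = S"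
    using rational_orthogonal_basis[OF independent_imp_finite[OF B(2)]] B by (auto simp: ratv_def)
  have sub: "subspace S" using E(4) subspace_span by metis
  have proj: "orth_proj S x = eproj E x" for x
    using eproj_in_span[of E x] eproj_orthogonal[OF E(2,1), of _ x] E(4)
    by (intro orth_proj_unique[OF sub]) (auto simp: inner_commute)
  let ?X = "(\<lambda>(i, j). eproj E (axis i 1) $ j) ` UNIV"
  have "?X \<subseteq> \<rat>"
    using ratv_eproj[OF E(3) ratv_axis] by (auto simp: ratv_def)
  from common_denominator[OF finite_imageI[OF finite] this]
  obtain q :: nat where q: "q > 0" and qX: "\<forall>x\<in>?X. real q * x \<in> \<int>" by blast
  have qE: "real q * eproj E (axis i 1) $ j \<in> \<int>" for i j
    by (rule qX[rule_format]) (auto intro!: image_eqI[of _ _ "(i, j)"])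
  have "\<exists>k'. real q *\<^sub>R orth_proj S (rv k) = rv k'" for k
  proof (rule int_vec_as_rv)
    fix j
    have "eproj E (rv k) = (\<Sum>i\<in>UNIV. (rv k $ i) *\<^sub>R eproj E (axis i 1))"
      by (subst vec_as_sum[of "rv k"]) (simp add: linear_sum[OF eproj_linear] linear_scale[OF eproj_linear] axis_sum_nth del: sum_component)
    then have "(real q *\<^sub>R orth_proj S (rv k)) $ j = (\<Sum>i\<in>UNIV. of_int (k $ i) * (real q * eproj E (axis i 1) $ j))"
      by (simp add: proj rv_def sum_distrib_left mult_ac)
    also have "\<dots> \<in> \<int>" by (intro Ints_sum Ints_mult[OF Ints_of_int] qE)
    finally show "(real q *\<^sub>R orth_proj S (rv k)) $ j \<in> \<int>" .
  qed
  then show ?thesis using that[of q] q by metis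
qed

lemma finite_resonance_vecs: "finite (resonance_vecs \<omega> Q)"
proof -
  let ?M = "\<lceil>Q\<rceil>"
  have "resonance_vecs \<omega> Q \<subseteq> (\<lambda>f. rv (\<chi> i. f i)) ` (PiE UNIV (\<lambda>_. {- ?M..?M}))"
  proof
    fix x assume "x \<in> resonance_vecs \<omega> Q"
    then have x: "\<And>i. x $ i \<in> \<int>" "infnorm x \<le> Q" by (auto simp: resonance_vecs_def int_vecs_def)
    obtain k where k: "x = rv k" using int_vec_as_rv[OF x(1)] by blast
    have "\<bar>real_of_int (k $ i)\<bar> \<le> Q" for i
      using nth_le_kn[of k i] x(2) by (simp add: k kn_rv)
    then have "k $ i \<in> {- ?M..?M}" for i
      using le_of_int_ceiling[of Q] by (smt (verit, ccfv_threshold) atLeastAtMost_iff of_int_le_iff of_int_minus)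
    then show "x \<in> (\<lambda>f. rv (\<chi> i. f i)) ` (PiE UNIV (\<lambda>_. {- ?M..?M}))"
      by (intro image_eqI[of _ _ "($) k"]) (auto simp: k)
  qed
  then show ?thesis by (rule finite_subset) (intro finite_imageI finite_PiE, auto)
qed

lemma resonance_vecs_nonresonant:
  assumes "x \<in> resonance_vecs \<omega> Q"
  shows "x \<bullet> \<omega> \<noteq> 0"
proof
  assume 0: "x \<bullet> \<omega> = 0"
  have x: "\<And>i. x $ i \<in> \<int>" "x \<in> res_space \<omega>" "infnorm x > 0"
    using assms by (auto simp: resonance_vecs_def int_vecs_def rat_hull_eq)
  obtain k where k: "x = rv k" using int_vec_as_rv[OF x(1)] by blast
  then have "kdot k x = 0" using 0 x(2) by (simp add: res_space_def kdot_inner)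
  then have "x \<bullet> x = 0" by (simp add: kdot_inner k)
  then show False using x(3) by (simp add: infnorm_pos_lt)
qed

lemma inverse_le_Psi: "x \<in> resonance_vecs \<omega> Q \<Longrightarrow> inverse \<bar>x \<bullet> \<omega>\<bar> \<le> Psi \<omega> Q"
  unfolding Psi_def by (intro Max_ge finite_imageI finite_resonance_vecs imageI)

text \<open>\<open>Psi\<close> only sees integer vectors in the hull; for another \<open>k\<close>, a fixed multiple of its projection
  is an integer vector in the hull, and it has the same product with \<open>\<omega>\<close> up to that factor.\<close>

lemma small_divisors:
  fixes \<omega> :: "real^'n"
  obtains q :: nat where "q > 0"
    "\<And>Q k. real (q * CARD('n)) * kn k \<le> Q \<Longrightarrow> kdot k \<omega> \<noteq> 0 \<Longrightarrow> 1 \<le> real q * Psi \<omega> Q * \<bar>kdot k \<omega>\<bar>"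
proof -
  have sub: "subspace (res_space \<omega>)" by (rule subspace_res_space)
  obtain q :: nat where q: "q > 0" "\<And>k. \<exists>k'. rv k' = real q *\<^sub>R orth_proj (res_space \<omega>) (rv k)"
    using orth_proj_integral[OF rational_res_space[of \<omega>]] by blast
  show ?thesis
  proof (rule that[OF q(1)])
    fix Q k assume k: "real (q * CARD('n)) * kn k \<le> Q" "kdot k \<omega> \<noteq> 0"
    let ?P = "orth_proj (res_space \<omega>) (rv k)"
    obtain k' where k': "rv k' = real q *\<^sub>R ?P" using q(2) by blast
    have "?P \<bullet> \<omega> = kdot k \<omega>"
      using orth_proj_props(2)[OF sub self_in_res_space, of "rv k"] by (simp add: kdot_inner inner_diff_left)
    then have dot: "rv k' \<bullet> \<omega> = real q * kdot k \<omega>" by (simp add: k')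
    then have "rv k' \<noteq> 0" using k(2) q(1) by auto
    then have pos: "infnorm (rv k') > 0" by (simp add: infnorm_pos_lt)
    have "infnorm (rv k') = real q * infnorm ?P" by (simp add: k' infnorm_mul)
    also have "\<dots> \<le> real q * (real CARD('n) * kn k)"
    proof (rule mult_left_mono)
      have "infnorm ?P \<le> norm ?P" by (rule infnorm_le_norm)
      also have "\<dots> \<le> norm (rv k)" by (rule norm_orth_proj_le[OF sub])
      also have "\<dots> \<le> real CARD('n) * infnorm (rv k)" by (rule norm_le_card_infnorm)
      finally show "infnorm ?P \<le> real CARD('n) * kn k" by (simp add: kn_rv)
    qed simp
    finally have "infnorm (rv k') \<le> Q" using k(1) by simp
    then have "rv k' \<in> resonance_vecs \<omega> Q"
      using pos orth_proj_props(1)[OF sub, of "rv k"] subspace_scale[OF sub]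
      by (auto simp: resonance_vecs_def int_vecs_def rat_hull_eq rv_def[of k'] k'[symmetric] rv_def)
        (metis k' rv_def orth_proj_props(1)[OF sub] subspace_scale[OF sub])
    from inverse_le_Psi[OF this] have "inverse (real q * \<bar>kdot k \<omega>\<bar>) \<le> Psi \<omega> Q"
      by (simp add: dot abs_mult)
    then show "1 \<le> real q * Psi \<omega> Q * \<bar>kdot k \<omega>\<bar>"
      using k(2) q(1) by (simp add: field_simps)
  qed
qed

text \<open>\<open>Psi\<close> is bounded below by its contribution from one fixed vector. Hence \<open>Delta\<close> tends to infinity and the set in
  the definition of \<open>Delta_star\<close> is bounded.\<close>

lemma Psi_lower_bound:
  assumes "resonance_vecs \<omega> Q0 \<noteq> {}"
  obtains p where "p > 0" "\<And>Q. Q0 \<le> Q \<Longrightarrow> p \<le> Psi \<omega> Q"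
proof -
  obtain x where x: "x \<in> resonance_vecs \<omega> Q0" using assms by blast
  show ?thesis
  proof (rule that[of "inverse \<bar>x \<bullet> \<omega>\<bar>"])
    show "inverse \<bar>x \<bullet> \<omega>\<bar> > 0" using resonance_vecs_nonresonant[OF x] by simp
    fix Q assume "Q0 \<le> Q"
    then have "x \<in> resonance_vecs \<omega> Q" using x by (auto simp: resonance_vecs_def)
    then show "inverse \<bar>x \<bullet> \<omega>\<bar> \<le> Psi \<omega> Q" by (rule inverse_le_Psi)
  qed
qed

text \<open>The supremum in \<open>Delta_star\<close> need not be attained, but it is attained up to the factor 2.\<close>

lemma Delta_star_witness:
  assumes Q0: "Q0 > 0" and ne: "resonance_vecs \<omega> Q0 \<noteq> {}" and x: "Delta \<omega> Q0 \<le> x"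
  obtains Q where "Q0 \<le> Q" "Delta \<omega> Q \<le> x" "Delta_star \<omega> Q0 x \<le> 2 * Q" "0 < Delta_star \<omega> Q0 x"
proof -
  let ?S = "{Q. Q \<ge> Q0 \<and> Delta \<omega> Q \<le> x}"
  obtain p where p: "p > 0" "\<And>Q. Q0 \<le> Q \<Longrightarrow> p \<le> Psi \<omega> Q" using Psi_lower_bound[OF ne] by blast
  have "Q \<le> x / p" if "Q \<in> ?S" for Q
  proof -
    have "Q * p \<le> Q * Psi \<omega> Q" using that Q0 p(2) by (intro mult_left_mono) auto
    then show ?thesis using that p(1) by (simp add: Delta_def field_simps)
  qed
  then have bdd: "bdd_above ?S" by (intro bdd_aboveI)
  have mem: "Q0 \<in> ?S" using x by simp
  then have "Q0 \<le> Delta_star \<omega> Q0 x" unfolding Delta_star_def by (intro cSup_upper bdd)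
  then have pos: "0 < Delta_star \<omega> Q0 x" using Q0 by simp
  then have "Delta_star \<omega> Q0 x / 2 < Sup ?S" unfolding Delta_star_def by simp
  then obtain Q where "Q \<in> ?S" "Delta_star \<omega> Q0 x / 2 < Q"
    using less_cSupE[of "Delta_star \<omega> Q0 x / 2" ?S] mem by blast
  then show ?thesis using that pos by auto
qed

section \<open>Continuation of solutions\<close>

definition sol :: "('a::euclidean_space \<Rightarrow> 'a) \<Rightarrow> 'a set \<Rightarrow> real set \<Rightarrow> (real \<Rightarrow> 'a) \<Rightarrow> bool" where
  "sol V D J x \<longleftrightarrow> is_interval J \<and> (\<forall>t\<in>J. x t \<in> D \<and> (x has_vector_derivative V (x t)) (at t within J))"

text \<open>Local existence, by the contraction principle for the integral equation. The integrand is
  evaluated at clamped times, so that the fixed point lives in the space of bounded continuous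
  functions on the whole line.\<close>

lemma local_solution:
  fixes V :: "'a::euclidean_space \<Rightarrow> 'a"
  assumes r: "r > 0" and L: "L > 0" and M: "M > 0"
    and lip: "\<And>x y. x \<in> cball x0 r \<Longrightarrow> y \<in> cball x0 r \<Longrightarrow> norm (V x - V y) \<le> L * norm (x - y)"
    and bd: "\<And>x. x \<in> cball x0 r \<Longrightarrow> norm (V x) \<le> M"
  shows "\<exists>h y. 0 < h \<and> y b = x0 \<and>
    (\<forall>t\<in>{b..b + h}. y t \<in> cball x0 r \<and> (y has_vector_derivative V (y t)) (at t within {b..b + h}))"
proof -
  \<comment> \<open>The first bound keeps the Picard iterates in the ball, the second makes the iteration a contraction.\<close>
  define h where "h = min (r / M) (1 / (2 * L))"
  have h: "h > 0" "h * M \<le> r" "h * L \<le> 1 / 2"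
    using r L M by (auto simp: h_def min_def field_simps)
  have contV: "continuous_on (cball x0 r) V"
  proof (rule lipschitz_on_continuous_on[of L])
    show "L-lipschitz_on (cball x0 r) V"
      using lip L by (intro lipschitz_onI) (auto simp: dist_norm)
  qed
  define S where "S = {u :: real \<Rightarrow>\<^sub>C 'a. \<forall>t. apply_bcontfun u t \<in> cball x0 r}"
  define cl where "cl t = max b (min t (b + h))" for t :: real
  have cl: "cl t \<in> {b..b + h}" for t using h by (auto simp: cl_def)
  have cl_id: "cl t = t" if "t \<in> {b..b + h}" for t using that by (auto simp: cl_def)
  have ccl: "continuous_on UNIV cl" unfolding cl_def by (intro continuous_intros)
  define P where "P u t = x0 + integral {b..cl t} (\<lambda>s. V (apply_bcontfun u s))" for u t
  have Vu: "continuous_on T (\<lambda>s. V (apply_bcontfun u s))" if "u \<in> S" for u T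
    using that by (intro continuous_on_compose2[OF contV]) (auto simp: S_def)
  have int: "(\<lambda>s. V (apply_bcontfun u s)) integrable_on {b..c}" if "u \<in> S" for u c
    by (intro integrable_continuous_real Vu that)
  have Pball: "P u t \<in> cball x0 r" if u: "u \<in> S" for u t
  proof -
    have "norm (integral {b..cl t} (\<lambda>s. V (apply_bcontfun u s))) \<le> M * (cl t - b)"
      using cl[of t] u by (intro integral_bound Vu) (auto intro!: bd simp: S_def)
    also have "\<dots> \<le> M * h" using cl[of t] M by (intro mult_left_mono) auto
    finally show ?thesis using h by (simp add: P_def dist_norm mult.commute)
  qed
  have Pcont: "continuous_on UNIV (P u)" if u: "u \<in> S" for u
  proof -
    have "continuous_on {b..b + h} (\<lambda>c. integral {b..c} (\<lambda>s. V (apply_bcontfun u s)))"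
      by (rule indefinite_integral_continuous_1) (rule int[OF u])
    then show ?thesis unfolding P_def
      by (intro continuous_intros continuous_on_compose2[OF _ ccl]) (use cl in auto)
  qed
  have Pbc: "P u \<in> bcontfun" if "u \<in> S" for u
    unfolding bcontfun_def using Pcont[OF that] Pball[OF that]
    by (auto intro!: bounded_subset[OF bounded_cball[of x0 r]])
  define \<Phi> where "\<Phi> u = Bcontfun (P u)" for u
  have \<Phi>: "apply_bcontfun (\<Phi> u) = P u" if "u \<in> S" for u
    unfolding \<Phi>_def using Pbc[OF that] by (simp add: Bcontfun_inverse)
  have "closed S"
  proof -
    have "S = PiC UNIV (\<lambda>_. cball x0 r)" by (auto simp: S_def mem_PiC_iff Pi_def)
    then show ?thesis by (simp add: closed_PiC)
  qed
  then have cS: "complete S" by (simp add: complete_eq_closed)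
  have "const_bcontfun x0 \<in> S" using r by (simp add: S_def const_bcontfun.rep_eq)
  then have neS: "S \<noteq> {}" by blast
  have img: "\<Phi> ` S \<subseteq> S" using \<Phi> Pball by (auto simp: S_def)
  have contr: "dist (\<Phi> u) (\<Phi> w) \<le> 1 / 2 * dist u w" if uw: "u \<in> S" "w \<in> S" for u w
  proof (rule dist_bound)
    fix t
    have "dist (P u t) (P w t) = norm (integral {b..cl t} (\<lambda>s. V (apply_bcontfun u s) - V (apply_bcontfun w s)))"
      by (simp add: P_def dist_norm integral_diff[OF int[OF uw(1)] int[OF uw(2)]])
    also have "\<dots> \<le> (L * dist u w) * (cl t - b)"
    proof (rule integral_bound)
      fix s
      have "norm (V (apply_bcontfun u s) - V (apply_bcontfun w s)) \<le> L * norm (apply_bcontfun u s - apply_bcontfun w s)"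
        using uw by (intro lip) (auto simp: S_def)
      also have "\<dots> \<le> L * dist u w"
        using dist_bounded[of u s w] L by (intro mult_left_mono) (auto simp: dist_norm)
      finally show "norm (V (apply_bcontfun u s) - V (apply_bcontfun w s)) \<le> L * dist u w" .
    qed (use cl[of t] uw in \<open>auto intro!: continuous_intros Vu\<close>)
    also have "\<dots> \<le> (L * dist u w) * h" using cl[of t] L by (intro mult_left_mono) auto
    also have "\<dots> = (h * L) * dist u w" by simp
    also have "\<dots> \<le> 1 / 2 * dist u w" using h by (intro mult_right_mono) auto
    finally show "dist (apply_bcontfun (\<Phi> u) t) (apply_bcontfun (\<Phi> w) t) \<le> 1 / 2 * dist u w"
      using uw by (simp add: \<Phi>)
  qed
  have "\<exists>!u\<in>S. \<Phi> u = u"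
    by (rule Banach_fix[OF cS neS _ _ img contr]) auto
  then obtain u where u: "u \<in> S" "\<Phi> u = u" by blast
  define y where "y = apply_bcontfun u"
  have y: "y t = x0 + integral {b..t} (\<lambda>s. V (y s))" if "t \<in> {b..b + h}" for t
  proof -
    have "apply_bcontfun u t = P u t" using fun_cong[OF \<Phi>[OF u(1)], of t] unfolding u(2) .
    also have "\<dots> = x0 + integral {b..t} (\<lambda>s. V (y s))"
      by (simp add: P_def y_def cl_id[OF that])
    finally show ?thesis by (simp only: y_def)
  qed
  show ?thesis
  proof (intro exI[of _ h] exI[of _ y] conjI ballI h(1))
    have "b \<in> {b..b + h}" using h by simp
    from y[OF this] show "y b = x0" by (simp only: interval_cbox integral_refl add_0_right)
    fix t assume t: "t \<in> {b..b + h}"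
    have "((\<lambda>t. x0 + integral {b..t} (\<lambda>s. V (y s))) has_vector_derivative 0 + V (y t)) (at t within {b..b + h})"
      using t Vu[OF u(1)] unfolding y_def
      by (intro has_vector_derivative_add has_vector_derivative_const integral_has_vector_derivative) auto
    then have "((\<lambda>t. x0 + integral {b..t} (\<lambda>s. V (y s))) has_vector_derivative V (y t)) (at t within {b..b + h})"
      by (simp only: add_0_left)
    then have "(y has_vector_derivative V (y t)) (at t within {b..b + h})"
      by (rule has_vector_derivative_transform[OF t, rotated]) (rule y)
    then show "(y has_vector_derivative V (y t)) (at t within {b..b + h})" .
    show "y t \<in> cball x0 r" using u(1) by (simp add: S_def y_def)
  qed
qed

lemma sol_glue:
  assumes x: "sol V D J x" and b: "b \<in> J" "\<And>t. t \<in> J \<Longrightarrow> t \<le> b" and h: "b < c"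
    and y: "y b = x b" "\<And>t. t \<in> {b..c} \<Longrightarrow> y t \<in> D \<and> (y has_vector_derivative V (y t)) (at t within {b..c})"
  shows "sol V D (J \<union> {b..c}) (\<lambda>t. if t \<in> J then x t else y t)"
  unfolding sol_def
proof (intro conjI ballI)
  have J: "is_interval J" using x by (simp add: sol_def)
  show "is_interval (J \<union> {b..c})"
    unfolding is_interval_1
  proof (intro ballI allI impI)
    fix u w z assume u: "u \<in> J \<union> {b..c}" and w: "w \<in> J \<union> {b..c}" and z: "u \<le> z \<and> z \<le> w"
    show "z \<in> J \<union> {b..c}"
    proof (cases "z \<le> b")
      case True
      then have "u \<in> J \<or> z = b" using u z by auto
      moreover have "z \<in> J" if "u \<in> J"
        using J b(1) True z that unfolding is_interval_1 by meson
      ultimately show ?thesis using b(1) by blast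
    next
      case False
      then have "z \<le> c" using w z b(2)[of w] by auto
      then show ?thesis using False by simp
    qed
  qed
  have "closure J \<subseteq> {..b}" using b by (intro closure_minimal) auto
  then have cl: "closure J \<inter> closure {b..c} = {b}"
    using b(1) closure_subset[of J] h by auto
  fix t assume t: "t \<in> J \<union> {b..c}"
  show "(if t \<in> J then x t else y t) \<in> D"
  proof (cases "t \<in> J")
    case True then show ?thesis using x by (simp add: sol_def)
  next
    case False then show ?thesis using t y(2)[of t] by simp
  qed
  have "((\<lambda>t. if t \<in> J then x t else y t) has_vector_derivative (if t \<in> J then V (x t) else V (y t))) (at t within J \<union> {b..c})"
  proof (rule has_vector_derivative_If_within_closures[OF t refl])
    assume "t \<in> J \<union> closure J \<inter> closure {b..c}"
    then show "(x has_vector_derivative V (x t)) (at t within J \<union> closure J \<inter> closure {b..c})"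
    proof -
      have "J \<union> closure J \<inter> closure {b..c} = J" unfolding cl using b(1) by blast
      then show ?thesis using x \<open>t \<in> J \<union> closure J \<inter> closure {b..c}\<close> by (simp only:) (simp add: sol_def)
    qed
  next
    assume "t \<in> {b..c} \<union> closure J \<inter> closure {b..c}"
    then have t: "t \<in> {b..c}" unfolding cl using h by auto
    have "{b..c} \<union> {b} = {b..c}" using h by auto
    then show "(y has_vector_derivative V (y t)) (at t within {b..c} \<union> closure J \<inter> closure {b..c})"
      unfolding cl using y(2)[OF t] by (simp only:)
  next
    assume "t \<in> closure J" "t \<in> closure {b..c}"
    then have "t = b" using cl by blast
    then show "x t = y t" "V (x t) = V (y t)" by (simp_all only: y(1))
  qed
  then show "((\<lambda>t. if t \<in> J then x t else y t) has_vector_derivative V (if t \<in> J then x t else y t)) (at t within J \<union> {b..c})"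
    by (cases "t \<in> J") simp_all
qed

lemma sol_subset: "sol V D J x \<Longrightarrow> J' \<subseteq> J \<Longrightarrow> is_interval J' \<Longrightarrow> sol V D J' x"
  unfolding sol_def by (metis has_vector_derivative_within_subset subsetD)

text \<open>A solution with bounded velocity has a limit at a missing right end point, and the limit
  continues it, because it satisfies the integral equation.\<close>

lemma sol_add_endpoint:
  fixes V :: "'a::euclidean_space \<Rightarrow> 'a"
  assumes x: "sol V D J x" and D: "closed D" and V: "continuous_on D V" and M: "\<And>z. z \<in> D \<Longrightarrow> norm (V z) \<le> M"
    and a: "a \<in> J" "a < b" and b: "b \<notin> J" "{a..<b} \<subseteq> J" "\<And>t. t \<in> J \<Longrightarrow> t < b"
  shows "\<exists>x'. sol V D (J \<union> {b}) x' \<and> (\<forall>t\<in>J. x' t = x t)"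
proof -
  have "x a \<in> D" using x a by (simp add: sol_def)
  then have M0: "M \<ge> 0" using M norm_ge_zero order_trans by blast
  have der: "(x has_vector_derivative V (x t)) (at t within {a..<b})" "x t \<in> D" if "t \<in> {a..<b}" for t
    using x b(2) that has_vector_derivative_within_subset[OF _ b(2), of x "V (x t)" t] by (auto simp: sol_def)
  have lip: "norm (x s - x t) \<le> M * norm (s - t)" if "s \<in> {a..<b}" "t \<in> {a..<b}" for s t
  proof (rule differentiable_bound[where S="{a..<b}" and f'="\<lambda>t s. s *\<^sub>R V (x t)"])
    fix t assume t: "t \<in> {a..<b}"
    show "(x has_derivative (\<lambda>s. s *\<^sub>R V (x t))) (at t within {a..<b})"
      using der[OF t] by (simp add: has_vector_derivative_def)
    show "onorm (\<lambda>s. s *\<^sub>R V (x t)) \<le> M"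
      using M[OF der(2)[OF t]] M0 by (intro onorm_le) (simp add: mult.commute[of M] mult_left_mono)
  qed (use that in auto)
  then have "M-lipschitz_on {a..<b} x"
    using M0 by (intro lipschitz_onI) (auto simp: dist_norm)
  then have "uniformly_continuous_on {a..<b} x" by (rule lipschitz_on_uniformly_continuous)
  then obtain g where g: "uniformly_continuous_on (closure {a..<b}) g" "\<And>t. t \<in> {a..<b} \<Longrightarrow> x t = g t"
    using uniformly_continuous_on_extension_on_closure[of "{a..<b}" x] by metis
  have cg: "continuous_on {a..b} g"
    using g(1) a uniformly_continuous_imp_continuous by simp
  have gD: "g t \<in> D" if "t \<in> {a..b}" for t
  proof -
    have "g ` closure {a..<b} \<subseteq> D"
    proof (rule image_closure_subset)
      show "continuous_on (closure {a..<b}) g" using g(1) uniformly_continuous_imp_continuous by blast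
    qed (use D g(2) der(2) in auto)
    then show ?thesis using that a by auto
  qed
  have cV: "continuous_on {a..b} (\<lambda>s. V (g s))"
    by (rule continuous_on_compose2[OF V cg]) (use gD in auto)
  define k where "k t = g t - (g a + integral {a..t} (\<lambda>s. V (g s)))" for t
  have k0: "k t = 0" if t: "t \<in> {a..<b}" for t
  proof -
    have "((\<lambda>s. V (g s)) has_integral (g t - g a)) {a..t}"
    proof (rule fundamental_theorem_of_calculus)
      fix s assume s: "s \<in> {a..t}"
      then have "(x has_vector_derivative V (x s)) (at s within {a..t})"
        using der(1)[of s] t by (auto intro: has_vector_derivative_within_subset)
      then have "(g has_vector_derivative V (x s)) (at s within {a..t})"
        using s t g(2) by (intro has_vector_derivative_transform[of s "{a..t}" g x]) auto
      then show "(g has_vector_derivative V (g s)) (at s within {a..t})" using g(2)[of s] s t by simp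
    qed (use t in auto)
    then show ?thesis by (simp add: k_def integral_unique)
  qed
  have "continuous_on {a..b} k"
    unfolding k_def by (intro continuous_intros cg indefinite_integral_continuous_1 integrable_continuous_real cV)
  then have k_closure: "k ` closure {a..<b} \<subseteq> {0}"
    using a k0 by (intro image_closure_subset) auto
  have gI: "g t = g a + integral {a..t} (\<lambda>s. V (g s))" if "t \<in> {a..b}" for t
  proof -
    have "k t = 0" using k_closure a that by (auto simp: image_subset_iff)
    then show ?thesis unfolding k_def by (rule eq_iff_diff_eq_0[THEN iffD2])
  qed
  have gder: "(g has_vector_derivative V (g t)) (at t within {a..b})" if t: "t \<in> {a..b}" for t
  proof -
    have "((\<lambda>t. g a + integral {a..t} (\<lambda>s. V (g s))) has_vector_derivative 0 + V (g t)) (at t within {a..b})"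
      by (intro has_vector_derivative_add has_vector_derivative_const integral_has_vector_derivative cV t)
    then have "((\<lambda>t. g a + integral {a..t} (\<lambda>s. V (g s))) has_vector_derivative V (g t)) (at t within {a..b})"
      by (simp only: add_0_left)
    then show ?thesis by (rule has_vector_derivative_transform[OF t, rotated]) (rule gI)
  qed
  let ?J = "J \<inter> {..a}"
  have Jint: "is_interval ?J" using x by (simp add: sol_def is_interval_Int is_interval_ic)
  have s: "sol V D (?J \<union> {a..b}) (\<lambda>t. if t \<in> ?J then x t else g t)"
    using a gD gder g(2)[of a]
    by (intro sol_glue sol_subset[OF x]) (auto simp: Jint)
  have e: "?J \<union> {a..b} = J \<union> {b}"
  proof
    show "?J \<union> {a..b} \<subseteq> J \<union> {b}" using b(2) by force
    show "J \<union> {b} \<subseteq> ?J \<union> {a..b}" using a b(3) by (auto simp: less_imp_le)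
  qed
  have "\<forall>t\<in>J. (if t \<in> ?J then x t else g t) = x t"
    using g(2) b(3) by auto
  then show ?thesis using s[unfolded e] by (intro exI[of _ "\<lambda>t. if t \<in> ?J then x t else g t"] conjI)
qed

lemma sol_extend_right:
  fixes V :: "'a::euclidean_space \<Rightarrow> 'a"
  assumes x: "sol V D J x" and D: "closed D" and L: "L > 0" and M: "M > 0"
    and lip: "\<And>z w. z \<in> D \<Longrightarrow> w \<in> D \<Longrightarrow> norm (V z - V w) \<le> L * norm (z - w)"
    and bd: "\<And>z. z \<in> D \<Longrightarrow> norm (V z) \<le> M"
    and J: "0 \<in> J" and \<tau>: "0 < \<tau>" "\<tau> \<notin> J" and r: "r > 0"
    and room: "\<And>t. t \<in> J \<Longrightarrow> 0 \<le> t \<Longrightarrow> t \<le> \<tau> \<Longrightarrow> cball (x t) r \<subseteq> D"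
  shows "\<exists>J' x'. J \<subset> J' \<and> sol V D J' x' \<and> (\<forall>t\<in>J. x' t = x t)"
proof -
  have int: "is_interval J" using x by (simp add: sol_def)
  have le: "t \<le> \<tau>" if "t \<in> J" for t
    using mem_is_interval_1_I[OF int J that, of \<tau>] \<tau> by linarith
  define b where "b = Sup J"
  have bdd: "bdd_above J" using le by (intro bdd_aboveI)
  have up: "t \<le> b" if "t \<in> J" for t unfolding b_def using that bdd by (rule cSup_upper)
  have b: "0 \<le> b" "b \<le> \<tau>" using up[OF J] J le by (auto simp: b_def intro: cSup_least)
  show ?thesis
  proof (cases "b \<in> J")
    case True
    have cb: "cball (x b) r \<subseteq> D" using room[OF True b] .
    have "\<exists>h y. 0 < h \<and> y b = x b \<and>
        (\<forall>t\<in>{b..b + h}. y t \<in> cball (x b) r \<and> (y has_vector_derivative V (y t)) (at t within {b..b + h}))"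
      by (rule local_solution[OF r L M]) (rule lip bd; erule subsetD[OF cb])+
    then obtain h y where h: "0 < h" "y b = x b"
        "\<forall>t\<in>{b..b + h}. y t \<in> cball (x b) r \<and> (y has_vector_derivative V (y t)) (at t within {b..b + h})"
      by blast
    have "sol V D (J \<union> {b..b + h}) (\<lambda>t. if t \<in> J then x t else y t)"
    proof (rule sol_glue[OF x True up])
      show "y t \<in> D \<and> (y has_vector_derivative V (y t)) (at t within {b..b + h})" if "t \<in> {b..b + h}" for t
        using h(3) cb that by blast
    qed (use h(1,2) in simp_all)
    moreover have "b + h \<notin> J" using up[of "b + h"] h(1) by auto
    then have "J \<subset> J \<union> {b..b + h}" using h(1) by auto
    ultimately show ?thesis
      by (intro exI[of _ "J \<union> {b..b + h}"] exI[of _ "\<lambda>t. if t \<in> J then x t else y t"] conjI) simp_all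
  next
    case False
    then have "b \<noteq> 0" using J by auto
    then have b0: "0 < b" using b by simp
    have sub: "{0..<b} \<subseteq> J"
    proof
      fix t assume t: "t \<in> {0..<b}"
      then obtain s where "s \<in> J" "t < s" using less_cSupE[of t J] J by (auto simp: b_def)
      then show "t \<in> J" using mem_is_interval_1_I[OF int J, of s t] t by simp
    qed
    have contV: "continuous_on D V"
      using lip L by (intro lipschitz_on_continuous_on[of L] lipschitz_onI) (auto simp: dist_norm)
    have lt: "t < b" if "t \<in> J" for t using up[OF that] False that by (cases "t = b") auto
    have "\<exists>x'. sol V D (J \<union> {b}) x' \<and> (\<forall>t\<in>J. x' t = x t)"
      by (rule sol_add_endpoint[OF x D contV bd J b0 False sub lt])
    moreover have "J \<subset> J \<union> {b}" using False by auto
    ultimately show ?thesis by (intro exI[of _ "J \<union> {b}"]) simp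
  qed
qed

lemma sol_reverse:
  assumes "sol V D J x"
  shows "sol (\<lambda>z. - V z) D (uminus ` J) (\<lambda>t. x (- t))"
  unfolding sol_def
proof (intro conjI ballI)
  show "is_interval (uminus ` J)" using assms by (simp add: sol_def)
  fix t assume "t \<in> uminus ` J"
  then have t: "- t \<in> J" by auto
  then show "x (- t) \<in> D" using assms by (simp add: sol_def)
  have "(x has_vector_derivative V (x (- t))) (at (- t) within uminus ` (uminus ` J))"
    using assms t by (simp add: sol_def image_image)
  moreover have "(uminus has_vector_derivative (-1)) (at t within uminus ` J)"
    by (auto intro!: derivative_eq_intros)
  ultimately have "(x \<circ> uminus has_vector_derivative (-1) *\<^sub>R V (x (- t))) (at t within uminus ` J)"
    by (intro vector_diff_chain_within)
  then show "((\<lambda>t. x (- t)) has_vector_derivative - V (x (- t))) (at t within uminus ` J)"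
    by (simp add: o_def)
qed

text \<open>At a finite end of its interval of existence a solution with bounded velocity either has a limit that can
  be added, or stops at an interior point where a local solution can be glued on. Negative times
  are reduced to positive ones by reversing the vector field.\<close>

theorem maximal_sol_exists_until:
  fixes V :: "'a::euclidean_space \<Rightarrow> 'a"
  assumes x: "sol V D J x" and max: "\<And>J' x'. J \<subset> J' \<Longrightarrow> sol V D J' x' \<Longrightarrow> (\<forall>t\<in>J. x' t = x t) \<Longrightarrow> False"
    and D: "closed D" and L: "L > 0" and M: "M > 0"
    and lip: "\<And>z w. z \<in> D \<Longrightarrow> w \<in> D \<Longrightarrow> norm (V z - V w) \<le> L * norm (z - w)"
    and bd: "\<And>z. z \<in> D \<Longrightarrow> norm (V z) \<le> M"
    and J: "0 \<in> J" and r: "r > 0"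
    and room: "\<And>t. t \<in> J \<Longrightarrow> \<bar>t\<bar> \<le> \<bar>\<tau>\<bar> \<Longrightarrow> cball (x t) r \<subseteq> D"
  shows "\<tau> \<in> J"
proof (rule ccontr)
  assume \<tau>: "\<tau> \<notin> J"
  then have "\<tau> \<noteq> 0" using J by auto
  then consider "\<tau> > 0" | "\<tau> < 0" by linarith
  then show False
  proof cases
    case 1
    have "\<exists>J' x'. J \<subset> J' \<and> sol V D J' x' \<and> (\<forall>t\<in>J. x' t = x t)"
      by (rule sol_extend_right[OF x D L M lip bd J 1 \<tau> r]) (use room 1 in auto)
    then show False using max by blast
  next
    case 2
    have "\<exists>J' x'. uminus ` J \<subset> J' \<and> sol (\<lambda>z. - V z) D J' x' \<and> (\<forall>t\<in>uminus ` J. x' t = x (- t))"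
    proof (rule sol_extend_right[OF sol_reverse[OF x] D L M])
      show "- \<tau> \<notin> uminus ` J" using \<tau> by auto
      show "norm (- V z - - V w) \<le> L * norm (z - w)" if "z \<in> D" "w \<in> D" for z w
        using lip[OF that] by (simp add: norm_minus_commute)
      show "cball (x (- t)) r \<subseteq> D" if "t \<in> uminus ` J" "0 \<le> t" "t \<le> - \<tau>" for t
      proof (rule room)
        show "- t \<in> J" using that(1) by auto
      qed (use that in simp)
    qed (use J 2 bd r in auto)
    then obtain J' x' where J': "uminus ` J \<subset> J'" "sol (\<lambda>z. - V z) D J' x'" "\<forall>t\<in>uminus ` J. x' t = x (- t)"
      by blast
    have "sol V D (uminus ` J') (\<lambda>t. x' (- t))"
      using sol_reverse[OF J'(2)] by simp
    moreover have "J \<subset> uminus ` J'"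
    proof
      show "J \<subseteq> uminus ` J'" using J'(1) by force
      obtain t where "t \<in> J'" "t \<notin> uminus ` J" using J'(1) by blast
      then show "J \<noteq> uminus ` J'" by force
    qed
    moreover have "\<forall>t\<in>J. x' (- t) = x t" using J'(3) by auto
    ultimately show False using max by blast
  qed
qed

section \<open>Fourier coefficients of the perturbation\<close>

lemma aball_shift_interval:
  assumes "I \<in> aball R"
  shows "{s. I + s *\<^sub>R axis i 1 \<in> aball R} = {- R - I $ i..R - I $ i}"
  using assms by (auto simp: infnorm_le_iff axis_def abs_le_iff split: if_splits)

lemma mem_phase_dom: "(\<theta>, I) \<in> phase_dom R \<longleftrightarrow> I \<in> aball R"
  by (simp add: phase_dom_def)

lemma phase_dom_direction:
  assumes "(\<theta>, I) \<in> phase_dom R"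
  shows "{s. (\<theta>, I) + s *\<^sub>R coord_dir (Inl i) \<in> phase_dom R} = UNIV"
    "{s. (\<theta>, I) + s *\<^sub>R coord_dir (Inr i) \<in> phase_dom R} = {s. I + s *\<^sub>R axis i 1 \<in> aball R}"
  using assms by (auto simp: coord_dir_def phase_dom_def)

text \<open>Every point of the closed domain is a limit of other points of the domain along each coordinate direction, so
  one-sided partial derivatives at the boundary are unique as well.\<close>

lemma phase_dom_nontrivial:
  assumes "R > 0" "x \<in> phase_dom R"
  shows "at 0 within {s. x + s *\<^sub>R coord_dir j \<in> phase_dom R} \<noteq> bot"
proof -
  obtain \<theta> I where x: "x = (\<theta>, I)" by force
  then have I: "I \<in> aball R" using assms by (simp add: mem_phase_dom)
  show ?thesis
  proof (cases j)
    case (Inl i)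
    then show ?thesis using phase_dom_direction(1)[of \<theta> I R i] assms x by simp
  next
    case (Inr i)
    have "{s. x + s *\<^sub>R coord_dir j \<in> phase_dom R} = {- R - I $ i..R - I $ i}"
      unfolding x Inr phase_dom_direction(2)[OF assms(2)[unfolded x]] by (rule aball_shift_interval[OF I])
    moreover have "0 islimpt {- R - I $ i..R - I $ i}"
      using I assms(1) by (simp add: islimpt_Icc infnorm_le_iff abs_le_iff) (metis add.commute le_add_iff1 minus_le_iff)
    ultimately show ?thesis by (simp add: trivial_limit_within)
  qed
qed

lemma jet_on_derivative:
  assumes "jet_on D f g" "x \<in> D"
  shows "((\<lambda>s. g l (x + s *\<^sub>R coord_dir j)) has_real_derivative g (l(j := Suc (l j))) x) (at 0 within {s. x + s *\<^sub>R coord_dir j \<in> D})"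
  using assms by (simp add: jet_on_def)

lemma gevrey_norm_bound:
  assumes n: "gevrey_norm \<alpha> L D f \<le> ereal \<epsilon>" and L: "L > 0" and x: "x \<in> D"
  shows "\<bar>mpartial D l f x\<bar> \<le> \<epsilon> * ((\<Prod>j\<in>UNIV. fact (l j)) powr \<alpha> * L powr (- (real (\<Sum>j\<in>UNIV. l j) * \<alpha>)))"
proof -
  let ?P = "(\<Prod>j\<in>UNIV. fact (l j)) :: real"
  have P: "?P > 0" by (rule prod_pos) simp
  let ?c = "L powr (real (\<Sum>j\<in>UNIV. l j) * \<alpha>) * ?P powr (- \<alpha>)"
  have c: "?c > 0" using L P by simp
  have "ereal ?c * ereal \<bar>mpartial D l f x\<bar> \<le> ereal ?c * C0_norm D (mpartial D l f)"
    unfolding C0_norm_def using x c by (intro ereal_mult_left_mono SUP_upper) auto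
  also have "\<dots> \<le> gevrey_norm \<alpha> L D f"
    unfolding gevrey_norm_def by (rule SUP_upper) simp
  finally have "?c * \<bar>mpartial D l f x\<bar> \<le> \<epsilon>" using n by (metis ereal_less_eq(3) order_trans times_ereal.simps(1))
  then show ?thesis using L P by (simp add: powr_minus field_simps)
qed

text \<open>The decay rate of Fourier coefficients that results from the Gevrey bounds with the constant
  \<open>2 powr \<alpha> * L powr (- \<alpha>)\<close> of \<open>ft_bound\<close>.\<close>

definition tau :: "real \<Rightarrow> real \<Rightarrow> real" where
  "tau \<alpha> L = (\<alpha> / exp 1) * (2 * pi / (2 powr \<alpha> * L powr (- \<alpha>))) powr (1 / \<alpha>)"

text \<open>Integrate by parts \<open>p\<close> times in the direction of the largest component of \<open>k\<close>, with the best \<open>p\<close>.\<close>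

lemma fc_decay:
  fixes g0 :: "real^'n \<Rightarrow> complex"
  assumes \<alpha>: "\<alpha> \<ge> 1" and A: "A \<ge> 0" and B: "B > 0"
    and cont: "\<And>i p. continuous_on UNIV (G i p)" and per: "\<And>i p. periodic (G i p)"
    and der: "\<And>i p \<theta>. ((\<lambda>s. G i p (\<theta> + s *\<^sub>R axis i 1)) has_vector_derivative G i (Suc p) \<theta>) (at 0)"
    and G0: "\<And>i. G i 0 = g0" and bd: "\<And>i p \<theta>. norm (G i p \<theta>) \<le> A * fact p powr \<alpha> * B ^ p"
  shows "norm (fc g0 k) \<le> A * exp \<alpha> * exp (- ((\<alpha> / exp 1) * (2 * pi / B) powr (1 / \<alpha>)) * kn k powr (1 / \<alpha>))"
proof -
  obtain i where i: "kn k = \<bar>real_of_int (k $ i)\<bar>"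
  proof -
    have m: "Max (range (\<lambda>i. \<bar>real_of_int (k $ i)\<bar>)) \<in> range (\<lambda>i. \<bar>real_of_int (k $ i)\<bar>)"
      by (rule Max_in) auto
    then have "Max (range (\<lambda>i. \<bar>real_of_int (k $ i)\<bar>)) \<le> kn k" using nth_le_kn[of k] by auto
    moreover have "kn k \<le> Max (range (\<lambda>i. \<bar>real_of_int (k $ i)\<bar>))"
      unfolding kn_def infnorm_le_iff by auto
    ultimately have "kn k = Max (range (\<lambda>i. \<bar>real_of_int (k $ i)\<bar>))" by (intro antisym)
    then have "kn k \<in> range (\<lambda>i. \<bar>real_of_int (k $ i)\<bar>)" using m by (simp only:)
    then show ?thesis using that by auto
  qed
  define x where "x = 2 * pi * kn k / B"
  have x: "x \<ge> 0" using B by (simp add: x_def)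
  define E where "E = exp \<alpha> * exp (- (\<alpha> / exp 1) * x powr (1 / \<alpha>))"
  have xp: "x powr (1 / \<alpha>) = (2 * pi / B) powr (1 / \<alpha>) * kn k powr (1 / \<alpha>)"
    unfolding x_def by (simp flip: powr_mult)
  have fcp: "norm (fc g0 k) * x ^ p \<le> A * fact p powr \<alpha>" for p
  proof -
    have "norm (fc (G i p) k) \<le> A * fact p powr \<alpha> * B ^ p" by (rule norm_fc_le[OF cont bd])
    moreover have "fc (G i p) k = (2 * pi * \<i> * of_int (k $ i)) ^ p * fc g0 k"
      using fc_iterated_derivative[of "G i" i p k, OF cont per der] G0 by simp
    ultimately have "(2 * pi * kn k) ^ p * norm (fc g0 k) \<le> A * fact p powr \<alpha> * B ^ p"
      by (simp add: norm_mult norm_power i)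
    then show ?thesis using B by (simp add: x_def power_divide field_simps)
  qed
  have "norm (fc g0 k) \<le> A * E"
  proof (cases "x = 0")
    case True
    have "norm (fc g0 k) \<le> A * 1" using fcp[of 0] by simp
    also have "\<dots> \<le> A * E" using A \<alpha> True by (intro mult_left_mono) (auto simp: E_def)
    finally show ?thesis .
  next
    case False
    obtain p where p: "fact p powr \<alpha> \<le> x ^ p * E" using exists_gevrey_order[OF x \<alpha>] unfolding E_def by blast
    have "norm (fc g0 k) * x ^ p \<le> A * (x ^ p * E)"
      using fcp[of p] mult_left_mono[OF p A] by linarith
    then have "norm (fc g0 k) * x ^ p \<le> (A * E) * x ^ p" by (simp add: mult_ac)
    then show ?thesis by (rule mult_right_le_imp_le) (use x False in simp)
  qed
  then show ?thesis by (simp add: E_def xp mult.assoc)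
qed

text \<open>\<open>g\<close> is a family of partial derivatives of \<open>f\<close> that satisfies the Gevrey bounds with the constant \<open>\<epsilon>\<close>.\<close>

locale perturbation =
  fixes \<alpha> L R \<epsilon> :: real and f :: "'n::finite phase \<Rightarrow> real" and g :: "('n + 'n \<Rightarrow> nat) \<Rightarrow> 'n phase \<Rightarrow> real"
  assumes \<alpha>: "\<alpha> \<ge> 1" and L: "L > 0" and R: "R > 0" and eps: "\<epsilon> > 0"
    and jet: "jet_on (phase_dom R) f g"
    and bound: "\<And>l x. x \<in> phase_dom R \<Longrightarrow>
      \<bar>g l x\<bar> \<le> \<epsilon> * ((\<Prod>j\<in>UNIV. fact (l j)) powr \<alpha> * L powr (- (real (\<Sum>j\<in>UNIV. l j) * \<alpha>)))"
    and f_per: "\<And>\<theta> I k. (\<theta>, I) \<in> phase_dom R \<Longrightarrow> f (\<theta> + rv k, I) = f (\<theta>, I)"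
begin

abbreviation D where "D \<equiv> phase_dom R :: 'n phase set"

text \<open>By induction on the order: a derivative within the domain is determined by the function on the domain.\<close>

lemma g_periodic: "(\<theta>, I) \<in> D \<Longrightarrow> g l (\<theta> + rv k, I) = g l (\<theta>, I)"
proof (induction "\<Sum>j\<in>UNIV. l j" arbitrary: l \<theta> I)
  case 0
  then have "l = (\<lambda>_. 0)" by (auto simp: fun_eq_iff)
  moreover have "(\<theta> + rv k, I) \<in> D" using 0 by (simp add: mem_phase_dom)
  ultimately show ?case using jet f_per[of \<theta> I k] 0 by (simp add: jet_on_def)
next
  case (Suc m)
  then obtain j where j: "l j \<noteq> 0" by (metis (no_types, lifting) nat.distinct(1) sum.neutral)
  define l' where "l' = l(j := l j - 1)"
  have l: "l = l'(j := Suc (l' j))" using j by (simp add: l'_def)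
  have "(\<Sum>j\<in>UNIV. l j) = Suc (\<Sum>j\<in>UNIV. l' j)"
  proof -
    have "(\<Sum>i\<in>UNIV. l i) = l j + (\<Sum>i\<in>UNIV - {j}. l i)" by (rule sum.remove) auto
    moreover have "(\<Sum>i\<in>UNIV. l' i) = l' j + (\<Sum>i\<in>UNIV - {j}. l' i)" by (rule sum.remove) auto
    moreover have "(\<Sum>i\<in>UNIV - {j}. l' i) = (\<Sum>i\<in>UNIV - {j}. l i)" by (rule sum.cong) (auto simp: l'_def)
    ultimately show ?thesis using j by (simp add: l'_def)
  qed
  then have m: "m = (\<Sum>j\<in>UNIV. l' j)" using Suc.hyps(2) by simp
  let ?x = "(\<theta>, I)" and ?y = "(\<theta> + rv k, I)"
  have y: "?y \<in> D" using Suc.prems by (simp add: mem_phase_dom)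
  let ?S = "{s. ?x + s *\<^sub>R coord_dir j \<in> D}"
  have S: "{s. ?y + s *\<^sub>R coord_dir j \<in> D} = ?S"
    by (cases j) (auto simp: coord_dir_def phase_dom_def)
  have eq: "g l' (?y + s *\<^sub>R coord_dir j) = g l' (?x + s *\<^sub>R coord_dir j)" if "s \<in> ?S" for s
  proof -
    obtain \<theta>' I' where xs: "?x + s *\<^sub>R coord_dir j = (\<theta>', I')" by force
    then have "?y + s *\<^sub>R coord_dir j = (\<theta>' + rv k, I')" by (auto simp: prod_eq_iff algebra_simps)
    then show ?thesis using Suc.hyps(1)[OF m, of \<theta>' I'] that xs by simp
  qed
  have "((\<lambda>s. g l' (?x + s *\<^sub>R coord_dir j)) has_real_derivative g l ?x) (at 0 within ?S)"
    using jet_on_derivative[OF jet Suc.prems, of l' j] l by simp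
  moreover have "((\<lambda>s. g l' (?x + s *\<^sub>R coord_dir j)) has_real_derivative g l ?y) (at 0 within ?S)"
  proof (rule has_field_derivative_transform_within[of _ _ _ _ 1])
    show "((\<lambda>s. g l' (?y + s *\<^sub>R coord_dir j)) has_real_derivative g l ?y) (at 0 within ?S)"
      using jet_on_derivative[OF jet y, of l' j] l S by simp
    show "0 \<in> ?S" using Suc.prems by simp
  qed (use eq in auto)
  ultimately show ?case
    using phase_dom_nontrivial[OF R Suc.prems, of j] by (meson has_field_derivative_unique)
qed

definition ft :: "('n + 'n \<Rightarrow> nat) \<Rightarrow> real^'n \<Rightarrow> real^'n \<Rightarrow> complex" where
  "ft l I \<theta> = of_real (g l (\<theta>, I))"

lemma ft_periodic: "I \<in> aball R \<Longrightarrow> periodic (ft l I)"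
  using g_periodic[of _ I l] by (simp add: periodic_def ft_def mem_phase_dom)

lemma ft_continuous2: "continuous_on (aball R \<times> S) (\<lambda>(I, \<theta>). ft l I \<theta>)"
proof -
  have "continuous_on D (g l)" using jet by (simp add: jet_on_def)
  then have "continuous_on (aball R \<times> S) (\<lambda>x. g l (snd x, fst x))"
    by (rule continuous_on_compose2) (auto intro!: continuous_intros simp: mem_phase_dom)
  then show ?thesis unfolding ft_def case_prod_unfold by (intro continuous_intros)
qed

lemma ft_continuous: "I \<in> aball R \<Longrightarrow> continuous_on S (ft l I)"
proof -
  assume I: "I \<in> aball R"
  have "continuous_on S (\<lambda>\<theta>. (\<lambda>(I, \<theta>). ft l I \<theta>) (I, \<theta>))"
    by (rule continuous_on_compose2[OF ft_continuous2[of S l]]) (use I in \<open>auto intro!: continuous_intros\<close>)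
  then show ?thesis by simp
qed

lemma ft_derivative_angle:
  assumes I: "I \<in> aball R"
  shows "((\<lambda>s. ft l I (\<theta> + s *\<^sub>R axis i 1)) has_vector_derivative ft (l(Inl i := Suc (l (Inl i)))) I \<theta>) (at 0)"
proof -
  have x: "(\<theta>, I) \<in> D" using I by (simp add: mem_phase_dom)
  have "((\<lambda>s. g l ((\<theta>, I) + s *\<^sub>R coord_dir (Inl i))) has_vector_derivative g (l(Inl i := Suc (l (Inl i)))) (\<theta>, I)) (at 0)"
    using jet_on_derivative[OF jet x, of l "Inl i"] phase_dom_direction(1)[OF x]
    by (simp add: has_real_derivative_iff_has_vector_derivative)
  from bounded_linear.has_vector_derivative[OF bounded_linear_of_real this]
  show ?thesis by (simp add: ft_def coord_dir_def)
qed

lemma ft_derivative_action: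
  assumes I: "I \<in> aball R"
  shows "((\<lambda>s. ft l (I + s *\<^sub>R axis i 1) \<theta>) has_vector_derivative ft (l(Inr i := Suc (l (Inr i)))) I \<theta>)
    (at 0 within {s. I + s *\<^sub>R axis i 1 \<in> aball R})"
proof -
  have x: "(\<theta>, I) \<in> D" using I by (simp add: mem_phase_dom)
  have "((\<lambda>s. g l ((\<theta>, I) + s *\<^sub>R coord_dir (Inr i))) has_vector_derivative g (l(Inr i := Suc (l (Inr i)))) (\<theta>, I))
      (at 0 within {s. I + s *\<^sub>R axis i 1 \<in> aball R})"
    using jet_on_derivative[OF jet x, of l "Inr i"] phase_dom_direction(2)[OF x]
    by (simp add: has_real_derivative_iff_has_vector_derivative)
  from bounded_linear.has_vector_derivative[OF bounded_linear_of_real this]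
  show ?thesis by (simp add: ft_def coord_dir_def)
qed

definition size_fac :: "('n + 'n \<Rightarrow> nat) \<Rightarrow> real" where
  "size_fac l = (\<Prod>j\<in>UNIV. fact (l j)) powr \<alpha> * L powr (- (real (\<Sum>j\<in>UNIV. l j) * \<alpha>))"

lemma size_fac_nonneg: "size_fac l \<ge> 0" by (simp add: size_fac_def)

text \<open>The factor \<open>2 powr (\<alpha> p)\<close> absorbs the passage from \<open>p!\<close> to \<open>(p + 1)!\<close>, needed when one
  derivative in the same direction has been taken already.\<close>

lemma ft_bound:
  assumes I: "I \<in> aball R" and l: "l (Inl i) \<le> 1"
  shows "norm (ft (l(Inl i := l (Inl i) + p)) I \<theta>) \<le> (\<epsilon> * size_fac l) * fact p powr \<alpha> * (2 powr \<alpha> * L powr (- \<alpha>)) ^ p"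
proof -
  let ?l = "l(Inl i := l (Inl i) + p)"
  let ?P = "\<Prod>j\<in>UNIV - {Inl i}. fact (l j) :: real"
  have P: "?P > 0" by (rule prod_pos) simp
  have f: "(fact (l (Inl i) + p) :: real) \<le> fact (l (Inl i)) * (fact p * 2 ^ p)"
  proof (cases "l (Inl i)")
    case 0
    have "(fact p :: real) * 1 \<le> fact p * 2 ^ p" by (intro mult_left_mono) auto
    then show ?thesis using 0 by simp
  next
    case (Suc q)
    then have "l (Inl i) = 1" using l by simp
    moreover have "real (Suc p) \<le> 2 ^ p"
      using of_nat_mono[OF Suc_leI[OF less_exp[of p]], where 'a=real] by simp
    then have "fact p * real (Suc p) \<le> fact p * 2 ^ p" by (intro mult_left_mono) auto
    ultimately show ?thesis by (simp add: mult.commute)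
  qed
  have prod: "(\<Prod>j\<in>UNIV. fact (?l j)) = fact (l (Inl i) + p) * ?P" "(\<Prod>j\<in>UNIV. fact (l j)) = fact (l (Inl i)) * ?P"
    by (subst prod.remove[of _ "Inl i"]; simp)+
  have sum: "(\<Sum>j\<in>UNIV. ?l j) = (\<Sum>j\<in>UNIV. l j) + p"
    by (subst (1 2) sum.remove[of _ "Inl i"]) auto
  have "(\<Prod>j\<in>UNIV. fact (?l j)) powr \<alpha> \<le> ((\<Prod>j\<in>UNIV. fact (l j)) * (fact p * 2 ^ p)) powr \<alpha>"
    unfolding prod using f P \<alpha> by (intro powr_mono2) (auto simp: mult_ac intro!: mult_right_mono)
  also have "\<dots> = (\<Prod>j\<in>UNIV. fact (l j)) powr \<alpha> * (fact p powr \<alpha> * (2 powr \<alpha>) ^ p)"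
  proof -
    have "((2::real) ^ p) powr \<alpha> = (2 powr \<alpha>) ^ p"
      by (simp add: powr_powr mult.commute flip: powr_realpow)
    then show ?thesis by (simp add: powr_mult)
  qed
  finally have 1: "(\<Prod>j\<in>UNIV. fact (?l j)) powr \<alpha> \<le> (\<Prod>j\<in>UNIV. fact (l j)) powr \<alpha> * (fact p powr \<alpha> * (2 powr \<alpha>) ^ p)" .
  have 2: "L powr (- (real (\<Sum>j\<in>UNIV. ?l j) * \<alpha>)) = L powr (- (real (\<Sum>j\<in>UNIV. l j) * \<alpha>)) * (L powr (- \<alpha>)) ^ p"
  proof -
    have "(L powr (- \<alpha>)) ^ p = L powr (- (real p * \<alpha>))"
      using L by (simp add: powr_powr mult.commute flip: powr_realpow)
    then show ?thesis unfolding sum by (simp add: algebra_simps flip: powr_add)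
  qed
  have "norm (ft ?l I \<theta>) \<le> \<epsilon> * ((\<Prod>j\<in>UNIV. fact (?l j)) powr \<alpha> * L powr (- (real (\<Sum>j\<in>UNIV. ?l j) * \<alpha>)))"
    using bound[of "(\<theta>, I)" ?l] I by (simp add: ft_def mem_phase_dom)
  also have "\<dots> \<le> \<epsilon> * (((\<Prod>j\<in>UNIV. fact (l j)) powr \<alpha> * (fact p powr \<alpha> * (2 powr \<alpha>) ^ p)) * (L powr (- (real (\<Sum>j\<in>UNIV. l j) * \<alpha>)) * (L powr (- \<alpha>)) ^ p))"
    unfolding 2 using 1 eps by (intro mult_left_mono mult_right_mono) auto
  also have "\<dots> = (\<epsilon> * size_fac l) * fact p powr \<alpha> * (2 powr \<alpha> * L powr (- \<alpha>)) ^ p"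
    by (simp add: size_fac_def power_mult_distrib mult_ac)
  finally show ?thesis .
qed

abbreviation \<tau> where "\<tau> \<equiv> tau \<alpha> L"

lemma tau_pos: "\<tau> > 0"
  using \<alpha> L by (simp add: tau_def)

lemma fc_ft_le:
  assumes I: "I \<in> aball R" and l: "\<And>i. l (Inl i) \<le> 1"
  shows "norm (fc (ft l I) k) \<le> \<epsilon> * size_fac l * exp \<alpha> * exp (- \<tau> * kn k powr (1 / \<alpha>))"
proof -
  have "norm (fc (ft l I) k) \<le> (\<epsilon> * size_fac l) * exp \<alpha> *
      exp (- ((\<alpha> / exp 1) * (2 * pi / (2 powr \<alpha> * L powr (- \<alpha>))) powr (1 / \<alpha>)) * kn k powr (1 / \<alpha>))"
  proof (rule fc_decay[where G="\<lambda>i p. ft (l(Inl i := l (Inl i) + p)) I"])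
    show "((\<lambda>s. ft (l(Inl i := l (Inl i) + p)) I (\<theta> + s *\<^sub>R axis i 1)) has_vector_derivative
        ft (l(Inl i := l (Inl i) + Suc p)) I \<theta>) (at 0)" for i p \<theta>
      using ft_derivative_angle[OF I, of "l(Inl i := l (Inl i) + p)" \<theta> i] by simp
    show "norm (ft (l(Inl i := l (Inl i) + p)) I \<theta>)
        \<le> (\<epsilon> * size_fac l) * fact p powr \<alpha> * (2 powr \<alpha> * L powr (- \<alpha>)) ^ p" for i p \<theta>
      by (rule ft_bound[where l=l]) (rule I, rule l)
  qed (use \<alpha> L eps size_fac_nonneg in \<open>auto intro!: ft_continuous ft_periodic I\<close>)
  then show ?thesis by (simp add: tau_def)
qed

end

section \<open>The truncated Hamiltonian as an observable\<close>

lemma has_vector_derivative_shift_within: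
  fixes e x :: "'a::real_vector" and h :: "'a \<Rightarrow> 'b::real_normed_vector"
  assumes "((\<lambda>\<sigma>. h ((x + s *\<^sub>R e) + \<sigma> *\<^sub>R e)) has_vector_derivative d) (at 0 within {\<sigma>. (x + s *\<^sub>R e) + \<sigma> *\<^sub>R e \<in> D})"
  shows "((\<lambda>r. h (x + r *\<^sub>R e)) has_vector_derivative d) (at s within {r. x + r *\<^sub>R e \<in> D})"
proof -
  let ?U = "{r. x + r *\<^sub>R e \<in> D}"
  have pt: "(x + s *\<^sub>R e) + (r - s) *\<^sub>R e = x + r *\<^sub>R e" for r
    by (simp add: scaleR_left_diff_distrib)
  have img: "(\<lambda>r. r - s) ` ?U \<subseteq> {\<sigma>. (x + s *\<^sub>R e) + \<sigma> *\<^sub>R e \<in> D}"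
    by (unfold image_subset_iff Ball_def mem_Collect_eq pt) blast
  have "((\<lambda>r. r - s) has_vector_derivative 1) (at s within ?U)"
    by (auto intro!: derivative_eq_intros)
  moreover have "((\<lambda>\<sigma>. h ((x + s *\<^sub>R e) + \<sigma> *\<^sub>R e)) has_vector_derivative d) (at (s - s) within (\<lambda>r. r - s) ` ?U)"
    using has_vector_derivative_within_subset[OF assms img] by simp
  ultimately have "((\<lambda>\<sigma>. h ((x + s *\<^sub>R e) + \<sigma> *\<^sub>R e)) \<circ> (\<lambda>r. r - s) has_vector_derivative 1 *\<^sub>R d) (at s within ?U)"
    by (rule vector_diff_chain_within)
  then show ?thesis by (simp only: o_def pt scaleR_one)
qed

text \<open>The multi-index that differentiates in the actions only.\<close>

definition jact :: "nat^('n::finite) \<Rightarrow> 'n + 'n \<Rightarrow> nat" where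
  "jact l = case_sum (\<lambda>_. 0) (\<lambda>i. l $ i)"

lemma jact_axis: "jact (l + axis i 1) = (jact l)(Inr i := Suc (jact l (Inr i)))"
  by (auto simp: jact_def fun_eq_iff axis_def split: sum.splits)

lemma jact_zero: "jact 0 = (\<lambda>_. 0)"
  by (auto simp: jact_def fun_eq_iff split: sum.splits)

lemma finite_modes: "finite {k :: int^('n::finite). kn k \<le> K}"
proof -
  have "{k :: int^'n. kn k \<le> K} \<subseteq> (\<lambda>f. \<chi> i. f i) ` (\<Pi>\<^sub>E i\<in>UNIV. {-\<lceil>K\<rceil>..\<lceil>K\<rceil>})"
  proof
    fix k :: "int^'n" assume "k \<in> {k. kn k \<le> K}"
    then have "\<bar>real_of_int (k $ i)\<bar> \<le> K" for i using nth_le_kn[of k i] by simp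
    then have "\<bar>real_of_int (k $ i)\<bar> \<le> real_of_int \<lceil>K\<rceil>" for i
      using le_of_int_ceiling[of K] order_trans by blast
    then have "\<bar>k $ i\<bar> \<le> \<lceil>K\<rceil>" for i by (metis of_int_abs of_int_le_iff)
    then have "(\<lambda>i. k $ i) \<in> (\<Pi>\<^sub>E i\<in>UNIV. {-\<lceil>K\<rceil>..\<lceil>K\<rceil>})" by (auto simp: abs_le_iff minus_le_iff)
    moreover have "k = (\<chi> i. (\<lambda>i. k $ i) i)" by (simp add: vec_eq_iff)
    ultimately show "k \<in> (\<lambda>f. \<chi> i. f i) ` (\<Pi>\<^sub>E i\<in>UNIV. {-\<lceil>K\<rceil>..\<lceil>K\<rceil>})" by blast
  qed
  moreover have "finite (\<Pi>\<^sub>E i\<in>(UNIV :: 'n set). {-\<lceil>K\<rceil>..\<lceil>K\<rceil>})" by (intro finite_PiE) auto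
  ultimately show ?thesis using finite_subset by blast
qed

lemma ev_one: "ev \<theta> I 1 = 1"
proof -
  have "ev \<theta> I 1 = (\<Sum>k\<in>{0}. jcoef (lk 1 k) 0 I * ek k \<theta>)"
    by (rule ev_superset) (auto simp: lookup_one in_keys_iff when_def split: if_splits)
  then show ?thesis by (simp add: lookup_one one_jet_def ek_zero)
qed

context perturbation
begin

sublocale gw: gevrey_weight \<alpha> "\<tau> / 2" "L powr \<alpha> / (2 * exp 1)" R "TYPE('n)"
  by unfold_locales (use \<alpha> L R tau_pos in auto)

lemma fc_ft_continuous: "continuous_on (aball R) (\<lambda>I. fc (ft l I) k)"
proof -
  have "continuous_on (aball R \<times> unit_cube) (\<lambda>x. (\<lambda>(I, \<theta>). ft l I \<theta>) x * ek (- k) (snd x))"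
    by (intro continuous_on_mult ft_continuous2 continuous_intros)
  then have "continuous_on (aball R \<times> unit_cube) (\<lambda>(I, \<theta>). ft l I \<theta> * ek (- k) \<theta>)"
    by (simp add: case_prod_unfold)
  then show ?thesis unfolding fc_def by (rule integral_continuous_on_param)
qed

text \<open>Differentiation under the integral sign, within the interval of parameters for which the action stays in the cube.\<close>

lemma fc_ft_derivative:
  assumes I: "I \<in> aball R"
  shows "((\<lambda>s. fc (ft l (I + s *\<^sub>R axis i 1)) k) has_vector_derivative fc (ft (l(Inr i := Suc (l (Inr i)))) I) k)
    (at 0 within {s. I + s *\<^sub>R axis i 1 \<in> aball R})"
proof -
  let ?U = "{s. I + s *\<^sub>R axis i 1 \<in> aball R}"
  let ?l = "l(Inr i := Suc (l (Inr i)))"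
  have "((\<lambda>s. integral unit_cube (\<lambda>\<theta>. ft l (I + s *\<^sub>R axis i 1) \<theta> * ek (- k) \<theta>)) has_vector_derivative
      integral unit_cube (\<lambda>\<theta>. ft ?l (I + 0 *\<^sub>R axis i 1) \<theta> * ek (- k) \<theta>)) (at 0 within ?U)"
  proof (rule leibniz_rule_vector_derivative)
    fix s :: real and \<theta> :: "real^'n" assume s: "s \<in> ?U"
    have "((\<lambda>s. ft l (I + s *\<^sub>R axis i 1) \<theta>) has_vector_derivative ft ?l (I + s *\<^sub>R axis i 1) \<theta>) (at s within ?U)"
      by (rule has_vector_derivative_shift_within) (use ft_derivative_action s in blast)
    then show "((\<lambda>s. ft l (I + s *\<^sub>R axis i 1) \<theta> * ek (- k) \<theta>) has_vector_derivative
        ft ?l (I + s *\<^sub>R axis i 1) \<theta> * ek (- k) \<theta>) (at s within ?U)"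
      by (rule has_vector_derivative_mult_left)
  next
    fix s assume "s \<in> ?U"
    then show "(\<lambda>\<theta>. ft l (I + s *\<^sub>R axis i 1) \<theta> * ek (- k) \<theta>) integrable_on unit_cube"
      by (intro integrable_continuous continuous_on_mult ft_continuous continuous_intros) auto
  next
    have "continuous_on (?U \<times> unit_cube) (\<lambda>x. (\<lambda>(I, \<theta>). ft ?l I \<theta>) (I + fst x *\<^sub>R axis i 1, snd x))"
      by (rule continuous_on_compose2[OF ft_continuous2[of UNIV ?l]]) (auto intro!: continuous_intros)
    then have "continuous_on (?U \<times> unit_cube) (\<lambda>x. (\<lambda>(I, \<theta>). ft ?l I \<theta>) (I + fst x *\<^sub>R axis i 1, snd x) * ek (- k) (snd x))"
      by (intro continuous_on_mult continuous_intros)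
    then show "continuous_on (?U \<times> unit_cube) (\<lambda>(s, \<theta>). ft ?l (I + s *\<^sub>R axis i 1) \<theta> * ek (- k) \<theta>)"
      by (simp add: case_prod_unfold)
  next
    show "0 \<in> ?U" using I by simp
    show "convex ?U" unfolding aball_shift_interval[OF I] by (rule convex_real_interval)
  qed
  then show ?thesis by (simp add: fc_def)
qed

definition jetk :: "int^'n \<Rightarrow> 'n jet" where
  "jetk k = Jet (\<lambda>l I. fc (ft (jact l) I) k / of_real (lfact l))"

lemma jet_smooth_jetk: "jet_smooth R (jetk k)"
  unfolding jet_smooth_def
proof (intro conjI allI ballI)
  show "continuous_on (aball R) (jcoef (jetk k) l)" for l
    unfolding jetk_def jcoef_Jet divide_inverse
    by (intro continuous_on_mult_right fc_ft_continuous)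
  fix l i and I :: "real^'n" assume I: "I \<in> aball R"
  have "((\<lambda>s. fc (ft (jact l) (I + s *\<^sub>R axis i 1)) k * inverse (of_real (lfact l))) has_vector_derivative
      fc (ft (jact (l + axis i 1)) I) k * inverse (of_real (lfact l))) (at 0 within {s. I + s *\<^sub>R axis i 1 \<in> aball R})"
    unfolding jact_axis by (intro has_vector_derivative_mult_left fc_ft_derivative I)
  moreover have "fc (ft (jact (l + axis i 1)) I) k * inverse (of_real (lfact l)) = jcoef (jd i (jetk k)) l I"
    unfolding jd_def jetk_def jcoef_Jet lfact_Suc
    by (simp add: divide_simps del: of_nat_Suc)
  ultimately show "((\<lambda>s. jcoef (jetk k) l (I + s *\<^sub>R axis i 1)) has_vector_derivative jcoef (jd i (jetk k)) l I)
      (at 0 within {s. I + s *\<^sub>R axis i 1 \<in> aball R})"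
    by (simp add: jetk_def divide_inverse)
qed

definition H1 :: "real \<Rightarrow> 'n obs" where
  "H1 K = (\<Sum>k | kn k \<le> K. Poly_Mapping.single k (jetk k))"

lemma lk_H1: "lk (H1 K) k = (if kn k \<le> K then jetk k else 0)"
  by (simp add: H1_def lookup_sum lookup_single when_def finite_modes)

lemma obs_smooth_H1: "obs_smooth R (H1 K)"
  by (simp add: obs_smooth_def lk_H1 jet_smooth_jetk jet_smooth_0)

lemma size_fac_jact: "size_fac (jact l) = lfact l powr \<alpha> * L powr (- (real (lsum l) * \<alpha>))"
proof -
  have "(\<Prod>j\<in>UNIV. fact (jact l j)) = lfact l"
    unfolding UNIV_Plus_UNIV[symmetric] by (subst prod.Plus) (simp_all add: jact_def lfact_def)
  moreover have "(\<Sum>j\<in>UNIV. jact l j) = lsum l"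
    unfolding UNIV_Plus_UNIV[symmetric] by (subst sum.Plus) (simp_all add: jact_def lsum_def)
  ultimately show ?thesis by (simp only: size_fac_def)
qed

lemma size_fac_single: "size_fac ((\<lambda>_. 0)(j := 1)) = L powr (- \<alpha>)"
proof -
  have "fact (((\<lambda>_. 0)(j := 1)) i) = (1 :: real)" for i by simp
  moreover have "(\<Sum>i\<in>UNIV. ((\<lambda>_. 0)(j := 1)) i) = (1 :: nat)" by (subst sum.remove[of _ j]) auto
  ultimately show ?thesis unfolding size_fac_def by simp
qed

definition A1 :: real where "A1 = exp \<alpha> * lattice_const \<alpha> (\<tau> / 2) CARD('n) * 2 ^ CARD('n)"

lemma A1_pos: "A1 > 0" by (simp add: A1_def lattice_const_pos)

text \<open>Half of the decay rate \<open>\<tau>\<close> of the Fourier coefficients is used up by the weight, the other half makes the sum over \<open>k\<close>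
  converge. With \<open>\<rho> = L powr \<alpha> / (2 * exp 1)\<close> the sum over \<open>l\<close> is one of powers of \<open>1 / 2\<close>.\<close>

lemma nle_H1: "gw.nle 1 (\<epsilon> * A1) (H1 K)"
proof (rule gw.nleI)
  fix I :: "real^'n" and F :: "((int^'n) \<times> (nat^'n)) set" assume I: "I \<in> aball R" and F: "finite F"
  let ?E = "\<lambda>k :: int^'n. exp (- (\<tau> / 2) * kn k powr (1 / \<alpha>))"
  have tm: "gw.wt 1 k l * norm (jcoef (lk (H1 K) k) l I) \<le> \<epsilon> * exp \<alpha> * (?E k * (1 / 2) ^ lsum l)" for k l
  proof (cases "kn k \<le> K")
    case False
    then show ?thesis using eps by (simp add: lk_H1 zero_jet_def)
  next
    case True
    have e: "exp (real (lsum l)) * (L powr \<alpha> / (2 * exp 1)) ^ lsum l = (L powr \<alpha>) ^ lsum l * (1 / 2) ^ lsum l"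
    proof -
      have "exp (real (lsum l)) = exp (1 :: real) ^ lsum l" using exp_of_nat_mult[of "lsum l" "1::real"] by simp
      then show ?thesis by (simp flip: power_mult_distrib)
    qed
    have L1: "(L powr \<alpha>) ^ lsum l * L powr (- (real (lsum l) * \<alpha>)) = 1"
    proof -
      have "(L powr \<alpha>) ^ lsum l = L powr (real (lsum l) * \<alpha>)"
        using L by (simp add: powr_powr mult.commute flip: powr_realpow)
      then show ?thesis using L by (simp flip: powr_add)
    qed
    have l1: "lfact l powr (1 - \<alpha>) * lfact l powr \<alpha> / lfact l = 1"
      by (simp add: abs_of_pos[OF lfact_pos] flip: powr_add)
    have x: "exp (\<tau> / 2 * kn k powr (1 / \<alpha>)) * exp (- \<tau> * kn k powr (1 / \<alpha>)) = ?E k"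
      by (simp add: algebra_simps flip: exp_add)
    have w: "gw.wt 1 k l = exp (\<tau> / 2 * kn k powr (1 / \<alpha>)) * lfact l powr (1 - \<alpha>) * ((L powr \<alpha>) ^ lsum l * (1 / 2) ^ lsum l)"
      unfolding gw.wt_def e[symmetric] by (simp add: exp_add)
    have "norm (jcoef (lk (H1 K) k) l I) = norm (fc (ft (jact l) I) k) / lfact l"
      using True by (simp add: lk_H1 jetk_def norm_divide abs_of_pos[OF lfact_pos])
    also have "\<dots> \<le> \<epsilon> * size_fac (jact l) * exp \<alpha> * exp (- \<tau> * kn k powr (1 / \<alpha>)) / lfact l"
      by (intro divide_right_mono fc_ft_le[OF I]) (simp_all add: jact_def less_imp_le)
    finally have "gw.wt 1 k l * norm (jcoef (lk (H1 K) k) l I) \<le>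
        gw.wt 1 k l * (\<epsilon> * size_fac (jact l) * exp \<alpha> * exp (- \<tau> * kn k powr (1 / \<alpha>)) / lfact l)"
      using gw.wt_pos[of 1 k l] by (intro mult_left_mono) auto
    also have "\<dots> = \<epsilon> * exp \<alpha> * ((exp (\<tau> / 2 * kn k powr (1 / \<alpha>)) * exp (- \<tau> * kn k powr (1 / \<alpha>))) * (1 / 2) ^ lsum l) *
        ((L powr \<alpha>) ^ lsum l * L powr (- (real (lsum l) * \<alpha>))) * (lfact l powr (1 - \<alpha>) * lfact l powr \<alpha> / lfact l)"
      unfolding w size_fac_jact by (simp only: times_divide_eq_left times_divide_eq_right mult_ac)
    also have "\<dots> = \<epsilon> * exp \<alpha> * (?E k * (1 / 2) ^ lsum l)"
      unfolding x L1 l1 by simp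
    finally show ?thesis .
  qed
  have "(\<Sum>x\<in>F. gw.wt 1 (fst x) (snd x) * norm (jcoef (lk (H1 K) (fst x)) (snd x) I))
      \<le> (\<Sum>x\<in>F. \<epsilon> * exp \<alpha> * (?E (fst x) * (1 / 2) ^ lsum (snd x)))"
    by (intro sum_mono tm)
  also have "\<dots> \<le> (\<Sum>x\<in>fst ` F \<times> snd ` F. \<epsilon> * exp \<alpha> * (?E (fst x) * (1 / 2) ^ lsum (snd x)))"
    using F eps by (intro sum_mono2 subset_fst_snd) auto
  also have "\<dots> = \<epsilon> * exp \<alpha> * ((\<Sum>k\<in>fst ` F. ?E k) * (\<Sum>l\<in>snd ` F. (1 / 2) ^ lsum l))"
  proof -
    have "(\<Sum>k\<in>fst ` F. ?E k) * (\<Sum>l\<in>snd ` F. (1 / 2) ^ lsum l)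
        = (\<Sum>x\<in>fst ` F \<times> snd ` F. ?E (fst x) * (1 / 2) ^ lsum (snd x))"
      unfolding sum_product sum.cartesian_product by (simp only: case_prod_unfold)
    then show ?thesis by (subst sum_distrib_left[symmetric]) (simp only:)
  qed
  also have "\<dots> \<le> \<epsilon> * exp \<alpha> * (lattice_const \<alpha> (\<tau> / 2) CARD('n) * 2 ^ CARD('n))"
    using F eps \<alpha> tau_pos lattice_const_pos[of \<alpha> "\<tau> / 2" "CARD('n)"]
    by (intro mult_left_mono mult_mono sum_exp_kn_le sum_half_powers_le) (auto intro!: sum_nonneg simp: less_imp_le)
  finally show "(\<Sum>x\<in>F. gw.wt 1 (fst x) (snd x) * norm (jcoef (lk (H1 K) (fst x)) (snd x) I)) \<le> \<epsilon> * A1"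
    by (simp add: A1_def mult.assoc)
qed

text \<open>The error of the Fourier truncation of a first partial derivative; \<open>L powr (- \<alpha>)\<close> is the Gevrey factor of order one.\<close>

definition E0 :: "real \<Rightarrow> real" where
  "E0 K = \<epsilon> * L powr (- \<alpha>) * exp \<alpha> * lattice_const \<alpha> (\<tau> / 2) CARD('n) * exp (- (\<tau> / 2) * K powr (1 / \<alpha>))"

lemma truncation_error:
  assumes I: "I \<in> aball R" and K: "K \<ge> 0"
  shows "norm (ft ((\<lambda>_. 0)(j := 1)) I \<theta> - (\<Sum>k | kn k \<le> K. fc (ft ((\<lambda>_. 0)(j := 1)) I) k * ek k \<theta>)) \<le> E0 K"
proof -
  let ?l = "(\<lambda>_. 0)(j := 1) :: 'n + 'n \<Rightarrow> nat"
  define C where "C = \<epsilon> * L powr (- \<alpha>) * exp \<alpha>"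
  have C: "C \<ge> 0" using eps by (simp add: C_def)
  define b where "b k = C * exp (- \<tau> * kn k powr (1 / \<alpha>))" for k :: "int^'n"
  have sb: "sum b F \<le> C * lattice_const \<alpha> \<tau> CARD('n)" if "finite F" for F
    unfolding b_def sum_distrib_left[symmetric]
    using that \<alpha> tau_pos by (intro mult_left_mono sum_exp_kn_le C) auto
  show ?thesis
  proof (rule fourier_truncation[where b=b])
    show "norm (fc (ft ?l I) k) \<le> b k" for k
      unfolding b_def C_def size_fac_single[of j, symmetric] by (rule fc_ft_le[where l="?l"]) (use I in auto)
    show "b summable_on UNIV"
      using sb C by (intro nonneg_bdd_above_summable_on bdd_aboveI2[of _ _ "C * lattice_const \<alpha> \<tau> CARD('n)"]) (auto simp: b_def)
    show "sum b F' \<le> E0 K" if F': "finite F'" "F' \<inter> {k. kn k \<le> K} = {}" for F'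
    proof -
      have "b k \<le> C * exp (- (\<tau> / 2) * K powr (1 / \<alpha>)) * exp (- (\<tau> / 2) * kn k powr (1 / \<alpha>))" if "k \<in> F'" for k
      proof -
        have "K powr (1 / \<alpha>) \<le> kn k powr (1 / \<alpha>)"
          using that F' K \<alpha> by (intro powr_mono2) auto
        then have "\<tau> / 2 * K powr (1 / \<alpha>) \<le> \<tau> / 2 * kn k powr (1 / \<alpha>)"
          using tau_pos by (intro mult_left_mono) auto
        then have "exp (- \<tau> * kn k powr (1 / \<alpha>)) \<le> exp (- (\<tau> / 2) * K powr (1 / \<alpha>) + - (\<tau> / 2) * kn k powr (1 / \<alpha>))"
          by (simp add: field_simps)
        then show ?thesis unfolding b_def exp_add mult.assoc using C by (intro mult_left_mono) auto
      qed
      then have "sum b F' \<le> (\<Sum>k\<in>F'. C * exp (- (\<tau> / 2) * K powr (1 / \<alpha>)) * exp (- (\<tau> / 2) * kn k powr (1 / \<alpha>)))"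
        by (intro sum_mono)
      also have "\<dots> \<le> C * exp (- (\<tau> / 2) * K powr (1 / \<alpha>)) * lattice_const \<alpha> (\<tau> / 2) CARD('n)"
        unfolding sum_distrib_left[symmetric] using F' C \<alpha> tau_pos by (intro mult_left_mono sum_exp_kn_le) auto
      also have "\<dots> = E0 K" unfolding E0_def C_def by (simp only: mult_ac)
      finally show ?thesis .
    qed
  qed (use I ft_continuous ft_periodic finite_modes in auto)
qed

lemma ev_dac_H1:
  assumes I: "I \<in> aball R"
  shows "ev \<theta> I (dac j (H1 K)) = (\<Sum>k | kn k \<le> K. fc (ft ((\<lambda>_. 0)(Inr j := 1)) I) k * ek k \<theta>)"
proof -
  have "ev \<theta> I (dac j (H1 K)) = (\<Sum>k | kn k \<le> K. jcoef (lk (dac j (H1 K)) k) 0 I * ek k \<theta>)"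
    by (rule ev_superset[OF finite_modes]) (auto simp: in_keys_iff lk_H1 jd_zero split: if_splits)
  also have "\<dots> = (\<Sum>k | kn k \<le> K. fc (ft ((\<lambda>_. 0)(Inr j := 1)) I) k * ek k \<theta>)"
    using jact_axis[of 0 j] by (intro sum.cong refl) (simp add: lk_H1 jd_def jetk_def jact_zero)
  finally show ?thesis .
qed

lemma ev_dth_H1:
  assumes I: "I \<in> aball R"
  shows "ev \<theta> I (dth j (H1 K)) = (\<Sum>k | kn k \<le> K. fc (ft ((\<lambda>_. 0)(Inl j := 1)) I) k * ek k \<theta>)"
proof -
  have fc: "fc (ft ((\<lambda>_. 0)(Inl j := 1)) I) k = 2 * pi * \<i> * of_int (k $ j) * fc (ft (\<lambda>_. 0) I) k" for k
  proof (rule fc_derivative)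
    show "((\<lambda>s. ft (\<lambda>_. 0) I (\<theta> + s *\<^sub>R axis j 1)) has_vector_derivative ft ((\<lambda>_. 0)(Inl j := 1)) I \<theta>) (at 0)" for \<theta>
      using ft_derivative_angle[OF I, of "\<lambda>_. 0" \<theta> j] by simp
  qed (use I ft_continuous ft_periodic in auto)
  have "ev \<theta> I (dth j (H1 K)) = (\<Sum>k | kn k \<le> K. jcoef (lk (dth j (H1 K)) k) 0 I * ek k \<theta>)"
    by (rule ev_superset[OF finite_modes]) (auto simp: in_keys_iff lk_H1 split: if_splits)
  also have "\<dots> = (\<Sum>k | kn k \<le> K. fc (ft ((\<lambda>_. 0)(Inl j := 1)) I) k * ek k \<theta>)"
    unfolding fc by (intro sum.cong refl) (simp add: lk_H1 jsc_def jetk_def jact_zero)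
  finally show ?thesis .
qed

text \<open>Along a solution, the quasi-integral changes at the rate of its bracket with the truncated
  Hamiltonian, up to the effect of the truncation.\<close>

theorem drift:
  fixes \<omega> v :: "real^'n" and \<theta> I :: "real \<Rightarrow> real^'n"
  defines "V \<equiv> CARD('n) * (R + exp 1 * (L powr \<alpha> / (2 * exp 1)))"
  assumes Psi: "\<Psi> > 0" and m: "m \<ge> 1" and K: "K \<ge> 0"
    and small_div: "\<And>k. kn k \<le> K \<Longrightarrow> kdot k \<omega> \<noteq> 0 \<Longrightarrow> 1 \<le> \<Psi> * (2 * pi * \<bar>kdot k \<omega>\<bar>)"
    and resonant: "\<And>k. kn k \<le> K \<Longrightarrow> kdot k \<omega> = 0 \<Longrightarrow> kdot k v = 0"
    and v: "\<And>i. \<bar>v $ i\<bar> \<le> 1"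
    and threshold: "2 * CARD('n) * gw.c0\<^sup>2 * 16 powr \<alpha> * real (m + 2) powr \<alpha> * \<Psi> * (\<epsilon> * A1) \<le> exp (- 1) / 32"
    and J: "is_interval J" "0 \<in> J" "t \<in> J"
    and sol: "\<And>t. t \<in> J \<Longrightarrow> I t \<in> aball R"
      "\<And>t. t \<in> J \<Longrightarrow> (\<theta> has_vector_derivative (\<chi> i. \<omega> $ i + g ((\<lambda>_. 0)(Inr i := 1)) (\<theta> t, I t))) (at t within J)"
      "\<And>t. t \<in> J \<Longrightarrow> (I has_vector_derivative (\<chi> i. - g ((\<lambda>_. 0)(Inl i := 1)) (\<theta> t, I t))) (at t within J)"
  shows "\<bar>v \<bullet> I t - v \<bullet> I 0\<bar> \<le> 2 * (V * real (m + 2) powr (- \<alpha>)) + \<bar>t\<bar> *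
    (2 * CARD('n) * gw.c0\<^sup>2 * 16 powr \<alpha> * V * (\<epsilon> * A1) * (2 * exp 1 * exp (- (\<tau> / 2 * K powr (1 / \<alpha>) / 4)) + exp (- real m))
      + CARD('n) * (2 * E0 K * (gw.c0 * 4 powr \<alpha> * (2 * V))))"
proof -
  interpret av: averaging \<alpha> "\<tau> / 2" "L powr \<alpha> / (2 * exp 1)" R \<omega> v "H1 K" "\<epsilon> * A1" K \<Psi> m
    by unfold_locales
      (use eps A1_pos Psi m K nle_H1 obs_smooth_H1 small_div resonant v threshold in auto)
  have V: "av.V = V" by (simp add: av.V_def V_def)
  obtain G where G: "obs_smooth R G"
    and near: "\<And>\<theta> I. I \<in> aball R \<Longrightarrow> norm (ev \<theta> I G - of_real (v \<bullet> I)) \<le> V * real (m + 2) powr (- \<alpha>)"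
    and pb: "\<And>\<theta> I. I \<in> aball R \<Longrightarrow> norm (ev \<theta> I (pb G (lin \<omega> + H1 K))) \<le>
      2 * CARD('n) * gw.c0\<^sup>2 * 16 powr \<alpha> * V * (\<epsilon> * A1) * (2 * exp 1 * exp (- (\<tau> / 2 * K powr (1 / \<alpha>) / 4)) + exp (- real m))"
    and Gth: "\<And>\<theta> I i. I \<in> aball R \<Longrightarrow> norm (ev \<theta> I (dth i G)) \<le> gw.c0 * 4 powr \<alpha> * (2 * V)"
    and Gac: "\<And>\<theta> I i. I \<in> aball R \<Longrightarrow> norm (ev \<theta> I (dac i G)) \<le> gw.c0 * 4 powr \<alpha> * (2 * V)"
    using av.quasi_integral unfolding V av.N_def av.\<Gamma>0_def av.\<theta>0_def by metis
  define D1 where "D1 = gw.c0 * 4 powr \<alpha> * (2 * V)"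
  define \<Lambda> where "\<Lambda> = 2 * CARD('n) * gw.c0\<^sup>2 * 16 powr \<alpha> * V * (\<epsilon> * A1) * (2 * exp 1 * exp (- (\<tau> / 2 * K powr (1 / \<alpha>) / 4)) + exp (- real m))
      + CARD('n) * (2 * E0 K * D1)"
  define G' where "G' t = (\<Sum>i\<in>UNIV. of_real ((\<chi> i. \<omega> $ i + g ((\<lambda>_. 0)(Inr i := 1)) (\<theta> t, I t)) $ i) * ev (\<theta> t) (I t) (dth i G)
      + of_real ((\<chi> i. - g ((\<lambda>_. 0)(Inl i := 1)) (\<theta> t, I t)) $ i) * ev (\<theta> t) (I t) (dac i G))" for t
  have der: "((\<lambda>t. ev (\<theta> t) (I t) G) has_vector_derivative G' t) (at t within J)" if "t \<in> J" for t
    unfolding G'_def by (rule ev_has_vector_derivative[OF G sol(1) that sol(2)[OF that] sol(3)[OF that]])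
  have bd: "norm (G' t) \<le> \<Lambda>" if t: "t \<in> J" for t
  proof -
    note It = sol(1)[OF t]
    define a b p q where "a i = ft ((\<lambda>_. 0)(Inr i := 1)) (I t) (\<theta> t)" "b i = ft ((\<lambda>_. 0)(Inl i := 1)) (I t) (\<theta> t)"
      "p i = ev (\<theta> t) (I t) (dac i (H1 K))" "q i = ev (\<theta> t) (I t) (dth i (H1 K))" for i
    have ab: "norm (a i - p i) \<le> E0 K" "norm (b i - q i) \<le> E0 K" for i
      unfolding a_b_p_q_def ev_dac_H1[OF It] ev_dth_H1[OF It] by (rule truncation_error[OF It K])+
    have G'eq: "G' t = (\<Sum>i\<in>UNIV. (of_real (\<omega> $ i) + a i) * ev (\<theta> t) (I t) (dth i G) - b i * ev (\<theta> t) (I t) (dac i G))"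
      by (simp add: G'_def a_b_p_q_def ft_def)
    have dac: "dac i (lin \<omega> + H1 K) = dac i (lin \<omega>) + dac i (H1 K)" for i
      by (intro poly_mapping_eqI) (simp add: lookup_add jd_add)
    have dth: "dth i (lin \<omega> + H1 K) = dth i (H1 K)" for i
      using dth_lin[of i \<omega>] by (intro poly_mapping_eqI) (simp add: lookup_add jsc_add poly_mapping_eq_iff fun_eq_iff)
    have "ev (\<theta> t) (I t) (pb G (lin \<omega> + H1 K)) =
        (\<Sum>i\<in>UNIV. (of_real (\<omega> $ i) + p i) * ev (\<theta> t) (I t) (dth i G) - q i * ev (\<theta> t) (I t) (dac i G))"
      unfolding ev_pb dac dth dac_lin ev_add ev_mulf_const ev_one a_b_p_q_def
      by (intro sum.cong refl) (simp add: mult.commute)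
    then have "G' t - ev (\<theta> t) (I t) (pb G (lin \<omega> + H1 K)) =
        (\<Sum>i\<in>UNIV. (a i - p i) * ev (\<theta> t) (I t) (dth i G) - (b i - q i) * ev (\<theta> t) (I t) (dac i G))"
      by (simp add: G'eq sum_subtractf[symmetric] algebra_simps)
    also have "norm \<dots> \<le> of_nat (card (UNIV :: 'n set)) * (2 * E0 K * D1)"
    proof (rule sum_norm_bound)
      fix i
      have "norm ((a i - p i) * ev (\<theta> t) (I t) (dth i G)) \<le> E0 K * D1"
        unfolding norm_mult D1_def by (intro mult_mono' ab Gth It) auto
      moreover have "norm ((b i - q i) * ev (\<theta> t) (I t) (dac i G)) \<le> E0 K * D1"
        unfolding norm_mult D1_def by (intro mult_mono' ab Gac It) auto
      ultimately show "norm ((a i - p i) * ev (\<theta> t) (I t) (dth i G) - (b i - q i) * ev (\<theta> t) (I t) (dac i G)) \<le> 2 * E0 K * D1"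
        using norm_triangle_ineq4[of "(a i - p i) * ev (\<theta> t) (I t) (dth i G)" "(b i - q i) * ev (\<theta> t) (I t) (dac i G)"] by linarith
    qed
    finally show ?thesis
      using pb[OF It, of "\<theta> t"] norm_triangle_sub[of "G' t" "ev (\<theta> t) (I t) (pb G (lin \<omega> + H1 K))"]
      unfolding \<Lambda>_def by linarith
  qed
  have \<Lambda>: "\<Lambda> \<ge> 0" using bd[OF J(2)] norm_ge_zero order_trans by blast
  have "norm (ev (\<theta> t) (I t) G - ev (\<theta> 0) (I 0) G) \<le> \<Lambda> * norm (t - 0)"
  proof (rule differentiable_bound[where S=J and f'="\<lambda>t s. s *\<^sub>R G' t"])
    show "convex J" using J(1) is_interval_convex by blast
    fix s assume s: "s \<in> J"
    show "((\<lambda>t. ev (\<theta> t) (I t) G) has_derivative (\<lambda>r. r *\<^sub>R G' s)) (at s within J)"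
      using der[OF s] by (simp add: has_vector_derivative_def)
    show "onorm (\<lambda>r. r *\<^sub>R G' s) \<le> \<Lambda>"
    proof (rule onorm_le)
      fix r show "norm (r *\<^sub>R G' s) \<le> \<Lambda> * norm r"
        using mult_right_mono[OF bd[OF s], of "\<bar>r\<bar>"] by (simp add: mult.commute)
    qed
  qed (use J in auto)
  then have "norm (ev (\<theta> t) (I t) G - ev (\<theta> 0) (I 0) G) \<le> \<bar>t\<bar> * \<Lambda>" by (simp add: mult.commute)
  moreover have "norm (x - y :: complex) \<le> norm (g - x) + norm (g - h) + norm (h - y)" for x y g h
  proof -
    have "x - y = (g - h) - (g - x) + (h - y)" by simp
    then show ?thesis
      using norm_triangle_ineq[of "(g - h) - (g - x)" "h - y"] norm_triangle_ineq4[of "g - h" "g - x"]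
      by (simp only:)
  qed
  from this[of "of_real (v \<bullet> I t)" "of_real (v \<bullet> I 0)" "ev (\<theta> t) (I t) G" "ev (\<theta> 0) (I 0) G"]
  have "norm (of_real (v \<bullet> I t) - of_real (v \<bullet> I 0) :: complex) \<le>
      norm (ev (\<theta> t) (I t) G - of_real (v \<bullet> I t)) + norm (ev (\<theta> t) (I t) G - ev (\<theta> 0) (I 0) G) + norm (ev (\<theta> 0) (I 0) G - of_real (v \<bullet> I 0))" .
  moreover have "norm (of_real (v \<bullet> I t) - of_real (v \<bullet> I 0) :: complex) = \<bar>v \<bullet> I t - v \<bullet> I 0\<bar>"
    unfolding of_real_diff[symmetric] norm_of_real ..
  ultimately show ?thesis
    using near[OF sol(1)[OF J(3)], of "\<theta> t"] near[OF sol(1)[OF J(2)], of "\<theta> 0"]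
    unfolding \<Lambda>_def D1_def by linarith
qed

end

section \<open>Choice of the truncation order and of the number of steps\<close>

text \<open>The threshold of the averaging procedure holds for \<open>m + 2\<close> the integer part of \<open>Q powr (1 / \<alpha>)\<close>, because
  \<open>Delta \<omega> Q * \<epsilon> \<le> c\<close>. The requirement on \<open>c1\<close> ensures that this integer part is at least 3.\<close>

theorem near_conservation:
  fixes \<omega> :: "real^'n"
  assumes \<alpha>: "\<alpha> \<ge> 1" and L: "L > 0" and R: "R > 0" and Q0: "Q0 > 0" and ne: "resonance_vecs \<omega> Q0 \<noteq> {}"
  shows "\<exists>c c1 a0 a \<Lambda> :: real. c > 0 \<and> c1 > 0 \<and> a0 > 0 \<and> a > 0 \<and> \<Lambda> > 0 \<and>
    (\<forall>\<epsilon> (f :: 'n phase \<Rightarrow> real) g v J \<theta> I t. perturbation \<alpha> L R \<epsilon> f g \<and> Delta \<omega> Q0 \<le> c / \<epsilon> \<and> c1 \<le> Delta_star \<omega> Q0 (c / \<epsilon>) \<and>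
      v \<in> res_space \<omega> \<and> (\<forall>i. \<bar>v $ i\<bar> \<le> 1) \<and> is_interval J \<and> 0 \<in> J \<and> t \<in> J \<and>
      (\<forall>t\<in>J. I t \<in> aball R \<and>
        (\<theta> has_vector_derivative (\<chi> i. \<omega> $ i + g ((\<lambda>_. 0)(Inr i := 1)) (\<theta> t, I t))) (at t within J) \<and>
        (I has_vector_derivative (\<chi> i. - g ((\<lambda>_. 0)(Inl i := 1)) (\<theta> t, I t))) (at t within J)) \<longrightarrow>
      \<bar>v \<bullet> I t - v \<bullet> I 0\<bar> \<le> a0 / Delta_star \<omega> Q0 (c / \<epsilon>)
        + \<bar>t\<bar> * (\<epsilon> * \<Lambda> * exp (- (a * Delta_star \<omega> Q0 (c / \<epsilon>) powr (1 / \<alpha>)))))"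
proof -
  obtain q :: nat where q: "q > 0"
    "\<And>Q k. real (q * CARD('n)) * kn k \<le> Q \<Longrightarrow> kdot k \<omega> \<noteq> 0 \<Longrightarrow> 1 \<le> real q * Psi \<omega> Q * \<bar>kdot k \<omega>\<bar>"
    using small_divisors[of \<omega>] by blast
  obtain p where p: "p > 0" "\<And>Q. Q0 \<le> Q \<Longrightarrow> p \<le> Psi \<omega> Q" using Psi_lower_bound[OF ne] by blast
  define b where "b = tau \<alpha> L / 2"
  have b: "b > 0" using \<alpha> L by (simp add: b_def tau_def)
  define V where "V = CARD('n) * (R + exp 1 * (L powr \<alpha> / (2 * exp 1)))"
  have V: "V > 0" using R L by (simp add: V_def add_pos_nonneg)
  define c0 where "c0 = max (2 * pi * (\<alpha> / b) powr \<alpha>) (\<alpha> powr \<alpha> / (L powr \<alpha> / (2 * exp 1)))"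
  have c0: "c0 > 0" using \<alpha> b by (simp add: c0_def less_max_iff_disj)
  define LC where "LC = lattice_const \<alpha> b CARD('n)"
  have LC: "LC > 0" by (simp add: LC_def lattice_const_pos)
  define A2 where "A2 = exp \<alpha> * LC * 2 ^ CARD('n)"
  have A2: "A2 > 0" using LC by (simp add: A2_def)
  define \<gamma> where "\<gamma> = 2 * CARD('n) * c0\<^sup>2 * 16 powr \<alpha>"
  have \<gamma>: "\<gamma> > 0" using c0 by (simp add: \<gamma>_def)
  define CF where "CF = real (q * CARD('n))"
  have CF: "CF > 0" using q(1) by (simp add: CF_def)
  \<comment> \<open>The threshold with \<open>N powr \<alpha> \<le> Q\<close> and \<open>\<Psi> = q * Psi \<omega> Q\<close> reads \<open>\<gamma> * q * A2 * \<epsilon> * Delta \<omega> Q \<le> exp (- 1) / 32\<close>.\<close>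
  define c where "c = exp (- 1) / 32 / (\<gamma> * q * A2)"
  have c: "c > 0" using \<gamma> q(1) A2 by (simp add: c_def)
  \<comment> \<open>The rates in \<open>Q powr (1 / \<alpha>)\<close> of the errors from cutting the series and from the modes beyond \<open>K = Q / CF\<close>.\<close>
  define a where "a = min 1 (b / (4 * CF powr (1 / \<alpha>)))"
  have a: "a > 0" "a \<le> 1" "a \<le> b / (4 * CF powr (1 / \<alpha>))" using b CF by (simp_all add: a_def)
  define D1 where "D1 = c0 * 4 powr \<alpha> * (2 * V)"
  have D1: "D1 > 0" using c0 V by (simp add: D1_def)
  define E1 where "E1 = L powr (- \<alpha>) * exp \<alpha> * LC"
  have E1: "E1 > 0" using L LC by (simp add: E1_def)
  define \<Lambda> where "\<Lambda> = \<gamma> * V * A2 * (2 * exp 1 + exp 3) + CARD('n) * (2 * E1 * D1)"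
  have \<Lambda>: "\<Lambda> > 0"
    unfolding \<Lambda>_def using \<gamma> V A2 E1 D1 by (intro add_pos_pos mult_pos_pos) auto
  \<comment> \<open>Twice the distance of the observable to \<open>v \<bullet> I\<close>, where \<open>2 powr \<alpha>\<close> accounts for rounding \<open>Q powr (1 / \<alpha>)\<close> down
    and another 2 for \<open>Delta_star \<le> 2 * Q\<close>.\<close>
  define a0 where "a0 = 2 powr \<alpha> * 4 * V"
  have a0: "a0 > 0" using V by (simp add: a0_def)
  define c1 where "c1 = 2 * 3 powr \<alpha>"
  have c1: "c1 > 0" by (simp add: c1_def)
  {
    fix \<epsilon> and f :: "'n phase \<Rightarrow> real" and g v J \<theta> I t
    assume pert: "perturbation \<alpha> L R \<epsilon> f g" and De: "Delta \<omega> Q0 \<le> c / \<epsilon>" and Ds: "c1 \<le> Delta_star \<omega> Q0 (c / \<epsilon>)"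
      and v: "v \<in> res_space \<omega>" "\<forall>i. \<bar>v $ i\<bar> \<le> 1" and J: "is_interval J" "0 \<in> J" "t \<in> J"
      and sol: "\<forall>t\<in>J. I t \<in> aball R \<and>
        (\<theta> has_vector_derivative (\<chi> i. \<omega> $ i + g ((\<lambda>_. 0)(Inr i := 1)) (\<theta> t, I t))) (at t within J) \<and>
        (I has_vector_derivative (\<chi> i. - g ((\<lambda>_. 0)(Inl i := 1)) (\<theta> t, I t))) (at t within J)"
    interpret perturbation \<alpha> L R \<epsilon> f g by (rule pert)
    define X where "X = Delta_star \<omega> Q0 (c / \<epsilon>)"
    obtain Q where Q: "Q0 \<le> Q" "Delta \<omega> Q \<le> c / \<epsilon>" "X \<le> 2 * Q" "0 < X"
      using Delta_star_witness[OF Q0 ne De] unfolding X_def by blast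
    have Q3: "3 powr \<alpha> \<le> Q" using Ds Q(3) by (simp add: c1_def X_def)
    have Qpos: "Q > 0" using Q(1) Q0 by simp
    define y where "y = Q powr (1 / \<alpha>)"
    have ya: "y powr \<alpha> = Q" using \<alpha> Qpos by (simp add: y_def powr_powr)
    have y3: "3 \<le> y"
    proof -
      have "(3 powr \<alpha>) powr (1 / \<alpha>) \<le> y" unfolding y_def using Q3 \<alpha> by (intro powr_mono2) auto
      then show ?thesis using \<alpha> by (simp add: powr_powr)
    qed
    define N where "N = nat \<lfloor>y\<rfloor>"
    have N: "real N \<le> y" "y - 1 < real N" "3 \<le> N" using y3 by (auto simp: N_def) linarith+
    define m where "m = N - 2"
    have mN: "m + 2 = N" "m \<ge> 1" using N by (auto simp: m_def)
    have Na: "real N powr \<alpha> \<le> Q" unfolding ya[symmetric] using N \<alpha> by (intro powr_mono2) auto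
    have Nb: "real N powr (- \<alpha>) \<le> 2 powr \<alpha> * 2 / X"
    proof -
      have "y / 2 \<le> real N" using N(2) y3 by linarith
      then have "(y / 2) powr \<alpha> \<le> real N powr \<alpha>" using y3 \<alpha> by (intro powr_mono2) auto
      then have Q2: "Q / 2 powr \<alpha> \<le> real N powr \<alpha>" using y3 by (simp add: powr_divide ya)
      have "real N powr (- \<alpha>) = 1 / real N powr \<alpha>" by (simp add: powr_minus_divide)
      also have "\<dots> \<le> 1 / (Q / 2 powr \<alpha>)" using Q2 Qpos N(3) by (intro divide_left_mono) auto
      also have "\<dots> = 2 powr \<alpha> / Q" by simp
      also have "\<dots> \<le> 2 powr \<alpha> * 2 / X" using Q(3,4) Qpos by (simp add: field_simps)
      finally show ?thesis .
    qed
    define K where "K = Q / CF"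
    have K: "K > 0" using Qpos CF by (simp add: K_def)
    have Psi: "Psi \<omega> Q > 0" using p(2)[OF Q(1)] p(1) by linarith
    have c0': "gw.c0 = c0" by (simp add: gw.c0_def c0_def b_def)
    have A2': "A1 = A2" by (simp add: A2_def A1_def LC_def b_def)
    have thr: "2 * CARD('n) * gw.c0\<^sup>2 * 16 powr \<alpha> * real (m + 2) powr \<alpha> * (real q * Psi \<omega> Q) * (\<epsilon> * A1) \<le> exp (- 1) / 32"
    proof -
      have "\<gamma> * real N powr \<alpha> * (real q * Psi \<omega> Q) * (\<epsilon> * A2) = (\<gamma> * q * A2) * \<epsilon> * (real N powr \<alpha> * Psi \<omega> Q)"
        by (simp only: mult_ac)
      also have "\<dots> \<le> (\<gamma> * q * A2) * \<epsilon> * (Q * Psi \<omega> Q)"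
        using Na Psi \<gamma> A2 eps by (intro mult_left_mono mult_right_mono) auto
      also have "\<dots> \<le> (\<gamma> * q * A2) * \<epsilon> * (c / \<epsilon>)"
        using Q(2) \<gamma> A2 eps unfolding Delta_def by (intro mult_left_mono) auto
      also have "\<dots> = exp (- 1) / 32" using eps \<gamma> q(1) A2 by (simp add: c_def)
      finally show ?thesis by (simp only: \<gamma>_def c0' A2' mN)
    qed
    have sd: "1 \<le> real q * Psi \<omega> Q * (2 * pi * \<bar>kdot k \<omega>\<bar>)" if "kn k \<le> K" "kdot k \<omega> \<noteq> 0" for k
    proof -
      have "real (q * CARD('n)) * kn k \<le> Q" using that(1) CF by (simp add: K_def CF_def field_simps)
      then have "1 \<le> real q * Psi \<omega> Q * \<bar>kdot k \<omega>\<bar>" using q(2) that(2) by blast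
      also have "\<dots> \<le> real q * Psi \<omega> Q * (2 * pi * \<bar>kdot k \<omega>\<bar>)"
      proof (intro mult_left_mono)
        show "\<bar>kdot k \<omega>\<bar> \<le> 2 * pi * \<bar>kdot k \<omega>\<bar>"
          using mult_right_mono[of 1 "2 * pi" "\<bar>kdot k \<omega>\<bar>"] pi_gt3 by simp
      qed (use Psi in auto)
      finally show ?thesis .
    qed
    define Z where "Z = exp (- (a * y))"
    have Ky: "b * K powr (1 / \<alpha>) / 4 = b / (4 * CF powr (1 / \<alpha>)) * y"
      using Qpos CF by (simp add: K_def y_def powr_divide)
    have Z1: "exp (- (b * K powr (1 / \<alpha>) / 4)) \<le> Z"
      unfolding Z_def Ky using mult_right_mono[OF a(3), of y] y3 by simp
    have Z2: "exp (- b * K powr (1 / \<alpha>)) \<le> Z"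
    proof -
      have "b * K powr (1 / \<alpha>) \<ge> b * K powr (1 / \<alpha>) / 4" using b by simp
      then have "exp (- b * K powr (1 / \<alpha>)) \<le> exp (- (b * K powr (1 / \<alpha>) / 4))" by simp
      then show ?thesis using Z1 by linarith
    qed
    have Z3: "exp (- real m) \<le> exp 3 * Z"
    proof -
      have "a * y \<le> y" using a(1,2) y3 mult_right_mono[of a 1 y] by simp
      moreover have "real m = real N - 2" using mN by (metis add_diff_cancel_right' of_nat_add of_nat_numeral)
      ultimately have "- real m \<le> 3 + - (a * y)" using N(2) by linarith
      then show ?thesis unfolding Z_def exp_add[symmetric] by simp
    qed
    have ZX: "Z \<le> exp (- (a / 2 * X powr (1 / \<alpha>)))"
    proof -
      have "X powr (1 / \<alpha>) \<le> (2 * Q) powr (1 / \<alpha>)" using Q(3,4) \<alpha> by (intro powr_mono2) auto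
      also have "\<dots> = 2 powr (1 / \<alpha>) * y" using Qpos by (simp add: powr_mult y_def)
      also have "\<dots> \<le> 2 powr 1 * y" using \<alpha> y3 by (intro mult_right_mono powr_mono) auto
      finally have "X powr (1 / \<alpha>) \<le> 2 * y" by simp
      then have "a / 2 * X powr (1 / \<alpha>) \<le> a / 2 * (2 * y)" using a(1) by (intro mult_left_mono) auto
      then show ?thesis by (simp add: Z_def)
    qed
    have "\<bar>v \<bullet> I t - v \<bullet> I 0\<bar> \<le> 2 * (V * real N powr (- \<alpha>)) + \<bar>t\<bar> *
        (\<gamma> * V * (\<epsilon> * A2) * (2 * exp 1 * exp (- (b * K powr (1 / \<alpha>) / 4)) + exp (- real m))
        + CARD('n) * (2 * E0 K * D1))"
    proof -
      have res: "kdot k v = 0" if "kn k \<le> K" "kdot k \<omega> = 0" for k using v(1) that by (simp add: res_space_def)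
      have "\<bar>v \<bullet> I t - v \<bullet> I 0\<bar> \<le> 2 * (CARD('n) * (R + exp 1 * (L powr \<alpha> / (2 * exp 1))) * real (m + 2) powr (- \<alpha>)) + \<bar>t\<bar> *
        (2 * CARD('n) * gw.c0\<^sup>2 * 16 powr \<alpha> * (CARD('n) * (R + exp 1 * (L powr \<alpha> / (2 * exp 1)))) * (\<epsilon> * A1)
            * (2 * exp 1 * exp (- (\<tau> / 2 * K powr (1 / \<alpha>) / 4)) + exp (- real m))
          + CARD('n) * (2 * E0 K * (gw.c0 * 4 powr \<alpha> * (2 * (CARD('n) * (R + exp 1 * (L powr \<alpha> / (2 * exp 1))))))))"
      proof (rule drift[where \<Psi>="real q * Psi \<omega> Q" and J=J and \<omega>=\<omega> and \<theta>=\<theta>])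
        show "0 < real q * Psi \<omega> Q" using q(1) Psi by simp
      qed (use mN K thr sd res v J sol in auto)
      then show ?thesis by (simp only: V_def \<gamma>_def D1_def c0' A2' b_def mN)
    qed
    also have "\<dots> \<le> a0 / X + \<bar>t\<bar> * (\<epsilon> * \<Lambda> * exp (- (a / 2 * X powr (1 / \<alpha>))))"
    proof (intro add_mono mult_left_mono)
      have "2 * (V * real N powr (- \<alpha>)) \<le> 2 * (V * (2 powr \<alpha> * 2 / X))"
        using Nb V by (intro mult_left_mono) auto
      then show "2 * (V * real N powr (- \<alpha>)) \<le> a0 / X" by (simp add: a0_def mult_ac)
      have "\<gamma> * V * (\<epsilon> * A2) * (2 * exp 1 * exp (- (b * K powr (1 / \<alpha>) / 4)) + exp (- real m))
          \<le> \<gamma> * V * (\<epsilon> * A2) * (2 * exp 1 * Z + exp 3 * Z)"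
        using Z1 Z3 \<gamma> V eps A2 by (intro mult_left_mono add_mono) auto
      moreover have "CARD('n) * (2 * E0 K * D1) \<le> CARD('n) * (2 * (\<epsilon> * E1 * Z) * D1)"
      proof -
        have "E0 K = \<epsilon> * E1 * exp (- b * K powr (1 / \<alpha>))"
          by (simp add: E0_def E1_def LC_def b_def mult.assoc)
        also have "\<dots> \<le> \<epsilon> * E1 * Z" using Z2 eps E1 by (intro mult_left_mono) auto
        finally show ?thesis using D1 by (intro mult_left_mono mult_right_mono) auto
      qed
      ultimately have "\<gamma> * V * (\<epsilon> * A2) * (2 * exp 1 * exp (- (b * K powr (1 / \<alpha>) / 4)) + exp (- real m)) + CARD('n) * (2 * E0 K * D1)
          \<le> \<gamma> * V * (\<epsilon> * A2) * (2 * exp 1 * Z + exp 3 * Z) + CARD('n) * (2 * (\<epsilon> * E1 * Z) * D1)" by linarith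
      also have "\<dots> = \<epsilon> * \<Lambda> * Z" by (simp add: \<Lambda>_def distrib_left distrib_right mult_ac)
      also have "\<dots> \<le> \<epsilon> * \<Lambda> * exp (- (a / 2 * X powr (1 / \<alpha>)))"
        using ZX eps \<Lambda> by (intro mult_left_mono) auto
      finally show "\<gamma> * V * (\<epsilon> * A2) * (2 * exp 1 * exp (- (b * K powr (1 / \<alpha>) / 4)) + exp (- real m)) + CARD('n) * (2 * E0 K * D1)
          \<le> \<epsilon> * \<Lambda> * exp (- (a / 2 * X powr (1 / \<alpha>)))" .
    qed simp
    finally have "\<bar>v \<bullet> I t - v \<bullet> I 0\<bar> \<le> a0 / X + \<bar>t\<bar> * (\<epsilon> * \<Lambda> * exp (- (a / 2 * X powr (1 / \<alpha>))))" .
  }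
  note est = this
  show ?thesis
  proof (intro exI conjI allI impI)
    show "c > 0" "c1 > 0" "a0 > 0" "a / 2 > 0" "\<Lambda> > 0" using c c1 a0 a \<Lambda> by auto
  qed (elim conjE, rule est)
qed

section \<open>The Hamiltonian vector field\<close>

text \<open>The choice of a family of derivatives in \<^const>\<open>mpartial\<close> is immaterial on the domain. For the first derivatives this is needed to split the
  field of \<open>H\<close> into \<open>\<omega>\<close> and the derivatives of \<open>f\<close>.\<close>

lemma jet_on_first_unique:
  assumes R: "R > 0" and g: "jet_on (phase_dom R) h g" and g': "jet_on (phase_dom R) h g'" and x: "x \<in> phase_dom R"
  shows "g ((\<lambda>_. 0)(j := 1)) x = g' ((\<lambda>_. 0)(j := 1)) x"
proof -
  let ?S = "{s. x + s *\<^sub>R coord_dir j \<in> phase_dom R}"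
  have "((\<lambda>s. g (\<lambda>_. 0) (x + s *\<^sub>R coord_dir j)) has_real_derivative g ((\<lambda>_. 0)(j := 1)) x) (at 0 within ?S)"
    using jet_on_derivative[OF g x, of "\<lambda>_. 0" j] by simp
  moreover have "((\<lambda>s. g (\<lambda>_. 0) (x + s *\<^sub>R coord_dir j)) has_real_derivative g' ((\<lambda>_. 0)(j := 1)) x) (at 0 within ?S)"
  proof (rule has_field_derivative_transform_within[of _ _ _ _ 1])
    show "((\<lambda>s. g' (\<lambda>_. 0) (x + s *\<^sub>R coord_dir j)) has_real_derivative g' ((\<lambda>_. 0)(j := 1)) x) (at 0 within ?S)"
      using jet_on_derivative[OF g' x, of "\<lambda>_. 0" j] by simp
    show "0 \<in> ?S" using x by simp
  qed (use g g' in \<open>auto simp: jet_on_def\<close>)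
  ultimately show ?thesis
    using phase_dom_nontrivial[OF R x, of j] by (meson has_field_derivative_unique)
qed

definition lin_jet :: "real^'n \<Rightarrow> ('n + 'n \<Rightarrow> nat) \<Rightarrow> ('n::finite) phase \<Rightarrow> real" where
  "lin_jet \<omega> l x = (if l = (\<lambda>_. 0) then \<omega> \<bullet> snd x else (\<Sum>i\<in>UNIV. if l = (\<lambda>_. 0)(Inr i := 1) then \<omega> $ i else 0))"

lemma multiindex_Suc_cases:
  "l(j := Suc (l j)) \<noteq> (\<lambda>_. 0)" "(l(j := Suc (l j)) = (\<lambda>_. 0)(k := 1)) \<longleftrightarrow> l = (\<lambda>_. 0) \<and> j = k"
proof -
  show "l(j := Suc (l j)) \<noteq> (\<lambda>_. 0)" by (metis fun_upd_same nat.distinct(1))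
  show "(l(j := Suc (l j)) = (\<lambda>_. 0)(k := 1)) \<longleftrightarrow> l = (\<lambda>_. 0) \<and> j = k"
  proof
    assume eq: "l(j := Suc (l j)) = (\<lambda>_. 0)(k := 1)"
    then have e: "(l(j := Suc (l j))) i = ((\<lambda>_. 0)(k := 1)) i" for i by simp
    have jk: "j = k" using e[of j] by (auto split: if_splits)
    have "l i = 0" for i using e[of i] jk by (cases "i = j") auto
    then show "l = (\<lambda>_. 0) \<and> j = k" using jk by auto
  qed auto
qed

lemma jet_on_lin: "jet_on D (\<lambda>x. \<omega> \<bullet> snd x) (lin_jet \<omega>)"
  unfolding jet_on_def
proof (intro conjI ballI allI)
  show "lin_jet \<omega> (\<lambda>_. 0) x = \<omega> \<bullet> snd x" for x by (simp add: lin_jet_def)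
  show "continuous_on D (lin_jet \<omega> l)" for l
    by (cases "l = (\<lambda>_. 0)") (auto simp: lin_jet_def intro!: continuous_intros)
  fix l j and x :: "'a phase"
  have v: "lin_jet \<omega> (l(j := Suc (l j))) x = (if l = (\<lambda>_. 0) then \<omega> \<bullet> snd (coord_dir j) else 0)"
    unfolding lin_jet_def multiindex_Suc_cases if_not_P[OF multiindex_Suc_cases(1)]
    by (cases j) (auto simp: coord_dir_def inner_axis if_distrib cong: if_cong)
  show "((\<lambda>s. lin_jet \<omega> l (x + s *\<^sub>R coord_dir j)) has_real_derivative lin_jet \<omega> (l(j := Suc (l j))) x)
      (at 0 within {s. x + s *\<^sub>R coord_dir j \<in> D})"
    unfolding v by (cases "l = (\<lambda>_. 0)")
      (auto simp: lin_jet_def inner_add_right intro!: derivative_eq_intros)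
qed

lemma jet_on_add:
  assumes "jet_on D f g" "jet_on D f' g'"
  shows "jet_on D (\<lambda>x. f x + f' x) (\<lambda>l x. g l x + g' l x)"
  using assms unfolding jet_on_def by (auto intro!: continuous_on_add DERIV_add)

lemma jet_on_diff:
  assumes "jet_on D f g" "jet_on D f' g'"
  shows "jet_on D (\<lambda>x. f x - f' x) (\<lambda>l x. g l x - g' l x)"
  using assms unfolding jet_on_def by (auto intro!: continuous_on_diff DERIV_diff)

lemma jet_on_cong: "jet_on D f g \<Longrightarrow> (\<And>x. x \<in> D \<Longrightarrow> f' x = f x) \<Longrightarrow> jet_on D f' g"
  unfolding jet_on_def by simp

lemma perturbation_of_hamiltonian:
  fixes \<omega> :: "real^'n"
  assumes \<alpha>: "\<alpha> \<ge> 1" and L: "L > 0" and R: "R > 0" and eps: "\<epsilon> > 0"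
    and H: "H \<in> gevrey \<alpha> L (phase_dom R)" and Hf: "\<forall>(\<theta>, I)\<in>phase_dom R. H (\<theta>, I) = \<omega> \<bullet> I + f (\<theta>, I)"
    and n: "gevrey_norm \<alpha> L (phase_dom R) f \<le> ereal \<epsilon>"
  shows "perturbation \<alpha> L R \<epsilon> f (\<lambda>l. mpartial (phase_dom R) l f)"
    and "x \<in> phase_dom R \<Longrightarrow> partial (phase_dom R) (Inr i) H x = \<omega> $ i + mpartial (phase_dom R) ((\<lambda>_. 0)(Inr i := 1)) f x"
    and "x \<in> phase_dom R \<Longrightarrow> partial (phase_dom R) (Inl i) H x = mpartial (phase_dom R) ((\<lambda>_. 0)(Inl i := 1)) f x"
proof -
  let ?D = "phase_dom R :: 'n phase set"
  have Hf': "H x = \<omega> \<bullet> snd x + f x" if "x \<in> ?D" for x using Hf that by (cases x) auto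
  define gH where "gH = (SOME g. jet_on ?D H g)"
  define gf where "gf = (SOME g. jet_on ?D f g)"
  have gH: "jet_on ?D H gH"
  proof -
    have "\<exists>g. jet_on ?D H g" using H by (simp add: gevrey_def smooth_fun_on_def)
    then show ?thesis unfolding gH_def by (rule someI_ex)
  qed
  have "jet_on ?D (\<lambda>x. H x - \<omega> \<bullet> snd x) (\<lambda>l x. gH l x - lin_jet \<omega> l x)"
    by (rule jet_on_diff[OF gH jet_on_lin])
  then have "jet_on ?D f (\<lambda>l x. gH l x - lin_jet \<omega> l x)"
    by (rule jet_on_cong) (simp add: Hf')
  then have gf: "jet_on ?D f gf" unfolding gf_def by (rule someI[of "jet_on ?D f"])
  have mf: "mpartial ?D l f = gf l" for l by (simp add: mpartial_def gf_def)
  show "perturbation \<alpha> L R \<epsilon> f (\<lambda>l. mpartial ?D l f)"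
  proof
    show "jet_on ?D f (\<lambda>l. mpartial ?D l f)" unfolding mf by (rule gf)
    show "\<bar>mpartial ?D l f x\<bar> \<le> \<epsilon> * ((\<Prod>j\<in>UNIV. fact (l j)) powr \<alpha> * L powr (- (real (\<Sum>j\<in>UNIV. l j) * \<alpha>)))"
      if "x \<in> ?D" for l x by (rule gevrey_norm_bound[OF n L that])
    fix \<theta> I k assume D: "(\<theta>, I) \<in> ?D"
    have D': "(\<theta> + rv k, I) \<in> ?D" using D by (simp add: mem_phase_dom)
    have "rv k \<in> int_vecs" by (simp add: int_vecs_def rv_def)
    then have "H (\<theta> + rv k, I) = H (\<theta>, I)"
      using H D unfolding gevrey_def angle_periodic_def by blast
    then show "f (\<theta> + rv k, I) = f (\<theta>, I)" using Hf'[OF D] Hf'[OF D'] by simp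
  qed (use \<alpha> L R eps in auto)
  have "jet_on ?D (\<lambda>x. \<omega> \<bullet> snd x + f x) (\<lambda>l x. lin_jet \<omega> l x + gf l x)"
    by (rule jet_on_add[OF jet_on_lin gf])
  then have "jet_on ?D H (\<lambda>l x. lin_jet \<omega> l x + gf l x)" by (rule jet_on_cong) (rule Hf')
  then have p: "partial ?D j H x = lin_jet \<omega> ((\<lambda>_. 0)(j := 1)) x + mpartial ?D ((\<lambda>_. 0)(j := 1)) f x"
    if "x \<in> ?D" for j x
    unfolding partial_def mf using jet_on_first_unique[OF R gH _ that] by (simp add: mpartial_def gH_def)
  have ne: "(\<lambda>_. 0)(j := 1) \<noteq> (\<lambda>_. 0 :: nat)" for j :: "'n + 'n" using multiindex_Suc_cases(1)[of "\<lambda>_. 0" j] by simp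
  have e: "(\<lambda>_. 0)(j := 1) = (\<lambda>_. 0 :: nat)(k := 1) \<longleftrightarrow> j = k" for j k :: "'n + 'n"
    using multiindex_Suc_cases(2)[of "\<lambda>_. 0" j k] by simp
  show "partial ?D (Inr i) H x = \<omega> $ i + mpartial ?D ((\<lambda>_. 0)(Inr i := 1)) f x" if "x \<in> ?D"
    unfolding p[OF that] lin_jet_def e if_not_P[OF ne] by simp
  show "partial ?D (Inl i) H x = mpartial ?D ((\<lambda>_. 0)(Inl i := 1)) f x" if "x \<in> ?D"
    unfolding p[OF that] lin_jet_def e if_not_P[OF ne] by simp
qed

definition ham_field :: "('n::finite) phase set \<Rightarrow> ('n phase \<Rightarrow> real) \<Rightarrow> 'n phase \<Rightarrow> 'n phase" where
  "ham_field D H z = ((\<chi> i. partial D (Inr i) H z), (\<chi> i. - partial D (Inl i) H z))"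

lemma ham_solution_iff_sol:
  "ham_solution D H J \<theta> I \<longleftrightarrow> 0 \<in> J \<and> sol (ham_field D H) D J (\<lambda>t. (\<theta> t, I t))"
proof -
  have "((\<lambda>t. (\<theta> t, I t)) has_vector_derivative ham_field D H (\<theta> t, I t)) (at t within J) \<longleftrightarrow>
      (\<theta> has_vector_derivative (\<chi> i. partial D (Inr i) H (\<theta> t, I t))) (at t within J) \<and>
      (I has_vector_derivative (\<chi> i. - partial D (Inl i) H (\<theta> t, I t))) (at t within J)" for t
  proof (intro iffI conjI)
    assume d: "((\<lambda>t. (\<theta> t, I t)) has_vector_derivative ham_field D H (\<theta> t, I t)) (at t within J)"
    show "(\<theta> has_vector_derivative (\<chi> i. partial D (Inr i) H (\<theta> t, I t))) (at t within J)"
      using bounded_linear.has_vector_derivative[OF bounded_linear_fst d] by (simp add: ham_field_def)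
    show "(I has_vector_derivative (\<chi> i. - partial D (Inl i) H (\<theta> t, I t))) (at t within J)"
      using bounded_linear.has_vector_derivative[OF bounded_linear_snd d] by (simp add: ham_field_def)
  next
    assume "(\<theta> has_vector_derivative (\<chi> i. partial D (Inr i) H (\<theta> t, I t))) (at t within J) \<and>
      (I has_vector_derivative (\<chi> i. - partial D (Inl i) H (\<theta> t, I t))) (at t within J)"
    then show "((\<lambda>t. (\<theta> t, I t)) has_vector_derivative ham_field D H (\<theta> t, I t)) (at t within J)"
      unfolding ham_field_def by (intro has_vector_derivative_Pair) auto
  qed
  then show ?thesis unfolding ham_solution_def sol_def by blast
qed

lemma phase_sum: "(\<Sum>j\<in>UNIV. c j *\<^sub>R coord_dir j) = ((\<chi> i. c (Inl i)), (\<chi> i. c (Inr i)) :: real^'n)"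
proof -
  have "(\<Sum>j\<in>UNIV. c j *\<^sub>R coord_dir j) = (\<Sum>i\<in>UNIV. c (Inl i) *\<^sub>R (axis i 1, 0)) + (\<Sum>i\<in>UNIV. c (Inr i) *\<^sub>R (0, axis i 1 :: real^'n))"
    unfolding UNIV_Plus_UNIV[symmetric] by (subst sum.Plus) (simp_all add: coord_dir_def o_def)
  moreover have "(\<Sum>i\<in>UNIV. d i * (axis i (1 :: real)) $ k) = d k" for d :: "'n \<Rightarrow> real" and k
    using axis_sum_nth[of d k] by simp
  ultimately show ?thesis
    by (simp add: prod_eq_iff fst_sum snd_sum vec_eq_iff)
qed

lemma norm_fst_snd_le: "norm (fst z) \<le> norm z" "norm (snd z) \<le> norm z"
  using norm_fst_le[of "fst z" "snd z"] norm_snd_le[of "snd z" "fst z"] by (simp_all only: prod.collapse)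

context perturbation
begin

lemma g_bounded: "\<exists>B\<ge>0. \<forall>z\<in>D. \<bar>g l z\<bar> \<le> B"
  using bound[of _ l] eps
  by (intro exI[of _ "\<epsilon> * ((\<Prod>j\<in>UNIV. fact (l j)) powr \<alpha> * L powr (- (real (\<Sum>j\<in>UNIV. l j) * \<alpha>)))"]) auto

text \<open>The next partial derivatives are bounded, and the domain contains the coordinate path between any two of its points.\<close>

lemma g_lipschitz: "\<exists>C\<ge>0. \<forall>z\<in>D. \<forall>w\<in>D. \<bar>g l z - g l w\<bar> \<le> C * norm (z - w)"
proof -
  obtain B0 where B0: "\<And>l. 0 \<le> B0 l" "\<And>l z. z \<in> D \<Longrightarrow> \<bar>g l z\<bar> \<le> B0 l"
    using g_bounded by metis
  define B where "B j = B0 (l(j := Suc (l j)))" for j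
  have B: "0 \<le> B j" "z \<in> D \<Longrightarrow> \<bar>g (l(j := Suc (l j))) z\<bar> \<le> B j" for j z
    unfolding B_def by (rule B0; assumption?)+
  define e where "e = (\<Sum>j\<in>UNIV. B j)"
  have e: "e \<ge> 0" unfolding e_def by (intro sum_nonneg B)
  have Be: "B j \<le> e" for j unfolding e_def by (rule member_le_sum) (use B in auto)
  have "\<bar>g l z - g l w\<bar> \<le> e * real CARD('n + 'n) * norm (z - w)" if z: "z \<in> D" and w: "w \<in> D" for z w
  proof -
    define h where "h = case_sum (\<lambda>i. (fst z - fst w) $ i) (\<lambda>i. (snd z - snd w) $ i)"
    have hs: "w + (\<Sum>j\<in>UNIV. (t j * h j) *\<^sub>R coord_dir j) \<in> D" if t: "\<And>j. 0 \<le> t j \<and> t j \<le> 1" for t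
    proof -
      have "\<bar>snd w $ i + t (Inr i) * (snd z $ i - snd w $ i)\<bar> \<le> R" for i
      proof -
        let ?t = "t (Inr i)"
        have c: "\<bar>snd w $ i\<bar> \<le> R" "\<bar>snd z $ i\<bar> \<le> R"
          using z w by (auto simp: phase_dom_def infnorm_le_iff)
        have "snd w $ i + ?t * (snd z $ i - snd w $ i) = (1 - ?t) * snd w $ i + ?t * snd z $ i"
          by (simp add: algebra_simps)
        also have "\<bar>\<dots>\<bar> \<le> (1 - ?t) * \<bar>snd w $ i\<bar> + ?t * \<bar>snd z $ i\<bar>"
          using t[of "Inr i"] abs_triangle_ineq[of "(1 - ?t) * snd w $ i" "?t * snd z $ i"] by (simp add: abs_mult)
        also have "\<dots> \<le> (1 - ?t) * R + ?t * R"
          using t[of "Inr i"] c by (intro add_mono mult_left_mono) auto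
        finally show ?thesis by (simp add: algebra_simps)
      qed
      then show ?thesis by (simp add: phase_sum phase_dom_def h_def infnorm_le_iff mem_Times_iff)
    qed
    have "norm (g l (w + (\<Sum>j\<in>UNIV. h j *\<^sub>R coord_dir j)) - g l w - (\<Sum>j\<in>UNIV. h j *\<^sub>R 0)) \<le> e * (\<Sum>j\<in>UNIV. \<bar>h j\<bar>)"
    proof (rule increment_le[where D=D and g'="\<lambda>j. g (l(j := Suc (l j)))"])
      fix j y assume "y \<in> D"
      then show "((\<lambda>s. g l (y + s *\<^sub>R coord_dir j)) has_vector_derivative g (l(j := Suc (l j))) y) (at 0 within {s. y + s *\<^sub>R coord_dir j \<in> D})"
        using jet_on_derivative[OF jet] by (simp only: has_real_derivative_iff_has_vector_derivative)
    next
      fix j and t :: "'n + 'n \<Rightarrow> real" assume "\<And>j. j \<in> UNIV \<Longrightarrow> 0 \<le> t j \<and> t j \<le> 1"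
      then have "w + (\<Sum>j\<in>UNIV. (t j * h j) *\<^sub>R coord_dir j) \<in> D" by (intro hs) simp
      from B(2)[OF this, of j] Be[of j]
      show "norm (g (l(j := Suc (l j))) (w + (\<Sum>j\<in>UNIV. (t j * h j) *\<^sub>R coord_dir j)) - 0) \<le> e" by simp
    qed (use hs in auto)
    moreover have "w + (\<Sum>j\<in>UNIV. h j *\<^sub>R coord_dir j) = z"
      by (simp add: phase_sum h_def prod_eq_iff vec_eq_iff)
    ultimately have "\<bar>g l z - g l w\<bar> \<le> e * (\<Sum>j\<in>UNIV. \<bar>h j\<bar>)" by simp
    also have "\<dots> \<le> e * (real CARD('n + 'n) * norm (z - w))"
    proof (intro mult_left_mono e sum_bounded_above)
      fix j
      have "\<bar>(fst (z - w)) $ i\<bar> \<le> norm (z - w)" "\<bar>(snd (z - w)) $ i\<bar> \<le> norm (z - w)" for i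
        using component_le_norm_cart[of "fst (z - w)" i] component_le_norm_cart[of "snd (z - w)" i]
          norm_fst_snd_le[of "z - w"] by linarith+
      then show "\<bar>h j\<bar> \<le> norm (z - w)" by (cases j) (simp_all add: h_def)
    qed
    finally show ?thesis by (simp add: mult.assoc)
  qed
  then show ?thesis using e by (intro exI[of _ "e * real CARD('n + 'n)"]) auto
qed

end

lemma field_lipschitz_bounded:
  fixes \<omega> :: "real^'n" and V :: "'n phase \<Rightarrow> 'n phase"
  assumes pert: "perturbation \<alpha> L R \<epsilon> f g"
    and V: "\<And>z. z \<in> phase_dom R \<Longrightarrow> V z = ((\<chi> i. \<omega> $ i + g (p i) z), (\<chi> i. - g (q i) z))"
  shows "\<exists>C M. C > 0 \<and> M > 0 \<and> (\<forall>z\<in>phase_dom R. \<forall>w\<in>phase_dom R. norm (V z - V w) \<le> C * norm (z - w)) \<and>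
    (\<forall>z\<in>phase_dom R. norm (V z) \<le> M)"
proof -
  interpret perturbation \<alpha> L R \<epsilon> f g by (rule pert)
  obtain C where C: "\<And>l. 0 \<le> C l" "\<And>l z w. z \<in> D \<Longrightarrow> w \<in> D \<Longrightarrow> \<bar>g l z - g l w\<bar> \<le> C l * norm (z - w)"
    using g_lipschitz by metis
  obtain B where B: "\<And>l. 0 \<le> B l" "\<And>l z. z \<in> D \<Longrightarrow> \<bar>g l z\<bar> \<le> B l"
    using g_bounded by metis
  have np: "norm (a, b) \<le> (\<Sum>i\<in>UNIV. \<bar>a $ i\<bar>) + (\<Sum>i\<in>UNIV. \<bar>b $ i\<bar>)" for a b :: "real^'n"
    using norm_Pair_le[of a b] norm_le_l1_cart[of a] norm_le_l1_cart[of b] by linarith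
  define C' where "C' = 1 + ((\<Sum>i\<in>UNIV. C (p i)) + (\<Sum>i\<in>UNIV. C (q i)))"
  define M where "M = 1 + ((\<Sum>i\<in>UNIV. \<bar>\<omega> $ i\<bar> + B (p i)) + (\<Sum>i\<in>UNIV. B (q i)))"
  have pos: "C' > 0" "M > 0"
    unfolding C'_def M_def by (intro add_pos_nonneg add_nonneg_nonneg sum_nonneg; simp add: C B)+
  have "norm (V z - V w) \<le> C' * norm (z - w)" if z: "z \<in> D" and w: "w \<in> D" for z w
  proof -
    have "V z - V w = ((\<chi> i. g (p i) z - g (p i) w), (\<chi> i. g (q i) w - g (q i) z))"
      by (simp add: V[OF z] V[OF w] vec_eq_iff)
    then have "norm (V z - V w) \<le> (\<Sum>i\<in>UNIV. \<bar>g (p i) z - g (p i) w\<bar>) + (\<Sum>i\<in>UNIV. \<bar>g (q i) w - g (q i) z\<bar>)"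
      using np[of "\<chi> i. g (p i) z - g (p i) w" "\<chi> i. g (q i) w - g (q i) z"] by simp
    also have "\<dots> \<le> (\<Sum>i\<in>UNIV. C (p i) * norm (z - w)) + (\<Sum>i\<in>UNIV. C (q i) * norm (z - w))"
      using C(2)[OF z w] C(2)[OF w z] by (intro add_mono sum_mono) (simp_all add: norm_minus_commute)
    also have "\<dots> \<le> C' * norm (z - w)"
      by (simp add: C'_def sum_distrib_right distrib_right)
    finally show ?thesis .
  qed
  moreover have "norm (V z) \<le> M" if z: "z \<in> D" for z
  proof -
    have "norm (V z) \<le> (\<Sum>i\<in>UNIV. \<bar>\<omega> $ i + g (p i) z\<bar>) + (\<Sum>i\<in>UNIV. \<bar>- g (q i) z\<bar>)"
      using np[of "\<chi> i. \<omega> $ i + g (p i) z" "\<chi> i. - g (q i) z"] by (simp add: V[OF z])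
    also have "\<dots> \<le> (\<Sum>i\<in>UNIV. \<bar>\<omega> $ i\<bar> + B (p i)) + (\<Sum>i\<in>UNIV. B (q i))"
    proof (intro add_mono sum_mono)
      show "\<bar>\<omega> $ i + g (p i) z\<bar> \<le> \<bar>\<omega> $ i\<bar> + B (p i)" for i
        using B(2)[OF z, of "p i"] abs_triangle_ineq[of "\<omega> $ i" "g (p i) z"] by linarith
      show "\<bar>- g (q i) z\<bar> \<le> B (q i)" for i using B(2)[OF z, of "q i"] by simp
    qed
    finally show ?thesis by (simp add: M_def)
  qed
  ultimately show ?thesis using pos by blast
qed

lemma closed_phase_dom: "closed (phase_dom R :: 'n::finite phase set)"
proof -
  have "phase_dom R = (\<Inter>i. {z :: 'n phase. \<bar>snd z $ i\<bar> \<le> R})"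
    by (auto simp: phase_dom_def infnorm_le_iff)
  then show ?thesis by (auto intro!: closed_INT closed_Collect_le continuous_intros)
qed

lemma cball_subset_phase_dom:
  assumes "infnorm (snd z) \<le> r"
  shows "cball z s \<subseteq> phase_dom (r + s)"
proof
  fix w assume "w \<in> cball z s"
  then have "norm (z - w) \<le> s" by (simp add: dist_norm)
  then have "infnorm (snd z - snd w) \<le> s"
    using infnorm_le_norm[of "snd z - snd w"] norm_fst_snd_le(2)[of "z - w"] by simp
  then have "infnorm (snd w) \<le> r + s"
    using assms infnorm_triangle[of "snd z" "snd w - snd z"] by (simp add: infnorm_sub)
  then show "w \<in> phase_dom (r + s)" by (cases w) (simp add: phase_dom_def)
qed

section \<open>Stability of the actions\<close>

theorem theorem2p1:
  fixes \<omega> :: "real^'n" and R \<alpha> L Q\<^sub>\<omega> :: real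
  assumes "CARD('n) \<ge> 2"
    and "R > 0" and "\<alpha> \<ge> 1" and "L > 0"
    and "\<omega> \<noteq> 0"
    and "Q\<^sub>\<omega> > 0" and "\<forall>Q\<ge>Q\<^sub>\<omega>. resonance_vecs \<omega> Q \<noteq> {}"
  shows "\<exists>c c\<^sub>1 a\<^sub>1 a\<^sub>2 a\<^sub>3 a\<^sub>4 a\<^sub>5 a\<^sub>6 :: real.
    c > 0 \<and> c\<^sub>1 > 0 \<and> a\<^sub>1 > 0 \<and> a\<^sub>2 > 0 \<and> a\<^sub>3 > 0 \<and> a\<^sub>4 > 0 \<and> a\<^sub>5 > 0 \<and> a\<^sub>6 > 0 \<and>
    (\<forall>(H :: 'n phase \<Rightarrow> real) (f :: 'n phase \<Rightarrow> real) (\<epsilon> :: real).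
       H \<in> gevrey \<alpha> L (phase_dom R) \<and>
       (\<forall>(\<theta>, I)\<in>phase_dom R. H (\<theta>, I) = \<omega> \<bullet> I + f (\<theta>, I)) \<and>
       \<epsilon> > 0 \<and> gevrey_norm \<alpha> L (phase_dom R) f \<le> ereal \<epsilon> \<and>
       Delta \<omega> Q\<^sub>\<omega> \<le> c / \<epsilon> \<and> Delta_star \<omega> Q\<^sub>\<omega> (c / \<epsilon>) \<ge> c\<^sub>1
       \<longrightarrow>
       Delta \<omega> Q\<^sub>\<omega> \<le> a\<^sub>2 / \<epsilon> \<and> Delta \<omega> Q\<^sub>\<omega> \<le> a\<^sub>6 / \<epsilon> \<and>
       (\<forall>(J :: real set) (\<theta> :: real \<Rightarrow> real^'n) (I :: real \<Rightarrow> real^'n) (\<theta>\<^sub>0 :: real^'n) (I\<^sub>0 :: real^'n)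
           (T\<^sub>0 :: ereal).
          maximal_ham_solution (phase_dom R) H J \<theta> I \<and>
          (\<theta> 0, I 0) = (\<theta>\<^sub>0, I\<^sub>0) \<and> (\<theta>\<^sub>0, I\<^sub>0) \<in> phase_dom (R / 4) \<and>
          T\<^sub>0 = exit_time (phase_dom (R / 4)) J \<theta> I
          \<longrightarrow>
          (\<forall>\<delta>::real.
             a\<^sub>1 * inverse (Delta_star \<omega> Q\<^sub>\<omega> (a\<^sub>2 / \<epsilon>)) \<le> \<delta> \<and> \<delta> \<le> a\<^sub>3
             \<longrightarrow>
             (\<forall>t\<in>J.
                ereal \<bar>t\<bar> \<le> ereal a\<^sub>4 *
                  min T\<^sub>0 (ereal (\<delta> * inverse \<epsilon> *
                    exp (a\<^sub>5 * Delta_star \<omega> Q\<^sub>\<omega> (a\<^sub>6 / \<epsilon>) powr (1 / \<alpha>))))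
                \<longrightarrow> infnorm (orth_proj (rat_hull \<omega>) (I t - I\<^sub>0)) \<le> \<delta>) \<and>
             (rat_hull \<omega> = UNIV \<longrightarrow>
               (\<forall>t::real.
                  \<bar>t\<bar> \<le> a\<^sub>4 * (\<delta> * inverse \<epsilon> *
                    exp (a\<^sub>5 * Delta_star \<omega> Q\<^sub>\<omega> (a\<^sub>6 / \<epsilon>) powr (1 / \<alpha>)))
                  \<longrightarrow> t \<in> J \<and> infnorm (I t - I\<^sub>0) \<le> \<delta>)))))"
proof -
  note R = assms(2) and \<alpha> = assms(3) and L = assms(4) and Q0 = assms(6)
  have ne: "resonance_vecs \<omega> Q\<^sub>\<omega> \<noteq> {}" using assms(7) by simp
  obtain c c1 a0 a \<Lambda> :: real where pos: "c > 0" "c1 > 0" "a0 > 0" "a > 0" "\<Lambda> > 0"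
    and drift0: "\<forall>\<epsilon> (f :: 'n phase \<Rightarrow> real) g v J \<theta> I t. perturbation \<alpha> L R \<epsilon> f g \<and> Delta \<omega> Q\<^sub>\<omega> \<le> c / \<epsilon> \<and> c1 \<le> Delta_star \<omega> Q\<^sub>\<omega> (c / \<epsilon>) \<and>
      v \<in> res_space \<omega> \<and> (\<forall>i. \<bar>v $ i\<bar> \<le> 1) \<and> is_interval J \<and> 0 \<in> J \<and> t \<in> J \<and>
      (\<forall>t\<in>J. I t \<in> aball R \<and>
        (\<theta> has_vector_derivative (\<chi> i. \<omega> $ i + g ((\<lambda>_. 0)(Inr i := 1)) (\<theta> t, I t))) (at t within J) \<and>
        (I has_vector_derivative (\<chi> i. - g ((\<lambda>_. 0)(Inl i := 1)) (\<theta> t, I t))) (at t within J)) \<longrightarrow>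
      \<bar>v \<bullet> I t - v \<bullet> I 0\<bar> \<le> a0 / Delta_star \<omega> Q\<^sub>\<omega> (c / \<epsilon>)
        + \<bar>t\<bar> * (\<epsilon> * \<Lambda> * exp (- (a * Delta_star \<omega> Q\<^sub>\<omega> (c / \<epsilon>) powr (1 / \<alpha>))))"
    using near_conservation[OF \<alpha> L R Q0 ne] by (elim exE conjE) (rule that)
  have drift: "\<bar>v \<bullet> I t - v \<bullet> I 0\<bar> \<le> a0 / Delta_star \<omega> Q\<^sub>\<omega> (c / \<epsilon>)
        + \<bar>t\<bar> * (\<epsilon> * \<Lambda> * exp (- (a * Delta_star \<omega> Q\<^sub>\<omega> (c / \<epsilon>) powr (1 / \<alpha>))))"
    if "perturbation \<alpha> L R \<epsilon> f g" "Delta \<omega> Q\<^sub>\<omega> \<le> c / \<epsilon>" "c1 \<le> Delta_star \<omega> Q\<^sub>\<omega> (c / \<epsilon>)"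
      "v \<in> res_space \<omega>" "\<forall>i. \<bar>v $ i\<bar> \<le> 1" "is_interval J" "0 \<in> J" "t \<in> J"
      "\<forall>t\<in>J. I t \<in> aball R \<and>
        (\<theta> has_vector_derivative (\<chi> i. \<omega> $ i + g ((\<lambda>_. 0)(Inr i := 1)) (\<theta> t, I t))) (at t within J) \<and>
        (I has_vector_derivative (\<chi> i. - g ((\<lambda>_. 0)(Inl i := 1)) (\<theta> t, I t))) (at t within J)"
    for \<epsilon> and f :: "'n phase \<Rightarrow> real" and g v J \<theta> I t
    by (rule drift0[THEN spec[of _ \<epsilon>], THEN spec[of _ f], THEN spec[of _ g], THEN spec[of _ v], THEN spec[of _ J],
        THEN spec[of _ \<theta>], THEN spec[of _ I], THEN spec[of _ t], THEN mp]) (intro conjI that)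
  \<comment> \<open>One half of \<open>\<delta>\<close> is left to the distance between the observable and \<open>v \<bullet> I\<close>, the other half to its drift.\<close>
  define a1 where "a1 = 2 * a0"
  define a4 where "a4 = 1 / (2 * \<Lambda>)"
  have a14: "a1 > 0" "a4 > 0" using pos by (simp_all add: a1_def a4_def)
  let ?D = "phase_dom R :: 'n phase set"
  \<comment> \<open>By symmetry of the projection, a component of the projected vector is its product with a projected coordinate
    vector, to which the drift estimate applies.\<close>
  have partI: "infnorm (orth_proj (rat_hull \<omega>) (I t - I\<^sub>0)) \<le> \<delta>"
    if H: "H \<in> gevrey \<alpha> L ?D" "\<forall>(\<theta>, I)\<in>?D. H (\<theta>, I) = \<omega> \<bullet> I + f (\<theta>, I)" and eps: "\<epsilon> > 0"
      and f: "gevrey_norm \<alpha> L ?D f \<le> ereal \<epsilon>" and De: "Delta \<omega> Q\<^sub>\<omega> \<le> c / \<epsilon>" "Delta_star \<omega> Q\<^sub>\<omega> (c / \<epsilon>) \<ge> c1"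
      and sol: "maximal_ham_solution ?D H J \<theta> I" and I0: "(\<theta> 0, I 0) = (\<theta>\<^sub>0, I\<^sub>0)"
      and \<delta>: "a1 * inverse (Delta_star \<omega> Q\<^sub>\<omega> (c / \<epsilon>)) \<le> \<delta>" and t: "t \<in> J"
      and tle: "\<bar>t\<bar> \<le> a4 * (\<delta> * inverse \<epsilon> * exp (a * Delta_star \<omega> Q\<^sub>\<omega> (c / \<epsilon>) powr (1 / \<alpha>)))"
    for H f \<epsilon> J \<theta> I \<theta>\<^sub>0 I\<^sub>0 \<delta> t
  proof -
    define X where "X = Delta_star \<omega> Q\<^sub>\<omega> (c / \<epsilon>)"
    have X: "X > 0" using De(2) pos by (simp add: X_def)
    note ph = perturbation_of_hamiltonian[OF \<alpha> L R eps H f]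
    have hs: "ham_solution ?D H J \<theta> I" using sol by (simp add: maximal_ham_solution_def)
    let ?g = "\<lambda>l. mpartial ?D l f"
    have ham: "is_interval J" "0 \<in> J" "\<forall>t\<in>J. I t \<in> aball R \<and>
        (\<theta> has_vector_derivative (\<chi> i. \<omega> $ i + ?g ((\<lambda>_. 0)(Inr i := 1)) (\<theta> t, I t))) (at t within J) \<and>
        (I has_vector_derivative (\<chi> i. - ?g ((\<lambda>_. 0)(Inl i := 1)) (\<theta> t, I t))) (at t within J)"
      using hs ph(2,3) by (auto simp: ham_solution_def mem_phase_dom)
    let ?P = "orth_proj (rat_hull \<omega>)"
    have S: "subspace (rat_hull \<omega>)" by (simp add: rat_hull_eq subspace_res_space)
    have "\<bar>?P (I t - I\<^sub>0) $ i\<bar> \<le> \<delta>" for i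
    proof -
      define v where "v = ?P (axis i 1)"
      have vS: "v \<in> res_space \<omega>" using orth_proj_props(1)[OF S] by (simp add: v_def rat_hull_eq)
      have v1: "\<forall>j. \<bar>v $ j\<bar> \<le> 1"
      proof
        fix j
        have "\<bar>v $ j\<bar> \<le> norm v" by (rule component_le_norm_cart)
        also have "\<dots> \<le> norm (axis i 1 :: real^'n)" unfolding v_def by (rule norm_orth_proj_le[OF S])
        finally show "\<bar>v $ j\<bar> \<le> 1" by simp
      qed
      have "?P (I t - I\<^sub>0) $ i = ?P (I t - I\<^sub>0) \<bullet> axis i 1" by (simp add: inner_axis)
      also have "\<dots> = v \<bullet> I t - v \<bullet> I 0"
        unfolding orth_proj_symmetric[OF S] v_def[symmetric] using I0 by (simp add: inner_diff_left inner_diff_right inner_commute)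
      also have "\<bar>\<dots>\<bar> \<le> a0 / X + \<bar>t\<bar> * (\<epsilon> * \<Lambda> * exp (- (a * X powr (1 / \<alpha>))))"
        unfolding X_def by (rule drift[where g="?g" and f=f and J=J and \<theta>=\<theta>, OF ph(1) De vS v1 ham(1,2) t ham(3)])
      also have "\<dots> \<le> \<delta> / 2 + \<delta> / 2"
      proof (intro add_mono)
        have "2 * (a0 * inverse X) \<le> \<delta>" using \<delta> unfolding X_def[symmetric] a1_def by (simp only: mult.assoc)
        then show "a0 / X \<le> \<delta> / 2" unfolding divide_inverse[of a0 X] by linarith
        have "\<bar>t\<bar> * (\<epsilon> * \<Lambda> * exp (- (a * X powr (1 / \<alpha>))))
            \<le> a4 * (\<delta> * inverse \<epsilon> * exp (a * X powr (1 / \<alpha>))) * (\<epsilon> * \<Lambda> * exp (- (a * X powr (1 / \<alpha>))))"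
          using tle eps pos by (intro mult_right_mono) (auto simp: X_def)
        also have "\<dots> = (a4 * \<Lambda>) * \<delta> * (inverse \<epsilon> * \<epsilon>) * (exp (a * X powr (1 / \<alpha>)) * exp (- (a * X powr (1 / \<alpha>))))"
          by (simp only: mult_ac)
        also have "\<dots> = (1 / 2) * \<delta> * 1 * 1"
        proof (intro arg_cong2[where f="(*)"] refl)
          show "a4 * \<Lambda> = 1 / 2" "inverse \<epsilon> * \<epsilon> = 1" using pos eps by (simp_all add: a4_def)
          show "exp (a * X powr (1 / \<alpha>)) * exp (- (a * X powr (1 / \<alpha>))) = 1" by (simp flip: exp_add)
        qed
        also have "\<dots> = \<delta> / 2" by simp
        finally show "\<bar>t\<bar> * (\<epsilon> * \<Lambda> * exp (- (a * X powr (1 / \<alpha>)))) \<le> \<delta> / 2" .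
      qed
      finally show ?thesis by simp
    qed
    then show ?thesis by (simp only: infnorm_le_iff) blast
  qed
  \<comment> \<open>Up to time \<open>t\<close> the actions stay in the ball of radius \<open>R / 4 + \<delta> \<le> R / 2\<close>, at distance at least \<open>R / 2\<close> from the boundary.\<close>
  have partII: "t \<in> J"
    if H: "H \<in> gevrey \<alpha> L ?D" "\<forall>(\<theta>, I)\<in>?D. H (\<theta>, I) = \<omega> \<bullet> I + f (\<theta>, I)" and eps: "\<epsilon> > 0"
      and f: "gevrey_norm \<alpha> L ?D f \<le> ereal \<epsilon>" and De: "Delta \<omega> Q\<^sub>\<omega> \<le> c / \<epsilon>" "Delta_star \<omega> Q\<^sub>\<omega> (c / \<epsilon>) \<ge> c1"
      and sol: "maximal_ham_solution ?D H J \<theta> I" and I0: "(\<theta> 0, I 0) = (\<theta>\<^sub>0, I\<^sub>0)" "(\<theta>\<^sub>0, I\<^sub>0) \<in> phase_dom (R / 4)"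
      and \<delta>: "a1 * inverse (Delta_star \<omega> Q\<^sub>\<omega> (c / \<epsilon>)) \<le> \<delta>" "\<delta> \<le> R / 4" and full: "rat_hull \<omega> = UNIV"
      and tle: "\<bar>t\<bar> \<le> a4 * (\<delta> * inverse \<epsilon> * exp (a * Delta_star \<omega> Q\<^sub>\<omega> (c / \<epsilon>) powr (1 / \<alpha>)))"
    for H f \<epsilon> J \<theta> I \<theta>\<^sub>0 I\<^sub>0 \<delta> t
  proof -
    note ph = perturbation_of_hamiltonian[OF \<alpha> L R eps H f]
    let ?V = "ham_field ?D H"
    have hs: "0 \<in> J" "sol ?V ?D J (\<lambda>t. (\<theta> t, I t))"
      using sol by (simp_all add: maximal_ham_solution_def ham_solution_iff_sol)
    have max: False if J': "J \<subset> J'" and x': "sol ?V ?D J' x'" "\<forall>t\<in>J. x' t = (\<theta> t, I t)" for J' x'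
    proof -
      have "sol ?V ?D J' (\<lambda>t. ((fst \<circ> x') t, (snd \<circ> x') t))" using x'(1) by simp
      moreover have "0 \<in> J'" using hs(1) J' by blast
      ultimately have "ham_solution ?D H J' (fst \<circ> x') (snd \<circ> x')" unfolding ham_solution_iff_sol by blast
      moreover have "\<forall>t\<in>J. (fst \<circ> x') t = \<theta> t \<and> (snd \<circ> x') t = I t" using x'(2) by simp
      ultimately show False using sol J' unfolding maximal_ham_solution_def by blast
    qed
    have "ham_field ?D H z = ((\<chi> i. \<omega> $ i + mpartial ?D ((\<lambda>_. 0)(Inr i := 1)) f z), (\<chi> i. - mpartial ?D ((\<lambda>_. 0)(Inl i := 1)) f z))"
      if "z \<in> ?D" for z
      unfolding ham_field_def ph(2)[OF that] ph(3)[OF that] ..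
    from field_lipschitz_bounded[OF ph(1) this] obtain C M where CM: "C > 0" "M > 0"
      "\<And>z w. z \<in> ?D \<Longrightarrow> w \<in> ?D \<Longrightarrow> norm (?V z - ?V w) \<le> C * norm (z - w)"
      "\<And>z. z \<in> ?D \<Longrightarrow> norm (?V z) \<le> M" by blast
    show ?thesis
    proof (rule maximal_sol_exists_until[OF hs(2) max closed_phase_dom CM hs(1), where r="R / 2"])
      fix s assume s: "s \<in> J" "\<bar>s\<bar> \<le> \<bar>t\<bar>"
      have "infnorm (orth_proj (rat_hull \<omega>) (I s - I\<^sub>0)) \<le> \<delta>"
        by (rule partI[OF H eps f De sol I0(1) \<delta>(1) s(1)]) (use s(2) tle in linarith)
      then have "infnorm (I s - I\<^sub>0) \<le> R / 4" using \<delta>(2) by (simp add: full orth_proj_UNIV)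
      moreover have "infnorm I\<^sub>0 \<le> R / 4" using I0(2) by (simp add: phase_dom_def)
      ultimately have "infnorm (I s) \<le> R / 2" using infnorm_triangle[of "I s - I\<^sub>0" I\<^sub>0] by simp
      then show "cball (\<theta> s, I s) (R / 2) \<subseteq> ?D"
        using cball_subset_phase_dom[of "(\<theta> s, I s)" "R / 2" "R / 2"] by simp
    qed (use R in auto)
  qed
  have conv: "\<bar>t\<bar> \<le> a4 * x" if "ereal \<bar>t\<bar> \<le> ereal a4 * min T (ereal x)" for t x T
  proof -
    have "ereal a4 * min T (ereal x) \<le> ereal a4 * ereal x"
      using a14 by (intro ereal_mult_left_mono min.cobounded2) auto
    from order_trans[OF that this] show ?thesis by simp
  qed
  show ?thesis
  proof (rule exI[of _ c], rule exI[of _ c1], rule exI[of _ a1], rule exI[of _ c], rule exI[of _ "R / 4"],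
      rule exI[of _ a4], rule exI[of _ a], rule exI[of _ c], intro conjI allI impI ballI, goal_cases)
    case (11 H f \<epsilon> J \<theta> I \<theta>\<^sub>0 I\<^sub>0 T\<^sub>0 \<delta> t)
    then show ?case
      by (elim conjE) (rule partI[where H=H and f=f and \<epsilon>=\<epsilon> and \<theta>=\<theta> and J=J and t=t]; (assumption | erule conv))
  next
    case (12 H f \<epsilon> J \<theta> I \<theta>\<^sub>0 I\<^sub>0 T\<^sub>0 \<delta> t)
    then show ?case
      by (elim conjE) (rule partII[where H=H and f=f and \<epsilon>=\<epsilon> and \<theta>=\<theta> and J=J and t=t]; assumption)
  next
    case (13 H f \<epsilon> J \<theta> I \<theta>\<^sub>0 I\<^sub>0 T\<^sub>0 \<delta> t)
    then have t: "t \<in> J"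
      by (elim conjE) (rule partII[where H=H and f=f and \<epsilon>=\<epsilon> and \<theta>=\<theta> and J=J and t=t]; assumption)
    from 13 have full: "rat_hull \<omega> = UNIV" by blast
    from 13 t have "infnorm (orth_proj (rat_hull \<omega>) (I t - I\<^sub>0)) \<le> \<delta>"
      by (elim conjE) (rule partI[where H=H and f=f and \<epsilon>=\<epsilon> and \<theta>=\<theta> and J=J and t=t]; assumption)
    then show ?case by (simp only: full orth_proj_UNIV)
  qed (use pos a14 R in simp_all)
qed

end
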